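(* For $i=1,2$, suppose that \[(G_i,N_i,\theta_i)_{\mathcal H}\geq_b(H_i,M_i,\varphi_i)_{\mathcal H}\] is afforded by $(\mathcal P_i,\mathcal P'_i)$ with common defect group $D_i$. Set \[G=G_1\times G_2,\quad H=H_1\times H_2,\quad N=N_1\times N_2,\quad M=M_1\times M_2,\] \[\Theta=\theta_1\otimes\theta_2,\quad\Phi=\varphi_1\otimes\varphi_2,\quad D=D_1\times D_2.\] Then $(\mathcal P_1\otimes\mathcal P_2,\mathcal P'_1\otimes\mathcal P'_2)$ affords \[(G_{\Theta^{\mathcal H}},N,\Theta)_{\mathcal H}\geq_b(H_{\Phi^{\mathcal H}},M,\Phi)_{\mathcal H},\] with common defect group $D$.
   Context: All groups are finite and all characters are ordinary. Fix a prime $p$. Let $\mathbb Q^{\mathrm{ab}}\subset\mathbb C$ be the field generated by all roots of unity, and let $\mathcal H\leq\mathrm{Gal}(\mathbb Q^{\mathrm{ab}}/\mathbb Q)$ be the subgroup of automorphisms that act on all roots of unity of order prime to $p$ as a common integral power of $\xi\mapsto\xi^p$ (the power may depend on the automorphism, not on the root of unity). Actions are right actions: for $X\unlhd A$, $\chi\in\mathrm{Irr}(X)$, $h\in A$, $\sigma\in\mathcal H$, put $\chi^{h\sigma}(x)=\sigma(\chi(hxh^{-1}))$; for a (matrix-valued) function $f$ and $a=(h,\sigma)$, $f^a(x)=\sigma(f(hxh^{-1}))$ entrywise. $\chi^{\mathcal H}$ is the $\mathcal H$-orbit of $\chi$, $A_\chi$ its inertia group, $A_{\chi^{\mathcal H}}=\{a\in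 A\mid\chi^a\in\chi^{\mathcal H}\}$, and for $B\leq A$, $(B\times\mathcal H)_\chi=\{(b,\sigma)\mid\chi^{b\sigma}=\chi\}$. For $K\unlhd X$ and $\zeta\in\mathrm{Irr}(K)$, $\mathrm{Irr}(X\mid\zeta)$ is the set of irreducible characters of $X$ whose restriction to $K$ contains $\zeta$. Subscripts denote restriction. $\otimes$ between characters or representations of different direct factors is the external tensor product. $\mathrm{bl}(\chi)$ is the $p$-block of $\chi$, and $c^J$ is Brauer's induced block (any equality involving it includes that it is defined). $\mathcal H$-triples. $(G,N,\theta)_{\mathcal H}$ is an $\mathcal H$-triple if $N\unlhd G$, $\theta\in\mathrm{Irr}(N)$ and $\{\theta^g\mid g\in G\}\subseteq\theta^{\mathcal H}$. A projective representation $\mathcal P$ of $G_\theta$ is associated with $(G_\theta,N,\theta)$ if $\mathcal P_N$ is a representation affording $\theta$ and $\mathcal P(nx)=\mathcal P(n)\mathcal P(x)$, $\mathcal P(xn)=\mathcal P(x)\mathcal P(n)$ for $n\in N$, $x\in G_\theta$; its factor set $\alpha$ is given by $\mathcal P(x)\mathcal P(y)=\alpha(x,y)\mathcal P(xy)$ and is inflated from $G_\theta/N$. Projective representations have entries in finite cyclotomic fields and root-of-unity-valued factor sets. For $a\in(G\times\mathcal H)_\theta$, the mixed comparison function $\mu_a$ of $\mathcal P$ is the unique function $G_\theta\to(\mathbb Q^{\mathrm{ab}})^\times$, constant on $N$-cosets with $\mu_a(1)=1$, such that $\mathcal P^a=\mu_aT\mathcal PT^{-1}$ for some invertible matrix $T$.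 Afforded correspondences. If $\mathcal P,\mathcal P'$ are associated with $(G_\theta,N,\theta)$ and $(H_\varphi,M,\varphi)$, where $M=N\cap H$, $G_\theta=NH_\varphi$, and their factor sets agree on $H_\varphi\times H_\varphi$, then for $N\leq W\leq G_\theta$ each $\xi\in\mathrm{Irr}(W\mid\theta)$ has the form $\mathrm{tr}(\mathcal Q\otimes\mathcal P_W)$ with $\mathcal Q$ a projective representation of $W/N$ (inflated to $W$) with factor set inverse to that of $\mathcal P_W$; the afforded bijection $\tau_W:\mathrm{Irr}(W\mid\theta)\to\mathrm{Irr}(W\cap H\mid\varphi)$ sends $\xi$ to $\mathrm{tr}(\mathcal Q_{W\cap H}\otimes\mathcal P'_{W\cap H})$. Block relation. Let $N\unlhd G$, $H\leq G$, $M=N\cap H$, and let $(G,N,\theta)_{\mathcal H}$, $(H,M,\varphi)_{\mathcal H}$ be $\mathcal H$-triples. Then $(G,N,\theta)_{\mathcal H}\geq_b(H,M,\varphi)_{\mathcal H}$ means: (i) $G=NH$, $\mathrm C_G(N)\leq H$, $(H\times\mathcal H)_\theta=(H\times\mathcal H)_\varphi$; (ii) there are associated projective representations $\mathcal P:G_\theta\to\mathrm{GL}_{\theta(1)}(\mathbb Q^{\mathrm{ab}})$ and $\mathcal P':H_\varphi\to\mathrm{GL}_{\varphi(1)}(\mathbb Q^{\mathrm{ab}})$ with root-of-unity-valued factor sets agreeing on $H_\varphi\times H_\varphi$, such that for every $c\in\mathrm C_G(N)$ the matrices $\mathcal P(c),\mathcal P'(c)$ are scalar with the same scalar; (iii)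 the comparison functions satisfy $\mu'_a=\mu_a|_{H_\varphi}$ for all $a\in(H\times\mathcal H)_\theta$; (iv) $\mathrm{bl}(\theta)$ and $\mathrm{bl}(\varphi)$ have a common defect group $D$ with $\mathrm N_N(D)\leq M$, and for every $N\leq W\leq G_\theta$ the correspondence $\tau_W$ afforded by the same pair satisfies $\mathrm{bl}(\tau_W(\xi))^W=\mathrm{bl}(\xi)$ for all $\xi\in\mathrm{Irr}(W\mid\theta)$. One says that $(\mathcal P,\mathcal P')$ affords the relation, with common defect group $D$. *)

theory Defs
  imports
    "Jordan_Normal_Form.VS_Connect"
    "HOL-Algebra.Bij"
    "HOL-Algebra.Group_Action"
    "HOL-Algebra.QuotRing"
begin

text \<open>
  Groups are HOL-Algebra groups, and a subgroup \<open>W\<close> of \<open>G\<close> is regarded as the group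
  \<open>G\<lparr>carrier := W\<rparr>\<close>. Characters are complex functions that are \<open>undefined\<close> outside the
  group they belong to, so that equality of characters is equality of functions.
\<close>

section \<open>The field generated by the roots of unity and its automorphisms\<close>

definition root_of_unity :: "complex \<Rightarrow> bool" where
  "root_of_unity z \<longleftrightarrow> (\<exists>n>0. z ^ n = 1)"

inductive_set Q_ab :: "complex set" where
  root: "root_of_unity z \<Longrightarrow> z \<in> Q_ab"
| add: "x \<in> Q_ab \<Longrightarrow> y \<in> Q_ab \<Longrightarrow> x + y \<in> Q_ab"
| uminus: "x \<in> Q_ab \<Longrightarrow> - x \<in> Q_ab"
| mult: "x \<in> Q_ab \<Longrightarrow> y \<in> Q_ab \<Longrightarrow> x * y \<in> Q_ab"
| inverse: "x \<in> Q_ab \<Longrightarrow> inverse x \<in> Q_ab"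

text \<open>Every field automorphism fixes the rationals.\<close>
definition Gal_Q_ab :: "(complex \<Rightarrow> complex) set" where
  "Gal_Q_ab = {\<sigma> \<in> Bij Q_ab. \<forall>x\<in>Q_ab. \<forall>y\<in>Q_ab.
      \<sigma> (x + y) = \<sigma> x + \<sigma> y \<and> \<sigma> (x * y) = \<sigma> x * \<sigma> y}"

text \<open>The exponent of the map \<open>\<xi> \<mapsto> \<xi> ^ p\<close> may be any integer; the second alternative
  says that \<open>\<sigma>\<close> acts as its \<open>-k\<close>-th power.\<close>
definition galH :: "nat \<Rightarrow> (complex \<Rightarrow> complex) set" where
  "galH p = {\<sigma> \<in> Gal_Q_ab. \<exists>k::nat.
      (\<forall>\<xi>. (\<exists>n>0. coprime n p \<and> \<xi> ^ n = 1) \<longrightarrow> \<sigma> \<xi> = \<xi> ^ (p ^ k)) \<or>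
      (\<forall>\<xi>. (\<exists>n>0. coprime n p \<and> \<xi> ^ n = 1) \<longrightarrow> (\<sigma> \<xi>) ^ (p ^ k) = \<xi>)}"

section \<open>Representations and characters\<close>

abbreviation GL :: "nat \<Rightarrow> complex mat monoid" where
  "GL n \<equiv> units_of (ring_mat TYPE(complex) n ())"

definition mat_trace :: "complex mat \<Rightarrow> complex" where
  "mat_trace A = (\<Sum>i<dim_row A. A $$ (i, i))"

text \<open>A representation of degree \<open>n\<close> is an element of \<open>hom G (GL n)\<close>.\<close>
definition irreducible_rep ::
  "('a, 'm) monoid_scheme \<Rightarrow> nat \<Rightarrow> ('a \<Rightarrow> complex mat) \<Rightarrow> bool" where
  "irreducible_rep G n R \<longleftrightarrow> R \<in> hom G (GL n) \<and> n > 0 \<and>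
     (\<forall>U. VectorSpace.subspace class_ring U (module_vec TYPE(complex) n) \<and>
          (\<forall>x\<in>carrier G. \<forall>v\<in>U. R x *\<^sub>v v \<in> U) \<longrightarrow>
        U = {0\<^sub>v n} \<or> U = carrier_vec n)"

definition Irr :: "('a, 'm) monoid_scheme \<Rightarrow> ('a \<Rightarrow> complex) set" where
  "Irr G = {\<lambda>x\<in>carrier G. mat_trace (R x) | R n. irreducible_rep G n R}"

text \<open>A restriction contains \<open>\<zeta>\<close> iff its inner product with \<open>\<zeta>\<close> is nonzero.\<close>
definition Irr_over ::
  "('a, 'm) monoid_scheme \<Rightarrow> 'a set \<Rightarrow> ('a \<Rightarrow> complex) \<Rightarrow> ('a \<Rightarrow> complex) set" where
  "Irr_over G N \<zeta> = {\<chi> \<in> Irr G.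
     (\<Sum>x\<in>N. \<chi> x * cnj (\<zeta> x)) / of_nat (card N) \<noteq> 0}"

definition char_tensor ::
  "'a set \<Rightarrow> 'b set \<Rightarrow> ('a \<Rightarrow> complex) \<Rightarrow> ('b \<Rightarrow> complex) \<Rightarrow> 'a \<times> 'b \<Rightarrow> complex" where
  "char_tensor N1 N2 \<theta>1 \<theta>2 = (\<lambda>(x, y) \<in> N1 \<times> N2. \<theta>1 x * \<theta>2 y)"

definition kronecker :: "complex mat \<Rightarrow> complex mat \<Rightarrow> complex mat" where
  "kronecker A B = mat (dim_row A * dim_row B) (dim_col A * dim_col B)
     (\<lambda>(i, j). A $$ (i div dim_row B, j div dim_col B) * B $$ (i mod dim_row B, j mod dim_col B))"

definition rep_tensor ::
  "('a \<Rightarrow> complex mat) \<Rightarrow> ('b \<Rightarrow> complex mat) \<Rightarrow> 'a \<times> 'b \<Rightarrow> complex mat" where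
  "rep_tensor P1 P2 = (\<lambda>(x, y). kronecker (P1 x) (P2 y))"

section \<open>Actions on characters\<close>

definition gal_act :: "'a set \<Rightarrow> (complex \<Rightarrow> complex) \<Rightarrow> ('a \<Rightarrow> complex) \<Rightarrow> 'a \<Rightarrow> complex" where
  "gal_act N \<sigma> \<chi> = (\<lambda>x\<in>N. \<sigma> (\<chi> x))"

definition conj_act ::
  "('a, 'm) monoid_scheme \<Rightarrow> 'a set \<Rightarrow> 'a \<Rightarrow> ('a \<Rightarrow> complex) \<Rightarrow> 'a \<Rightarrow> complex" where
  "conj_act G N h \<chi> = (\<lambda>x\<in>N. \<chi> (h \<otimes>\<^bsub>G\<^esub> x \<otimes>\<^bsub>G\<^esub> inv\<^bsub>G\<^esub> h))"

definition gal_orbit :: "nat \<Rightarrow> 'a set \<Rightarrow> ('a \<Rightarrow> complex) \<Rightarrow> ('a \<Rightarrow> complex) set" where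
  "gal_orbit p N \<chi> = {gal_act N \<sigma> \<chi> | \<sigma>. \<sigma> \<in> galH p}"

definition inertia ::
  "('a, 'm) monoid_scheme \<Rightarrow> 'a set \<Rightarrow> ('a \<Rightarrow> complex) \<Rightarrow> 'a set" where
  "inertia G N \<chi> = {g \<in> carrier G. conj_act G N g \<chi> = \<chi>}"

definition orbit_inertia ::
  "nat \<Rightarrow> ('a, 'm) monoid_scheme \<Rightarrow> 'a set \<Rightarrow> ('a \<Rightarrow> complex) \<Rightarrow> 'a set" where
  "orbit_inertia p G N \<chi> = {g \<in> carrier G. conj_act G N g \<chi> \<in> gal_orbit p N \<chi>}"

text \<open>The group \<open>(B \<times> \<H>)\<^sub>\<chi>\<close>, for \<open>\<chi>\<close> a character of \<open>N\<close>.\<close>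
definition mixed_inertia ::
  "nat \<Rightarrow> ('a, 'm) monoid_scheme \<Rightarrow> 'a set \<Rightarrow> 'a set \<Rightarrow> ('a \<Rightarrow> complex) \<Rightarrow>
   ('a \<times> (complex \<Rightarrow> complex)) set" where
  "mixed_inertia p G B N \<chi> =
     {(b, \<sigma>). b \<in> B \<and> \<sigma> \<in> galH p \<and> gal_act N \<sigma> (conj_act G N b \<chi>) = \<chi>}"

definition H_triple ::
  "nat \<Rightarrow> ('a, 'm) monoid_scheme \<Rightarrow> 'a set \<Rightarrow> ('a \<Rightarrow> complex) \<Rightarrow> bool" where
  "H_triple p G N \<theta> \<longleftrightarrow> group G \<and> finite (carrier G) \<and> N \<lhd> G \<and>
     \<theta> \<in> Irr (G\<lparr>carrier := N\<rparr>) \<and> (\<forall>g\<in>carrier G. conj_act G N g \<theta> \<in> gal_orbit p N \<theta>)"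

section \<open>Projective representations\<close>

definition projective_rep ::
  "('a, 'm) monoid_scheme \<Rightarrow> nat \<Rightarrow> ('a \<Rightarrow> complex mat) \<Rightarrow> bool" where
  "projective_rep G n P \<longleftrightarrow>
     (\<forall>x\<in>carrier G. P x \<in> carrier (GL n) \<and> elements_mat (P x) \<subseteq> Q_ab) \<and>
     (\<forall>x\<in>carrier G. \<forall>y\<in>carrier G. \<exists>c. root_of_unity c \<and> P x * P y = c \<cdot>\<^sub>m P (x \<otimes>\<^bsub>G\<^esub> y))"

definition factor_set ::
  "('a, 'm) monoid_scheme \<Rightarrow> ('a \<Rightarrow> complex mat) \<Rightarrow> 'a \<Rightarrow> 'a \<Rightarrow> complex" where
  "factor_set G P x y = (THE c. P x * P y = c \<cdot>\<^sub>m P (x \<otimes>\<^bsub>G\<^esub> y))"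

definition associated_rep ::
  "('a, 'm) monoid_scheme \<Rightarrow> 'a set \<Rightarrow> ('a \<Rightarrow> complex) \<Rightarrow> ('a \<Rightarrow> complex mat) \<Rightarrow> bool" where
  "associated_rep G N \<theta> P \<longleftrightarrow> (\<exists>n.
     projective_rep (G\<lparr>carrier := inertia G N \<theta>\<rparr>) n P \<and>
     P \<in> hom (G\<lparr>carrier := N\<rparr>) (GL n)) \<and>
     (\<lambda>x\<in>N. mat_trace (P x)) = \<theta> \<and>
     (\<forall>n\<in>N. \<forall>x\<in>inertia G N \<theta>.
        P (n \<otimes>\<^bsub>G\<^esub> x) = P n * P x \<and> P (x \<otimes>\<^bsub>G\<^esub> n) = P x * P n)"

text \<open>\<open>\<mu>\<close> is the mixed comparison function \<open>\<mu>\<^sub>a\<close> of \<open>P\<close> for \<open>a = (h, \<sigma>)\<close>; only its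
  values on the inertia group matter, and these are determined by \<open>P\<close> and \<open>a\<close>.
  The matrices \<open>T\<close> and \<open>S\<close> below are inverse to each other.\<close>
definition comparison_function ::
  "('a, 'm) monoid_scheme \<Rightarrow> 'a set \<Rightarrow> ('a \<Rightarrow> complex) \<Rightarrow> ('a \<Rightarrow> complex mat) \<Rightarrow>
   'a \<Rightarrow> (complex \<Rightarrow> complex) \<Rightarrow> ('a \<Rightarrow> complex) \<Rightarrow> bool" where
  "comparison_function G N \<theta> P h \<sigma> \<mu> \<longleftrightarrow>
     (\<forall>x\<in>inertia G N \<theta>. \<mu> x \<in> Q_ab - {0}) \<and>
     (\<forall>n\<in>N. \<forall>x\<in>inertia G N \<theta>. \<mu> (n \<otimes>\<^bsub>G\<^esub> x) = \<mu> x) \<and>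
     \<mu> \<one>\<^bsub>G\<^esub> = 1 \<and>
     (\<exists>T S. \<forall>x\<in>inertia G N \<theta>.
        similar_mat_wit (map_mat \<sigma> (P (h \<otimes>\<^bsub>G\<^esub> x \<otimes>\<^bsub>G\<^esub> inv\<^bsub>G\<^esub> h))) (\<mu> x \<cdot>\<^sub>m P x) T S)"

text \<open>The graph of the bijection \<open>\<tau>\<^sub>W\<close> afforded by \<open>(P, P')\<close>, consisting of all pairs
  \<open>(tr (Q \<otimes> P\<^sub>W), tr (Q \<otimes> P'))\<close> whose first entry lies in \<open>Irr(W | \<theta>)\<close>.
  Every element of \<open>Irr(W | \<theta>)\<close> occurs as a first entry, for exactly one second entry.\<close>
definition afforded_graph ::
  "('a, 'm) monoid_scheme \<Rightarrow> 'a set \<Rightarrow> ('a \<Rightarrow> complex) \<Rightarrow> 'a set \<Rightarrow>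
   ('a \<Rightarrow> complex mat) \<Rightarrow> ('a \<Rightarrow> complex mat) \<Rightarrow> 'a set \<Rightarrow>
   (('a \<Rightarrow> complex) \<times> ('a \<Rightarrow> complex)) set" where
  "afforded_graph G N \<theta> H P P' W = {(\<xi>, \<psi>). \<xi> \<in> Irr_over (G\<lparr>carrier := W\<rparr>) N \<theta> \<and>
     (\<exists>m Q. projective_rep (G\<lparr>carrier := W\<rparr>) m Q \<and>
        (\<forall>x\<in>W. \<forall>n\<in>N. Q (n \<otimes>\<^bsub>G\<^esub> x) = Q x) \<and>
        (\<forall>x\<in>W. \<forall>y\<in>W. factor_set G Q x y = inverse (factor_set G P x y)) \<and>
        \<xi> = (\<lambda>x\<in>W. mat_trace (kronecker (Q x) (P x))) \<and>
        \<psi> = (\<lambda>x\<in>W \<inter> H. mat_trace (kronecker (Q x) (P' x))))}"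

section \<open>Blocks\<close>

definition alg_int_ring :: "complex ring" where
  "alg_int_ring = class_ring\<lparr>carrier := {x. algebraic_int x}\<rparr>"

text \<open>
  As usual, one works with a maximal ideal \<open>\<MM>\<close> containing \<open>p\<close> of the ring of algebraic
  integers, with residue field \<open>F = alg_int_ring Quot \<MM>\<close>. (The blocks, their defect groups
  and block induction do not depend on \<open>\<MM>\<close>.) Blocks are sets of ordinary irreducible characters.
\<close>

definition conj_classes :: "('a, 'm) monoid_scheme \<Rightarrow> 'a set set" where
  "conj_classes G = {{h \<otimes>\<^bsub>G\<^esub> x \<otimes>\<^bsub>G\<^esub> inv\<^bsub>G\<^esub> h | h. h \<in> carrier G} | x. x \<in> carrier G}"

text \<open>For a union \<open>S\<close> of conjugacy classes, \<open>omega G \<chi> S\<close> is the value of the central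
  character of \<open>\<chi>\<close> at the sum of the elements of \<open>S\<close>, and \<open>lambda \<MM> G \<chi> S\<close> its image
  in \<open>F\<close>.\<close>
definition omega :: "('a, 'm) monoid_scheme \<Rightarrow> ('a \<Rightarrow> complex) \<Rightarrow> 'a set \<Rightarrow> complex" where
  "omega G \<chi> S = (\<Sum>x\<in>S. \<chi> x) / \<chi> \<one>\<^bsub>G\<^esub>"

definition lambda ::
  "complex set \<Rightarrow> ('a, 'm) monoid_scheme \<Rightarrow> ('a \<Rightarrow> complex) \<Rightarrow> 'a set \<Rightarrow> complex set" where
  "lambda \<MM> G \<chi> S = \<MM> +>\<^bsub>alg_int_ring\<^esub> omega G \<chi> S"

definition bl ::
  "complex set \<Rightarrow> ('a, 'm) monoid_scheme \<Rightarrow> ('a \<Rightarrow> complex) \<Rightarrow> ('a \<Rightarrow> complex) set" where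
  "bl \<MM> G \<chi> = {\<psi> \<in> Irr G. \<forall>K\<in>conj_classes G. lambda \<MM> G \<psi> K = lambda \<MM> G \<chi> K}"

definition blocks :: "complex set \<Rightarrow> ('a, 'm) monoid_scheme \<Rightarrow> ('a \<Rightarrow> complex) set set" where
  "blocks \<MM> G = bl \<MM> G ` Irr G"

text \<open>\<open>b\<close> is a block of the subgroup \<open>J\<close> of \<open>G\<close>, and Brauer's induced block \<open>b\<^sup>G\<close> is
  defined and equal to \<open>B\<close>: the map \<open>K \<mapsto> \<lambda>\<^sub>b (K \<inter> J)\<close> on class sums of \<open>G\<close> is the central
  character \<open>\<lambda>\<^sub>B\<close>.\<close>
definition induced_block_eq ::
  "complex set \<Rightarrow> ('a, 'm) monoid_scheme \<Rightarrow> 'a set \<Rightarrow>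
   ('a \<Rightarrow> complex) set \<Rightarrow> ('a \<Rightarrow> complex) set \<Rightarrow> bool" where
  "induced_block_eq \<MM> G J b B \<longleftrightarrow> b \<in> blocks \<MM> (G\<lparr>carrier := J\<rparr>) \<and> B \<in> blocks \<MM> G \<and>
     (\<forall>\<psi>\<in>b. \<forall>\<chi>\<in>B. \<forall>K\<in>conj_classes G.
        lambda \<MM> (G\<lparr>carrier := J\<rparr>) \<psi> (K \<inter> J) = lambda \<MM> G \<chi> K)"

text \<open>The coefficient at \<open>x\<close> of the sum of the primitive central idempotents of the complex
  group algebra belonging to the characters in \<open>B\<close>. It lies in the localisation of the ring
  of algebraic integers at \<open>\<MM>\<close>, and its image in \<open>F\<close> is the coefficient of the block idempotent.\<close>
definition idem_coeff ::
  "('a, 'm) monoid_scheme \<Rightarrow> ('a \<Rightarrow> complex) set \<Rightarrow> 'a \<Rightarrow> complex" where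
  "idem_coeff G B x = (\<Sum>\<chi>\<in>B. \<chi> \<one>\<^bsub>G\<^esub> * \<chi> (inv\<^bsub>G\<^esub> x)) / of_nat (card (carrier G))"

definition local_max_ideal :: "complex set \<Rightarrow> complex set" where
  "local_max_ideal \<MM> = {a. \<exists>s. algebraic_int s \<and> s \<notin> \<MM> \<and> s * a \<in> \<MM>}"

text \<open>A class on which both \<open>\<lambda>\<^sub>B\<close> and the coefficient of the block idempotent are nonzero in \<open>F\<close>.\<close>
definition defect_class ::
  "complex set \<Rightarrow> ('a, 'm) monoid_scheme \<Rightarrow> ('a \<Rightarrow> complex) set \<Rightarrow> 'a set \<Rightarrow> bool" where
  "defect_class \<MM> G B K \<longleftrightarrow> K \<in> conj_classes G \<and>
     (\<forall>\<chi>\<in>B. lambda \<MM> G \<chi> K \<noteq> \<zero>\<^bsub>alg_int_ring Quot \<MM>\<^esub>) \<and>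
     (\<forall>x\<in>K. idem_coeff G B x \<notin> local_max_ideal \<MM>)"

definition centralizer :: "('a, 'm) monoid_scheme \<Rightarrow> 'a set \<Rightarrow> 'a set" where
  "centralizer G S = {g \<in> carrier G. \<forall>s\<in>S. g \<otimes>\<^bsub>G\<^esub> s = s \<otimes>\<^bsub>G\<^esub> g}"

definition sylow_subgroup :: "nat \<Rightarrow> ('a, 'm) monoid_scheme \<Rightarrow> 'a set \<Rightarrow> bool" where
  "sylow_subgroup p G D \<longleftrightarrow> subgroup D G \<and>
     card D = p ^ multiplicity p (card (carrier G))"

definition defect_group ::
  "complex set \<Rightarrow> nat \<Rightarrow> ('a, 'm) monoid_scheme \<Rightarrow> ('a \<Rightarrow> complex) set \<Rightarrow> 'a set \<Rightarrow> bool" where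
  "defect_group \<MM> p G B D \<longleftrightarrow> (\<exists>K. defect_class \<MM> G B K \<and>
     (\<exists>x\<in>K. sylow_subgroup p (G\<lparr>carrier := centralizer G {x}\<rparr>) D))"

section \<open>The block relation\<close>

text \<open>\<open>affords_block_rel \<MM> p G N \<theta> H M \<phi> P P' D\<close>: the relation
  \<open>(G, N, \<theta>)\<^sub>\<H> \<ge>\<^sub>b (H, M, \<phi>)\<^sub>\<H>\<close> holds, and is afforded by \<open>(P, P')\<close> with common defect group \<open>D\<close>.\<close>
definition affords_block_rel ::
  "complex set \<Rightarrow> nat \<Rightarrow> ('a, 'm) monoid_scheme \<Rightarrow> 'a set \<Rightarrow> ('a \<Rightarrow> complex) \<Rightarrow>
   'a set \<Rightarrow> 'a set \<Rightarrow> ('a \<Rightarrow> complex) \<Rightarrow>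
   ('a \<Rightarrow> complex mat) \<Rightarrow> ('a \<Rightarrow> complex mat) \<Rightarrow> 'a set \<Rightarrow> bool" where
  "affords_block_rel \<MM> p G N \<theta> H M \<phi> P P' D \<longleftrightarrow>
     H_triple p G N \<theta> \<and> subgroup H G \<and> M = N \<inter> H \<and> H_triple p (G\<lparr>carrier := H\<rparr>) M \<phi> \<and>
     carrier G = N <#>\<^bsub>G\<^esub> H \<and> centralizer G N \<subseteq> H \<and>
     mixed_inertia p G H N \<theta> = mixed_inertia p G H M \<phi> \<and>
     associated_rep G N \<theta> P \<and> associated_rep (G\<lparr>carrier := H\<rparr>) M \<phi> P' \<and>
     (\<forall>x\<in>inertia (G\<lparr>carrier := H\<rparr>) M \<phi>. \<forall>y\<in>inertia (G\<lparr>carrier := H\<rparr>) M \<phi>.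
        factor_set G P x y = factor_set G P' x y) \<and>
     (\<forall>c\<in>centralizer G N. \<exists>z. P c = z \<cdot>\<^sub>m 1\<^sub>m (dim_row (P c)) \<and> P' c = z \<cdot>\<^sub>m 1\<^sub>m (dim_row (P' c))) \<and>
     (\<forall>(h, \<sigma>)\<in>mixed_inertia p G H N \<theta>. \<exists>\<mu> \<mu>'.
        comparison_function G N \<theta> P h \<sigma> \<mu> \<and>
        comparison_function (G\<lparr>carrier := H\<rparr>) M \<phi> P' h \<sigma> \<mu>' \<and>
        (\<forall>x\<in>inertia (G\<lparr>carrier := H\<rparr>) M \<phi>. \<mu>' x = \<mu> x)) \<and>
     defect_group \<MM> p (G\<lparr>carrier := N\<rparr>) (bl \<MM> (G\<lparr>carrier := N\<rparr>) \<theta>) D \<and>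
     defect_group \<MM> p (G\<lparr>carrier := M\<rparr>) (bl \<MM> (G\<lparr>carrier := M\<rparr>) \<phi>) D \<and>
     normalizer (G\<lparr>carrier := N\<rparr>) D \<subseteq> M \<and>
     (\<forall>W. subgroup W G \<and> N \<subseteq> W \<and> W \<subseteq> inertia G N \<theta> \<longrightarrow>
        (\<forall>(\<xi>, \<psi>)\<in>afforded_graph G N \<theta> H P P' W.
           induced_block_eq \<MM> (G\<lparr>carrier := W\<rparr>) (W \<inter> H)
             (bl \<MM> (G\<lparr>carrier := W \<inter> H\<rparr>) \<psi>) (bl \<MM> (G\<lparr>carrier := W\<rparr>) \<xi>)))"

end

theory Submission
  imports
    Defs
    "Jordan_Normal_Form.Spectral_Radius"
    "HOL-Algebra.Multiplicative_Group"
begin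

text \<open>
  Let \<open>(P, P')\<close> afford \<open>(G, N, \<theta>) \<ge>\<^sub>b (H, M, \<phi>)\<close>, and let \<open>T\<close> be the inertia group of \<open>\<theta>\<close> in \<open>G\<close>.
  For an orbit \<open>C\<close> of \<open>N\<close> on \<open>T\<close> by conjugation, consider the two normalised orbit sums
  \<open>s(C) = (\<Sum>y\<in>C. tr P(y)) / \<theta>(1)\<close> and \<open>s'(C) = (\<Sum>y\<in>C \<inter> H. tr P'(y)) / \<phi>(1)\<close>. The proof rests on the
  fact that the block condition for all groups \<open>W\<close> between \<open>N\<close> and \<open>T\<close> amounts to the
  congruences \<open>s(C) \<equiv> s'(C)\<close> modulo \<open>\<MM>\<close> for all orbits \<open>C\<close>. The block condition itself does not pass
  to direct products in an obvious way, because a group between \<open>N\<^sub>1 \<times> N\<^sub>2\<close> and \<open>T\<^sub>1 \<times> T\<^sub>2\<close> need not be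
  a product. The congruences do: the orbit of \<open>(x, y)\<close> under \<open>N\<^sub>1 \<times> N\<^sub>2\<close> is the product of the
  orbits of \<open>x\<close> and \<open>y\<close>, so both orbit sums of the tensor products are products of orbit sums.

  Blocks give congruences (\<open>orbit_congruence\<close>). Given \<open>x \<in> T\<close>, take \<open>W = \<langle>N, x\<rangle>\<close>. As \<open>W / N\<close> is cyclic,
  the factor set of \<open>P\<close> is a coboundary on \<open>W\<close> (\<open>cyclic_twist\<close>), so a root-of-unity-valued function \<open>q\<close>
  makes \<open>\<xi> = q \<cdot> tr P\<close> a character of \<open>W\<close> corresponding to \<open>q \<cdot> tr P'\<close>. The orbit of \<open>x\<close> under \<open>N\<close> is a
  conjugacy class of \<open>W\<close>, and the equality of central characters at this class is the congruence
  multiplied by \<open>q(x)\<close>.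

  Congruences give blocks (\<open>block_transfer\<close>). Let \<open>\<xi> = tr (Q \<otimes> P)\<close> be irreducible and \<open>\<psi> = tr (Q \<otimes> P')\<close>.
  Taking the partial trace of a class sum of \<open>W\<close> over the second tensor factor shows that the
  difference \<open>d\<close> of the central characters of \<open>\<xi>\<close> and \<open>\<psi>\<close> satisfies
  \<open>d \<cdot> 1 = (\<Sum>C. (s(C) - s'(C)) \<cdot> Q(C))\<close>, a combination of matrices \<open>Q(x)\<close> with coefficients in \<open>\<MM>\<close>.
  Since these matrices are permuted up to roots of unity by multiplication with each other, a
  determinant argument (\<open>MM_eigenvalue\<close>) yields \<open>d \<in> \<MM>\<close>.

  The common defect group is treated separately. The irreducible characters of a direct product
  are the tensor products (\<open>Irr_DirProd\<close>), hence the block of a tensor product consists of tensor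
  products and its idempotent coefficients are products; that a product of two coefficients that
  are nonzero modulo \<open>\<MM>\<close> is again nonzero (\<open>local_max_ideal_prime\<close>) uses that the localisation of
  the algebraic integers at \<open>\<MM>\<close> is a valuation ring. All conditions on Galois
  twists can be read off componentwise, since \<open>\<chi>\<^sub>1 \<otimes> \<chi>\<^sub>2\<close> determines \<open>\<chi>\<^sub>1\<close> and \<open>\<chi>\<^sub>2\<close>.
\<close>

section \<open>Matrix representations and Schur's lemma\<close>

lemma carrier_GL:
  "A \<in> carrier (GL n) \<longleftrightarrow> A \<in> carrier_mat n n \<and> (\<exists>B\<in>carrier_mat n n. B * A = 1\<^sub>m n \<and> A * B = 1\<^sub>m n)"
  by (auto simp: units_of_def Units_def ring_mat_def)

lemma mult_GL [simp]: "A \<otimes>\<^bsub>GL n\<^esub> B = A * B"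
  by (simp add: units_of_def ring_mat_def)

lemma hom_GL_I:
  assumes "group G" "\<And>x. x \<in> carrier G \<Longrightarrow> R x \<in> carrier_mat n n"
    "R \<one>\<^bsub>G\<^esub> = 1\<^sub>m n"
    "\<And>x y. x \<in> carrier G \<Longrightarrow> y \<in> carrier G \<Longrightarrow> R (x \<otimes>\<^bsub>G\<^esub> y) = R x * R y"
  shows "R \<in> hom G (GL n)"
proof -
  interpret group G by fact
  have "R x \<in> carrier (GL n)" if x: "x \<in> carrier G" for x
    unfolding carrier_GL
    by (intro conjI bexI[of _ "R (inv\<^bsub>G\<^esub> x)"])
      (use x assms(2) assms(3) assms(4)[of x "inv\<^bsub>G\<^esub> x"] assms(4)[of "inv\<^bsub>G\<^esub> x" x] in auto)
  then show ?thesis using assms(4) by (auto simp: hom_def)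
qed

lemma hom_GL_D:
  assumes "group G" "R \<in> hom G (GL n)"
  shows "\<And>x. x \<in> carrier G \<Longrightarrow> R x \<in> carrier_mat n n"
    "R \<one>\<^bsub>G\<^esub> = 1\<^sub>m n"
    "\<And>x y. x \<in> carrier G \<Longrightarrow> y \<in> carrier G \<Longrightarrow> R (x \<otimes>\<^bsub>G\<^esub> y) = R x * R y"
proof -
  interpret group G by fact
  show c: "\<And>x. x \<in> carrier G \<Longrightarrow> R x \<in> carrier_mat n n"
    using assms(2) by (auto simp: hom_def carrier_GL)
  show m: "\<And>x y. x \<in> carrier G \<Longrightarrow> y \<in> carrier G \<Longrightarrow> R (x \<otimes>\<^bsub>G\<^esub> y) = R x * R y"
    using assms(2) by (auto simp: hom_def)
  have "R \<one>\<^bsub>G\<^esub> \<in> carrier (GL n)" using assms(2) by (auto simp: hom_def)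
  then obtain B where B: "B \<in> carrier_mat n n" "B * R \<one>\<^bsub>G\<^esub> = 1\<^sub>m n"
    unfolding carrier_GL by auto
  have "R \<one>\<^bsub>G\<^esub> = R \<one>\<^bsub>G\<^esub> * R \<one>\<^bsub>G\<^esub>" using m[of "\<one>\<^bsub>G\<^esub>" "\<one>\<^bsub>G\<^esub>"] by simp
  then have "B * R \<one>\<^bsub>G\<^esub> = (B * R \<one>\<^bsub>G\<^esub>) * R \<one>\<^bsub>G\<^esub>"
    using B c[of "\<one>\<^bsub>G\<^esub>"] by (metis assoc_mult_mat one_closed)
  then show "R \<one>\<^bsub>G\<^esub> = 1\<^sub>m n" using B c[of "\<one>\<^bsub>G\<^esub>"] by simp
qed

lemma mult_mat_entry:
  assumes "A \<in> carrier_mat m n" "B \<in> carrier_mat n k" "i < m" "j < k"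
  shows "(A * B) $$ (i, j) = (\<Sum>l<n. A $$ (i, l) * B $$ (l, j))"
  using assms by (auto simp: scalar_prod_def atLeast0LessThan)

lemma mult_vec_entry:
  assumes "A \<in> carrier_mat m n" "v \<in> carrier_vec n" "i < m"
  shows "(A *\<^sub>v v) $ i = (\<Sum>l<n. A $$ (i, l) * v $ l)"
  using assms by (auto simp: scalar_prod_def atLeast0LessThan)

lemma mat_trace_comm:
  assumes "A \<in> carrier_mat m n" "B \<in> carrier_mat n m"
  shows "mat_trace (A * B) = mat_trace (B * A)"
proof -
  have "mat_trace (A * B) = (\<Sum>i<m. \<Sum>l<n. A $$ (i, l) * B $$ (l, i))"
    using assms by (simp add: mat_trace_def mult_mat_entry del: index_mult_mat(1))
  also have "\<dots> = (\<Sum>l<n. \<Sum>i<m. B $$ (l, i) * A $$ (i, l))"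
    by (subst sum.swap) (simp add: mult.commute)
  also have "\<dots> = mat_trace (B * A)"
    using assms by (simp add: mat_trace_def mult_mat_entry del: index_mult_mat(1))
  finally show ?thesis .
qed

lemma mat_trace_one [simp]: "mat_trace (1\<^sub>m n) = of_nat n"
  by (simp add: mat_trace_def)

lemma subspace_iff:
  "VectorSpace.subspace class_ring U (module_vec TYPE(complex) n) \<longleftrightarrow>
     U \<subseteq> carrier_vec n \<and> 0\<^sub>v n \<in> U \<and> (\<forall>v\<in>U. \<forall>w\<in>U. v + w \<in> U) \<and> (\<forall>c. \<forall>v\<in>U. c \<cdot>\<^sub>v v \<in> U)"
proof -
  have "vectorspace (class_ring :: complex ring) (module_vec TYPE(complex) n)"
    "Module.module (class_ring :: complex ring) (module_vec TYPE(complex) n)"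
    by (rule vec_vs, rule vec_module)
  then show ?thesis
    unfolding VectorSpace.subspace_def submodule_def
    by (simp add: module_vec_simps class_ring_simps) blast
qed

text \<open>Irreducibility is a property of a set of matrices, so that it also makes sense for the values of
  a projective representation.\<close>
definition acts_irreducibly :: "nat \<Rightarrow> complex mat set \<Rightarrow> bool" where
  "acts_irreducibly n \<S> \<longleftrightarrow> n > 0 \<and> (\<forall>U. U \<subseteq> carrier_vec n \<and> 0\<^sub>v n \<in> U \<and>
     (\<forall>v\<in>U. \<forall>w\<in>U. v + w \<in> U) \<and> (\<forall>c. \<forall>v\<in>U. c \<cdot>\<^sub>v v \<in> U) \<and>
     (\<forall>A\<in>\<S>. \<forall>v\<in>U. A *\<^sub>v v \<in> U) \<longrightarrow> U = {0\<^sub>v n} \<or> U = carrier_vec n)"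

lemma irreducible_rep_iff:
  "irreducible_rep G n R \<longleftrightarrow> R \<in> hom G (GL n) \<and> acts_irreducibly n (R ` carrier G)"
  unfolding irreducible_rep_def acts_irreducibly_def subspace_iff by auto

lemma acts_irreducibly_cases [consumes 1]:
  assumes "acts_irreducibly n \<S>"
    "U \<subseteq> carrier_vec n" "0\<^sub>v n \<in> U"
    "\<And>v w. v \<in> U \<Longrightarrow> w \<in> U \<Longrightarrow> v + w \<in> U" "\<And>c v. v \<in> U \<Longrightarrow> c \<cdot>\<^sub>v v \<in> U"
    "\<And>A v. A \<in> \<S> \<Longrightarrow> v \<in> U \<Longrightarrow> A *\<^sub>v v \<in> U"
  shows "U = {0\<^sub>v n} \<or> U = carrier_vec n"
  using assms(1)[unfolded acts_irreducibly_def, THEN conjunct2, THEN spec, of U]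
  by (rule mp) (use assms(2-) in simp)

lemma mat_eq_zeroI:
  fixes A :: "complex mat"
  assumes "A \<in> carrier_mat m n" "\<And>v. v \<in> carrier_vec n \<Longrightarrow> A *\<^sub>v v = 0\<^sub>v m"
  shows "A = 0\<^sub>m m n"
proof (rule eq_matI)
  fix i j assume ij: "i < dim_row (0\<^sub>m m n :: complex mat)" "j < dim_col (0\<^sub>m m n :: complex mat)"
  then have "(A *\<^sub>v unit_vec n j) $ i = 0" using assms(2)[of "unit_vec n j"] by simp
  then show "A $$ (i, j) = 0\<^sub>m m n $$ (i, j)" using ij assms(1) by simp
qed (use assms in auto)

text \<open>An eigenspace of \<open>T\<close> is stable under every matrix commuting with \<open>T\<close>.\<close>
theorem schur_scalar:
  assumes irr: "acts_irreducibly n \<S>" and S: "\<S> \<subseteq> carrier_mat n n"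
    and T: "T \<in> carrier_mat n n" and comm: "\<And>A. A \<in> \<S> \<Longrightarrow> A * T = T * A"
  obtains c where "T = c \<cdot>\<^sub>m 1\<^sub>m n"
proof -
  have n: "n > 0" using irr by (simp add: acts_irreducibly_def)
  obtain c where "eigenvalue T c"
    using spectrum_non_empty[OF T n] by (auto simp: spectrum_def)
  then obtain v where v: "v \<in> carrier_vec n" "v \<noteq> 0\<^sub>v n" "T *\<^sub>v v = c \<cdot>\<^sub>v v"
    using T by (auto simp: eigenvalue_def eigenvector_def)
  define U where "U = {v \<in> carrier_vec n. T *\<^sub>v v = c \<cdot>\<^sub>v v}"
  have "U = {0\<^sub>v n} \<or> U = carrier_vec n"
    using irr
  proof (rule acts_irreducibly_cases)
    show "v + w \<in> U" if "v \<in> U" "w \<in> U" for v w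
      using that T by (auto simp: U_def mult_add_distrib_mat_vec smult_add_distrib_vec)
    show "d \<cdot>\<^sub>v v \<in> U" if "v \<in> U" for v d
      using that T by (auto simp: U_def mult_mat_vec smult_smult_assoc mult.commute)
    show "A *\<^sub>v v \<in> U" if "A \<in> \<S>" "v \<in> U" for v A
    proof -
      have A: "A \<in> carrier_mat n n" and v: "v \<in> carrier_vec n" "T *\<^sub>v v = c \<cdot>\<^sub>v v"
        using that S by (auto simp: U_def)
      have "T *\<^sub>v (A *\<^sub>v v) = A *\<^sub>v (T *\<^sub>v v)"
        using comm[OF that(1)] A T v(1) by (metis assoc_mult_mat_vec)
      then show ?thesis using A v T by (auto simp: U_def mult_mat_vec)
    qed
  qed (use T in \<open>auto simp: U_def\<close>)
  then have all: "U = carrier_vec n" using v by (auto simp: U_def)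
  have "T = c \<cdot>\<^sub>m 1\<^sub>m n"
  proof (rule eq_matI)
    fix i j assume ij: "i < dim_row (c \<cdot>\<^sub>m 1\<^sub>m n)" "j < dim_col (c \<cdot>\<^sub>m 1\<^sub>m n)"
    have "unit_vec n j \<in> U" using all by simp
    then have "(T *\<^sub>v unit_vec n j) $ i = (c \<cdot>\<^sub>v unit_vec n j) $ i" by (simp add: U_def)
    then show "T $$ (i, j) = (c \<cdot>\<^sub>m 1\<^sub>m n) $$ (i, j)" using ij T
      by (auto simp: mult_mat_vec_def scalar_prod_right_unit unit_vec_def[of n j, symmetric])
  qed (use T in auto)
  then show ?thesis by (rule that)
qed

text \<open>If there were more columns than rows, padding with zero rows would give a square matrix of
  determinant zero, which has a nonzero kernel vector.\<close>
lemma injective_mat_dim_le: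
  fixes B :: "complex mat"
  assumes B: "B \<in> carrier_mat n m" and inj: "\<And>v. v \<in> carrier_vec m \<Longrightarrow> B *\<^sub>v v = 0\<^sub>v n \<Longrightarrow> v = 0\<^sub>v m"
  shows "m \<le> n"
proof (rule ccontr)
  assume "\<not> m \<le> n"
  then have nm: "n < m" by simp
  define C where "C = mat m m (\<lambda>(i, j). if i < n then B $$ (i, j) else 0)"
  have C: "C \<in> carrier_mat m m" by (simp add: C_def)
  have "multrow (m - 1) 0 C = C"
    using nm by (intro eq_matI) (auto simp: C_def)
  then have "det C = 0" using det_multrow[of "m - 1" m C 0] nm C by simp
  then obtain v where v: "v \<in> carrier_vec m" "v \<noteq> 0\<^sub>v m" "C *\<^sub>v v = 0\<^sub>v m"
    using det_0_iff_vec_prod_zero_field[OF C] by auto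
  have "B *\<^sub>v v = 0\<^sub>v n"
  proof (rule eq_vecI)
    fix i assume i: "i < dim_vec (0\<^sub>v n :: complex vec)"
    have "(C *\<^sub>v v) $ i = 0" using v nm i by simp
    then show "(B *\<^sub>v v) $ i = 0\<^sub>v n $ i"
      using i nm mult_vec_entry[OF C v(1), of i] mult_vec_entry[OF B v(1), of i] by (simp add: C_def)
  qed (use B in auto)
  then show False using inj v by auto
qed

lemma injective_square_invertible:
  fixes B :: "complex mat"
  assumes B: "B \<in> carrier_mat n n" and inj: "\<And>v. v \<in> carrier_vec n \<Longrightarrow> B *\<^sub>v v = 0\<^sub>v n \<Longrightarrow> v = 0\<^sub>v n"
  obtains C where "C \<in> carrier_mat n n" "B * C = 1\<^sub>m n" "C * B = 1\<^sub>m n"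
proof -
  have "det B \<noteq> 0" using det_0_iff_vec_prod_zero_field[OF B] inj by auto
  then obtain C where "C \<in> carrier_mat n n" "C * B = 1\<^sub>m n"
    using det_non_zero_imp_unit[OF B] by (auto simp: Units_def ring_mat_def)
  then show ?thesis using mat_mult_left_right_inverse[of C n B] B that by auto
qed

section \<open>Schur orthogonality\<close>

text \<open>The image of a nonzero intertwiner is a nonzero stable subspace. The columns of \<open>Y\<close> are preimages
  of the unit vectors.\<close>
lemma intertwiner_surjective:
  assumes irr: "acts_irreducibly m (S ` X)"
    and T: "T \<in> carrier_mat m n" "T \<noteq> 0\<^sub>m m n"
    and R: "\<And>x. x \<in> X \<Longrightarrow> R x \<in> carrier_mat n n" and S: "\<And>x. x \<in> X \<Longrightarrow> S x \<in> carrier_mat m m"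
    and ST: "\<And>x. x \<in> X \<Longrightarrow> S x * T = T * R x"
  obtains Y where "Y \<in> carrier_mat n m" "T * Y = 1\<^sub>m m"
proof -
  define U where "U = {T *\<^sub>v v | v. v \<in> carrier_vec n}"
  have "U = {0\<^sub>v m} \<or> U = carrier_vec m"
    using irr
  proof (rule acts_irreducibly_cases)
    show "U \<subseteq> carrier_vec m" using T by (auto simp: U_def)
    show "0\<^sub>v m \<in> U" using T by (auto simp: U_def intro!: exI[of _ "0\<^sub>v n"])
    show "v + w \<in> U" if "v \<in> U" "w \<in> U" for v w
    proof -
      from that obtain a b where "v = T *\<^sub>v a" "w = T *\<^sub>v b" "a \<in> carrier_vec n" "b \<in> carrier_vec n"
        by (auto simp: U_def)
      then show ?thesis using T unfolding U_def
        by (auto intro!: exI[of _ "a + b"] simp: mult_add_distrib_mat_vec)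
    qed
    show "d \<cdot>\<^sub>v v \<in> U" if "v \<in> U" for v d
    proof -
      from that obtain a where "v = T *\<^sub>v a" "a \<in> carrier_vec n" by (auto simp: U_def)
      then show ?thesis using T unfolding U_def
        by (auto intro!: exI[of _ "d \<cdot>\<^sub>v a"] simp: mult_mat_vec)
    qed
    show "A *\<^sub>v v \<in> U" if A: "A \<in> S ` X" and v: "v \<in> U" for v A
    proof -
      obtain x where x: "x \<in> X" "A = S x" using A by auto
      obtain a where a: "a \<in> carrier_vec n" "v = T *\<^sub>v a" using v by (auto simp: U_def)
      have "S x *\<^sub>v (T *\<^sub>v a) = (S x * T) *\<^sub>v a" using T(1) S[OF x(1)] a(1) by simp
      also have "\<dots> = T *\<^sub>v (R x *\<^sub>v a)" using T(1) R[OF x(1)] a(1) by (simp add: ST[OF x(1)])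
      finally show ?thesis using R[OF x(1)] a x unfolding U_def by auto
    qed
  qed
  moreover have "U \<noteq> {0\<^sub>v m}"
  proof
    assume U: "U = {0\<^sub>v m}"
    have "T = 0\<^sub>m m n"
    proof (rule mat_eq_zeroI[OF T(1)])
      fix v :: "complex vec" assume "v \<in> carrier_vec n"
      then have "T *\<^sub>v v \<in> U" unfolding U_def by auto
      then show "T *\<^sub>v v = 0\<^sub>v m" using U by simp
    qed
    then show False using T by simp
  qed
  ultimately have all: "U = carrier_vec m" by simp
  then have "\<exists>v\<in>carrier_vec n. T *\<^sub>v v = unit_vec m j" for j
  proof -
    have "unit_vec m j \<in> U" using all by simp
    then obtain v where "v \<in> carrier_vec n" "unit_vec m j = T *\<^sub>v v" unfolding U_def by blast
    then show ?thesis by metis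
  qed
  then obtain f where f: "\<And>j. f j \<in> carrier_vec n" "\<And>j. T *\<^sub>v f j = unit_vec m j" by metis
  define Y where "Y = mat n m (\<lambda>(i, j). f j $ i)"
  have Y: "Y \<in> carrier_mat n m" by (simp add: Y_def)
  have "T * Y = 1\<^sub>m m"
  proof (rule eq_matI)
    fix i j assume ij: "i < dim_row (1\<^sub>m m :: complex mat)" "j < dim_col (1\<^sub>m m :: complex mat)"
    have "(T * Y) $$ (i, j) = (\<Sum>l<n. T $$ (i, l) * f j $ l)"
      using ij mult_mat_entry[OF T(1) Y, of i j] by (simp add: Y_def)
    also have "\<dots> = (T *\<^sub>v f j) $ i" using mult_vec_entry[OF T(1) f(1), of i j] ij by simp
    finally show "(T * Y) $$ (i, j) = 1\<^sub>m m $$ (i, j)" using ij by (auto simp: f(2))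
  qed (use T Y in auto)
  then show ?thesis using Y that by blast
qed

text \<open>The sum over \<open>g\<close> of \<open>S(g) * E * R(inv g)\<close>, where \<open>E\<close> is the matrix unit at \<open>(j, k)\<close>.\<close>
definition averaged_intertwiner where
  "averaged_intertwiner G m n S R j k =
    mat m n (\<lambda>(i, l). \<Sum>g\<in>carrier G. S g $$ (i, j) * R (inv\<^bsub>G\<^esub> g) $$ (k, l) :: complex)"

lemma averaged_intertwiner:
  assumes G: "group G" "finite (carrier G)"
    and R: "R \<in> hom G (GL n)" and S: "S \<in> hom G (GL m)" and jk: "j < m" "k < n"
    and h: "h \<in> carrier G"
  shows "S h * averaged_intertwiner G m n S R j k = averaged_intertwiner G m n S R j k * R h"
    (is "_ * ?T = _")
proof -
  interpret group G by fact
  note R = hom_GL_D[OF G(1) R] and S = hom_GL_D[OF G(1) S]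
  have T: "?T \<in> carrier_mat m n" by (simp add: averaged_intertwiner_def)
  show ?thesis
  proof (rule eq_matI)
    fix i l assume il: "i < dim_row (?T * R h)" "l < dim_col (?T * R h)"
    then have il: "i < m" "l < n" using T R(1)[OF h] by auto
    have "(S h * ?T) $$ (i, l) =
      (\<Sum>a<m. S h $$ (i, a) * (\<Sum>g\<in>carrier G. S g $$ (a, j) * R (inv\<^bsub>G\<^esub> g) $$ (k, l)))"
      using il by (subst mult_mat_entry[OF S(1)[OF h] T]) (auto simp: averaged_intertwiner_def)
    also have "\<dots> = (\<Sum>g\<in>carrier G. (\<Sum>a<m. S h $$ (i, a) * S g $$ (a, j)) * R (inv\<^bsub>G\<^esub> g) $$ (k, l))"
      by (subst sum_distrib_left, subst sum.swap) (simp add: sum_distrib_right mult.assoc)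
    also have "\<dots> = (\<Sum>g\<in>carrier G. S (h \<otimes>\<^bsub>G\<^esub> g) $$ (i, j) * R (inv\<^bsub>G\<^esub> g) $$ (k, l))"
      using il jk h by (intro sum.cong refl) (simp add: S(3) mult_mat_entry[OF S(1) S(1)] del: index_mult_mat(1))
    also have "\<dots> = (\<Sum>g\<in>carrier G. S g $$ (i, j) * R (inv\<^bsub>G\<^esub> g \<otimes>\<^bsub>G\<^esub> h) $$ (k, l))"
      by (rule sum.reindex_bij_witness[of _ "\<lambda>g. inv\<^bsub>G\<^esub> h \<otimes>\<^bsub>G\<^esub> g" "\<lambda>g. h \<otimes>\<^bsub>G\<^esub> g"])
        (use h in \<open>auto simp: inv_mult_group m_assoc[symmetric]\<close>, simp add: m_assoc)
    also have "\<dots> = (\<Sum>g\<in>carrier G. S g $$ (i, j) * (\<Sum>b<n. R (inv\<^bsub>G\<^esub> g) $$ (k, b) * R h $$ (b, l)))"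
      using il jk h by (intro sum.cong refl) (simp add: R(3) mult_mat_entry[OF R(1) R(1)] del: index_mult_mat(1))
    also have "\<dots> = (\<Sum>b<n. (\<Sum>g\<in>carrier G. S g $$ (i, j) * R (inv\<^bsub>G\<^esub> g) $$ (k, b)) * R h $$ (b, l))"
      by (subst sum_distrib_left, subst sum.swap) (simp add: sum_distrib_right mult.assoc)
    also have "\<dots> = (?T * R h) $$ (i, l)"
      using il by (subst mult_mat_entry[OF T R(1)[OF h]]) (auto simp: averaged_intertwiner_def)
    finally show "(S h * ?T) $$ (i, l) = (?T * R h) $$ (i, l)" .
  qed (use T R(1)[OF h] S(1)[OF h] in auto)
qed

text \<open>The pairing of the two characters is the sum of the entries at \<open>(j, k)\<close> of the averaged
  intertwiners for \<open>(j, k)\<close>, so these cannot all vanish.\<close>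
lemma nonzero_pairing_intertwiner:
  assumes G: "group G" "finite (carrier G)"
    and R: "R \<in> hom G (GL n)" and S: "S \<in> hom G (GL m)"
    and nz: "(\<Sum>g\<in>carrier G. mat_trace (S g) * mat_trace (R (inv\<^bsub>G\<^esub> g))) \<noteq> 0"
  obtains T where "T \<in> carrier_mat m n" "T \<noteq> 0\<^sub>m m n"
    "\<And>x. x \<in> carrier G \<Longrightarrow> S x * T = T * R x"
proof -
  interpret group G by fact
  note R' = hom_GL_D[OF G(1) R] and S' = hom_GL_D[OF G(1) S]
  have "\<exists>j<m. \<exists>k<n. averaged_intertwiner G m n S R j k \<noteq> 0\<^sub>m m n"
  proof (rule ccontr)
    assume "\<not> ?thesis"
    then have z: "averaged_intertwiner G m n S R j k $$ (j, k) = 0" if "j < m" "k < n" for j k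
      using that by simp
    have "(\<Sum>g\<in>carrier G. mat_trace (S g) * mat_trace (R (inv\<^bsub>G\<^esub> g))) =
      (\<Sum>g\<in>carrier G. (\<Sum>j<m. S g $$ (j, j)) * (\<Sum>k<n. R (inv\<^bsub>G\<^esub> g) $$ (k, k)))"
      using carrier_matD[OF R'(1)] carrier_matD[OF S'(1)] by (intro sum.cong refl) (simp add: mat_trace_def)
    also have "\<dots> = (\<Sum>g\<in>carrier G. \<Sum>j<m. \<Sum>k<n. S g $$ (j, j) * R (inv\<^bsub>G\<^esub> g) $$ (k, k))"
      by (simp add: sum_product)
    also have "\<dots> = (\<Sum>j<m. \<Sum>k<n. \<Sum>g\<in>carrier G. S g $$ (j, j) * R (inv\<^bsub>G\<^esub> g) $$ (k, k))"
      by (subst sum.swap, rule sum.cong[OF refl], rule sum.swap)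
    also have "\<dots> = (\<Sum>j<m. \<Sum>k<n. averaged_intertwiner G m n S R j k $$ (j, k))"
      by (intro sum.cong refl) (simp add: averaged_intertwiner_def)
    also have "\<dots> = 0" using z by simp
    finally show False using nz by simp
  qed
  then obtain j k where jk: "j < m" "k < n" "averaged_intertwiner G m n S R j k \<noteq> 0\<^sub>m m n" by blast
  show ?thesis
    by (rule that[OF _ jk(3) averaged_intertwiner[OF G R S jk(1,2)]])
      (auto simp: averaged_intertwiner_def)
qed

text \<open>The averaged intertwiner of \<open>R\<close> with itself is a scalar matrix by Schur's lemma, and its trace
  determines the scalar.\<close>
theorem schur_orthogonality:
  assumes G: "group G" "finite (carrier G)" and irr: "irreducible_rep G n R"
    and "i < n" "j < n" "k < n" "l < n"
  shows "(\<Sum>g\<in>carrier G. R g $$ (i, j) * R (inv\<^bsub>G\<^esub> g) $$ (k, l)) =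
    (if i = l \<and> j = k then of_nat (card (carrier G)) / of_nat n else 0)"
proof -
  interpret group G by fact
  have hom: "R \<in> hom G (GL n)" and acts: "acts_irreducibly n (R ` carrier G)"
    using irr by (auto simp: irreducible_rep_iff)
  note R = hom_GL_D[OF G(1) hom]
  let ?T = "averaged_intertwiner G n n R R j k"
  obtain c where c: "?T = c \<cdot>\<^sub>m 1\<^sub>m n"
  proof (rule schur_scalar[OF acts])
    show "R ` carrier G \<subseteq> carrier_mat n n" using R(1) by auto
    show "?T \<in> carrier_mat n n" by (simp add: averaged_intertwiner_def)
    show "A * ?T = ?T * A" if "A \<in> R ` carrier G" for A
      using averaged_intertwiner[OF G hom hom assms(5,6)] that by auto
  qed
  have "of_nat n * c = (\<Sum>a<n. ?T $$ (a, a))" by (simp add: c)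
  also have "\<dots> = (\<Sum>a<n. \<Sum>g\<in>carrier G. R (inv\<^bsub>G\<^esub> g) $$ (k, a) * R g $$ (a, j))"
    by (simp add: averaged_intertwiner_def mult.commute)
  also have "\<dots> = (\<Sum>g\<in>carrier G. \<Sum>a<n. R (inv\<^bsub>G\<^esub> g) $$ (k, a) * R g $$ (a, j))"
    by (rule sum.swap)
  also have "\<dots> = (\<Sum>g\<in>carrier G. (R (inv\<^bsub>G\<^esub> g) * R g) $$ (k, j))"
    using assms(5,6) by (intro sum.cong refl) (simp add: mult_mat_entry[OF R(1) R(1)] del: index_mult_mat(1))
  also have "\<dots> = (\<Sum>g\<in>carrier G. 1\<^sub>m n $$ (k, j))"
    by (intro sum.cong refl arg_cong[of _ _ "\<lambda>A. A $$ (k, j)"]) (simp add: R(3)[symmetric] R(2))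
  also have "\<dots> = of_nat (card (carrier G)) * (if j = k then 1 else 0)"
    using assms(5,6) by simp
  finally have "c = (if j = k then of_nat (card (carrier G)) / of_nat n else 0)"
    using assms(5) by (cases "j = k") (simp_all add: field_simps)
  moreover have "(\<Sum>g\<in>carrier G. R g $$ (i, j) * R (inv\<^bsub>G\<^esub> g) $$ (k, l)) = ?T $$ (i, l)"
    using assms by (simp add: averaged_intertwiner_def)
  ultimately show ?thesis using assms by (simp add: c)
qed

lemma irreducible_character_norm:
  assumes G: "group G" "finite (carrier G)" and irr: "irreducible_rep G n R"
  shows "(\<Sum>g\<in>carrier G. mat_trace (R g) * mat_trace (R (inv\<^bsub>G\<^esub> g))) = of_nat (card (carrier G))"
proof -
  interpret group G by fact
  have hom: "R \<in> hom G (GL n)" and n: "n > 0"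
    using irr by (auto simp: irreducible_rep_iff acts_irreducibly_def)
  note R = hom_GL_D[OF G(1) hom]
  have "(\<Sum>g\<in>carrier G. mat_trace (R g) * mat_trace (R (inv\<^bsub>G\<^esub> g))) =
      (\<Sum>g\<in>carrier G. (\<Sum>j<n. R g $$ (j, j)) * (\<Sum>k<n. R (inv\<^bsub>G\<^esub> g) $$ (k, k)))"
    using carrier_matD[OF R(1)] by (intro sum.cong refl) (simp add: mat_trace_def)
  also have "\<dots> = (\<Sum>g\<in>carrier G. \<Sum>j<n. \<Sum>k<n. R g $$ (j, j) * R (inv\<^bsub>G\<^esub> g) $$ (k, k))"
    by (simp add: sum_product)
  also have "\<dots> = (\<Sum>j<n. \<Sum>k<n. \<Sum>g\<in>carrier G. R g $$ (j, j) * R (inv\<^bsub>G\<^esub> g) $$ (k, k))"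
    by (subst sum.swap, rule sum.cong[OF refl], rule sum.swap)
  also have "\<dots> = (\<Sum>j<n. \<Sum>k<n. if j = k then of_nat (card (carrier G)) / of_nat n else 0)"
    by (intro sum.cong refl) (simp add: schur_orthogonality[OF G irr])
  also have "\<dots> = of_nat (card (carrier G))" using n by simp
  finally show ?thesis .
qed

text \<open>The character has nonzero norm, hence there is a nonzero intertwiner onto \<open>S\<close>. It is surjective by
  irreducibility and invertible because the degrees agree, and it carries stable subspaces to stable
  subspaces.\<close>
lemma irreducible_of_character:
  assumes G: "group G" "finite (carrier G)" and irr: "irreducible_rep G m S"
    and R: "R \<in> hom G (GL n)"
    and eq: "\<And>g. g \<in> carrier G \<Longrightarrow> mat_trace (R g) = mat_trace (S g)"
  shows "irreducible_rep G n R"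
proof -
  interpret group G by fact
  have homS: "S \<in> hom G (GL m)" and acts: "acts_irreducibly m (S ` carrier G)"
    using irr by (auto simp: irreducible_rep_iff)
  note R' = hom_GL_D[OF G(1) R] and S' = hom_GL_D[OF G(1) homS]
  have "of_nat n = (of_nat m :: complex)" using eq[of "\<one>\<^bsub>G\<^esub>"] by (simp add: R' S')
  then have nm: "n = m" by simp
  have "(\<Sum>g\<in>carrier G. mat_trace (S g) * mat_trace (R (inv\<^bsub>G\<^esub> g))) \<noteq> 0"
    using irreducible_character_norm[OF G irr] eq G(2) by (simp add: card_gt_0_iff) (metis card_eq_0_iff empty_iff one_closed)
  then obtain T where T: "T \<in> carrier_mat m n" "T \<noteq> 0\<^sub>m m n"
    and ST: "\<And>x. x \<in> carrier G \<Longrightarrow> S x * T = T * R x"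
    using nonzero_pairing_intertwiner[OF G R homS] by metis
  obtain Y where Y: "Y \<in> carrier_mat n m" "T * Y = 1\<^sub>m m"
    using intertwiner_surjective[OF acts T R'(1) S'(1) ST] by blast
  have Ti: "T \<in> carrier_mat n n" "Y \<in> carrier_mat n n" using T Y nm by auto
  have YT: "Y * T = 1\<^sub>m n" using mat_mult_left_right_inverse[OF Ti] Y nm by simp
  have YTv: "Y *\<^sub>v (T *\<^sub>v v) = v" if "v \<in> carrier_vec n" for v
    using that Ti YT by (metis assoc_mult_mat_vec one_mult_mat_vec)
  have TYv: "T *\<^sub>v (Y *\<^sub>v v) = v" if "v \<in> carrier_vec n" for v
    using that Ti Y nm by (metis assoc_mult_mat_vec one_mult_mat_vec)
  have "acts_irreducibly n (R ` carrier G)" unfolding acts_irreducibly_def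
  proof (intro conjI allI impI)
    show "n > 0" using acts nm by (simp add: acts_irreducibly_def)
    fix U assume U: "U \<subseteq> carrier_vec n \<and> 0\<^sub>v n \<in> U \<and>
     (\<forall>v\<in>U. \<forall>w\<in>U. v + w \<in> U) \<and> (\<forall>c. \<forall>v\<in>U. c \<cdot>\<^sub>v v \<in> U) \<and>
     (\<forall>A\<in>R ` carrier G. \<forall>v\<in>U. A *\<^sub>v v \<in> U)"
    define V where "V = {v \<in> carrier_vec n. Y *\<^sub>v v \<in> U}"
    have "V = {0\<^sub>v m} \<or> V = carrier_vec m"
      using acts
    proof (rule acts_irreducibly_cases)
      show "v + w \<in> V" if "v \<in> V" "w \<in> V" for v w
        using that Ti U by (auto simp: V_def mult_add_distrib_mat_vec)
      show "d \<cdot>\<^sub>v v \<in> V" if "v \<in> V" for v d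
        using that Ti U by (auto simp: V_def mult_mat_vec)
      have "Y *\<^sub>v 0\<^sub>v n = 0\<^sub>v n" using Ti by auto
      then show "0\<^sub>v m \<in> V" using U nm by (simp add: V_def)
      show "V \<subseteq> carrier_vec m" using nm by (auto simp: V_def)
      show "A *\<^sub>v v \<in> V" if A: "A \<in> S ` carrier G" and v: "v \<in> V" for v A
      proof -
        obtain x where x: "x \<in> carrier G" "A = S x" using A by auto
        have Sx: "S x \<in> carrier_mat n n" and Rx: "R x \<in> carrier_mat n n" using S'(1) R'(1) x nm by auto
        have v: "v \<in> carrier_vec n" "Y *\<^sub>v v \<in> U" using v by (auto simp: V_def)
        have Yv: "Y *\<^sub>v v \<in> carrier_vec n" using Ti v by simp
        have "S x *\<^sub>v v = S x *\<^sub>v (T *\<^sub>v (Y *\<^sub>v v))" using TYv v by simp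
        also have "\<dots> = (S x * T) *\<^sub>v (Y *\<^sub>v v)" using Sx Ti Yv by (metis assoc_mult_mat_vec)
        also have "\<dots> = T *\<^sub>v (R x *\<^sub>v (Y *\<^sub>v v))" unfolding ST[OF x(1)] using Rx Ti Yv by (metis assoc_mult_mat_vec)
        finally have "Y *\<^sub>v (S x *\<^sub>v v) = R x *\<^sub>v (Y *\<^sub>v v)"
          using YTv[of "R x *\<^sub>v (Y *\<^sub>v v)"] Rx Yv by simp
        then show ?thesis using U v x Sx by (auto simp: V_def)
      qed
    qed
    then show "U = {0\<^sub>v n} \<or> U = carrier_vec n"
    proof
      assume V: "V = {0\<^sub>v m}"
      have "v = 0\<^sub>v n" if "v \<in> U" for v
      proof -
        have "v \<in> carrier_vec n" using that U by auto
        then have "T *\<^sub>v v \<in> V" using that YTv Ti by (simp add: V_def)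
        then have "T *\<^sub>v v = 0\<^sub>v n" using V nm by simp
        then have "v = Y *\<^sub>v 0\<^sub>v n" using YTv[OF \<open>v \<in> carrier_vec n\<close>] by simp
        then show ?thesis using Ti by auto
      qed
      then show ?thesis using U by blast
    next
      assume V: "V = carrier_vec m"
      have "v \<in> U" if "v \<in> carrier_vec n" for v
      proof -
        have "T *\<^sub>v v \<in> V" using V that Ti nm by simp
        then show ?thesis using YTv[OF that] by (simp add: V_def)
      qed
      then show ?thesis using U by blast
    qed
  qed
  then show ?thesis using R by (simp add: irreducible_rep_iff)
qed

section \<open>Kronecker products of irreducible families\<close>

lemma sum_lessThan_product:
  fixes f :: "nat \<Rightarrow> 'c :: comm_monoid_add"
  shows "(\<Sum>i<m * n. f i) = (\<Sum>a<m. \<Sum>b<n. f (a * n + b))"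
proof -
  have "(\<Sum>i<m * n. f i) = (\<Sum>a<m. sum f {a * n..<a * n + n})"
    by (simp add: sum.nat_group)
  also have "\<dots> = (\<Sum>a<m. \<Sum>b<n. f (a * n + b))"
  proof (rule sum.cong[OF refl])
    fix a
    show "sum f {a * n..<a * n + n} = (\<Sum>b<n. f (a * n + b))"
      by (rule sum.reindex_bij_witness[of _ "\<lambda>b. a * n + b" "\<lambda>i. i - a * n"]) auto
  qed
  finally show ?thesis .
qed

lemma index_pair_less: "a < m \<Longrightarrow> b < n \<Longrightarrow> a * n + b < m * (n::nat)"
proof -
  assume "a < m" "b < n"
  then have "a * n + b < (a + 1) * n" by simp
  also have "\<dots> \<le> m * n" using \<open>a < m\<close> by (intro mult_le_mono1) simp
  finally show ?thesis .
qed

lemma index_pair_cases: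
  assumes "i < m * (n::nat)"
  obtains a b where "a < m" "b < n" "i = a * n + b"
proof -
  have n: "n > 0" using assms by (cases n) auto
  show ?thesis
    by (rule that[of "i div n" "i mod n"]) (use assms n in \<open>auto simp: less_mult_imp_div_less\<close>)
qed

lemma kronecker_carrier:
  "A \<in> carrier_mat a b \<Longrightarrow> B \<in> carrier_mat c d \<Longrightarrow> kronecker A B \<in> carrier_mat (a * c) (b * d)"
  by (auto simp: kronecker_def)

lemma kronecker_entry:
  assumes "A \<in> carrier_mat a b" "B \<in> carrier_mat c d" "i < a" "k < c" "j < b" "l < d"
  shows "kronecker A B $$ (i * c + k, j * d + l) = A $$ (i, j) * B $$ (k, l)"
  using assms index_pair_less[of i a k c] index_pair_less[of j b l d]
  by (auto simp: kronecker_def)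

lemma eq_mat_pairI:
  assumes "A \<in> carrier_mat (a * c) (b * d)" "B \<in> carrier_mat (a * c) (b * d)"
    "\<And>i k j l. i < a \<Longrightarrow> k < c \<Longrightarrow> j < b \<Longrightarrow> l < d \<Longrightarrow>
       A $$ (i * c + k, j * d + l) = B $$ (i * c + k, j * d + l)"
  shows "A = B"
proof (rule eq_matI)
  fix i j assume "i < dim_row B" "j < dim_col B"
  then have "i < a * c" "j < b * d" using assms by auto
  then show "A $$ (i, j) = B $$ (i, j)" by (metis index_pair_cases assms(3))
qed (use assms in auto)

lemma eq_vec_pairI:
  assumes "v \<in> carrier_vec (m * n)" "w \<in> carrier_vec (m * n)"
    "\<And>i k. i < m \<Longrightarrow> k < n \<Longrightarrow> v $ (i * n + k) = w $ (i * n + k)"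
  shows "v = w"
proof (rule eq_vecI)
  fix i assume "i < dim_vec w"
  then have "i < m * n" using assms by auto
  then show "v $ i = w $ i" by (metis index_pair_cases assms(3))
qed (use assms in auto)

lemma kronecker_mult:
  assumes "A \<in> carrier_mat a b" "B \<in> carrier_mat c d" "A' \<in> carrier_mat b e" "B' \<in> carrier_mat d f"
  shows "kronecker A B * kronecker A' B' = kronecker (A * A') (B * B')"
proof (rule eq_mat_pairI)
  note K = kronecker_carrier[OF assms(1,2)] kronecker_carrier[OF assms(3,4)]
  show "kronecker A B * kronecker A' B' \<in> carrier_mat (a * c) (e * f)" using K by simp
  show "kronecker (A * A') (B * B') \<in> carrier_mat (a * c) (e * f)"
    using assms by (intro kronecker_carrier) auto
  fix i k j l assume ix: "i < a" "k < c" "j < e" "l < f"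
  have "(kronecker A B * kronecker A' B') $$ (i * c + k, j * f + l) =
      (\<Sum>s<b. \<Sum>t<d. (A $$ (i, s) * B $$ (k, t)) * (A' $$ (s, j) * B' $$ (t, l)))"
    using ix by (simp add: mult_mat_entry[OF K] index_pair_less sum_lessThan_product
      kronecker_entry[OF assms(1,2)] kronecker_entry[OF assms(3,4)] del: index_mult_mat(1))
  also have "\<dots> = (\<Sum>s<b. A $$ (i, s) * A' $$ (s, j)) * (\<Sum>t<d. B $$ (k, t) * B' $$ (t, l))"
    by (simp add: sum_product algebra_simps)
  also have "\<dots> = kronecker (A * A') (B * B') $$ (i * c + k, j * f + l)"
    using ix assms
    by (subst kronecker_entry[of _ a e _ c f])
      (auto simp: mult_mat_entry[OF assms(1,3)] mult_mat_entry[OF assms(2,4)] simp del: index_mult_mat(1))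
  finally show "(kronecker A B * kronecker A' B') $$ (i * c + k, j * f + l) =
    kronecker (A * A') (B * B') $$ (i * c + k, j * f + l)" .
qed

lemma kronecker_one: "kronecker (1\<^sub>m m) (1\<^sub>m n) = 1\<^sub>m (m * n)"
proof (rule eq_mat_pairI)
  show "kronecker (1\<^sub>m m) (1\<^sub>m n) \<in> carrier_mat (m * n) (m * n)" by (intro kronecker_carrier) auto
  fix i k j l assume ix: "i < m" "k < n" "j < m" "l < n"
  have "i * n + k = j * n + l \<longleftrightarrow> i = j \<and> k = l"
  proof
    assume eq: "i * n + k = j * n + l"
    have "(i * n + k) div n = i" "(i * n + k) mod n = k" "(j * n + l) div n = j" "(j * n + l) mod n = l"
      using ix by auto
    then show "i = j \<and> k = l" using eq by metis
  qed simp
  then show "kronecker (1\<^sub>m m) (1\<^sub>m n) $$ (i * n + k, j * n + l) = 1\<^sub>m (m * n) $$ (i * n + k, j * n + l)"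
    using ix by (subst kronecker_entry[of _ m m _ n n]) (auto simp: index_pair_less)
qed auto

lemma kronecker_smult:
  assumes "A \<in> carrier_mat a b" "B \<in> carrier_mat c d"
  shows "kronecker (x \<cdot>\<^sub>m A) (y \<cdot>\<^sub>m B) = (x * y) \<cdot>\<^sub>m kronecker A B"
proof (rule eq_mat_pairI)
  show "kronecker (x \<cdot>\<^sub>m A) (y \<cdot>\<^sub>m B) \<in> carrier_mat (a * c) (b * d)"
    using assms by (intro kronecker_carrier) auto
  show "(x * y) \<cdot>\<^sub>m kronecker A B \<in> carrier_mat (a * c) (b * d)"
    using kronecker_carrier[OF assms] by auto
  fix i k j l assume ix: "i < a" "k < c" "j < b" "l < d"
  then show "kronecker (x \<cdot>\<^sub>m A) (y \<cdot>\<^sub>m B) $$ (i * c + k, j * d + l) =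
      ((x * y) \<cdot>\<^sub>m kronecker A B) $$ (i * c + k, j * d + l)"
    using assms kronecker_carrier[OF assms] index_pair_less[of i a k c] index_pair_less[of j b l d]
    by (subst kronecker_entry[of _ a b _ c d]) (auto simp: kronecker_entry[OF assms])
qed

lemma mat_trace_kronecker:
  assumes "A \<in> carrier_mat m m" "B \<in> carrier_mat n n"
  shows "mat_trace (kronecker A B) = mat_trace A * mat_trace B"
proof -
  have "mat_trace (kronecker A B) = (\<Sum>i<m. \<Sum>k<n. A $$ (i, i) * B $$ (k, k))"
    using carrier_matD[OF kronecker_carrier[OF assms]]
    by (simp add: mat_trace_def sum_lessThan_product kronecker_entry[OF assms])
  then show ?thesis using assms by (simp add: mat_trace_def sum_product)
qed

lemma kronecker_GL:
  assumes "A \<in> carrier (GL m)" "B \<in> carrier (GL n)"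
  shows "kronecker A B \<in> carrier (GL (m * n))"
proof -
  obtain A' where A: "A \<in> carrier_mat m m" "A' \<in> carrier_mat m m" "A' * A = 1\<^sub>m m" "A * A' = 1\<^sub>m m"
    using assms(1) unfolding carrier_GL by auto
  obtain B' where B: "B \<in> carrier_mat n n" "B' \<in> carrier_mat n n" "B' * B = 1\<^sub>m n" "B * B' = 1\<^sub>m n"
    using assms(2) unfolding carrier_GL by auto
  show ?thesis unfolding carrier_GL
    by (intro conjI bexI[of _ "kronecker A' B'"] kronecker_carrier)
      (use A B in \<open>simp_all add: kronecker_mult[of _ m m _ n n _ m _ n] kronecker_one kronecker_carrier\<close>)
qed

lemma kronecker_vec_entry:
  assumes "A \<in> carrier_mat m m" "B \<in> carrier_mat n n" "v \<in> carrier_vec (m * n)" "i < m" "k < n"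
  shows "(kronecker A B *\<^sub>v v) $ (i * n + k) = (\<Sum>j<m. \<Sum>l<n. A $$ (i, j) * B $$ (k, l) * v $ (j * n + l))"
  using assms index_pair_less[OF assms(4,5)]
  by (simp add: mult_vec_entry[OF kronecker_carrier[OF assms(1,2)] assms(3)] sum_lessThan_product
      kronecker_entry[OF assms(1,2)] del: index_mult_mat_vec)

text \<open>Linear combinations of vectors are written entrywise: vectors of all dimensions share one type,
  so that this type has no zero and no finite sums.\<close>
lemma subspace_sum_mem:
  assumes U: "U \<subseteq> carrier_vec n" "0\<^sub>v n \<in> U"
    "\<And>v w. v \<in> U \<Longrightarrow> w \<in> U \<Longrightarrow> v + w \<in> U" "\<And>c v. v \<in> U \<Longrightarrow> c \<cdot>\<^sub>v v \<in> U"
    and "finite A" "\<And>x. x \<in> A \<Longrightarrow> w x \<in> U"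
  shows "vec n (\<lambda>i. \<Sum>x\<in>A. c x * w x $ i :: complex) \<in> U"
  using assms(5,6)
proof (induction A)
  case empty
  have "vec n (\<lambda>i. 0) = (0\<^sub>v n :: complex vec)" by auto
  then show ?case using U(2) by simp
next
  case (insert x A)
  have "vec n (\<lambda>i. \<Sum>x\<in>insert x A. c x * w x $ i) = c x \<cdot>\<^sub>v w x + vec n (\<lambda>i. \<Sum>x\<in>A. c x * w x $ i)"
    using insert.hyps carrier_vecD[OF subsetD[OF U(1) insert.prems[OF insertI1]]]
    by (intro eq_vecI) simp_all
  then show ?case using insert U by auto
qed

text \<open>If \<open>U\<close> is stable under the matrices \<open>Q x\<close>, then the tensor product of \<open>U\<close> with the full space \<open>carrier_vec n\<close> is
  stable under the matrices \<open>kronecker (Q x) (P x)\<close>.\<close>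
lemma acts_irreducibly_tensor_factor:
  assumes irr: "acts_irreducibly (m * n) ((\<lambda>x. kronecker (Q x) (P x)) ` X)"
    and Q: "\<And>x. x \<in> X \<Longrightarrow> Q x \<in> carrier_mat m m" and P: "\<And>x. x \<in> X \<Longrightarrow> P x \<in> carrier_mat n n"
  shows "acts_irreducibly m (Q ` X)"
  unfolding acts_irreducibly_def
proof (intro conjI allI impI)
  have mn: "m * n > 0" using irr by (simp add: acts_irreducibly_def)
  then show "m > 0" by simp
  have n: "n > 0" using mn by simp
  fix U assume "U \<subseteq> carrier_vec m \<and> 0\<^sub>v m \<in> U \<and>
     (\<forall>v\<in>U. \<forall>w\<in>U. v + w \<in> U) \<and> (\<forall>c. \<forall>v\<in>U. c \<cdot>\<^sub>v v \<in> U) \<and>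
     (\<forall>A\<in>Q ` X. \<forall>v\<in>U. A *\<^sub>v v \<in> U)"
  then have U: "U \<subseteq> carrier_vec m" "0\<^sub>v m \<in> U"
    "\<And>v w. v \<in> U \<Longrightarrow> w \<in> U \<Longrightarrow> v + w \<in> U" "\<And>c v. v \<in> U \<Longrightarrow> c \<cdot>\<^sub>v v \<in> U"
    and UQ: "\<And>x v. x \<in> X \<Longrightarrow> v \<in> U \<Longrightarrow> Q x *\<^sub>v v \<in> U" by auto
  \<comment> \<open>A vector of length \<open>m * n\<close> is a tuple of \<open>n\<close> slices of length \<open>m\<close>; it lies in the tensor product
    of \<open>U\<close> with \<open>carrier_vec n\<close> iff all its slices lie in \<open>U\<close>.\<close>
  define slice where "slice v k = vec m (\<lambda>i. v $ (i * n + k))" for v :: "complex vec" and k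
  define V where "V = {v \<in> carrier_vec (m * n). \<forall>k<n. slice v k \<in> U}"
  have V: "V = {0\<^sub>v (m * n)} \<or> V = carrier_vec (m * n)"
    using irr
  proof (rule acts_irreducibly_cases)
    show "0\<^sub>v (m * n) \<in> V"
    proof -
      have "slice (0\<^sub>v (m * n)) k = 0\<^sub>v m" if "k < n" for k
        using that by (auto simp: slice_def index_pair_less)
      then show ?thesis using U by (simp add: V_def)
    qed
    show "v + w \<in> V" if "v \<in> V" "w \<in> V" for v w
    proof -
      have "slice (v + w) k = slice v k + slice w k" if "k < n" for k
        using that \<open>v \<in> V\<close> \<open>w \<in> V\<close> by (auto simp: slice_def V_def index_pair_less)
      then show ?thesis using U that by (simp add: V_def)
    qed
    show "d \<cdot>\<^sub>v v \<in> V" if "v \<in> V" for v d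
    proof -
      have "slice (d \<cdot>\<^sub>v v) k = d \<cdot>\<^sub>v slice v k" if "k < n" for k
        using that \<open>v \<in> V\<close> by (auto simp: slice_def V_def index_pair_less)
      then show ?thesis using U that by (simp add: V_def)
    qed
    show "A *\<^sub>v v \<in> V" if A: "A \<in> (\<lambda>x. kronecker (Q x) (P x)) ` X" and v: "v \<in> V" for v A
    proof -
      obtain x where x: "x \<in> X" "A = kronecker (Q x) (P x)" using A by auto
      note c = Q[OF x(1)] P[OF x(1)]
      have v: "v \<in> carrier_vec (m * n)" "\<And>l. l < n \<Longrightarrow> slice v l \<in> U" using v by (auto simp: V_def)
      have "slice (A *\<^sub>v v) k \<in> U" if k: "k < n" for k
      proof -
        have "slice (A *\<^sub>v v) k = vec m (\<lambda>i. \<Sum>l<n. P x $$ (k, l) * (Q x *\<^sub>v slice v l) $ i)"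
        proof (rule eq_vecI)
          fix i assume i: "i < dim_vec (vec m (\<lambda>i. \<Sum>l<n. P x $$ (k, l) * (Q x *\<^sub>v slice v l) $ i))"
          then have "slice (A *\<^sub>v v) k $ i = (\<Sum>j<m. \<Sum>l<n. Q x $$ (i, j) * P x $$ (k, l) * v $ (j * n + l))"
            using kronecker_vec_entry[OF c v(1)] k by (simp add: slice_def x(2))
          also have "\<dots> = (\<Sum>l<n. P x $$ (k, l) * (\<Sum>j<m. Q x $$ (i, j) * slice v l $ j))"
            by (subst sum.swap) (simp add: slice_def sum_distrib_left algebra_simps)
          also have "\<dots> = (\<Sum>l<n. P x $$ (k, l) * (Q x *\<^sub>v slice v l) $ i)"
            using i by (simp add: mult_vec_entry[OF c(1)] slice_def del: index_mult_mat_vec)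
          finally show "slice (A *\<^sub>v v) k $ i = vec m (\<lambda>i. \<Sum>l<n. P x $$ (k, l) * (Q x *\<^sub>v slice v l) $ i) $ i"
            using i by simp
        qed (simp add: slice_def)
        also have "\<dots> \<in> U"
          by (rule subspace_sum_mem[OF U]) (use UQ x v in auto)
        finally show ?thesis .
      qed
      moreover have "A *\<^sub>v v \<in> carrier_vec (m * n)"
        using kronecker_carrier[OF c] v x by auto
      ultimately show ?thesis by (simp add: V_def)
    qed
  qed (auto simp: V_def)
  \<comment> \<open>\<open>emb u\<close> has \<open>u\<close> as its first slice and zeros elsewhere.\<close>
  define emb where "emb u = vec (m * n) (\<lambda>r. if r mod n = 0 then u $ (r div n) else 0)" for u :: "complex vec"
  have slice_emb: "slice (emb u) k = (if k = 0 then u else 0\<^sub>v m)" if "k < n" "u \<in> carrier_vec m" for u k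
    using that n by (auto simp: slice_def emb_def index_pair_less)
  have emb: "emb u \<in> V" if "u \<in> U" for u
  proof -
    have "u \<in> carrier_vec m" using that U by auto
    then show ?thesis using that U slice_emb by (auto simp: V_def emb_def)
  qed
  from V show "U = {0\<^sub>v m} \<or> U = carrier_vec m"
  proof
    assume V0: "V = {0\<^sub>v (m * n)}"
    have "u = 0\<^sub>v m" if "u \<in> U" for u
    proof -
      have "u \<in> carrier_vec m" using that U by auto
      then have "u = slice (emb u) 0" using slice_emb n by simp
      also have "emb u = 0\<^sub>v (m * n)" using emb[OF that] V0 by simp
      finally show ?thesis using n by (auto simp: slice_def index_pair_less)
    qed
    then show ?thesis using U(1,2) by blast
  next
    assume V1: "V = carrier_vec (m * n)"
    have "u \<in> U" if "u \<in> carrier_vec m" for u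
    proof -
      have "emb u \<in> V" using V1 by (simp add: emb_def)
      then show ?thesis using slice_emb[of 0 u] that n by (auto simp: V_def)
    qed
    then show ?thesis using U(1,2) by blast
  qed
qed

text \<open>By Schur orthogonality the matrices \<open>P x\<close> with \<open>Q x = 1\<close> span all \<open>n \<times> n\<close> matrices. A stable subspace
  is therefore stable under \<open>kronecker 1 A\<close> for every \<open>A\<close>, and then under \<open>kronecker (Q x) 1\<close> because
  \<open>P x\<close> is invertible. The first property shows that it is the tensor product of some \<open>U\<close> with
  \<open>carrier_vec n\<close>, the second one that \<open>U\<close> is stable under the matrices \<open>Q x\<close>.\<close>
theorem tensor_acts_irreducibly:
  assumes irr: "acts_irreducibly m (Q ` X)"
    and Q: "\<And>x. x \<in> X \<Longrightarrow> Q x \<in> carrier_mat m m" and P: "\<And>x. x \<in> X \<Longrightarrow> P x \<in> carrier (GL n)"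
    and M: "group M" "finite (carrier M)" and R: "irreducible_rep M n R"
    and MX: "\<And>g. g \<in> carrier M \<Longrightarrow> \<exists>x\<in>X. Q x = 1\<^sub>m m \<and> P x = R g"
  shows "acts_irreducibly (m * n) ((\<lambda>x. kronecker (Q x) (P x)) ` X)"
  unfolding acts_irreducibly_def
proof (intro conjI allI impI)
  have homR: "R \<in> hom M (GL n)" and n: "n > 0" using R by (auto simp: irreducible_rep_iff acts_irreducibly_def)
  note Rc = hom_GL_D(1)[OF M(1) homR]
  show "m * n > 0" using irr n by (simp add: acts_irreducibly_def)
  fix V assume "V \<subseteq> carrier_vec (m * n) \<and> 0\<^sub>v (m * n) \<in> V \<and>
     (\<forall>v\<in>V. \<forall>w\<in>V. v + w \<in> V) \<and> (\<forall>c. \<forall>v\<in>V. c \<cdot>\<^sub>v v \<in> V) \<and>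
     (\<forall>A\<in>(\<lambda>x. kronecker (Q x) (P x)) ` X. \<forall>v\<in>V. A *\<^sub>v v \<in> V)"
  then have V: "V \<subseteq> carrier_vec (m * n)" "0\<^sub>v (m * n) \<in> V"
    "\<And>v w. v \<in> V \<Longrightarrow> w \<in> V \<Longrightarrow> v + w \<in> V" "\<And>c v. v \<in> V \<Longrightarrow> c \<cdot>\<^sub>v v \<in> V"
    and VQP: "\<And>x v. x \<in> X \<Longrightarrow> v \<in> V \<Longrightarrow> kronecker (Q x) (P x) *\<^sub>v v \<in> V" by auto
  \<comment> \<open>\<open>E k l\<close> is the action of the matrix unit at \<open>(k, l)\<close> on the second tensor factor.\<close>
  define E where "E k l v = vec (m * n) (\<lambda>r. if r mod n = k then v $ (r div n * n + l) else 0)"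
    for k l and v :: "complex vec"
  have E_entry: "E k l v $ (i * n + a) = (if a = k then v $ (i * n + l) else 0)"
    if "i < m" "a < n" for k l v i a
    using that n by (simp add: E_def index_pair_less)
  have VE: "E k l v \<in> V" if kl: "k < n" "l < n" and v: "v \<in> V" for k l v
  proof -
    have vc: "v \<in> carrier_vec (m * n)" using v V by auto
    define w where "w g = kronecker (1\<^sub>m m) (R g) *\<^sub>v v" for g
    \<comment> \<open>Orthogonality expresses a matrix unit as this combination of the matrices \<open>R g\<close>.\<close>
    define c where "c g = of_nat n / of_nat (card (carrier M)) * R (inv\<^bsub>M\<^esub> g) $$ (l, k)" for g
    have wV: "w g \<in> V" if "g \<in> carrier M" for g
      using MX[OF that] VQP v unfolding w_def by metis
    have "E k l v = vec (m * n) (\<lambda>r. \<Sum>g\<in>carrier M. c g * w g $ r)"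
    proof (rule eq_vec_pairI)
      fix i a assume ia: "i < m" "a < n"
      have w: "w g $ (i * n + a) = (\<Sum>b<n. R g $$ (a, b) * v $ (i * n + b))" if "g \<in> carrier M" for g
      proof -
        have "w g $ (i * n + a) = (\<Sum>j<m. \<Sum>b<n. 1\<^sub>m m $$ (i, j) * R g $$ (a, b) * v $ (j * n + b))"
          unfolding w_def by (rule kronecker_vec_entry[OF _ Rc[OF that] vc ia]) simp
        also have "\<dots> = (\<Sum>j<m. if i = j then \<Sum>b<n. R g $$ (a, b) * v $ (j * n + b) else 0)"
          using ia by (intro sum.cong refl) simp
        finally show ?thesis using ia by simp
      qed
      have "(\<Sum>g\<in>carrier M. c g * w g $ (i * n + a)) =
          (\<Sum>g\<in>carrier M. \<Sum>b<n. of_nat n / of_nat (card (carrier M)) * v $ (i * n + b) *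
             (R g $$ (a, b) * R (inv\<^bsub>M\<^esub> g) $$ (l, k)))"
      proof (rule sum.cong[OF refl])
        fix g assume g: "g \<in> carrier M"
        show "c g * w g $ (i * n + a) = (\<Sum>b<n. of_nat n / of_nat (card (carrier M)) * v $ (i * n + b) *
             (R g $$ (a, b) * R (inv\<^bsub>M\<^esub> g) $$ (l, k)))"
          unfolding w[OF g] c_def sum_distrib_left by (intro sum.cong refl) simp
      qed
      also have "\<dots> = (\<Sum>b<n. of_nat n / of_nat (card (carrier M)) * v $ (i * n + b) *
             (\<Sum>g\<in>carrier M. R g $$ (a, b) * R (inv\<^bsub>M\<^esub> g) $$ (l, k)))"
        by (subst sum.swap) (simp add: sum_distrib_left)
      also have "\<dots> = (\<Sum>b<n. if b = l then (if a = k then v $ (i * n + b) else 0) else 0)"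
      proof (intro sum.cong refl)
        fix b assume b: "b \<in> {..<n}"
        have "card (carrier M) \<noteq> 0" using M group.is_monoid[OF M(1), THEN monoid.one_closed] by auto
        then show "of_nat n / of_nat (card (carrier M)) * v $ (i * n + b) *
             (\<Sum>g\<in>carrier M. R g $$ (a, b) * R (inv\<^bsub>M\<^esub> g) $$ (l, k)) =
             (if b = l then (if a = k then v $ (i * n + b) else 0) else 0)"
          using b kl ia n by (subst schur_orthogonality[OF M R]) auto
      qed
      also have "\<dots> = E k l v $ (i * n + a)" using kl ia by (simp add: E_entry)
      finally show "E k l v $ (i * n + a) = vec (m * n) (\<lambda>r. \<Sum>g\<in>carrier M. c g * w g $ r) $ (i * n + a)"
        using ia by (simp add: index_pair_less)
    qed (auto simp: E_def)
    also have "\<dots> \<in> V" by (rule subspace_sum_mem[OF V M(2) wV])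
    finally show ?thesis .
  qed
  have VA: "kronecker (1\<^sub>m m) A *\<^sub>v v \<in> V" if A: "A \<in> carrier_mat n n" and v: "v \<in> V" for A v
  proof -
    have vc: "v \<in> carrier_vec (m * n)" using v V by auto
    have "kronecker (1\<^sub>m m) A *\<^sub>v v = vec (m * n) (\<lambda>r. \<Sum>(k, l)\<in>{..<n} \<times> {..<n}. A $$ (k, l) * E k l v $ r)"
    proof (rule eq_vec_pairI)
      show "kronecker (1\<^sub>m m) A *\<^sub>v v \<in> carrier_vec (m * n)"
        using kronecker_carrier[of "1\<^sub>m m" m m A n n] A vc by auto
      fix i a assume ia: "i < m" "a < n"
      have "(kronecker (1\<^sub>m m) A *\<^sub>v v) $ (i * n + a) =
        (\<Sum>j<m. \<Sum>b<n. 1\<^sub>m m $$ (i, j) * A $$ (a, b) * v $ (j * n + b))"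
        by (rule kronecker_vec_entry[OF _ A vc ia]) simp
      also have "\<dots> = (\<Sum>j<m. if i = j then \<Sum>b<n. A $$ (a, b) * v $ (j * n + b) else 0)"
        using ia by (intro sum.cong refl) simp
      also have "\<dots> = (\<Sum>k<n. \<Sum>l<n. A $$ (k, l) * E k l v $ (i * n + a))"
      proof -
        have "(\<Sum>k<n. \<Sum>l<n. A $$ (k, l) * E k l v $ (i * n + a)) =
          (\<Sum>k<n. if a = k then \<Sum>l<n. A $$ (k, l) * v $ (i * n + l) else 0)"
          using ia by (intro sum.cong refl) (auto simp: E_entry)
        then show ?thesis using ia by simp
      qed
      finally show "(kronecker (1\<^sub>m m) A *\<^sub>v v) $ (i * n + a) =
        vec (m * n) (\<lambda>r. \<Sum>(k, l)\<in>{..<n} \<times> {..<n}. A $$ (k, l) * E k l v $ r) $ (i * n + a)"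
        using ia by (simp add: index_pair_less sum.cartesian_product)
    qed simp
    also have "\<dots> = vec (m * n) (\<lambda>r. \<Sum>x\<in>{..<n} \<times> {..<n}. A $$ x * E (fst x) (snd x) v $ r)"
      by (simp add: case_prod_unfold)
    also have "\<dots> \<in> V" by (rule subspace_sum_mem[OF V]) (use VE v in auto)
    finally show ?thesis .
  qed
  have VQ: "kronecker (Q x) (1\<^sub>m n) *\<^sub>v v \<in> V" if x: "x \<in> X" and v: "v \<in> V" for x v
  proof -
    obtain B where B: "B \<in> carrier_mat n n" "B * P x = 1\<^sub>m n" and Px: "P x \<in> carrier_mat n n"
      using P[OF x] unfolding carrier_GL by auto
    have "kronecker (1\<^sub>m m) B *\<^sub>v (kronecker (Q x) (P x) *\<^sub>v v) \<in> V" using VA VQP B x v by auto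
    also have "kronecker (1\<^sub>m m) B *\<^sub>v (kronecker (Q x) (P x) *\<^sub>v v) =
      (kronecker (1\<^sub>m m) B * kronecker (Q x) (P x)) *\<^sub>v v"
      using V v kronecker_carrier[of "1\<^sub>m m" m m B n n] kronecker_carrier[OF Q[OF x] Px] B
      by (intro assoc_mult_mat_vec[symmetric]) auto
    also have "kronecker (1\<^sub>m m) B * kronecker (Q x) (P x) = kronecker (Q x) (1\<^sub>m n)"
      using kronecker_mult[of "1\<^sub>m m" m m B n n "Q x" m "P x" n] B Px Q[OF x] by simp
    finally show ?thesis .
  qed
  \<comment> \<open>\<open>emb u\<close> is the tensor product of \<open>u\<close> with the first unit vector.\<close>
  define emb where "emb u = vec (m * n) (\<lambda>r. if r mod n = 0 then u $ (r div n) else 0)" for u :: "complex vec"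
  have emb_entry: "emb u $ (i * n + a) = (if a = 0 then u $ i else 0)" if "i < m" "a < n" for u i a
    using that by (simp add: emb_def index_pair_less)
  have embc: "emb u \<in> carrier_vec (m * n)" for u by (simp add: emb_def)
  define U where "U = {u \<in> carrier_vec m. emb u \<in> V}"
  have U: "U = {0\<^sub>v m} \<or> U = carrier_vec m"
    using irr
  proof (rule acts_irreducibly_cases)
    have "emb (0\<^sub>v m) = 0\<^sub>v (m * n)"
      by (rule eq_vec_pairI[OF embc]) (auto simp: emb_entry index_pair_less)
    then show "0\<^sub>v m \<in> U" using V by (simp add: U_def)
    show "v + w \<in> U" if "v \<in> U" "w \<in> U" for v w
    proof -
      have "emb (v + w) = emb v + emb w"
        using that by (intro eq_vec_pairI[OF embc]) (auto simp: emb_entry index_pair_less embc U_def carrier_vecD[OF embc])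
      then show ?thesis using V that by (simp add: U_def)
    qed
    show "d \<cdot>\<^sub>v v \<in> U" if "v \<in> U" for v d
    proof -
      have "emb (d \<cdot>\<^sub>v v) = d \<cdot>\<^sub>v emb v"
        using that by (intro eq_vec_pairI[OF embc]) (auto simp: emb_entry index_pair_less embc U_def carrier_vecD[OF embc])
      then show ?thesis using V that by (simp add: U_def)
    qed
    show "A *\<^sub>v u \<in> U" if A: "A \<in> Q ` X" and u: "u \<in> U" for u A
    proof -
      obtain x where x: "x \<in> X" "A = Q x" using A by auto
      have u: "u \<in> carrier_vec m" "emb u \<in> V" using u by (auto simp: U_def)
      have "emb (Q x *\<^sub>v u) = kronecker (Q x) (1\<^sub>m n) *\<^sub>v emb u"
      proof (rule eq_vec_pairI[OF embc])
        show "kronecker (Q x) (1\<^sub>m n) *\<^sub>v emb u \<in> carrier_vec (m * n)"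
          using kronecker_carrier[OF Q[OF x(1)], of "1\<^sub>m n" n n] embc by auto
        fix i a assume ia: "i < m" "a < n"
        have "(kronecker (Q x) (1\<^sub>m n) *\<^sub>v emb u) $ (i * n + a) =
          (\<Sum>j<m. \<Sum>b<n. Q x $$ (i, j) * 1\<^sub>m n $$ (a, b) * emb u $ (j * n + b))"
          by (rule kronecker_vec_entry[OF Q[OF x(1)] _ embc ia]) simp
        also have "\<dots> = (\<Sum>j<m. \<Sum>b<n. if b = a then (if a = 0 then Q x $$ (i, j) * u $ j else 0) else 0)"
          using ia by (intro sum.cong refl) (auto simp: emb_entry)
        also have "\<dots> = (if a = 0 then (Q x *\<^sub>v u) $ i else 0)"
          using ia by (simp add: mult_vec_entry[OF Q[OF x(1)] u(1)] del: index_mult_mat_vec)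
        finally show "emb (Q x *\<^sub>v u) $ (i * n + a) = (kronecker (Q x) (1\<^sub>m n) *\<^sub>v emb u) $ (i * n + a)"
          using ia by (simp add: emb_entry)
      qed
      then show ?thesis using VQ[OF x(1) u(2)] u(1) Q[OF x(1)] x by (auto simp: U_def)
    qed
  qed (auto simp: U_def)
  have decomp: "v = vec (m * n) (\<lambda>r. \<Sum>l<n. 1 * E l 0 (E 0 l v) $ r)" if "v \<in> carrier_vec (m * n)" for v
  proof (rule eq_vec_pairI[OF that])
    fix i a assume ia: "i < m" "a < n"
    have "(\<Sum>l<n. E l 0 (E 0 l v) $ (i * n + a)) = (\<Sum>l<n. if a = l then v $ (i * n + l) else 0)"
      using ia n E_entry[OF ia(1) n] by (intro sum.cong refl) (auto simp: E_entry)
    then show "v $ (i * n + a) = vec (m * n) (\<lambda>r. \<Sum>l<n. 1 * E l 0 (E 0 l v) $ r) $ (i * n + a)"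
      using ia by (simp add: index_pair_less)
  qed simp
  have E_emb: "\<exists>u\<in>carrier_vec m. E 0 l v = emb u" for l v
  proof (intro bexI)
    show "E 0 l v = emb (vec m (\<lambda>i. v $ (i * n + l)))"
      by (rule eq_vec_pairI[OF _ embc]) (auto simp: E_entry emb_entry, simp add: E_def)
  qed simp
  from U show "V = {0\<^sub>v (m * n)} \<or> V = carrier_vec (m * n)"
  proof
    assume U0: "U = {0\<^sub>v m}"
    have "v = 0\<^sub>v (m * n)" if v: "v \<in> V" for v
    proof (rule eq_vec_pairI)
      show "v \<in> carrier_vec (m * n)" using v V by auto
      fix i l assume il: "i < m" "l < n"
      obtain u where u: "u \<in> carrier_vec m" "E 0 l v = emb u" using E_emb by blast
      then have "u \<in> U" using VE[OF n il(2) v] by (simp add: U_def)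
      then have "u = 0\<^sub>v m" using U0 by simp
      then have "E 0 l v $ (i * n + 0) = 0" using u il n emb_entry[of i 0 u] by simp
      then show "v $ (i * n + l) = 0\<^sub>v (m * n) $ (i * n + l)"
        using E_entry[of i 0 0 l v] il n by (simp add: index_pair_less)
    qed simp
    then show ?thesis using V(1,2) by blast
  next
    assume U1: "U = carrier_vec m"
    have "v \<in> V" if v: "v \<in> carrier_vec (m * n)" for v
    proof -
      have "E 0 l v \<in> V" for l using E_emb[of l v] U1 by (auto simp: U_def)
      then show ?thesis
        by (subst decomp[OF v], intro subspace_sum_mem[OF V]) (use VE n in auto)
    qed
    then show ?thesis using V(1,2) by blast
  qed
qed

section \<open>Subrepresentations and class sums\<close>

text \<open>Choose an injective matrix with columns in \<open>U\<close> and as many columns as possible: a vector of \<open>U\<close> outside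
  its range could be added as a further column.\<close>
lemma subspace_basis_mat:
  assumes U: "U \<subseteq> carrier_vec n" "0\<^sub>v n \<in> U"
    "\<And>v w. v \<in> U \<Longrightarrow> w \<in> U \<Longrightarrow> v + w \<in> U" "\<And>c v. v \<in> U \<Longrightarrow> c \<cdot>\<^sub>v v \<in> U"
  obtains m and B :: "complex mat" where "B \<in> carrier_mat n m"
    "\<And>v. v \<in> carrier_vec m \<Longrightarrow> B *\<^sub>v v = 0\<^sub>v n \<Longrightarrow> v = 0\<^sub>v m"
    "U = {B *\<^sub>v v | v. v \<in> carrier_vec m}"
proof -
  define P where "P m \<longleftrightarrow> (\<exists>B\<in>carrier_mat n m. (\<forall>v\<in>carrier_vec m. B *\<^sub>v v = 0\<^sub>v n \<longrightarrow> v = 0\<^sub>v m) \<and>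
    (\<forall>v\<in>carrier_vec m. B *\<^sub>v v \<in> U))" for m
  have "P 0" unfolding P_def
  proof (intro bexI conjI ballI impI)
    fix v :: "complex vec" assume v: "v \<in> carrier_vec 0"
    then show "v = 0\<^sub>v 0" by auto
    have "0\<^sub>m n 0 *\<^sub>v v = 0\<^sub>v n" using v by (intro eq_vecI) (auto simp: scalar_prod_def)
    then show "0\<^sub>m n 0 *\<^sub>v v \<in> U" using U(2) by simp
  qed auto
  moreover have bound: "m \<le> n" if "P m" for m
    using that injective_mat_dim_le[of _ n m] unfolding P_def by blast
  ultimately obtain m where m: "P m" "\<And>k. P k \<Longrightarrow> k \<le> m"
    using GreatestI_nat[of P 0 n] Greatest_le_nat[of P _ n] by blast
  then obtain B where B: "B \<in> carrier_mat n m"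
    and inj: "\<And>v. v \<in> carrier_vec m \<Longrightarrow> B *\<^sub>v v = 0\<^sub>v n \<Longrightarrow> v = 0\<^sub>v m"
    and BU: "\<And>v. v \<in> carrier_vec m \<Longrightarrow> B *\<^sub>v v \<in> U" unfolding P_def by blast
  have "u \<in> {B *\<^sub>v v | v. v \<in> carrier_vec m}" if u: "u \<in> U" for u
  proof (rule ccontr)
    assume nu: "u \<notin> {B *\<^sub>v v | v. v \<in> carrier_vec m}"
    have uc: "u \<in> carrier_vec n" using u U by auto
    define C where "C = mat n (Suc m) (\<lambda>(i, j). if j < m then B $$ (i, j) else u $ i)"
    have C: "C \<in> carrier_mat n (Suc m)" by (simp add: C_def)
    define r where "r v = vec m (\<lambda>i. v $ i)" for v :: "complex vec"
    have Cv: "C *\<^sub>v v = B *\<^sub>v r v + v $ m \<cdot>\<^sub>v u" if "v \<in> carrier_vec (Suc m)" for v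
    proof (rule eq_vecI)
      fix i assume "i < dim_vec (B *\<^sub>v r v + v $ m \<cdot>\<^sub>v u)"
      then have i: "i < n" using uc by simp
      have "(C *\<^sub>v v) $ i = (\<Sum>l<m. B $$ (i, l) * r v $ l) + u $ i * v $ m"
        by (subst mult_vec_entry[OF C that i]) (use i in \<open>simp add: C_def r_def\<close>)
      also have "(\<Sum>l<m. B $$ (i, l) * r v $ l) = (B *\<^sub>v r v) $ i"
        by (rule mult_vec_entry[OF B _ i, symmetric]) (simp add: r_def)
      finally show "(C *\<^sub>v v) $ i = (B *\<^sub>v r v + v $ m \<cdot>\<^sub>v u) $ i"
        using i uc B by (simp add: mult.commute)
    qed (use C uc in auto)
    have rc: "r v \<in> carrier_vec m" for v by (simp add: r_def)
    have "P (Suc m)" unfolding P_def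
    proof (intro bexI[OF _ C] conjI ballI impI)
      fix v :: "complex vec" assume v: "v \<in> carrier_vec (Suc m)"
      show "C *\<^sub>v v \<in> U" unfolding Cv[OF v] using U u BU[OF rc] by blast
      assume "C *\<^sub>v v = 0\<^sub>v n"
      then have z: "B *\<^sub>v r v + v $ m \<cdot>\<^sub>v u = 0\<^sub>v n" using Cv[OF v] by simp
      have vm: "v $ m = 0"
      proof (rule ccontr)
        assume nz: "v $ m \<noteq> 0"
        have "u = B *\<^sub>v ((- 1 / v $ m) \<cdot>\<^sub>v r v)"
        proof (rule eq_vecI)
          fix i assume "i < dim_vec (B *\<^sub>v ((- 1 / v $ m) \<cdot>\<^sub>v r v))"
          then have i: "i < n" using B by simp
          have "(B *\<^sub>v r v + v $ m \<cdot>\<^sub>v u) $ i = 0" using z i by simp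
          then have "(B *\<^sub>v r v) $ i + v $ m * u $ i = 0" using i uc B by simp
          then have "u $ i = (- 1 / v $ m) * (B *\<^sub>v r v) $ i"
            using nz by (simp add: field_simps add_eq_0_iff)
          then show "u $ i = (B *\<^sub>v ((- 1 / v $ m) \<cdot>\<^sub>v r v)) $ i"
            using B rc[of v] i by (subst mult_mat_vec[OF B rc]) simp
        qed (use uc B in auto)
        then show False using nu rc[of v] by auto
      qed
      then have "B *\<^sub>v r v = B *\<^sub>v r v + v $ m \<cdot>\<^sub>v u" using uc B by (intro eq_vecI) auto
      then have "B *\<^sub>v r v = 0\<^sub>v n" using z by simp
      then have "r v = 0\<^sub>v m" using inj rc by blast
      then have "v $ i = 0" if "i < m" for i using that by (metis index_zero_vec(1) r_def index_vec)
      then show "v = 0\<^sub>v (Suc m)" using vm v by (intro eq_vecI) (auto simp: less_Suc_eq)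
    qed
    then show False using m(2) by fastforce
  qed
  then have "U = {B *\<^sub>v v | v. v \<in> carrier_vec m}" using BU by blast
  then show ?thesis using that[OF B inj] by blast
qed

lemma injective_mat_cancel:
  fixes B :: "complex mat"
  assumes B: "B \<in> carrier_mat n m" "\<And>v. v \<in> carrier_vec m \<Longrightarrow> B *\<^sub>v v = 0\<^sub>v n \<Longrightarrow> v = 0\<^sub>v m"
    and XY: "X \<in> carrier_mat m k" "Y \<in> carrier_mat m k" "B * X = B * Y"
  shows "X = Y"
proof -
  have "X - Y = 0\<^sub>m m k"
  proof (rule mat_eq_zeroI)
    fix v :: "complex vec" assume v: "v \<in> carrier_vec k"
    have "B *\<^sub>v ((X - Y) *\<^sub>v v) = (B * (X - Y)) *\<^sub>v v" using B XY v by (intro assoc_mult_mat_vec[symmetric]) auto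
    also have "B * (X - Y) = 0\<^sub>m n k" using B XY by (subst mult_minus_distrib_mat) auto
    also have "0\<^sub>m n k *\<^sub>v v = 0\<^sub>v n" using v by auto
    finally have "B *\<^sub>v ((X - Y) *\<^sub>v v) = 0\<^sub>v n" .
    moreover have "X - Y \<in> carrier_mat m k" using XY by auto
    ultimately show "(X - Y) *\<^sub>v v = 0\<^sub>v m" using B(2)[of "(X - Y) *\<^sub>v v"] v by auto
  qed (use XY in auto)
  then have "(X - Y) $$ (i, j) = 0" if "i < m" "j < k" for i j using that by simp
  then show ?thesis using XY by (intro eq_matI) auto
qed

text \<open>Induction on the degree. A proper stable subspace is the range of an injective matrix \<open>B\<close>, and the
  coordinates with respect to its columns define a representation of smaller degree.\<close>
lemma exists_irreducible_subrep:
  assumes G: "group G" and R: "R \<in> hom G (GL n)" and n: "n > 0"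
  shows "\<exists>d S T. irreducible_rep G d S \<and> T \<in> carrier_mat n d \<and>
    (\<forall>v\<in>carrier_vec d. T *\<^sub>v v = 0\<^sub>v n \<longrightarrow> v = 0\<^sub>v d) \<and> (\<forall>x\<in>carrier G. R x * T = T * S x)"
  using R n
proof (induction n arbitrary: R rule: less_induct)
  case (less n)
  interpret group G by fact
  note R = hom_GL_D[OF G less.prems(1)]
  show ?case
  proof (cases "irreducible_rep G n R")
    case True
    then show ?thesis
      by (intro exI[of _ n] exI[of _ R] exI[of _ "1\<^sub>m n"]) (use True in \<open>auto simp: right_mult_one_mat[OF R(1)] left_mult_one_mat[OF R(1)]\<close>)
  next
    case False
    then have "\<not> acts_irreducibly n (R ` carrier G)"
      using less.prems(1) by (simp add: irreducible_rep_iff)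
    then have "\<exists>U. (U \<subseteq> carrier_vec n \<and> 0\<^sub>v n \<in> U \<and>
       (\<forall>v\<in>U. \<forall>w\<in>U. v + w \<in> U) \<and> (\<forall>c. \<forall>v\<in>U. c \<cdot>\<^sub>v v \<in> U) \<and>
       (\<forall>A\<in>R ` carrier G. \<forall>v\<in>U. A *\<^sub>v v \<in> U)) \<and> \<not> (U = {0\<^sub>v n} \<or> U = carrier_vec n)"
      using less.prems(2) by (simp only: acts_irreducibly_def not_all not_imp simp_thms)
    then obtain U where U': "(U \<subseteq> carrier_vec n \<and> 0\<^sub>v n \<in> U \<and>
       (\<forall>v\<in>U. \<forall>w\<in>U. v + w \<in> U) \<and> (\<forall>c. \<forall>v\<in>U. c \<cdot>\<^sub>v v \<in> U) \<and>
       (\<forall>A\<in>R ` carrier G. \<forall>v\<in>U. A *\<^sub>v v \<in> U)) \<and> \<not> (U = {0\<^sub>v n} \<or> U = carrier_vec n)" ..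
    note U = U'[THEN conjunct1, THEN conjunct1] U'[THEN conjunct1, THEN conjunct2, THEN conjunct1]
      U'[THEN conjunct1, THEN conjunct2, THEN conjunct2, THEN conjunct1, rule_format]
      U'[THEN conjunct1, THEN conjunct2, THEN conjunct2, THEN conjunct2, THEN conjunct1, rule_format]
    have UR: "R x *\<^sub>v v \<in> U" if "x \<in> carrier G" "v \<in> U" for x v
      by (rule U'[THEN conjunct1, THEN conjunct2, THEN conjunct2, THEN conjunct2, THEN conjunct2, rule_format])
        (use that in simp_all)
    have U0: "U \<noteq> {0\<^sub>v n}" "U \<noteq> carrier_vec n" using U'[THEN conjunct2] by simp_all
    obtain m and B :: "complex mat" where B: "B \<in> carrier_mat n m"
      and inj: "\<And>v. v \<in> carrier_vec m \<Longrightarrow> B *\<^sub>v v = 0\<^sub>v n \<Longrightarrow> v = 0\<^sub>v m"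
      and UB: "U = {B *\<^sub>v v | v. v \<in> carrier_vec m}" by (rule subspace_basis_mat[OF U]) (assumption | rule that, assumption, blast, assumption)+
    have "m \<noteq> 0"
    proof
      assume "m = 0"
      then have "B *\<^sub>v v = 0\<^sub>v n" if "v \<in> carrier_vec m" for v
        using that B by (intro eq_vecI) (auto simp: scalar_prod_def)
      then show False using UB U0(1) U(2) by auto
    qed
    moreover have "m < n"
    proof (rule ccontr)
      assume "\<not> m < n"
      then have m: "m = n" using injective_mat_dim_le[OF B inj] by simp
      obtain C where C: "C \<in> carrier_mat n n" "B * C = 1\<^sub>m n"
        using injective_square_invertible[of B n] B inj m by metis
      have "v \<in> U" if "v \<in> carrier_vec n" for v
      proof -
        have "v = B *\<^sub>v (C *\<^sub>v v)" using that B C m by (metis assoc_mult_mat_vec one_mult_mat_vec)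
        then show ?thesis using UB C that m by auto
      qed
      then show False using U(1) U0(2) by blast
    qed
    moreover
    have "\<exists>s\<in>carrier_vec m. R x *\<^sub>v col B j = B *\<^sub>v s" if x: "x \<in> carrier G" and j: "j < m" for x j
    proof -
      have "col B j = B *\<^sub>v unit_vec m j"
        using B j by (intro eq_vecI) (auto simp: scalar_prod_right_unit)
      then have "col B j \<in> U" unfolding UB by auto
      then have "R x *\<^sub>v col B j \<in> U" using UR x by simp
      then show ?thesis unfolding UB by blast
    qed
    then obtain s where s: "\<And>x j. x \<in> carrier G \<Longrightarrow> j < m \<Longrightarrow> s x j \<in> carrier_vec m"
      "\<And>x j. x \<in> carrier G \<Longrightarrow> j < m \<Longrightarrow> R x *\<^sub>v col B j = B *\<^sub>v s x j" by metis
    define S where "S x = mat m m (\<lambda>(i, j). s x j $ i)" for x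
    have Sc: "S x \<in> carrier_mat m m" for x by (simp add: S_def)
    have RB: "R x * B = B * S x" if x: "x \<in> carrier G" for x
    proof (rule eq_matI)
      fix i j assume "i < dim_row (B * S x)" "j < dim_col (B * S x)"
      then have ij: "i < n" "j < m" using B Sc[of x] by auto
      have "(R x * B) $$ (i, j) = (R x *\<^sub>v col B j) $ i" using ij R(1)[OF x] B by simp
      also have "\<dots> = (B *\<^sub>v s x j) $ i" using s x ij by simp
      also have "s x j = col (S x) j" using ij s x by (auto simp: S_def)
      finally show "(R x * B) $$ (i, j) = (B * S x) $$ (i, j)" using ij B Sc by (simp add: S_def)
    qed (use R(1)[OF x] B Sc[of x] in auto)
    have "S \<in> hom G (GL m)"
    proof (rule hom_GL_I[OF G Sc])
      show "S \<one>\<^bsub>G\<^esub> = 1\<^sub>m m"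
        by (rule injective_mat_cancel[OF B inj Sc one_carrier_mat]) (use RB[of "\<one>\<^bsub>G\<^esub>"] R(2) B in auto)
      fix x y assume xy: "x \<in> carrier G" "y \<in> carrier G"
      show "S (x \<otimes>\<^bsub>G\<^esub> y) = S x * S y"
      proof (rule injective_mat_cancel[OF B inj Sc])
        show "S x * S y \<in> carrier_mat m m" by (rule mult_carrier_mat[OF Sc Sc])
        have "B * S (x \<otimes>\<^bsub>G\<^esub> y) = (R x * R y) * B" using RB[of "x \<otimes>\<^bsub>G\<^esub> y"] R(3) xy by simp
        also have "\<dots> = R x * (B * S y)" using R(1) B xy by (simp add: RB assoc_mult_mat[of _ n n _ n])
        also have "\<dots> = (R x * B) * S y" by (rule assoc_mult_mat[symmetric, OF R(1)[OF xy(1)] B Sc])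
        also have "\<dots> = B * (S x * S y)" unfolding RB[OF xy(1)] by (rule assoc_mult_mat[OF B Sc Sc])
        finally show "B * S (x \<otimes>\<^bsub>G\<^esub> y) = B * (S x * S y)" .
      qed
    qed
    ultimately obtain d S' T where IH: "irreducible_rep G d S'" "T \<in> carrier_mat m d"
      "\<And>v. v \<in> carrier_vec d \<Longrightarrow> T *\<^sub>v v = 0\<^sub>v m \<Longrightarrow> v = 0\<^sub>v d"
      "\<And>x. x \<in> carrier G \<Longrightarrow> S x * T = T * S' x"
      using less.IH[of m S] by blast
    have S'c: "S' x \<in> carrier_mat d d" if "x \<in> carrier G" for x
      using hom_GL_D(1)[OF G _ that] IH(1) by (auto simp: irreducible_rep_iff)
    show ?thesis
    proof (intro exI conjI ballI impI)
      show "irreducible_rep G d S'" by fact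
      show "B * T \<in> carrier_mat n d" using B IH by auto
      fix v :: "complex vec" assume v: "v \<in> carrier_vec d" "(B * T) *\<^sub>v v = 0\<^sub>v n"
      then have "B *\<^sub>v (T *\<^sub>v v) = 0\<^sub>v n" using B IH(2) by (metis assoc_mult_mat_vec)
      then show "v = 0\<^sub>v d" using inj IH(2,3) v by auto
    next
      fix x assume x: "x \<in> carrier G"
      have "R x * (B * T) = (R x * B) * T" by (rule assoc_mult_mat[symmetric, OF R(1)[OF x] B IH(2)])
      also have "\<dots> = B * (S x * T)" unfolding RB[OF x] by (rule assoc_mult_mat[OF B Sc IH(2)])
      also have "\<dots> = (B * T) * S' x" unfolding IH(4)[OF x]
        by (rule assoc_mult_mat[symmetric, OF B IH(2) S'c[OF x]])
      finally show "R x * (B * T) = B * T * S' x" .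
    qed
  qed
qed

lemma IrrE:
  assumes "\<chi> \<in> Irr G"
  obtains n R where "irreducible_rep G n R" "\<chi> = (\<lambda>x\<in>carrier G. mat_trace (R x))"
  using assms unfolding Irr_def by auto

lemma IrrI: "irreducible_rep G n R \<Longrightarrow> (\<lambda>x\<in>carrier G. mat_trace (R x)) \<in> Irr G"
  unfolding Irr_def by auto

lemma irreducible_rep_trace_one:
  assumes "group G" "irreducible_rep G n R"
  shows "mat_trace (R \<one>\<^bsub>G\<^esub>) = of_nat n" "n > 0"
proof -
  have "R \<in> hom G (GL n)" using assms by (simp add: irreducible_rep_def)
  then show "mat_trace (R \<one>\<^bsub>G\<^esub>) = of_nat n" by (simp add: hom_GL_D(2)[OF assms(1)])
  show "n > 0" using assms(2) by (simp only: irreducible_rep_def)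
qed

text \<open>The sum of \<open>R\<close> over a set closed under conjugation commutes with \<open>R\<close>, so Schur's lemma applies; the
  trace gives the scalar.\<close>
lemma class_sum_scalar:
  assumes G: "group G" "finite (carrier G)" and irr: "irreducible_rep G n R"
    and S: "S \<subseteq> carrier G" "\<And>x h. x \<in> S \<Longrightarrow> h \<in> carrier G \<Longrightarrow> h \<otimes>\<^bsub>G\<^esub> x \<otimes>\<^bsub>G\<^esub> inv\<^bsub>G\<^esub> h \<in> S"
    and ij: "i < n" "j < n"
  shows "(\<Sum>x\<in>S. R x $$ (i, j)) = (if i = j then (\<Sum>x\<in>S. mat_trace (R x)) / of_nat n else 0)"
proof -
  interpret group G by fact
  have hom: "R \<in> hom G (GL n)" and acts: "acts_irreducibly n (R ` carrier G)"
    using irr by (auto simp: irreducible_rep_iff)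
  note R = hom_GL_D[OF G(1) hom]
  define T where "T = mat n n (\<lambda>(i, j). \<Sum>x\<in>S. R x $$ (i, j))"
  have T: "T \<in> carrier_mat n n" by (simp add: T_def)
  obtain c where c: "T = c \<cdot>\<^sub>m 1\<^sub>m n"
  proof (rule schur_scalar[OF acts _ T])
    show "R ` carrier G \<subseteq> carrier_mat n n" using R(1) by auto
    fix A assume "A \<in> R ` carrier G"
    then obtain h where h: "h \<in> carrier G" "A = R h" by auto
    have cancel: "inv\<^bsub>G\<^esub> h \<otimes>\<^bsub>G\<^esub> (h \<otimes>\<^bsub>G\<^esub> x) = x" "h \<otimes>\<^bsub>G\<^esub> (inv\<^bsub>G\<^esub> h \<otimes>\<^bsub>G\<^esub> x) = x"
      if "x \<in> S" for x
      using that h S(1) by (auto simp: m_assoc[symmetric])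
    show "A * T = T * A"
    proof (rule eq_matI)
      fix a b assume "a < dim_row (T * A)" "b < dim_col (T * A)"
      then have ab: "a < n" "b < n" using T R(1)[OF h(1)] h by auto
      have "(A * T) $$ (a, b) = (\<Sum>l<n. R h $$ (a, l) * (\<Sum>x\<in>S. R x $$ (l, b)))"
        using ab unfolding h(2) by (subst mult_mat_entry[OF R(1)[OF h(1)] T]) (auto simp: T_def)
      also have "\<dots> = (\<Sum>x\<in>S. \<Sum>l<n. R h $$ (a, l) * R x $$ (l, b))"
        by (subst sum_distrib_left, rule sum.swap)
      also have "\<dots> = (\<Sum>x\<in>S. R (h \<otimes>\<^bsub>G\<^esub> x) $$ (a, b))"
        using ab h S(1) by (intro sum.cong refl)
          (simp add: R(3) mult_mat_entry[OF R(1) R(1)] subset_iff del: index_mult_mat(1))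
      also have "\<dots> = (\<Sum>x\<in>S. R (x \<otimes>\<^bsub>G\<^esub> h) $$ (a, b))"
        using h(1) S(1) S(2)[OF _ h(1)] S(2)[OF _ inv_closed[OF h(1)]] cancel
        by (intro sum.reindex_bij_witness[of _ "\<lambda>x. inv\<^bsub>G\<^esub> h \<otimes>\<^bsub>G\<^esub> x \<otimes>\<^bsub>G\<^esub> h" "\<lambda>x. h \<otimes>\<^bsub>G\<^esub> x \<otimes>\<^bsub>G\<^esub> inv\<^bsub>G\<^esub> h"])
          (auto simp: m_assoc subset_iff)
      also have "\<dots> = (\<Sum>x\<in>S. \<Sum>l<n. R x $$ (a, l) * R h $$ (l, b))"
        using ab h S(1) by (intro sum.cong refl)
          (simp add: R(3) mult_mat_entry[OF R(1) R(1)] subset_iff del: index_mult_mat(1))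
      also have "\<dots> = (\<Sum>l<n. (\<Sum>x\<in>S. R x $$ (a, l)) * R h $$ (l, b))"
        by (subst sum.swap) (simp add: sum_distrib_right)
      also have "\<dots> = (T * A) $$ (a, b)"
        using ab unfolding h(2) by (subst mult_mat_entry[OF T R(1)[OF h(1)]]) (auto simp: T_def)
      finally show "(A * T) $$ (a, b) = (T * A) $$ (a, b)" .
    qed (use T R(1)[OF h(1)] h in auto)
  qed
  have "of_nat n * c = (\<Sum>i<n. T $$ (i, i))" by (simp add: c)
  also have "\<dots> = (\<Sum>x\<in>S. \<Sum>i<n. R x $$ (i, i))" by (simp add: T_def, rule sum.swap)
  also have "\<dots> = (\<Sum>x\<in>S. mat_trace (R x))"
    using S(1) R(1) by (intro sum.cong refl) (auto simp: mat_trace_def)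
  finally have "c = (\<Sum>x\<in>S. mat_trace (R x)) / of_nat n" using ij by (simp add: field_simps)
  moreover have "(\<Sum>x\<in>S. R x $$ (i, j)) = T $$ (i, j)" using ij by (simp add: T_def)
  ultimately show ?thesis using ij by (simp add: c)
qed

section \<open>Central characters are integral\<close>

text \<open>An eigenvalue of an integer matrix is a root of its characteristic polynomial, which is monic.\<close>
lemma algebraic_int_eigenvalue:
  fixes a :: "'i \<Rightarrow> 'i \<Rightarrow> int" and d :: complex
  assumes I: "finite I" and v: "i0 \<in> I" "v i0 \<noteq> 0"
    and eq: "\<And>i. i \<in> I \<Longrightarrow> d * v i = (\<Sum>j\<in>I. of_int (a i j) * v j)"
  shows "algebraic_int d"
proof -
  obtain n and f :: "nat \<Rightarrow> 'i" where f: "bij_betw f {..<n} I"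
    using ex_bij_betw_nat_finite[OF I] by (auto simp: atLeast0LessThan)
  define A where "A = mat n n (\<lambda>(r, s). a (f r) (f s))"
  define B :: "complex mat" where "B = map_mat of_int A"
  have A: "A \<in> carrier_mat n n" and B: "B \<in> carrier_mat n n" by (auto simp: A_def B_def)
  define w where "w = vec n (\<lambda>r. v (f r))"
  have w: "w \<in> carrier_vec n" by (simp add: w_def)
  have fI: "f r \<in> I" if "r < n" for r using f that by (auto simp: bij_betw_def)
  have "B *\<^sub>v w = d \<cdot>\<^sub>v w"
  proof (rule eq_vecI)
    fix r assume "r < dim_vec (d \<cdot>\<^sub>v w)"
    then have r: "r < n" using w by simp
    have "(B *\<^sub>v w) $ r = (\<Sum>s<n. of_int (a (f r) (f s)) * v (f s))"
      by (subst mult_vec_entry[OF B w r]) (use r in \<open>simp add: B_def A_def w_def\<close>)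
    also have "\<dots> = (\<Sum>j\<in>I. of_int (a (f r) j) * v j)"
      by (rule sum.reindex_bij_betw[OF f])
    also have "\<dots> = d * v (f r)" using eq[OF fI[OF r]] by simp
    finally show "(B *\<^sub>v w) $ r = (d \<cdot>\<^sub>v w) $ r" using r by (simp add: w_def)
  qed (use B w in auto)
  moreover obtain r0 where "r0 < n" "f r0 = i0" using f v(1) by (auto simp: bij_betw_def)
  then have "w $ r0 \<noteq> 0" using v(2) by (simp add: w_def)
  then have "w \<noteq> 0\<^sub>v n" using \<open>r0 < n\<close> by auto
  ultimately have "eigenvalue B d" using B w by (auto simp: eigenvalue_def eigenvector_def)
  then have "poly (char_poly B) d = 0" using eigenvalue_root_char_poly[OF B] by simp
  moreover have "char_poly B = map_poly of_int (char_poly A)"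
    unfolding B_def by (rule of_int_hom.char_poly_hom[OF A])
  moreover have "lead_coeff (char_poly A) = 1" using degree_monic_char_poly[OF A] by simp
  ultimately show ?thesis unfolding algebraic_int_altdef_ipoly by auto
qed

lemma Irr_one:
  assumes "group G" "\<chi> \<in> Irr G"
  obtains n :: nat where "n > 0" "\<chi> \<one>\<^bsub>G\<^esub> = of_nat n"
proof -
  interpret group G by fact
  obtain n R where R: "irreducible_rep G n R" "\<chi> = (\<lambda>x\<in>carrier G. mat_trace (R x))"
    using assms(2) by (rule IrrE)
  show ?thesis using that[of n] irreducible_rep_trace_one[OF assms(1) R(1)] R(2) by simp
qed

lemma class_sum_omega:
  assumes G: "group G" "finite (carrier G)" and irr: "irreducible_rep G n R"
    and \<chi>: "\<chi> = (\<lambda>x\<in>carrier G. mat_trace (R x))"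
    and S: "S \<subseteq> carrier G" "\<And>x h. x \<in> S \<Longrightarrow> h \<in> carrier G \<Longrightarrow> h \<otimes>\<^bsub>G\<^esub> x \<otimes>\<^bsub>G\<^esub> inv\<^bsub>G\<^esub> h \<in> S"
    and ij: "i < n" "j < n"
  shows "(\<Sum>x\<in>S. R x $$ (i, j)) = (if i = j then omega G \<chi> S else 0)"
proof -
  interpret group G by fact
  have "(\<Sum>x\<in>S. \<chi> x) = (\<Sum>x\<in>S. mat_trace (R x))" using S(1) by (intro sum.cong) (auto simp: \<chi>)
  moreover have "\<chi> \<one>\<^bsub>G\<^esub> = of_nat n" using irreducible_rep_trace_one[OF G(1) irr] by (simp add: \<chi>)
  ultimately show ?thesis using class_sum_scalar[OF G irr S ij] by (simp add: omega_def)
qed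

text \<open>Multiplication by the sum of the elements of \<open>S\<close> has, on the basis of group elements, a matrix
  with entries 0 and 1. The entries of \<open>R\<close> at \<open>(0, 0)\<close> form an eigenvector, with the value of the central
  character as eigenvalue.\<close>
lemma omega_algebraic_int:
  assumes G: "group G" "finite (carrier G)" and \<chi>: "\<chi> \<in> Irr G"
    and S: "S \<subseteq> carrier G" "\<And>x h. x \<in> S \<Longrightarrow> h \<in> carrier G \<Longrightarrow> h \<otimes>\<^bsub>G\<^esub> x \<otimes>\<^bsub>G\<^esub> inv\<^bsub>G\<^esub> h \<in> S"
  shows "algebraic_int (omega G \<chi> S)"
proof -
  interpret group G by fact
  obtain n R where irr: "irreducible_rep G n R" and \<chi>R: "\<chi> = (\<lambda>x\<in>carrier G. mat_trace (R x))"
    using \<chi> by (rule IrrE)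
  have hom: "R \<in> hom G (GL n)" using irr by (simp add: irreducible_rep_iff)
  note R = hom_GL_D[OF G(1) hom]
  have n: "0 < n" using irreducible_rep_trace_one[OF G(1) irr] by simp
  show ?thesis
  proof (rule algebraic_int_eigenvalue[of "carrier G" "\<one>\<^bsub>G\<^esub>" "\<lambda>b. R b $$ (0, 0)"
        _ "\<lambda>b c. if c \<otimes>\<^bsub>G\<^esub> inv\<^bsub>G\<^esub> b \<in> S then 1 else 0"])
    show "R \<one>\<^bsub>G\<^esub> $$ (0, 0) \<noteq> 0" using n by (simp add: R(2))
    fix b assume b: "b \<in> carrier G"
    have "(\<Sum>c\<in>carrier G. of_int (if c \<otimes>\<^bsub>G\<^esub> inv\<^bsub>G\<^esub> b \<in> S then 1 else 0) * R c $$ (0, 0)) =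
      (\<Sum>c\<in>{c \<in> carrier G. c \<otimes>\<^bsub>G\<^esub> inv\<^bsub>G\<^esub> b \<in> S}. R c $$ (0, 0))"
      using G(2) by (intro sum.mono_neutral_cong_right) auto
    also have "\<dots> = (\<Sum>x\<in>S. R (x \<otimes>\<^bsub>G\<^esub> b) $$ (0, 0))"
      using b S(1) by (intro sum.reindex_bij_witness[of _ "\<lambda>x. x \<otimes>\<^bsub>G\<^esub> b" "\<lambda>c. c \<otimes>\<^bsub>G\<^esub> inv\<^bsub>G\<^esub> b"])
        (auto simp: m_assoc subset_iff)
    also have "\<dots> = (\<Sum>x\<in>S. \<Sum>l<n. R x $$ (0, l) * R b $$ (l, 0))"
      using n b S(1) by (intro sum.cong refl)
        (simp add: R(3) mult_mat_entry[OF R(1) R(1)] subset_iff del: index_mult_mat(1))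
    also have "\<dots> = (\<Sum>l<n. (\<Sum>x\<in>S. R x $$ (0, l)) * R b $$ (l, 0))"
      by (subst sum.swap) (simp add: sum_distrib_right)
    also have "\<dots> = (\<Sum>l<n. if 0 = l then omega G \<chi> S * R b $$ (l, 0) else 0)"
      using n by (intro sum.cong refl) (simp add: class_sum_omega[OF G irr \<chi>R S])
    also have "\<dots> = omega G \<chi> S * R b $$ (0, 0)" using n by simp
    finally show "omega G \<chi> S * R b $$ (0, 0) =
      (\<Sum>c\<in>carrier G. of_int (if c \<otimes>\<^bsub>G\<^esub> inv\<^bsub>G\<^esub> b \<in> S then 1 else 0) * R c $$ (0, 0))" by simp
  qed (use G in auto)
qed

definition conj_class :: "('a, 'm) monoid_scheme \<Rightarrow> 'a \<Rightarrow> 'a set" where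
  "conj_class G x = (\<lambda>h. h \<otimes>\<^bsub>G\<^esub> x \<otimes>\<^bsub>G\<^esub> inv\<^bsub>G\<^esub> h) ` carrier G"

lemma conj_classes_eq: "conj_classes G = conj_class G ` carrier G"
  unfolding conj_classes_def conj_class_def by blast

lemma conj_class_self: "group G \<Longrightarrow> x \<in> carrier G \<Longrightarrow> x \<in> conj_class G x"
proof -
  assume "group G" "x \<in> carrier G"
  then interpret group G by simp
  show ?thesis unfolding conj_class_def
    by (rule image_eqI[of _ _ "\<one>\<^bsub>G\<^esub>"]) (use \<open>x \<in> carrier G\<close> in auto)
qed

lemma conj_class_subset: "group G \<Longrightarrow> x \<in> carrier G \<Longrightarrow> conj_class G x \<subseteq> carrier G"
proof -
  assume "group G" "x \<in> carrier G"
  then interpret group G by simp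
  show ?thesis unfolding conj_class_def using \<open>x \<in> carrier G\<close> by auto
qed

lemma conj_class_invariant:
  assumes "group G" "x \<in> carrier G" "y \<in> conj_class G x" "h \<in> carrier G"
  shows "h \<otimes>\<^bsub>G\<^esub> y \<otimes>\<^bsub>G\<^esub> inv\<^bsub>G\<^esub> h \<in> conj_class G x"
proof -
  interpret group G by fact
  obtain g where g: "g \<in> carrier G" "y = g \<otimes>\<^bsub>G\<^esub> x \<otimes>\<^bsub>G\<^esub> inv\<^bsub>G\<^esub> g" using assms(3) by (auto simp: conj_class_def)
  show ?thesis unfolding conj_class_def
    by (rule image_eqI[of _ _ "h \<otimes>\<^bsub>G\<^esub> g"]) (use assms g in \<open>auto simp: m_assoc inv_mult_group\<close>)
qed

section \<open>Congruences modulo a maximal ideal of the algebraic integers\<close>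

context
  fixes \<MM> :: "complex set"
  assumes MM: "maximalideal \<MM> alg_int_ring"
begin

interpretation M: maximalideal \<MM> alg_int_ring by (rule MM)

lemma alg_int_ring_simps:
  "carrier alg_int_ring = {x. algebraic_int x}" "x \<otimes>\<^bsub>alg_int_ring\<^esub> y = x * y"
  "x \<oplus>\<^bsub>alg_int_ring\<^esub> y = x + y" "\<zero>\<^bsub>alg_int_ring\<^esub> = 0" "\<one>\<^bsub>alg_int_ring\<^esub> = 1"
  by (simp_all add: alg_int_ring_def class_ring_simps)

text \<open>Closure of the algebraic integers under the ring operations is part of the hypothesis that \<open>\<MM>\<close> is an
  ideal of a ring.\<close>
lemma alg_int_add: "algebraic_int x \<Longrightarrow> algebraic_int y \<Longrightarrow> algebraic_int (x + y :: complex)"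
  using M.a_closed[of x y] by (simp add: alg_int_ring_simps)

lemma alg_int_mult: "algebraic_int x \<Longrightarrow> algebraic_int y \<Longrightarrow> algebraic_int (x * y :: complex)"
  using M.m_closed[of x y] by (simp add: alg_int_ring_simps)

lemma alg_int_diff: "algebraic_int x \<Longrightarrow> algebraic_int y \<Longrightarrow> algebraic_int (x - y :: complex)"
  using alg_int_add[of x "- y"] by simp

lemma alg_int_sum: "(\<And>i. i \<in> I \<Longrightarrow> algebraic_int (f i)) \<Longrightarrow> algebraic_int (\<Sum>i\<in>I. f i :: complex)"
  by (induction I rule: infinite_finite_induct) (auto intro: alg_int_add)

lemma alg_int_prod: "(\<And>i. i \<in> I \<Longrightarrow> algebraic_int (f i)) \<Longrightarrow> algebraic_int (\<Prod>i\<in>I. f i :: complex)"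
  by (induction I rule: infinite_finite_induct) (auto intro: alg_int_mult)

lemma alg_int_power: "algebraic_int x \<Longrightarrow> algebraic_int (x ^ n :: complex)"
  by (induction n) (auto intro: alg_int_mult)

lemma MM_alg_int: "x \<in> \<MM> \<Longrightarrow> algebraic_int x"
  using M.a_subset by (auto simp: alg_int_ring_simps)

lemma MM_zero: "0 \<in> \<MM>" using additive_subgroup.zero_closed[OF M.additive_subgroup_axioms] by (simp add: alg_int_ring_simps)

lemma MM_add: "x \<in> \<MM> \<Longrightarrow> y \<in> \<MM> \<Longrightarrow> x + y \<in> \<MM>"
  using additive_subgroup.a_closed[OF M.additive_subgroup_axioms] by (auto simp: alg_int_ring_simps)

lemma MM_mult: "x \<in> \<MM> \<Longrightarrow> algebraic_int y \<Longrightarrow> x * y \<in> \<MM>"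
  using M.I_r_closed[of x y] by (simp add: alg_int_ring_simps)

lemma MM_mult': "x \<in> \<MM> \<Longrightarrow> algebraic_int y \<Longrightarrow> y * x \<in> \<MM>"
  using MM_mult[of x y] by (simp add: mult.commute)

lemma MM_uminus: "x \<in> \<MM> \<Longrightarrow> - x \<in> \<MM>"
  using MM_mult[of x "-1"] by simp

lemma MM_diff: "x \<in> \<MM> \<Longrightarrow> y \<in> \<MM> \<Longrightarrow> x - y \<in> \<MM>"
  using MM_add[of x "- y"] MM_uminus[of y] by simp

lemma MM_sum: "(\<And>i. i \<in> I \<Longrightarrow> f i \<in> \<MM>) \<Longrightarrow> (\<Sum>i\<in>I. f i) \<in> \<MM>"
  by (induction I rule: infinite_finite_induct) (auto intro: MM_add MM_zero)

lemma MM_prime: "algebraic_int x \<Longrightarrow> algebraic_int y \<Longrightarrow> x * y \<in> \<MM> \<Longrightarrow> x \<in> \<MM> \<or> y \<in> \<MM>"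
proof -
  assume a: "algebraic_int x" "algebraic_int y" "x * y \<in> \<MM>"
  have "cring (alg_int_ring :: complex ring)"
    by (intro cring.intro M.ring_axioms comm_monoid.intro M.monoid_axioms comm_monoid_axioms.intro)
      (simp add: alg_int_ring_simps)
  then interpret cring alg_int_ring .
  have "primeideal \<MM> alg_int_ring" by (rule maximalideal_prime[OF MM])
  then interpret P: primeideal \<MM> alg_int_ring .
  show ?thesis using P.I_prime[of x y] a by (simp add: alg_int_ring_simps)
qed

lemma MM_one: "1 \<notin> \<MM>"
proof
  assume "1 \<in> \<MM>"
  then have "x \<in> \<MM>" if "algebraic_int x" for x using MM_mult[of 1 x] that by simp
  then have "\<MM> = carrier alg_int_ring" using MM_alg_int by (auto simp: alg_int_ring_simps)
  then show False using M.I_notcarr by simp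
qed

lemma MM_power: "algebraic_int x \<Longrightarrow> x ^ n \<in> \<MM> \<Longrightarrow> x \<in> \<MM>"
proof (induction n)
  case 0 then show ?case using MM_one by simp
next
  case (Suc n) then show ?case using MM_prime[of x "x ^ n"] by (auto intro: alg_int_power)
qed

lemma coset_eq_iff: "\<MM> +>\<^bsub>alg_int_ring\<^esub> a = \<MM> +>\<^bsub>alg_int_ring\<^esub> b \<longleftrightarrow> a - b \<in> \<MM>"
proof -
  have c: "\<MM> +>\<^bsub>alg_int_ring\<^esub> x = {m + x | m. m \<in> \<MM>}" for x
    by (auto simp: a_r_coset_def' alg_int_ring_simps)
  show ?thesis unfolding c
  proof
    assume "{m + a | m. m \<in> \<MM>} = {m + b | m. m \<in> \<MM>}"
    then have "0 + a \<in> {m + b | m. m \<in> \<MM>}" using MM_zero by blast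
    then show "a - b \<in> \<MM>" by auto
  next
    assume ab: "a - b \<in> \<MM>"
    have "m + a \<in> {m + b | m. m \<in> \<MM>}" if "m \<in> \<MM>" for m
      using MM_add[OF that ab] by (auto intro!: exI[of _ "m + (a - b)"])
    moreover have "m + b \<in> {m + a | m. m \<in> \<MM>}" if "m \<in> \<MM>" for m
      using MM_diff[OF that ab] by (auto intro!: exI[of _ "m - (a - b)"])
    ultimately show "{m + a | m. m \<in> \<MM>} = {m + b | m. m \<in> \<MM>}" by auto
  qed
qed

lemma lambda_eq_iff: "lambda \<MM> G \<chi> S = lambda \<MM> G' \<chi>' S' \<longleftrightarrow> omega G \<chi> S - omega G' \<chi>' S' \<in> \<MM>"
  unfolding lambda_def by (rule coset_eq_iff)

lemma lambda_zero_iff: "lambda \<MM> G \<chi> S = \<zero>\<^bsub>alg_int_ring Quot \<MM>\<^esub> \<longleftrightarrow> omega G \<chi> S \<in> \<MM>"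
proof -
  have "\<MM> +>\<^bsub>alg_int_ring\<^esub> 0 = \<MM>"
    by (auto simp: a_r_coset_def' alg_int_ring_simps)
  then show ?thesis using coset_eq_iff[of "omega G \<chi> S" 0] by (simp add: lambda_def FactRing_def)
qed

lemma MM_prod_cong:
  "(\<And>i. i \<in> I \<Longrightarrow> algebraic_int (f i) \<and> algebraic_int (g i) \<and> f i - g i \<in> \<MM>) \<Longrightarrow>
    (\<Prod>i\<in>I. f i) - (\<Prod>i\<in>I. g i) \<in> \<MM>"
proof (induction I rule: infinite_finite_induct)
  case (insert i I)
  have "(\<Prod>j\<in>insert i I. f j) - (\<Prod>j\<in>insert i I. g j) =
    f i * ((\<Prod>j\<in>I. f j) - (\<Prod>j\<in>I. g j)) + (f i - g i) * (\<Prod>j\<in>I. g j)"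
    using insert.hyps by (simp add: algebra_simps)
  moreover have "f i * ((\<Prod>j\<in>I. f j) - (\<Prod>j\<in>I. g j)) \<in> \<MM>"
    by (intro MM_mult') (use insert in auto)
  moreover have "(f i - g i) * (\<Prod>j\<in>I. g j) \<in> \<MM>"
    by (intro MM_mult alg_int_prod) (use insert.prems in auto)
  ultimately show ?case by (simp add: MM_add)
qed (auto intro: MM_zero)

lemma MM_mult_cong:
  assumes "algebraic_int a" "algebraic_int b'" "a - a' \<in> \<MM>" "b - b' \<in> \<MM>"
  shows "a * b - a' * b' \<in> \<MM>"
proof -
  have "a * b - a' * b' = a * (b - b') + (a - a') * b'" by (simp add: algebra_simps)
  then show ?thesis using assms by (auto intro: MM_add MM_mult MM_mult')
qed

text \<open>The matrix \<open>d \<cdot> 1 - a\<close> kills \<open>v\<close>, so its determinant vanishes. Modulo \<open>\<MM>\<close> this determinant is a power of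
  \<open>d\<close>, and \<open>\<MM>\<close> is prime.\<close>
lemma MM_eigenvalue:
  assumes I: "finite I" and v: "i0 \<in> I" "v i0 \<noteq> 0" and d: "algebraic_int d"
    and a: "\<And>i j. i \<in> I \<Longrightarrow> j \<in> I \<Longrightarrow> a i j \<in> \<MM>"
    and eq: "\<And>i. i \<in> I \<Longrightarrow> d * v i = (\<Sum>j\<in>I. a i j * v j)"
  shows "d \<in> \<MM>"
proof -
  obtain n and f :: "nat \<Rightarrow> 'a" where f: "bij_betw f {..<n} I"
    using ex_bij_betw_nat_finite[OF I] by (auto simp: atLeast0LessThan)
  have fI: "f r \<in> I" if "r < n" for r using f that by (auto simp: bij_betw_def)
  define B where "B = mat n n (\<lambda>(r, s). (if r = s then d else 0) - a (f r) (f s))"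
  have B: "B \<in> carrier_mat n n" by (auto simp: B_def)
  define w where "w = vec n (\<lambda>r. v (f r))"
  have w: "w \<in> carrier_vec n" by (simp add: w_def)
  have "B *\<^sub>v w = 0\<^sub>v n"
  proof (rule eq_vecI)
    fix r assume "r < dim_vec (0\<^sub>v n :: complex vec)"
    then have r: "r < n" by simp
    have "(B *\<^sub>v w) $ r = (\<Sum>s<n. ((if r = s then d else 0) - a (f r) (f s)) * v (f s))"
      by (subst mult_vec_entry[OF B w r]) (use r in \<open>simp add: B_def w_def\<close>)
    also have "\<dots> = (\<Sum>s<n. (if r = s then d * v (f s) else 0)) - (\<Sum>s<n. a (f r) (f s) * v (f s))"
      by (subst sum_subtractf[symmetric], intro sum.cong) (auto simp: algebra_simps)
    also have "(\<Sum>s<n. a (f r) (f s) * v (f s)) = (\<Sum>j\<in>I. a (f r) j * v j)"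
      by (rule sum.reindex_bij_betw[OF f])
    also have "\<dots> = d * v (f r)" using eq[OF fI[OF r]] by simp
    finally show "(B *\<^sub>v w) $ r = 0\<^sub>v n $ r" using r by simp
  qed (use B w in auto)
  moreover obtain r0 where "r0 < n" "f r0 = i0" using f v(1) by (auto simp: bij_betw_def)
  then have "w $ r0 \<noteq> 0" using v(2) by (simp add: w_def)
  then have "w \<noteq> 0\<^sub>v n" using \<open>r0 < n\<close> by auto
  ultimately have "det B = 0" using det_0_iff_vec_prod_zero_field[OF B] w by blast
  moreover
  define C where "C = mat n n (\<lambda>(r, s). if r = s then d else 0)"
  have "det C = d ^ n"
  proof -
    have "C = d \<cdot>\<^sub>m 1\<^sub>m n" by (intro eq_matI) (auto simp: C_def)
    then show ?thesis by (simp add: det_smult)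
  qed
  moreover have "det B - det C \<in> \<MM>"
  proof -
    have "det B - det C = (\<Sum>\<pi> | \<pi> permutes {0..<n}. signof \<pi> *
      ((\<Prod>i = 0..<n. B $$ (i, \<pi> i)) - (\<Prod>i = 0..<n. C $$ (i, \<pi> i))))"
      by (simp add: det_def B_def C_def sum_subtractf right_diff_distrib)
    also have "\<dots> \<in> \<MM>"
    proof (intro MM_sum MM_mult' MM_prod_cong)
      fix \<pi> assume "\<pi> \<in> {\<pi>. \<pi> permutes {0..<n}}"
      then have perm: "\<pi> permutes {0..<n}" by simp
      show "algebraic_int (signof \<pi> :: complex)" by (simp add: sign_def)
      fix i assume i: "i \<in> {0..<n}"
      then have \<pi>: "\<pi> i < n" using permutes_in_image[OF perm, of i] by simp
      have aM: "a (f i) (f (\<pi> i)) \<in> \<MM>" using a[OF fI fI] i \<pi> by simp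
      then show "algebraic_int (B $$ (i, \<pi> i)) \<and> algebraic_int (C $$ (i, \<pi> i)) \<and> B $$ (i, \<pi> i) - C $$ (i, \<pi> i) \<in> \<MM>"
        using i \<pi> d aM MM_alg_int[OF aM] MM_uminus[OF aM] alg_int_diff[OF d MM_alg_int[OF aM]]
        by (cases "i = \<pi> i") (simp_all add: B_def C_def)
    qed
    finally show ?thesis .
  qed
  ultimately have "d ^ n \<in> \<MM>" using MM_uminus by fastforce
  then show ?thesis using MM_power d by blast
qed

end

section \<open>Irreducible characters of a direct product\<close>

lemma Irr_undefined: "\<chi> \<in> Irr G \<Longrightarrow> x \<notin> carrier G \<Longrightarrow> \<chi> x = undefined"
  by (auto elim!: IrrE)

lemma Irr_norm:
  assumes G: "group G" "finite (carrier G)" and \<chi>: "\<chi> \<in> Irr G"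
  shows "(\<Sum>g\<in>carrier G. \<chi> g * \<chi> (inv\<^bsub>G\<^esub> g)) = of_nat (card (carrier G))"
proof -
  interpret group G by fact
  obtain n R where irr: "irreducible_rep G n R" and \<chi>R: "\<chi> = (\<lambda>x\<in>carrier G. mat_trace (R x))"
    using \<chi> by (rule IrrE)
  have "(\<Sum>g\<in>carrier G. \<chi> g * \<chi> (inv\<^bsub>G\<^esub> g)) =
    (\<Sum>g\<in>carrier G. mat_trace (R g) * mat_trace (R (inv\<^bsub>G\<^esub> g)))"
    by (intro sum.cong refl) (simp add: \<chi>R)
  then show ?thesis using irreducible_character_norm[OF G irr] by simp
qed

lemma Irr_conj:
  assumes G: "group G" and \<chi>: "\<chi> \<in> Irr G" and "x \<in> carrier G" "h \<in> carrier G"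
  shows "\<chi> (h \<otimes>\<^bsub>G\<^esub> x \<otimes>\<^bsub>G\<^esub> inv\<^bsub>G\<^esub> h) = \<chi> x"
proof -
  interpret group G by fact
  obtain n R where irr: "irreducible_rep G n R" and \<chi>R: "\<chi> = (\<lambda>x\<in>carrier G. mat_trace (R x))"
    using \<chi> by (rule IrrE)
  have hom: "R \<in> hom G (GL n)" using irr by (simp add: irreducible_rep_iff)
  note R = hom_GL_D[OF G hom]
  have hi: "inv\<^bsub>G\<^esub> h \<in> carrier G" using assms by simp
  have "R (h \<otimes>\<^bsub>G\<^esub> x \<otimes>\<^bsub>G\<^esub> inv\<^bsub>G\<^esub> h) = R (h \<otimes>\<^bsub>G\<^esub> x) * R (inv\<^bsub>G\<^esub> h)" using assms by (intro R(3)) auto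
  then have "mat_trace (R (h \<otimes>\<^bsub>G\<^esub> x \<otimes>\<^bsub>G\<^esub> inv\<^bsub>G\<^esub> h)) = mat_trace (R (inv\<^bsub>G\<^esub> h) * R (h \<otimes>\<^bsub>G\<^esub> x))"
    using assms by (simp add: mat_trace_comm[of _ n n] R(1))
  also have "R (inv\<^bsub>G\<^esub> h) * R (h \<otimes>\<^bsub>G\<^esub> x) = R (inv\<^bsub>G\<^esub> h \<otimes>\<^bsub>G\<^esub> (h \<otimes>\<^bsub>G\<^esub> x))" using assms by (intro R(3)[symmetric]) auto
  also have "inv\<^bsub>G\<^esub> h \<otimes>\<^bsub>G\<^esub> (h \<otimes>\<^bsub>G\<^esub> x) = x" using assms by (simp add: m_assoc[symmetric])
  finally show ?thesis using assms by (simp add: \<chi>R)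
qed

lemma finite_group_card:
  assumes "group G" "finite (carrier G)"
  shows "card (carrier G) > 0"
  using assms group.is_monoid[OF assms(1), THEN monoid.one_closed] by (auto simp: card_gt_0_iff)

lemma conj_class_DirProd:
  assumes "group G1" "group G2" "x \<in> carrier G1" "y \<in> carrier G2"
  shows "conj_class (G1 \<times>\<times> G2) (x, y) = conj_class G1 x \<times> conj_class G2 y"
  unfolding conj_class_def using assms by (force simp: inv_DirProd)

lemma conj_classes_DirProdE:
  assumes "group G1" "group G2" "K \<in> conj_classes (G1 \<times>\<times> G2)"
  obtains K1 K2 where "K1 \<in> conj_classes G1" "K2 \<in> conj_classes G2" "K = K1 \<times> K2"
proof -
  obtain z where z: "z \<in> carrier (G1 \<times>\<times> G2)" "K = conj_class (G1 \<times>\<times> G2) z"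
    using assms(3) by (auto simp: conj_classes_eq)
  then obtain x y where xy: "x \<in> carrier G1" "y \<in> carrier G2" "z = (x, y)" by auto
  show ?thesis
    by (rule that[of "conj_class G1 x" "conj_class G2 y"])
      (use xy z conj_class_DirProd[OF assms(1,2) xy(1,2)] in \<open>simp_all add: conj_classes_eq\<close>)
qed

lemma conj_classes_DirProdI:
  assumes "group G1" "group G2" "K1 \<in> conj_classes G1" "K2 \<in> conj_classes G2"
  shows "K1 \<times> K2 \<in> conj_classes (G1 \<times>\<times> G2)"
proof -
  obtain x y where xy: "x \<in> carrier G1" "y \<in> carrier G2" "K1 = conj_class G1 x" "K2 = conj_class G2 y"
    using assms(3,4) by (auto simp: conj_classes_eq)
  show ?thesis unfolding conj_classes_eq
    by (rule image_eqI[of _ _ "(x, y)"]) (use xy conj_class_DirProd[OF assms(1,2) xy(1,2)] in simp_all)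
qed

lemma irreducible_rep_tensor:
  assumes G1: "group G1" "finite (carrier G1)" and G2: "group G2" "finite (carrier G2)"
    and R: "irreducible_rep G1 m R" and S: "irreducible_rep G2 n S"
  shows "irreducible_rep (G1 \<times>\<times> G2) (m * n) (rep_tensor R S)"
proof -
  interpret G1: group G1 by fact
  interpret G2: group G2 by fact
  have hR: "R \<in> hom G1 (GL m)" and hS: "S \<in> hom G2 (GL n)"
    and aR: "acts_irreducibly m (R ` carrier G1)" using R S by (auto simp: irreducible_rep_iff)
  note R' = hom_GL_D[OF G1(1) hR] and S' = hom_GL_D[OF G2(1) hS]
  have G: "group (G1 \<times>\<times> G2)" by (rule DirProd_group[OF G1(1) G2(1)])
  have eq: "rep_tensor R S = (\<lambda>x. kronecker (R (fst x)) (S (snd x)))"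
    by (auto simp: rep_tensor_def)
  have "(\<lambda>x. R (fst x)) ` (carrier G1 \<times> carrier G2) = R ` carrier G1"
    by (force intro: G2.one_closed)
  then have a: "acts_irreducibly m ((\<lambda>x. R (fst x)) ` (carrier G1 \<times> carrier G2))" using aR by simp
  have "acts_irreducibly (m * n) (rep_tensor R S ` (carrier G1 \<times> carrier G2))"
    unfolding eq
  proof (rule tensor_acts_irreducibly[OF a _ _ G2 S])
    fix g assume g: "g \<in> carrier G2"
    show "\<exists>x\<in>carrier G1 \<times> carrier G2. R (fst x) = 1\<^sub>m m \<and> S (snd x) = S g"
      by (rule bexI[of _ "(\<one>\<^bsub>G1\<^esub>, g)"]) (use g R' in auto)
  qed (use R'(1) hS in \<open>auto simp: hom_def\<close>)
  moreover have "rep_tensor R S \<in> hom (G1 \<times>\<times> G2) (GL (m * n))"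
  proof (rule hom_GL_I[OF G])
    fix x assume "x \<in> carrier (G1 \<times>\<times> G2)"
    then show "rep_tensor R S x \<in> carrier_mat (m * n) (m * n)"
      using R'(1) S'(1) by (auto simp: eq intro: kronecker_carrier)
    fix y assume "y \<in> carrier (G1 \<times>\<times> G2)"
    then show "rep_tensor R S (x \<otimes>\<^bsub>G1 \<times>\<times> G2\<^esub> y) = rep_tensor R S x * rep_tensor R S y"
      using \<open>x \<in> _\<close> R' S' by (cases x, cases y) (auto simp: eq kronecker_mult[of _ m m _ n n _ m _ n])
  next
    show "rep_tensor R S \<one>\<^bsub>G1 \<times>\<times> G2\<^esub> = 1\<^sub>m (m * n)" using R' S' by (simp add: eq kronecker_one)
  qed
  ultimately show ?thesis by (simp add: irreducible_rep_iff)
qed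

lemma char_tensor_Irr:
  assumes G1: "group G1" "finite (carrier G1)" and G2: "group G2" "finite (carrier G2)"
    and \<chi>: "\<chi>1 \<in> Irr G1" "\<chi>2 \<in> Irr G2"
  shows "char_tensor (carrier G1) (carrier G2) \<chi>1 \<chi>2 \<in> Irr (G1 \<times>\<times> G2)"
proof -
  obtain m R where R: "irreducible_rep G1 m R" "\<chi>1 = (\<lambda>x\<in>carrier G1. mat_trace (R x))" using \<chi>(1) by (rule IrrE)
  obtain n S where S: "irreducible_rep G2 n S" "\<chi>2 = (\<lambda>x\<in>carrier G2. mat_trace (S x))" using \<chi>(2) by (rule IrrE)
  have hR: "R \<in> hom G1 (GL m)" and hS: "S \<in> hom G2 (GL n)" using R S by (auto simp: irreducible_rep_iff)
  have "char_tensor (carrier G1) (carrier G2) \<chi>1 \<chi>2 =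
    (\<lambda>x\<in>carrier (G1 \<times>\<times> G2). mat_trace (rep_tensor R S x))"
    using hom_GL_D(1)[OF G1(1) hR] hom_GL_D(1)[OF G2(1) hS]
    by (auto simp: char_tensor_def rep_tensor_def R(2) S(2) fun_eq_iff mat_trace_kronecker[of _ m _ n])
  then show ?thesis using IrrI[OF irreducible_rep_tensor[OF G1 G2 R(1) S(1)]] by simp
qed

text \<open>Let \<open>S\<close> be an irreducible subrepresentation of the restriction. By hypothesis the class sums of \<open>G\<close>
  act as scalars on the whole space; on \<open>S\<close> these scalars are the values of the central
  character. Comparing traces shows that the restricted character is a multiple of the character of
  \<open>S\<close>, with the quotient of the degrees as factor.\<close>
lemma restriction_multiple_of_irreducible:
  assumes G: "group G" "finite (carrier G)" and J: "group J"
    and R: "irreducible_rep J n R" and \<iota>: "\<iota> \<in> hom G J"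
    and scal: "\<And>x. x \<in> carrier G \<Longrightarrow> \<exists>c. \<forall>i<n. \<forall>j<n. (\<Sum>z\<in>conj_class G x. R (\<iota> z) $$ (i, j)) = (if i = j then c else 0)"
  obtains \<chi> and c :: complex where "\<chi> \<in> Irr G" "c \<noteq> 0" "c \<in> \<real>" "Re c \<ge> 0"
    "\<And>x. x \<in> carrier G \<Longrightarrow> mat_trace (R (\<iota> x)) = c * \<chi> x"
proof -
  interpret G: group G by fact
  interpret J: group J by fact
  have hR: "R \<in> hom J (GL n)" and n: "n > 0" using R irreducible_rep_trace_one[OF J R] by (auto simp: irreducible_rep_iff)
  define R' where "R' x = R (\<iota> x)" for x
  have hR': "R' \<in> hom G (GL n)"
  proof -
    have "R' = R \<circ> \<iota>" by (auto simp: R'_def)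
    then show ?thesis using hom_compose[OF \<iota> hR] by simp
  qed
  note R' = hom_GL_D[OF G(1) hR']
  obtain d S T where S: "irreducible_rep G d S" and T: "T \<in> carrier_mat n d"
    and inj: "\<And>v. v \<in> carrier_vec d \<Longrightarrow> T *\<^sub>v v = 0\<^sub>v n \<Longrightarrow> v = 0\<^sub>v d"
    and RT: "\<And>x. x \<in> carrier G \<Longrightarrow> R' x * T = T * S x"
    using exists_irreducible_subrep[OF G(1) hR' n] by metis
  have hS: "S \<in> hom G (GL d)" using S by (auto simp: irreducible_rep_iff)
  note S' = hom_GL_D[OF G(1) hS]
  have d: "d > 0" using irreducible_rep_trace_one[OF G(1) S] by simp
  have "T \<noteq> 0\<^sub>m n d"
  proof
    assume "T = 0\<^sub>m n d"
    then have "T *\<^sub>v unit_vec d 0 = 0\<^sub>v n"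
      by (intro eq_vecI) (auto simp: scalar_prod_def)
    then have "unit_vec d 0 = (0\<^sub>v d :: complex vec)" using inj by simp
    then show False using d by (metis unit_vec_nonzero)
  qed
  then obtain a b where ab: "a < n" "b < d" "T $$ (a, b) \<noteq> 0"
    using T by (metis carrier_matD eq_matI index_zero_mat)
  define \<chi> where "\<chi> = (\<lambda>x\<in>carrier G. mat_trace (S x))"
  define c where "c = of_nat n / (of_nat d :: complex)"
  have tr: "mat_trace (R (\<iota> x)) = c * \<chi> x" if x: "x \<in> carrier G" for x
  proof -
    let ?K = "conj_class G x"
    have K: "?K \<subseteq> carrier G" "x \<in> ?K" using conj_class_subset[OF G(1) x] conj_class_self[OF G(1) x] by auto
    have finK: "finite ?K" using K G(2) finite_subset by blast
    obtain w where w: "\<And>i j. i < n \<Longrightarrow> j < n \<Longrightarrow> (\<Sum>z\<in>?K. R' z $$ (i, j)) = (if i = j then w else 0)"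
      using scal[OF x] unfolding R'_def by blast
    have s: "(\<Sum>z\<in>?K. S z $$ (i, j)) = (if i = j then omega G \<chi> ?K else 0)" if "i < d" "j < d" for i j
      by (rule class_sum_omega[OF G S \<chi>_def K(1) conj_class_invariant[OF G(1) x] that])
    have "w * T $$ (a, b) = (\<Sum>l<n. if a = l then w * T $$ (l, b) else 0)" using ab by simp
    also have "\<dots> = (\<Sum>l<n. (\<Sum>z\<in>?K. R' z $$ (a, l)) * T $$ (l, b))"
      using ab by (intro sum.cong refl) (simp add: w)
    also have "\<dots> = (\<Sum>z\<in>?K. \<Sum>l<n. R' z $$ (a, l) * T $$ (l, b))"
      by (subst sum.swap) (simp add: sum_distrib_right)
    also have "\<dots> = (\<Sum>z\<in>?K. (R' z * T) $$ (a, b))"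
    proof (rule sum.cong[OF refl])
      fix z assume "z \<in> ?K"
      then have z: "z \<in> carrier G" using K by auto
      show "(\<Sum>l<n. R' z $$ (a, l) * T $$ (l, b)) = (R' z * T) $$ (a, b)"
        by (rule mult_mat_entry[OF R'(1)[OF z] T ab(1,2), symmetric])
    qed
    also have "\<dots> = (\<Sum>z\<in>?K. \<Sum>l<d. T $$ (a, l) * S z $$ (l, b))"
    proof (rule sum.cong[OF refl])
      fix z assume "z \<in> ?K"
      then have z: "z \<in> carrier G" using K by auto
      show "(R' z * T) $$ (a, b) = (\<Sum>l<d. T $$ (a, l) * S z $$ (l, b))"
        unfolding RT[OF z] by (rule mult_mat_entry[OF T S'(1)[OF z] ab(1,2)])
    qed
    also have "\<dots> = (\<Sum>l<d. T $$ (a, l) * (\<Sum>z\<in>?K. S z $$ (l, b)))"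
      by (subst sum.swap) (simp add: sum_distrib_left)
    also have "\<dots> = (\<Sum>l<d. if l = b then T $$ (a, l) * omega G \<chi> ?K else 0)"
      using ab by (intro sum.cong refl) (simp add: s)
    also have "\<dots> = T $$ (a, b) * omega G \<chi> ?K" using ab by simp
    finally have w\<chi>: "w = omega G \<chi> ?K" using ab by simp
    have "of_nat n * w = (\<Sum>i<n. \<Sum>z\<in>?K. R' z $$ (i, i))" by (simp add: w)
    also have "\<dots> = (\<Sum>z\<in>?K. \<Sum>i<n. R' z $$ (i, i))" by (rule sum.swap)
    also have "\<dots> = (\<Sum>z\<in>?K. mat_trace (R' z))"
      using K R'(1) by (intro sum.cong refl) (auto simp: mat_trace_def)
    also have "\<dots> = (\<Sum>z\<in>?K. mat_trace (R' x))"
    proof (rule sum.cong[OF refl])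
      fix z assume "z \<in> ?K"
      then obtain h where h: "h \<in> carrier G" "z = h \<otimes>\<^bsub>G\<^esub> x \<otimes>\<^bsub>G\<^esub> inv\<^bsub>G\<^esub> h" by (auto simp: conj_class_def)
      have "\<iota> z = \<iota> h \<otimes>\<^bsub>J\<^esub> \<iota> x \<otimes>\<^bsub>J\<^esub> inv\<^bsub>J\<^esub> (\<iota> h)"
        using h x \<iota> group_hom.hom_inv[of G J \<iota> h] G(1) J
        by (simp add: hom_mult[OF \<iota>] group_hom_def group_hom_axioms_def)
      then show "mat_trace (R' z) = mat_trace (R' x)"
        using Irr_conj[OF J IrrI[OF R], of "\<iota> x" "\<iota> h"] h x hom_in_carrier[OF \<iota>] by (simp add: R'_def)
    qed
    finally have n1: "of_nat n * w = of_nat (card ?K) * mat_trace (R' x)" by simp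
    have "(\<Sum>z\<in>?K. \<chi> z) = (\<Sum>z\<in>?K. \<chi> x)"
      using Irr_conj[OF G(1) IrrI[OF S]] x by (intro sum.cong refl) (auto simp: conj_class_def \<chi>_def)
    then have n2: "omega G \<chi> ?K = of_nat (card ?K) * \<chi> x / of_nat d"
      using irreducible_rep_trace_one[OF G(1) S] by (simp add: omega_def \<chi>_def)
    have "card ?K \<noteq> 0" using K finK by auto
    moreover have "of_nat (card ?K) * mat_trace (R' x) = of_nat (card ?K) * (c * \<chi> x)"
      unfolding n1[symmetric] w\<chi> n2 c_def by simp
    ultimately show ?thesis by (simp add: R'_def)
  qed
  show ?thesis
  proof (rule that)
    show "\<chi> \<in> Irr G" unfolding \<chi>_def by (rule IrrI[OF S])
    show "c \<noteq> 0" using n d by (simp add: c_def)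
    have c: "c = of_real (real n / real d)" by (simp add: c_def)
    show "c \<in> \<real>" unfolding c by simp
    show "Re c \<ge> 0" unfolding c by simp
  qed (rule tr)
qed

lemma nonneg_real_square_one:
  assumes "(c :: complex) \<in> \<real>" "Re c \<ge> 0" "c * c = 1"
  shows "c = 1"
proof -
  from assms(1) obtain r where c: "c = of_real r" by (auto simp: Reals_def)
  then have "r * r = 1" "r \<ge> 0" using assms by (simp_all flip: of_real_mult)
  then have "r = 1" by (metis abs_of_nonneg mult_cancel_left1 power2_eq_square real_sqrt_abs2 real_sqrt_one)
  then show ?thesis using c by simp
qed

text \<open>A class of one factor is a class of the product, so class sums of the factors act as scalars and
  the restrictions to the factors are multiples of irreducible characters. Summing \<open>R\<close> over the class
  of \<open>(x, \<one>)\<close> times \<open>(\<one>, y)\<close> gives \<open>\<chi> (x, y) = \<chi> (x, \<one>) * \<chi> (\<one>, y) / n\<close>, whence \<open>\<chi>\<close> is a nonnegative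
  multiple of a tensor product. As irreducible characters have norm 1, the multiple is 1.\<close>
theorem Irr_DirProd:
  assumes G1: "group G1" "finite (carrier G1)" and G2: "group G2" "finite (carrier G2)"
    and \<chi>: "\<chi> \<in> Irr (G1 \<times>\<times> G2)"
  obtains \<chi>1 \<chi>2 where "\<chi>1 \<in> Irr G1" "\<chi>2 \<in> Irr G2" "\<chi> = char_tensor (carrier G1) (carrier G2) \<chi>1 \<chi>2"
proof -
  interpret G1: group G1 by fact
  interpret G2: group G2 by fact
  let ?G = "G1 \<times>\<times> G2"
  have G: "group ?G" "finite (carrier ?G)" using DirProd_group[OF G1(1) G2(1)] G1 G2 by auto
  interpret G: group ?G by fact
  obtain n R where R: "irreducible_rep ?G n R" and \<chi>R: "\<chi> = (\<lambda>x\<in>carrier ?G. mat_trace (R x))"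
    using \<chi> by (rule IrrE)
  have hR: "R \<in> hom ?G (GL n)" and n: "n > 0"
    using R irreducible_rep_trace_one[OF G(1) R] by (auto simp: irreducible_rep_iff)
  note R' = hom_GL_D[OF G(1) hR]
  have conj1: "conj_class ?G (x, \<one>\<^bsub>G2\<^esub>) = (\<lambda>z. (z, \<one>\<^bsub>G2\<^esub>)) ` conj_class G1 x" if "x \<in> carrier G1" for x
  proof -
    have "conj_class G2 \<one>\<^bsub>G2\<^esub> = {\<one>\<^bsub>G2\<^esub>}" by (auto simp: conj_class_def)
    then show ?thesis using conj_class_DirProd[OF G1(1) G2(1) that, of "\<one>\<^bsub>G2\<^esub>"] by auto
  qed
  have conj2: "conj_class ?G (\<one>\<^bsub>G1\<^esub>, y) = (\<lambda>z. (\<one>\<^bsub>G1\<^esub>, z)) ` conj_class G2 y" if "y \<in> carrier G2" for y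
  proof -
    have "conj_class G1 \<one>\<^bsub>G1\<^esub> = {\<one>\<^bsub>G1\<^esub>}" by (auto simp: conj_class_def)
    then show ?thesis using conj_class_DirProd[OF G1(1) G2(1) G1.one_closed that] by auto
  qed
  have sc: "(\<Sum>z\<in>conj_class ?G w. R z $$ (i, j)) = (if i = j then omega ?G \<chi> (conj_class ?G w) else 0)"
    if "w \<in> carrier ?G" "i < n" "j < n" for w i j
    by (rule class_sum_omega[OF G R \<chi>R conj_class_subset[OF G(1) that(1)] conj_class_invariant[OF G(1) that(1)] that(2,3)])
  obtain \<chi>1 c1 where \<chi>1: "\<chi>1 \<in> Irr G1" "c1 \<noteq> 0" "c1 \<in> \<real>" "Re c1 \<ge> 0"
    "\<And>x. x \<in> carrier G1 \<Longrightarrow> mat_trace (R (x, \<one>\<^bsub>G2\<^esub>)) = c1 * \<chi>1 x"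
  proof (rule restriction_multiple_of_irreducible[OF G1 G(1) R, of "\<lambda>x. (x, \<one>\<^bsub>G2\<^esub>)"])
    show "(\<lambda>x. (x, \<one>\<^bsub>G2\<^esub>)) \<in> hom G1 ?G" by (auto simp: hom_def)
    fix x assume x: "x \<in> carrier G1"
    show "\<exists>c. \<forall>i<n. \<forall>j<n. (\<Sum>z\<in>conj_class G1 x. R (z, \<one>\<^bsub>G2\<^esub>) $$ (i, j)) = (if i = j then c else 0)"
    proof -
      have "(\<Sum>z\<in>conj_class G1 x. R (z, \<one>\<^bsub>G2\<^esub>) $$ (i, j)) = (\<Sum>z\<in>conj_class ?G (x, \<one>\<^bsub>G2\<^esub>). R z $$ (i, j))" for i j
        by (simp add: conj1[OF x] sum.reindex inj_on_def)
      then show ?thesis using x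
        by (intro exI[of _ "omega ?G \<chi> (conj_class ?G (x, \<one>\<^bsub>G2\<^esub>))"]) (simp add: sc)
    qed
  qed (rule that, assumption, assumption, assumption, assumption, blast)
  obtain \<chi>2 c2 where \<chi>2: "\<chi>2 \<in> Irr G2" "c2 \<noteq> 0" "c2 \<in> \<real>" "Re c2 \<ge> 0"
    "\<And>y. y \<in> carrier G2 \<Longrightarrow> mat_trace (R (\<one>\<^bsub>G1\<^esub>, y)) = c2 * \<chi>2 y"
  proof (rule restriction_multiple_of_irreducible[OF G2 G(1) R, of "\<lambda>y. (\<one>\<^bsub>G1\<^esub>, y)"])
    show "(\<lambda>y. (\<one>\<^bsub>G1\<^esub>, y)) \<in> hom G2 ?G" by (auto simp: hom_def)
    fix x assume x: "x \<in> carrier G2"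
    show "\<exists>c. \<forall>i<n. \<forall>j<n. (\<Sum>z\<in>conj_class G2 x. R (\<one>\<^bsub>G1\<^esub>, z) $$ (i, j)) = (if i = j then c else 0)"
    proof -
      have "(\<Sum>z\<in>conj_class G2 x. R (\<one>\<^bsub>G1\<^esub>, z) $$ (i, j)) = (\<Sum>z\<in>conj_class ?G (\<one>\<^bsub>G1\<^esub>, x). R z $$ (i, j))" for i j
        by (simp add: conj2[OF x] sum.reindex inj_on_def)
      then show ?thesis using x
        by (intro exI[of _ "omega ?G \<chi> (conj_class ?G (\<one>\<^bsub>G1\<^esub>, x))"]) (simp add: sc)
    qed
  qed (rule that, assumption, assumption, assumption, assumption, blast)
  have \<chi>R': "\<chi> z = mat_trace (R z)" if "z \<in> carrier ?G" for z using that by (simp add: \<chi>R)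
  have prod: "\<chi> (x, y) = (c1 * c2 / of_nat n) * (\<chi>1 x * \<chi>2 y)" if x: "x \<in> carrier G1" and y: "y \<in> carrier G2" for x y
  proof -
    let ?K = "conj_class ?G (x, \<one>\<^bsub>G2\<^esub>)"
    have xc: "(x, \<one>\<^bsub>G2\<^esub>) \<in> carrier ?G" and yc: "(\<one>\<^bsub>G1\<^esub>, y) \<in> carrier ?G" using x y by auto
    have K: "?K \<subseteq> carrier ?G" "(x, \<one>\<^bsub>G2\<^esub>) \<in> ?K" using conj_class_subset[OF G(1) xc] conj_class_self[OF G(1) xc] by auto
    have K0: "card ?K \<noteq> 0" using K finite_subset[OF K(1) G(2)] by auto
    have cc: "\<chi> z = \<chi> (x, \<one>\<^bsub>G2\<^esub>)" if "z \<in> ?K" for z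
      using that Irr_conj[OF G(1) \<chi> xc] unfolding conj_class_def by blast
    have cc': "\<chi> (z \<otimes>\<^bsub>?G\<^esub> (\<one>\<^bsub>G1\<^esub>, y)) = \<chi> (x, y)" if zK: "z \<in> ?K" for z
    proof -
      obtain h where h: "h \<in> carrier G1" "z = (h \<otimes>\<^bsub>G1\<^esub> x \<otimes>\<^bsub>G1\<^esub> inv\<^bsub>G1\<^esub> h, \<one>\<^bsub>G2\<^esub>)"
        using zK unfolding conj1[OF x] by (auto simp: conj_class_def)
      have "z \<otimes>\<^bsub>?G\<^esub> (\<one>\<^bsub>G1\<^esub>, y) = (h, \<one>\<^bsub>G2\<^esub>) \<otimes>\<^bsub>?G\<^esub> (x, y) \<otimes>\<^bsub>?G\<^esub> inv\<^bsub>?G\<^esub> (h, \<one>\<^bsub>G2\<^esub>)"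
        using h x y by (simp add: inv_DirProd[OF G1(1) G2(1)])
      then show ?thesis using Irr_conj[OF G(1) \<chi>, of "(x, y)" "(h, \<one>\<^bsub>G2\<^esub>)"] x y h by simp
    qed
    have "of_nat (card ?K) * \<chi> (x, y) = (\<Sum>z\<in>?K. \<chi> (z \<otimes>\<^bsub>?G\<^esub> (\<one>\<^bsub>G1\<^esub>, y)))" by (simp add: cc')
    also have "\<dots> = (\<Sum>z\<in>?K. \<Sum>i<n. \<Sum>l<n. R z $$ (i, l) * R (\<one>\<^bsub>G1\<^esub>, y) $$ (l, i))"
    proof (rule sum.cong[OF refl])
      fix z assume "z \<in> ?K"
      then have z: "z \<in> carrier ?G" using K by auto
      have "\<chi> (z \<otimes>\<^bsub>?G\<^esub> (\<one>\<^bsub>G1\<^esub>, y)) = mat_trace (R z * R (\<one>\<^bsub>G1\<^esub>, y))"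
        using G.m_closed[OF z yc] R'(3)[OF z yc] by (simp add: \<chi>R' del: carrier_DirProd mult_DirProd)
      also have "\<dots> = (\<Sum>i<n. \<Sum>l<n. R z $$ (i, l) * R (\<one>\<^bsub>G1\<^esub>, y) $$ (l, i))"
        using carrier_matD[OF R'(1)[OF z]] carrier_matD[OF R'(1)[OF yc]]
        by (simp add: mat_trace_def mult_mat_entry[OF R'(1)[OF z] R'(1)[OF yc]] del: index_mult_mat(1))
      finally show "\<chi> (z \<otimes>\<^bsub>?G\<^esub> (\<one>\<^bsub>G1\<^esub>, y)) = \<dots>" .
    qed
    also have "\<dots> = (\<Sum>i<n. \<Sum>l<n. (\<Sum>z\<in>?K. R z $$ (i, l)) * R (\<one>\<^bsub>G1\<^esub>, y) $$ (l, i))"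
      unfolding sum_distrib_right
    proof (subst sum.swap, rule sum.cong[OF refl])
      fix i
      show "(\<Sum>z\<in>?K. \<Sum>l<n. R z $$ (i, l) * R (\<one>\<^bsub>G1\<^esub>, y) $$ (l, i)) =
        (\<Sum>l<n. \<Sum>z\<in>?K. R z $$ (i, l) * R (\<one>\<^bsub>G1\<^esub>, y) $$ (l, i))" by (rule sum.swap)
    qed
    also have "\<dots> = (\<Sum>i<n. \<Sum>l<n. if i = l then omega ?G \<chi> ?K * R (\<one>\<^bsub>G1\<^esub>, y) $$ (l, i) else 0)"
      by (intro sum.cong refl) (simp add: sc[OF xc])
    also have "\<dots> = omega ?G \<chi> ?K * \<chi> (\<one>\<^bsub>G1\<^esub>, y)"
      using carrier_matD[OF R'(1)[OF yc]] yc by (simp add: \<chi>R mat_trace_def sum_distrib_left)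
    also have "omega ?G \<chi> ?K = of_nat (card ?K) * \<chi> (x, \<one>\<^bsub>G2\<^esub>) / of_nat n"
      using cc irreducible_rep_trace_one[OF G(1) R] by (simp add: omega_def \<chi>R')
    finally have "\<chi> (x, y) = \<chi> (x, \<one>\<^bsub>G2\<^esub>) / of_nat n * \<chi> (\<one>\<^bsub>G1\<^esub>, y)"
      using K0 n by (simp add: field_simps)
    then show ?thesis using \<chi>1(5)[OF x] \<chi>2(5)[OF y] xc yc by (simp add: \<chi>R')
  qed
  define c where "c = c1 * c2 / of_nat n"
  have cr: "c \<in> \<real>" "Re c \<ge> 0"
  proof -
    obtain r1 r2 where "c1 = of_real r1" "c2 = of_real r2" using \<chi>1 \<chi>2 by (auto simp: Reals_def)
    then have "c = of_real (r1 * r2 / real n)" "r1 \<ge> 0" "r2 \<ge> 0" using \<chi>1 \<chi>2 by (auto simp: c_def)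
    then show "c \<in> \<real>" "Re c \<ge> 0" by auto
  qed
  have "of_nat (card (carrier G1)) * of_nat (card (carrier G2)) = (\<Sum>z\<in>carrier ?G. \<chi> z * \<chi> (inv\<^bsub>?G\<^esub> z))"
    using Irr_norm[OF G \<chi>] by (simp add: card_cartesian_product)
  also have "\<dots> = (\<Sum>x\<in>carrier G1. \<Sum>y\<in>carrier G2. c * c * ((\<chi>1 x * \<chi>1 (inv\<^bsub>G1\<^esub> x)) * (\<chi>2 y * \<chi>2 (inv\<^bsub>G2\<^esub> y))))"
    by (subst sum.cartesian_product, subst carrier_DirProd, intro sum.cong refl)
      (auto simp: inv_DirProd[OF G1(1) G2(1)] prod c_def)
  also have "\<dots> = c * c * (of_nat (card (carrier G1)) * of_nat (card (carrier G2)))"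
    unfolding Irr_norm[OF G1 \<chi>1(1), symmetric] Irr_norm[OF G2 \<chi>2(1), symmetric]
    by (subst sum_product) (simp only: sum_distrib_left)
  finally have "c * c = 1" using finite_group_card[OF G1] finite_group_card[OF G2] by simp
  then have "c = 1" by (rule nonneg_real_square_one[OF cr])
  then have "\<chi> = char_tensor (carrier G1) (carrier G2) \<chi>1 \<chi>2"
    using prod Irr_undefined[OF \<chi>] by (auto simp: char_tensor_def fun_eq_iff c_def)
  then show ?thesis using that \<chi>1(1) \<chi>2(1) by blast
qed

text \<open>Equal tensor products have proportional factors, and proportional irreducible characters agree
  because both have norm 1 and positive degree.\<close>
lemma char_tensor_cancel:
  assumes G1: "group G1" "finite (carrier G1)" and G2: "group G2" "finite (carrier G2)"
    and \<chi>: "\<chi>1 \<in> Irr G1" "\<chi>2 \<in> Irr G2" "\<psi>1 \<in> Irr G1" "\<psi>2 \<in> Irr G2"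
    and eq: "char_tensor (carrier G1) (carrier G2) \<chi>1 \<chi>2 = char_tensor (carrier G1) (carrier G2) \<psi>1 \<psi>2"
  shows "\<chi>1 = \<psi>1 \<and> \<chi>2 = \<psi>2"
proof -
  interpret G1: group G1 by fact
  interpret G2: group G2 by fact
  have e: "\<chi>1 x * \<chi>2 y = \<psi>1 x * \<psi>2 y" if "x \<in> carrier G1" "y \<in> carrier G2" for x y
    using fun_cong[OF eq, of "(x, y)"] that by (simp add: char_tensor_def)
  obtain a where a: "a > (0::nat)" "\<chi>2 \<one>\<^bsub>G2\<^esub> = of_nat a" using Irr_one[OF G2(1) \<chi>(2)] .
  obtain b where b: "b > (0::nat)" "\<psi>2 \<one>\<^bsub>G2\<^esub> = of_nat b" using Irr_one[OF G2(1) \<chi>(4)] .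
  define c :: complex where "c = of_nat b / of_nat a"
  have c: "\<chi>1 x = c * \<psi>1 x" if "x \<in> carrier G1" for x
    using e[OF that G2.one_closed] a b by (simp add: c_def field_simps)
  have "(\<Sum>g\<in>carrier G1. \<chi>1 g * \<chi>1 (inv\<^bsub>G1\<^esub> g)) = c * c * (\<Sum>g\<in>carrier G1. \<psi>1 g * \<psi>1 (inv\<^bsub>G1\<^esub> g))"
    unfolding sum_distrib_left by (intro sum.cong refl) (simp add: c)
  then have cc: "c * c = 1"
    using finite_group_card[OF G1] by (simp add: Irr_norm[OF G1 \<chi>(1)] Irr_norm[OF G1 \<chi>(3)])
  have cr: "c = of_real (real b / real a)" by (simp add: c_def)
  have "c \<in> \<real>" "Re c \<ge> 0" unfolding cr by simp_all
  then have "c = 1" using cc by (rule nonneg_real_square_one)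
  then have 1: "\<chi>1 x = \<psi>1 x" if "x \<in> carrier G1" for x using c that by simp
  obtain k where k: "k > (0::nat)" "\<psi>1 \<one>\<^bsub>G1\<^esub> = of_nat k" using Irr_one[OF G1(1) \<chi>(3)] .
  have 2: "\<chi>2 y = \<psi>2 y" if "y \<in> carrier G2" for y
    using e[OF G1.one_closed that] 1[OF G1.one_closed] k by simp
  have "\<chi>1 x = \<psi>1 x" for x
    by (cases "x \<in> carrier G1") (simp_all add: 1 Irr_undefined[OF \<chi>(1)] Irr_undefined[OF \<chi>(3)])
  moreover have "\<chi>2 x = \<psi>2 x" for x
    by (cases "x \<in> carrier G2") (simp_all add: 2 Irr_undefined[OF \<chi>(2)] Irr_undefined[OF \<chi>(4)])
  ultimately show ?thesis by auto
qed

lemma omega_DirProd: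
  assumes "S \<subseteq> carrier G1" "T \<subseteq> carrier G2" "group G1" "group G2"
  shows "omega (G1 \<times>\<times> G2) (char_tensor (carrier G1) (carrier G2) \<chi>1 \<chi>2) (S \<times> T) = omega G1 \<chi>1 S * omega G2 \<chi>2 T"
proof -
  interpret G1: group G1 by fact
  interpret G2: group G2 by fact
  have "(\<Sum>z\<in>S \<times> T. char_tensor (carrier G1) (carrier G2) \<chi>1 \<chi>2 z) = (\<Sum>(x, y)\<in>S \<times> T. \<chi>1 x * \<chi>2 y)"
    using assms by (intro sum.cong refl) (auto simp: char_tensor_def)
  also have "\<dots> = (\<Sum>x\<in>S. \<chi>1 x) * (\<Sum>y\<in>T. \<chi>2 y)"
    by (simp add: sum_product sum.cartesian_product)
  finally show ?thesis by (simp add: omega_def char_tensor_def)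
qed

section \<open>Blocks and defect groups of a direct product\<close>

lemma centralizer_subgroup:
  assumes "group G" "S \<subseteq> carrier G"
  shows "subgroup (centralizer G S) G"
proof -
  interpret group G by fact
  show ?thesis
  proof (rule subgroupI)
    show "centralizer G S \<subseteq> carrier G" by (auto simp: centralizer_def)
    have "\<one>\<^bsub>G\<^esub> \<in> centralizer G S" using assms by (auto simp: centralizer_def)
    then show "centralizer G S \<noteq> {}" by blast
    fix a assume a: "a \<in> centralizer G S"
    show "inv\<^bsub>G\<^esub> a \<in> centralizer G S"
      unfolding centralizer_def
    proof (intro CollectI conjI ballI)
      show "inv\<^bsub>G\<^esub> a \<in> carrier G" using a by (auto simp: centralizer_def)
      fix s assume s: "s \<in> S"
      have c: "a \<in> carrier G" "s \<in> carrier G" "a \<otimes>\<^bsub>G\<^esub> s = s \<otimes>\<^bsub>G\<^esub> a" using a s assms(2) by (auto simp: centralizer_def)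
      have "inv\<^bsub>G\<^esub> a \<otimes>\<^bsub>G\<^esub> s = inv\<^bsub>G\<^esub> a \<otimes>\<^bsub>G\<^esub> (s \<otimes>\<^bsub>G\<^esub> a) \<otimes>\<^bsub>G\<^esub> inv\<^bsub>G\<^esub> a" using c by (simp add: m_assoc)
      also have "\<dots> = s \<otimes>\<^bsub>G\<^esub> inv\<^bsub>G\<^esub> a" unfolding c(3)[symmetric] using c(1,2) by (simp add: m_assoc[symmetric])
      finally show "inv\<^bsub>G\<^esub> a \<otimes>\<^bsub>G\<^esub> s = s \<otimes>\<^bsub>G\<^esub> inv\<^bsub>G\<^esub> a" .
    qed
    fix b assume b: "b \<in> centralizer G S"
    show "a \<otimes>\<^bsub>G\<^esub> b \<in> centralizer G S"
      unfolding centralizer_def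
    proof (intro CollectI conjI ballI)
      show "a \<otimes>\<^bsub>G\<^esub> b \<in> carrier G" using a b by (auto simp: centralizer_def)
      fix s assume s: "s \<in> S"
      have c: "a \<in> carrier G" "b \<in> carrier G" "s \<in> carrier G" "a \<otimes>\<^bsub>G\<^esub> s = s \<otimes>\<^bsub>G\<^esub> a" "b \<otimes>\<^bsub>G\<^esub> s = s \<otimes>\<^bsub>G\<^esub> b"
        using a b s assms(2) by (auto simp: centralizer_def)
      have "a \<otimes>\<^bsub>G\<^esub> b \<otimes>\<^bsub>G\<^esub> s = a \<otimes>\<^bsub>G\<^esub> s \<otimes>\<^bsub>G\<^esub> b" using c(1,2,3,5) by (simp add: m_assoc)
      also have "\<dots> = s \<otimes>\<^bsub>G\<^esub> (a \<otimes>\<^bsub>G\<^esub> b)" unfolding c(4) by (rule m_assoc[OF c(3,1,2)])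
      finally show "a \<otimes>\<^bsub>G\<^esub> b \<otimes>\<^bsub>G\<^esub> s = s \<otimes>\<^bsub>G\<^esub> (a \<otimes>\<^bsub>G\<^esub> b)" .
    qed
  qed
qed

text \<open>Divide an integral polynomial with root \<open>a\<close> by its content.\<close>
lemma algebraic_primitive_equation:
  fixes a :: complex and p :: nat
  assumes "algebraic a" "prime p"
  obtains c :: "nat \<Rightarrow> int" and n where "(\<Sum>i\<le>n. of_int (c i) * a ^ i) = 0" "\<And>i. i > n \<Longrightarrow> c i = 0"
    "\<exists>i\<le>n. \<not> int p dvd c i" "n > 0"
proof -
  obtain f :: "int poly" where f: "f \<noteq> 0" "poly (map_poly of_int f) a = 0"
    using algebraicE'[OF assms(1)] .
  define g where "g = primitive_part f"
  have g: "smult (content f) g = f" by (simp add: g_def)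
  have c0: "content f \<noteq> 0" using f by simp
  have g0: "g \<noteq> 0" using f g by auto
  have "map_poly of_int f = smult (of_int (content f)) (map_poly of_int g :: complex poly)"
    by (subst g[symmetric]) (simp add: map_poly_smult)
  then have ga: "poly (map_poly of_int g) a = 0" using f c0 by simp
  have cg: "content g = 1" using f by (simp add: g_def)
  have eq: "(\<Sum>i\<le>degree g. of_int (Polynomial.coeff g i) * a ^ i) = 0"
    using ga by (simp add: poly_altdef degree_map_poly coeff_map_poly)
  have nd: "\<exists>i\<le>degree g. \<not> int p dvd Polynomial.coeff g i"
  proof (rule ccontr)
    assume "\<not> ?thesis"
    then have "int p dvd Polynomial.coeff g i" for i by (cases "i \<le> degree g") (auto simp: coeff_eq_0)
    then have "[:int p:] dvd g" by (simp add: const_poly_dvd_iff)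
    then have "int p dvd 1" using cg by (simp add: const_poly_dvd_iff_dvd_content)
    then show False using assms(2) by auto
  qed
  have "degree g > 0"
  proof (rule ccontr)
    assume "\<not> degree g > 0"
    then have "degree g = 0" by simp
    then have "Polynomial.coeff g 0 = 0" using eq by simp
    then show False using g0 \<open>degree g = 0\<close> by (metis leading_coeff_0_iff)
  qed
  then show ?thesis using that[OF eq _ nd] by (simp add: coeff_eq_0)
qed

text \<open>With \<open>f = (\<Sum>k\<le>n. c k X\<^sup>k)\<close>, the sum is a coefficient of \<open>f / (X - a)\<close>. Multiplication by it maps the
  group generated by \<open>1, a, \<dots>, a ^ (n - 1)\<close> to itself: its product with \<open>a ^ j\<close> is visibly such a combination
  for \<open>j < i\<close>, and for \<open>j \<ge> i\<close> after replacing the sum by minus the complementary part of \<open>f(a) = 0\<close>.\<close>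
lemma quotient_coefficient_algebraic_int:
  fixes a :: complex and c :: "nat \<Rightarrow> int"
  assumes eq: "(\<Sum>i\<le>n. of_int (c i) * a ^ i) = 0" and c0: "\<And>i. i > n \<Longrightarrow> c i = 0" and n: "n > 0"
    and i: "1 \<le> i" "i \<le> n"
  shows "algebraic_int (\<Sum>k\<in>{i..n}. of_int (c k) * a ^ (k - i))" (is "algebraic_int ?b")
proof (rule algebraic_int_eigenvalue[of "{..<n}" 0 "\<lambda>j. a ^ j" _
    "\<lambda>j l. if j < i then (if j \<le> l then c (l + i - j) else 0) else (if j \<le> l + i \<and> l < j then - c (l + i - j) else 0)"])
  fix j assume j: "j \<in> {..<n}"
  show "?b * a ^ j = (\<Sum>l<n. of_int (if j < i then (if j \<le> l then c (l + i - j) else 0)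
      else (if j \<le> l + i \<and> l < j then - c (l + i - j) else 0)) * a ^ l)"
  proof (cases "j < i")
    case True
    have "(\<Sum>l<n. of_int (if j \<le> l then c (l + i - j) else 0) * a ^ l) =
      (\<Sum>l\<in>{j..n + j - i}. of_int (c (l + i - j)) * a ^ l)"
      using True i j c0 by (intro sum.mono_neutral_cong_right) auto
    also have "\<dots> = (\<Sum>k\<in>{i..n}. of_int (c k) * a ^ (k + j - i))"
      using True i by (intro sum.reindex_bij_witness[of _ "\<lambda>k. k + j - i" "\<lambda>l. l + i - j"]) auto
    also have "\<dots> = ?b * a ^ j"
      unfolding sum_distrib_right
    proof (rule sum.cong[OF refl])
      fix k assume "k \<in> {i..n}"
      then have "k + j - i = (k - i) + j" by simp
      then show "of_int (c k) * a ^ (k + j - i) = of_int (c k) * a ^ (k - i) * a ^ j"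
        by (simp only: power_add mult.assoc)
    qed
    finally show ?thesis using True by simp
  next
    case False
    have "{..n} = {..<i} \<union> {i..n}" using i by auto
    then have "(\<Sum>k\<in>{i..n}. of_int (c k) * a ^ k) = - (\<Sum>k<i. of_int (c k) * a ^ k)"
      using eq by (simp add: sum.union_disjoint ivl_disj_int add_eq_0_iff2)
    moreover have "?b * a ^ j = (\<Sum>k\<in>{i..n}. of_int (c k) * a ^ k) * a ^ (j - i)"
      unfolding sum_distrib_right
    proof (rule sum.cong[OF refl])
      fix k assume "k \<in> {i..n}"
      then have "(k - i) + j = k + (j - i)" using False by simp
      then show "of_int (c k) * a ^ (k - i) * a ^ j = of_int (c k) * a ^ k * a ^ (j - i)"
        by (simp only: mult.assoc flip: power_add)
    qed
    ultimately have "?b * a ^ j = - (\<Sum>k<i. of_int (c k) * a ^ (k + (j - i)))"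
      by (simp add: sum_distrib_right power_add mult.assoc)
    also have "\<dots> = (\<Sum>k<i. of_int (- c k) * a ^ (k + (j - i)))" by (simp add: sum_negf)
    also have "\<dots> = (\<Sum>l\<in>{j - i..<j}. of_int (- c (l + i - j)) * a ^ l)"
      using False by (intro sum.reindex_bij_witness[of _ "\<lambda>l. l + i - j" "\<lambda>k. k + (j - i)"]) auto
    also have "\<dots> = (\<Sum>l<n. of_int (if j \<le> l + i \<and> l < j then - c (l + i - j) else 0) * a ^ l)"
      using False j by (intro sum.mono_neutral_cong_left) auto
    finally show ?thesis using False by simp
  qed
qed (use n in auto)

lemma conj_classes_invariant:
  assumes "group G" "K \<in> conj_classes G"
  shows "K \<subseteq> carrier G" "\<And>x h. x \<in> K \<Longrightarrow> h \<in> carrier G \<Longrightarrow> h \<otimes>\<^bsub>G\<^esub> x \<otimes>\<^bsub>G\<^esub> inv\<^bsub>G\<^esub> h \<in> K"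
proof -
  obtain z where z: "z \<in> carrier G" "K = conj_class G z" using assms(2) by (auto simp: conj_classes_eq)
  show "K \<subseteq> carrier G" using conj_class_subset[OF assms(1) z(1)] z(2) by simp
  show "\<And>x h. x \<in> K \<Longrightarrow> h \<in> carrier G \<Longrightarrow> h \<otimes>\<^bsub>G\<^esub> x \<otimes>\<^bsub>G\<^esub> inv\<^bsub>G\<^esub> h \<in> K"
    using conj_class_invariant[OF assms(1) z(1)] z(2) by simp
qed

lemma algebraic_of_multiple:
  assumes "algebraic_int (of_nat N * a)" "N > 0"
  shows "algebraic (a :: complex)"
proof -
  obtain f :: "int poly" where f: "poly (map_poly of_int f) (of_nat N * a) = 0" "lead_coeff f = 1"
    using assms(1) unfolding algebraic_int_altdef_ipoly by auto
  define g where "g = pcompose f [:0, int N:]"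
  have g0: "g \<noteq> 0" using f(2) assms(2) by (auto simp: g_def pcompose_eq_0_iff)
  have "map_poly of_int g = pcompose (map_poly of_int f) ([:0, of_nat N:] :: complex poly)"
  proof -
    have "map_poly of_int [:0, int N:] = ([:0, of_nat N:] :: complex poly)"
      by (intro poly_eqI) (auto simp: coeff_map_poly coeff_pCons split: nat.splits)
    then show ?thesis unfolding g_def by (simp add: of_int_hom.map_poly_pcompose)
  qed
  then have "poly (map_poly of_int g) a = 0" using f by (simp add: poly_pcompose mult.commute)
  then show ?thesis
    by (intro algebraicI[of "map_poly of_int g"]) (use g0 in \<open>auto simp: coeff_map_poly\<close>)
qed

context
  fixes \<MM> :: "complex set" and p :: nat
  assumes MM: "maximalideal \<MM> alg_int_ring" and p: "prime p" "of_nat p \<in> \<MM>"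
begin

lemma int_not_in_MM: "\<not> int p dvd c \<Longrightarrow> of_int c \<notin> \<MM>"
proof
  assume "\<not> int p dvd c" and cM: "of_int c \<in> \<MM>"
  then have "coprime (int p) c" using p(1) by (simp add: prime_imp_coprime)
  then obtain u v where "u * int p + v * c = 1" using bezout_int[of "int p" c] by (metis coprime_iff_gcd_eq_1)
  then have "(of_int u * of_nat p + of_int v * of_int c :: complex) = 1"
    by (metis of_int_1 of_int_add of_int_mult of_int_of_nat_eq)
  moreover have "of_int u * of_nat p + of_int v * of_int c \<in> \<MM>"
    by (intro MM_add[OF MM] MM_mult'[OF MM] p(2) cM) auto
  ultimately show False using MM_one[OF MM] by simp
qed

text \<open>This is the valuation property of the localisation at \<open>\<MM>\<close>. Let \<open>b i\<close> be the coefficients of \<open>f / (X - a)\<close>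
  for a primitive integral equation \<open>f(a) = 0\<close>, so that \<open>b i = c i + a * b (i + 1)\<close>. All \<open>b i\<close> and \<open>a * b i\<close>
  are algebraic integers. If every \<open>a * b i\<close> were in \<open>\<MM>\<close>, then so would be every \<open>b i\<close>, because \<open>a\<close> is
  not in the maximal ideal of the localisation, and thus every \<open>c i\<close>. Hence \<open>t = a * b i\<close> is suitable for
  some \<open>i\<close>.\<close>
lemma inverse_integral_at_MM:
  assumes a: "algebraic a" "a \<notin> local_max_ideal \<MM>"
  obtains t where "algebraic_int t" "t \<notin> \<MM>" "algebraic_int (t * inverse a)" "a \<noteq> 0"
proof -
  have a0: "a \<noteq> 0"
  proof
    assume "a = 0"
    then have "a \<in> local_max_ideal \<MM>"
      unfolding local_max_ideal_def using MM_one[OF MM] MM_zero[OF MM] by (auto intro!: exI[of _ 1])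
    then show False using a by simp
  qed
  obtain c :: "nat \<Rightarrow> int" and n where eq: "(\<Sum>i\<le>n. of_int (c i) * a ^ i) = 0"
    and c0: "\<And>i. i > n \<Longrightarrow> c i = 0" and nd: "\<exists>i\<le>n. \<not> int p dvd c i" and n: "n > 0"
    using algebraic_primitive_equation[OF a(1) p(1)] by metis
  define b where "b i = (\<Sum>k\<in>{i..n}. of_int (c k) * a ^ (k - i))" for i
  have b_alg: "algebraic_int (b i)" if "1 \<le> i" "i \<le> n" for i
    unfolding b_def by (rule quotient_coefficient_algebraic_int[OF eq c0 n that])
  have rec: "b i = of_int (c i) + a * b (Suc i)" if "i \<le> n" for i
  proof -
    have "{i..n} = insert i {Suc i..n}" using that by auto
    then have "b i = of_int (c i) + (\<Sum>k\<in>{Suc i..n}. of_int (c k) * a ^ (k - i))" by (simp add: b_def)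
    also have "(\<Sum>k\<in>{Suc i..n}. of_int (c k) * a ^ (k - i)) = a * b (Suc i)"
      unfolding b_def sum_distrib_left
    proof (rule sum.cong[OF refl])
      fix k assume "k \<in> {Suc i..n}"
      then have "k - i = Suc (k - Suc i)" by (simp add: Suc_diff_Suc)
      then show "of_int (c k) * a ^ (k - i) = a * (of_int (c k) * a ^ (k - Suc i))"
        by (simp only: power_Suc mult.left_commute)
    qed
    finally show ?thesis .
  qed
  have b0: "b 0 = 0" using eq by (simp add: b_def atLeast0AtMost)
  have bn: "b (Suc n) = 0" by (simp add: b_def)
  have ab_alg: "algebraic_int (a * b i)" if "1 \<le> i" "i \<le> n" for i
  proof -
    have "a * b i = b (i - 1) - of_int (c (i - 1))" using rec[of "i - 1"] that by simp
    moreover have "algebraic_int (b (i - 1))" using that b0 b_alg[of "i - 1"] by (cases "i = 1") auto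
    ultimately show ?thesis by (simp add: alg_int_diff[OF MM])
  qed
  have "\<exists>i. 1 \<le> i \<and> i \<le> n \<and> a * b i \<notin> \<MM>"
  proof (rule ccontr)
    assume neg: "\<not> ?thesis"
    have bM: "b i \<in> \<MM>" if "i \<le> Suc n" for i
    proof (cases "i = 0 \<or> i = Suc n")
      case True then show ?thesis using b0 bn MM_zero[OF MM] by auto
    next
      case False
      then have i: "1 \<le> i" "i \<le> n" using that by auto
      show ?thesis
      proof (rule ccontr)
        assume "b i \<notin> \<MM>"
        then have "a \<in> local_max_ideal \<MM>" unfolding local_max_ideal_def
          using b_alg[OF i] neg i by (auto intro!: exI[of _ "b i"] simp: mult.commute)
        then show False using a by simp
      qed
    qed
    have "of_int (c i) \<in> \<MM>" if "i \<le> n" for i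
    proof -
      have "a * b (Suc i) \<in> \<MM>" using neg bn MM_zero[OF MM] that by (cases "i = n") auto
      moreover have "of_int (c i) = b i - a * b (Suc i)" using rec[OF that] by simp
      ultimately show ?thesis using bM[of i] that MM_diff[OF MM] by simp
    qed
    then show False using nd int_not_in_MM by blast
  qed
  then obtain i where i: "1 \<le> i" "i \<le> n" "a * b i \<notin> \<MM>" by blast
  have "a * b i * inverse a = b i" using a0 by simp
  then have "algebraic_int (a * b i * inverse a)" using b_alg[OF i(1,2)] by (simp only:)
  then show ?thesis by (rule that[OF ab_alg[OF i(1,2)] i(3) _ a0])
qed

lemma local_max_ideal_prime:
  assumes a: "algebraic a" "a \<notin> local_max_ideal \<MM>" and b: "algebraic b" "b \<notin> local_max_ideal \<MM>"
  shows "a * b \<notin> local_max_ideal \<MM>"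
proof
  assume "a * b \<in> local_max_ideal \<MM>"
  then obtain s where s: "algebraic_int s" "s \<notin> \<MM>" "s * (a * b) \<in> \<MM>" by (auto simp: local_max_ideal_def)
  obtain t where t: "algebraic_int t" "t \<notin> \<MM>" "algebraic_int (t * inverse a)" "a \<noteq> 0"
    using inverse_integral_at_MM[OF a] .
  obtain u where u: "algebraic_int u" "u \<notin> \<MM>" "algebraic_int (u * inverse b)" "b \<noteq> 0"
    using inverse_integral_at_MM[OF b] .
  have "s * (a * b) * ((t * inverse a) * (u * inverse b)) \<in> \<MM>"
    by (intro MM_mult[OF MM] s alg_int_mult[OF MM] t u)
  also have "s * (a * b) * ((t * inverse a) * (u * inverse b)) = s * (t * u)" using t u by (simp add: field_simps)
  finally have "s * (t * u) \<in> \<MM>" .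
  then have "t * u \<in> \<MM>" using MM_prime[OF MM s(1) alg_int_mult[OF MM t(1) u(1)]] s(2) by auto
  then show False using MM_prime[OF MM t(1) u(1)] t(2) u(2) by auto
qed

text \<open>Up to a nonzero integral factor, the coefficient is the sum of the algebraic integers
  \<open>\<chi>(1)\<^sup>2 * omega G \<chi> K\<close>, where \<open>K\<close> is the class of \<open>inv x\<close>.\<close>
lemma idem_coeff_algebraic:
  fixes G (structure)
  assumes G: "group G" "finite (carrier G)" and B: "B \<subseteq> Irr G" and x: "x \<in> carrier G"
  shows "algebraic (idem_coeff G B x)"
proof (rule algebraic_of_multiple)
  interpret group G by fact
  let ?K = "conj_class G (inv x)"
  have ix: "inv x \<in> carrier G" using x by simp
  have K: "?K \<subseteq> carrier G" "inv x \<in> ?K" using conj_class_subset[OF G(1) ix] conj_class_self[OF G(1) ix] by auto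
  have K0: "card ?K > 0" using K finite_subset[OF K(1) G(2)] by (auto simp: card_gt_0_iff)
  show "card ?K * card (carrier G) > 0" using K0 finite_group_card[OF G] by simp
  have "of_nat (card ?K * card (carrier G)) * idem_coeff G B x =
    (\<Sum>\<chi>\<in>B. \<chi> \<one> * \<chi> \<one> * omega G \<chi> ?K)"
  proof -
    have om: "omega G \<chi> ?K = of_nat (card ?K) * \<chi> (inv x) / \<chi> \<one>" if "\<chi> \<in> Irr G" for \<chi>
    proof -
      have "(\<Sum>y\<in>?K. \<chi> y) = (\<Sum>y\<in>?K. \<chi> (inv x))"
        using Irr_conj[OF G(1) that ix] by (intro sum.cong refl) (auto simp: conj_class_def)
      then show ?thesis by (simp add: omega_def)
    qed
    have "of_nat (card ?K * card (carrier G)) * idem_coeff G B x =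
      (\<Sum>\<chi>\<in>B. of_nat (card ?K) * (\<chi> \<one> * \<chi> (inv x)))"
      using finite_group_card[OF G] unfolding sum_distrib_left[symmetric] by (simp add: idem_coeff_def)
    also have "\<dots> = (\<Sum>\<chi>\<in>B. \<chi> \<one> * \<chi> \<one> * omega G \<chi> ?K)"
    proof (rule sum.cong[OF refl])
      fix \<chi> assume "\<chi> \<in> B"
      then have \<chi>: "\<chi> \<in> Irr G" using B by auto
      obtain n where "n > (0::nat)" "\<chi> \<one> = of_nat n" using Irr_one[OF G(1) \<chi>] .
      then show "of_nat (card ?K) * (\<chi> \<one> * \<chi> (inv x)) = \<chi> \<one> * \<chi> \<one> * omega G \<chi> ?K"
        by (simp add: om[OF \<chi>])
    qed
    finally show ?thesis .
  qed
  also have "algebraic_int \<dots>"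
  proof (rule alg_int_sum[OF MM])
    fix \<chi> assume "\<chi> \<in> B"
    then have \<chi>: "\<chi> \<in> Irr G" using B by auto
    obtain n where n: "n > (0::nat)" "\<chi> \<one> = of_nat n" using Irr_one[OF G(1) \<chi>] .
    show "algebraic_int (\<chi> \<one> * \<chi> \<one> * omega G \<chi> ?K)"
      unfolding n(2) by (intro alg_int_mult[OF MM] algebraic_int_of_nat
        omega_algebraic_int[OF G \<chi> K(1) conj_class_invariant[OF G(1) ix]])
  qed
  finally show "algebraic_int (of_nat (card ?K * card (carrier G)) * idem_coeff G B x)" .
qed

lemma bl_iff: "\<psi> \<in> bl \<MM> G \<chi> \<longleftrightarrow> \<psi> \<in> Irr G \<and> (\<forall>K\<in>conj_classes G. omega G \<psi> K - omega G \<chi> K \<in> \<MM>)"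
  by (simp add: bl_def lambda_eq_iff[OF MM])

text \<open>The central character of a tensor product is the product of the central characters. Letting one of
  the two classes be trivial separates the congruences for the factors.\<close>
lemma bl_DirProd:
  assumes G1: "group G1" "finite (carrier G1)" and G2: "group G2" "finite (carrier G2)"
    and \<chi>: "\<chi>1 \<in> Irr G1" "\<chi>2 \<in> Irr G2"
  shows "bl \<MM> (G1 \<times>\<times> G2) (char_tensor (carrier G1) (carrier G2) \<chi>1 \<chi>2) =
    (\<lambda>(\<psi>1, \<psi>2). char_tensor (carrier G1) (carrier G2) \<psi>1 \<psi>2) ` (bl \<MM> G1 \<chi>1 \<times> bl \<MM> G2 \<chi>2)"
    (is "?L = ?R")
proof -
  interpret G1: group G1 by fact
  interpret G2: group G2 by fact
  note inv1 = conj_classes_invariant[OF G1(1)] and inv2 = conj_classes_invariant[OF G2(1)]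
  have om1: "algebraic_int (omega G1 \<psi> K)" if "\<psi> \<in> Irr G1" "K \<in> conj_classes G1" for \<psi> K
    by (rule omega_algebraic_int[OF G1 that(1) inv1[OF that(2)]])
  have om2: "algebraic_int (omega G2 \<psi> K)" if "\<psi> \<in> Irr G2" "K \<in> conj_classes G2" for \<psi> K
    by (rule omega_algebraic_int[OF G2 that(1) inv2[OF that(2)]])
  have one1: "{\<one>\<^bsub>G1\<^esub>} \<in> conj_classes G1" unfolding conj_classes_eq
    by (rule image_eqI[of _ _ "\<one>\<^bsub>G1\<^esub>"]) (auto simp: conj_class_def)
  have one2: "{\<one>\<^bsub>G2\<^esub>} \<in> conj_classes G2" unfolding conj_classes_eq
    by (rule image_eqI[of _ _ "\<one>\<^bsub>G2\<^esub>"]) (auto simp: conj_class_def)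
  have oo1: "omega G1 \<psi> {\<one>\<^bsub>G1\<^esub>} = 1" if psi: "\<psi> \<in> Irr G1" for \<psi>
  proof -
    obtain n where "n > (0::nat)" "\<psi> \<one>\<^bsub>G1\<^esub> = of_nat n" using Irr_one[OF G1(1) psi] .
    then show ?thesis by (simp add: omega_def)
  qed
  have oo2: "omega G2 \<psi> {\<one>\<^bsub>G2\<^esub>} = 1" if psi: "\<psi> \<in> Irr G2" for \<psi>
  proof -
    obtain n where "n > (0::nat)" "\<psi> \<one>\<^bsub>G2\<^esub> = of_nat n" using Irr_one[OF G2(1) psi] .
    then show ?thesis by (simp add: omega_def)
  qed
  show ?thesis
  proof (intro equalityI subsetI)
    fix \<psi> assume \<psi>: "\<psi> \<in> ?L"
    then have "\<psi> \<in> Irr (G1 \<times>\<times> G2)" by (simp add: bl_iff)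
    then obtain \<psi>1 \<psi>2 where \<psi>i: "\<psi>1 \<in> Irr G1" "\<psi>2 \<in> Irr G2"
      "\<psi> = char_tensor (carrier G1) (carrier G2) \<psi>1 \<psi>2" by (rule Irr_DirProd[OF G1 G2])
    have cong: "omega G1 \<psi>1 K1 * omega G2 \<psi>2 K2 - omega G1 \<chi>1 K1 * omega G2 \<chi>2 K2 \<in> \<MM>"
      if "K1 \<in> conj_classes G1" "K2 \<in> conj_classes G2" for K1 K2
    proof -
      have "K1 \<times> K2 \<in> conj_classes (G1 \<times>\<times> G2)" by (rule conj_classes_DirProdI[OF G1(1) G2(1) that])
      then show ?thesis using \<psi> inv1(1)[OF that(1)] inv2(1)[OF that(2)]
        unfolding bl_iff \<psi>i(3) by (metis omega_DirProd[OF _ _ G1(1) G2(1)])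
    qed
    have "\<psi>1 \<in> bl \<MM> G1 \<chi>1" unfolding bl_iff
      using cong[OF _ one2] \<psi>i \<chi> by (simp add: oo2)
    moreover have "\<psi>2 \<in> bl \<MM> G2 \<chi>2" unfolding bl_iff
      using cong[OF one1] \<psi>i \<chi> by (simp add: oo1)
    ultimately show "\<psi> \<in> ?R" unfolding \<psi>i(3) by (intro image_eqI[of _ _ "(\<psi>1, \<psi>2)"]) auto
  next
    fix \<psi> assume "\<psi> \<in> ?R"
    then obtain \<psi>1 \<psi>2 where \<psi>i: "\<psi>1 \<in> bl \<MM> G1 \<chi>1" "\<psi>2 \<in> bl \<MM> G2 \<chi>2"
      "\<psi> = char_tensor (carrier G1) (carrier G2) \<psi>1 \<psi>2" by auto
    have irr: "\<psi>1 \<in> Irr G1" "\<psi>2 \<in> Irr G2" using \<psi>i by (auto simp: bl_iff)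
    show "\<psi> \<in> ?L" unfolding bl_iff
    proof (intro conjI ballI)
      show "\<psi> \<in> Irr (G1 \<times>\<times> G2)" unfolding \<psi>i(3) by (rule char_tensor_Irr[OF G1 G2 irr])
      fix K assume "K \<in> conj_classes (G1 \<times>\<times> G2)"
      then obtain K1 K2 where K: "K1 \<in> conj_classes G1" "K2 \<in> conj_classes G2" "K = K1 \<times> K2"
        by (rule conj_classes_DirProdE[OF G1(1) G2(1)])
      have "omega G1 \<psi>1 K1 * omega G2 \<psi>2 K2 - omega G1 \<chi>1 K1 * omega G2 \<chi>2 K2 \<in> \<MM>"
        by (rule MM_mult_cong[OF MM]) (use om1 om2 irr \<chi> K \<psi>i in \<open>auto simp: bl_iff\<close>)
      then show "omega (G1 \<times>\<times> G2) \<psi> K - omega (G1 \<times>\<times> G2) (char_tensor (carrier G1) (carrier G2) \<chi>1 \<chi>2) K \<in> \<MM>"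
        unfolding \<psi>i(3) K(3) using inv1(1)[OF K(1)] inv2(1)[OF K(2)] by (simp add: omega_DirProd G1 G2)
    qed
  qed
qed

lemma idem_coeff_DirProd:
  assumes G1: "group G1" "finite (carrier G1)" and G2: "group G2" "finite (carrier G2)"
    and \<chi>: "\<chi>1 \<in> Irr G1" "\<chi>2 \<in> Irr G2" and x: "x \<in> carrier G1" "y \<in> carrier G2"
  shows "idem_coeff (G1 \<times>\<times> G2) (bl \<MM> (G1 \<times>\<times> G2) (char_tensor (carrier G1) (carrier G2) \<chi>1 \<chi>2)) (x, y) =
    idem_coeff G1 (bl \<MM> G1 \<chi>1) x * idem_coeff G2 (bl \<MM> G2 \<chi>2) y"
proof -
  interpret G1: group G1 by fact
  interpret G2: group G2 by fact
  let ?T = "\<lambda>(\<psi>1, \<psi>2). char_tensor (carrier G1) (carrier G2) \<psi>1 \<psi>2"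
  have inj: "inj_on ?T (bl \<MM> G1 \<chi>1 \<times> bl \<MM> G2 \<chi>2)"
  proof (rule inj_onI, clarify)
    fix a b a' b' assume "a \<in> bl \<MM> G1 \<chi>1" "b \<in> bl \<MM> G2 \<chi>2" "a' \<in> bl \<MM> G1 \<chi>1" "b' \<in> bl \<MM> G2 \<chi>2"
      "char_tensor (carrier G1) (carrier G2) a b = char_tensor (carrier G1) (carrier G2) a' b'"
    then show "a = a' \<and> b = b'" by (intro char_tensor_cancel[OF G1 G2]) (simp_all add: bl_iff)
  qed
  show ?thesis
    unfolding idem_coeff_def bl_DirProd[OF G1 G2 \<chi>] sum.reindex[OF inj]
    using x by (simp add: case_prod_unfold inv_DirProd[OF G1(1) G2(1)] char_tensor_def sum_product
        sum.cartesian_product card_cartesian_product algebra_simps)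
qed

text \<open>A product of defect classes is a defect class, because both nonvanishing conditions are
  multiplicative. The centralizer of \<open>(x, y)\<close> is the product of the centralizers, so a product of Sylow
  subgroups is a Sylow subgroup of it.\<close>
lemma defect_group_DirProd:
  assumes G1: "group G1" "finite (carrier G1)" and G2: "group G2" "finite (carrier G2)"
    and \<chi>: "\<chi>1 \<in> Irr G1" "\<chi>2 \<in> Irr G2"
    and D1: "defect_group \<MM> p G1 (bl \<MM> G1 \<chi>1) D1" and D2: "defect_group \<MM> p G2 (bl \<MM> G2 \<chi>2) D2"
  shows "defect_group \<MM> p (G1 \<times>\<times> G2) (bl \<MM> (G1 \<times>\<times> G2) (char_tensor (carrier G1) (carrier G2) \<chi>1 \<chi>2)) (D1 \<times> D2)"
proof -
  interpret G1: group G1 by fact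
  interpret G2: group G2 by fact
  let ?G = "G1 \<times>\<times> G2" and ?\<chi> = "char_tensor (carrier G1) (carrier G2) \<chi>1 \<chi>2"
  obtain K1 x where K1: "defect_class \<MM> G1 (bl \<MM> G1 \<chi>1) K1" "x \<in> K1"
    and S1: "sylow_subgroup p (G1\<lparr>carrier := centralizer G1 {x}\<rparr>) D1" using D1 by (auto simp: defect_group_def)
  obtain K2 y where K2: "defect_class \<MM> G2 (bl \<MM> G2 \<chi>2) K2" "y \<in> K2"
    and S2: "sylow_subgroup p (G2\<lparr>carrier := centralizer G2 {y}\<rparr>) D2" using D2 by (auto simp: defect_group_def)
  have K1c: "K1 \<in> conj_classes G1" and K2c: "K2 \<in> conj_classes G2" using K1 K2 by (auto simp: defect_class_def)
  note i1 = conj_classes_invariant[OF G1(1) K1c] and i2 = conj_classes_invariant[OF G2(1) K2c]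
  have xy: "x \<in> carrier G1" "y \<in> carrier G2" using i1(1) i2(1) K1(2) K2(2) by auto
  have "defect_class \<MM> ?G (bl \<MM> ?G ?\<chi>) (K1 \<times> K2)"
    unfolding defect_class_def
  proof (intro conjI ballI)
    show "K1 \<times> K2 \<in> conj_classes ?G" by (rule conj_classes_DirProdI[OF G1(1) G2(1) K1c K2c])
    fix \<psi> assume "\<psi> \<in> bl \<MM> ?G ?\<chi>"
    then obtain \<psi>1 \<psi>2 where \<psi>: "\<psi>1 \<in> bl \<MM> G1 \<chi>1" "\<psi>2 \<in> bl \<MM> G2 \<chi>2"
      "\<psi> = char_tensor (carrier G1) (carrier G2) \<psi>1 \<psi>2" unfolding bl_DirProd[OF G1 G2 \<chi>] by auto
    have irr: "\<psi>1 \<in> Irr G1" "\<psi>2 \<in> Irr G2" using \<psi> by (auto simp: bl_iff)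
    have "omega G1 \<psi>1 K1 \<notin> \<MM>" "omega G2 \<psi>2 K2 \<notin> \<MM>"
      using K1(1) K2(1) \<psi> by (auto simp: defect_class_def lambda_zero_iff[OF MM])
    then have "omega G1 \<psi>1 K1 * omega G2 \<psi>2 K2 \<notin> \<MM>"
      using MM_prime[OF MM omega_algebraic_int[OF G1 irr(1) i1] omega_algebraic_int[OF G2 irr(2) i2]] by blast
    then show "lambda \<MM> ?G \<psi> (K1 \<times> K2) \<noteq> \<zero>\<^bsub>alg_int_ring Quot \<MM>\<^esub>"
      unfolding lambda_zero_iff[OF MM] \<psi>(3) omega_DirProd[OF i1(1) i2(1) G1(1) G2(1)] .
  next
    fix z assume "z \<in> K1 \<times> K2"
    then obtain a b where ab: "z = (a, b)" "a \<in> K1" "b \<in> K2" by auto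
    then have abc: "a \<in> carrier G1" "b \<in> carrier G2" using i1 i2 by auto
    show "idem_coeff ?G (bl \<MM> ?G ?\<chi>) z \<notin> local_max_ideal \<MM>"
      unfolding ab(1) idem_coeff_DirProd[OF G1 G2 \<chi> abc]
    proof (rule local_max_ideal_prime)
      show "algebraic (idem_coeff G1 (bl \<MM> G1 \<chi>1) a)"
        by (rule idem_coeff_algebraic[OF G1 _ abc(1)]) (auto simp: bl_iff)
      show "algebraic (idem_coeff G2 (bl \<MM> G2 \<chi>2) b)"
        by (rule idem_coeff_algebraic[OF G2 _ abc(2)]) (auto simp: bl_iff)
    qed (use K1(1) K2(1) ab in \<open>auto simp: defect_class_def\<close>)
  qed
  moreover have "sylow_subgroup p (?G\<lparr>carrier := centralizer ?G {(x, y)}\<rparr>) (D1 \<times> D2)"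
  proof -
    let ?C1 = "G1\<lparr>carrier := centralizer G1 {x}\<rparr>" and ?C2 = "G2\<lparr>carrier := centralizer G2 {y}\<rparr>"
    have cent: "centralizer ?G {(x, y)} = centralizer G1 {x} \<times> centralizer G2 {y}"
      by (auto simp: centralizer_def)
    have eq: "?G\<lparr>carrier := centralizer ?G {(x, y)}\<rparr> = ?C1 \<times>\<times> ?C2"
      unfolding cent by (simp add: DirProd_def)
    have sub1: "subgroup (centralizer G1 {x}) G1" by (rule centralizer_subgroup[OF G1(1)]) (use xy in simp)
    have sub2: "subgroup (centralizer G2 {y}) G2" by (rule centralizer_subgroup[OF G2(1)]) (use xy in simp)
    have g: "group ?C1" "group ?C2" using G1.subgroup_imp_group[OF sub1] G2.subgroup_imp_group[OF sub2] by auto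
    have "subgroup (D1 \<times> D2) (?C1 \<times>\<times> ?C2)"
      using DirProd_subgroups[OF g(1) _ g(2)] S1 S2 by (auto simp: sylow_subgroup_def)
    moreover have "card (D1 \<times> D2) = p ^ multiplicity p (card (carrier (?C1 \<times>\<times> ?C2)))"
    proof -
      have "card (carrier ?C1) > 0" "card (carrier ?C2) > 0"
        using finite_group_card[OF g(1)] finite_group_card[OF g(2)]
          finite_subset[of "centralizer G1 {x}" "carrier G1"] finite_subset[of "centralizer G2 {y}" "carrier G2"] G1 G2
        by (auto simp: centralizer_def)
      then show ?thesis using S1 S2 p(1)
        by (simp add: sylow_subgroup_def card_cartesian_product prime_elem_multiplicity_mult_distrib power_add)
    qed
    ultimately show ?thesis unfolding sylow_subgroup_def eq by simp
  qed
  ultimately show ?thesis unfolding defect_group_def using K1(2) K2(2) by blast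
qed

end

section \<open>From congruences of orbit sums to induced blocks\<close>

definition conj_orbit :: "('a, 'm) monoid_scheme \<Rightarrow> 'a set \<Rightarrow> 'a \<Rightarrow> 'a set" where
  "conj_orbit G N x = (\<lambda>h. h \<otimes>\<^bsub>G\<^esub> x \<otimes>\<^bsub>G\<^esub> inv\<^bsub>G\<^esub> h) ` N"

lemma conj_orbit_self:
  assumes "group G" "subgroup N G" "x \<in> carrier G"
  shows "x \<in> conj_orbit G N x"
proof -
  interpret group G by fact
  show ?thesis unfolding conj_orbit_def
    by (rule image_eqI[of _ _ "\<one>\<^bsub>G\<^esub>"]) (use assms in \<open>auto intro: subgroup.one_closed\<close>)
qed

lemma conj_orbit_subset_of_mem:
  assumes "group G" "subgroup N G" "x \<in> carrier G" "y \<in> conj_orbit G N x"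
  shows "conj_orbit G N y \<subseteq> conj_orbit G N x" "x \<in> conj_orbit G N y" "y \<in> carrier G"
proof -
  interpret group G by fact
  interpret N: subgroup N G by fact
  obtain g where g: "g \<in> N" "y = g \<otimes>\<^bsub>G\<^esub> x \<otimes>\<^bsub>G\<^esub> inv\<^bsub>G\<^esub> g" using assms(4) by (auto simp: conj_orbit_def)
  have gc: "g \<in> carrier G" using g(1) by simp
  show y: "y \<in> carrier G" using g gc assms(3) by simp
  show "conj_orbit G N y \<subseteq> conj_orbit G N x"
  proof
    fix z assume "z \<in> conj_orbit G N y"
    then obtain h where h: "h \<in> N" "z = h \<otimes>\<^bsub>G\<^esub> y \<otimes>\<^bsub>G\<^esub> inv\<^bsub>G\<^esub> h" by (auto simp: conj_orbit_def)
    show "z \<in> conj_orbit G N x" unfolding conj_orbit_def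
      by (rule image_eqI[of _ _ "h \<otimes>\<^bsub>G\<^esub> g"]) (use h g assms(3) in \<open>auto simp: m_assoc inv_mult_group\<close>)
  qed
  have "x = inv\<^bsub>G\<^esub> g \<otimes>\<^bsub>G\<^esub> y \<otimes>\<^bsub>G\<^esub> inv\<^bsub>G\<^esub> (inv\<^bsub>G\<^esub> g)"
  proof -
    have "inv\<^bsub>G\<^esub> g \<otimes>\<^bsub>G\<^esub> y \<otimes>\<^bsub>G\<^esub> g = (inv\<^bsub>G\<^esub> g \<otimes>\<^bsub>G\<^esub> g) \<otimes>\<^bsub>G\<^esub> x \<otimes>\<^bsub>G\<^esub> (inv\<^bsub>G\<^esub> g \<otimes>\<^bsub>G\<^esub> g)"
      unfolding g(2) using gc assms(3) by (simp only: m_assoc inv_closed m_closed)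
    then show ?thesis using gc assms(3) by simp
  qed
  then show "x \<in> conj_orbit G N y" unfolding conj_orbit_def by (rule image_eqI) (use g in simp)
qed

lemma conj_orbit_eq:
  assumes "group G" "subgroup N G" "x \<in> carrier G" "y \<in> conj_orbit G N x"
  shows "conj_orbit G N y = conj_orbit G N x"
  using conj_orbit_subset_of_mem[OF assms]
    conj_orbit_subset_of_mem(1)[OF assms(1,2) conj_orbit_subset_of_mem(3)[OF assms] conj_orbit_subset_of_mem(2)[OF assms]]
  by simp

lemma conj_orbit_coset:
  assumes "N \<lhd> G" "x \<in> carrier G" "y \<in> conj_orbit G N x"
  obtains k where "k \<in> N" "y = k \<otimes>\<^bsub>G\<^esub> x"
proof -
  interpret N: normal N G by fact
  obtain h where h: "h \<in> N" "y = h \<otimes>\<^bsub>G\<^esub> x \<otimes>\<^bsub>G\<^esub> inv\<^bsub>G\<^esub> h" using assms(3) by (auto simp: conj_orbit_def)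
  have "x \<otimes>\<^bsub>G\<^esub> inv\<^bsub>G\<^esub> h \<otimes>\<^bsub>G\<^esub> inv\<^bsub>G\<^esub> x \<in> N" using h(1) assms(2) N.inv_op_closed2[of x "inv\<^bsub>G\<^esub> h"] by simp
  then have "h \<otimes>\<^bsub>G\<^esub> (x \<otimes>\<^bsub>G\<^esub> inv\<^bsub>G\<^esub> h \<otimes>\<^bsub>G\<^esub> inv\<^bsub>G\<^esub> x) \<in> N" using h(1) by simp
  moreover have "y = h \<otimes>\<^bsub>G\<^esub> (x \<otimes>\<^bsub>G\<^esub> inv\<^bsub>G\<^esub> h \<otimes>\<^bsub>G\<^esub> inv\<^bsub>G\<^esub> x) \<otimes>\<^bsub>G\<^esub> x"
    using h assms(2) by (simp add: N.m_assoc)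
  ultimately show ?thesis by (rule that)
qed

lemma GL_D: "A \<in> carrier (GL n) \<Longrightarrow> A \<in> carrier_mat n n"
  by (simp add: carrier_GL)

lemma GL_nonzero_entry:
  assumes "A \<in> carrier (GL n)" "n > 0"
  obtains i j where "i < n" "j < n" "A $$ (i, j) \<noteq> 0"
proof -
  obtain B where B: "B \<in> carrier_mat n n" "B * A = 1\<^sub>m n" "A \<in> carrier_mat n n"
    using assms(1) unfolding carrier_GL by auto
  have "\<exists>i<n. \<exists>j<n. A $$ (i, j) \<noteq> 0"
  proof (rule ccontr)
    assume "\<not> ?thesis"
    then have "(B * A) $$ (0, 0) = 0"
      using assms(2) by (subst mult_mat_entry[OF B(1,3)]) auto
    then show False using B assms(2) by simp
  qed
  then show ?thesis using that by blast
qed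

lemma smult_GL_cancel:
  assumes A: "A \<in> carrier (GL n)" "n > 0" and eq: "a \<cdot>\<^sub>m A = b \<cdot>\<^sub>m A"
  shows "a = b"
proof -
  obtain i j where ij: "i < n" "j < n" "A $$ (i, j) \<noteq> 0" using GL_nonzero_entry[OF A] .
  have "(a \<cdot>\<^sub>m A) $$ (i, j) = (b \<cdot>\<^sub>m A) $$ (i, j)" using eq by simp
  then show ?thesis using ij GL_D[OF A(1)] by simp
qed

lemma factor_set_eqI:
  assumes "P (x \<otimes>\<^bsub>G\<^esub> y) \<in> carrier (GL n)" "n > 0" "P x * P y = c \<cdot>\<^sub>m P (x \<otimes>\<^bsub>G\<^esub> y)"
  shows "factor_set G P x y = c"
  unfolding factor_set_def
proof (rule the_equality)
  fix d assume "P x * P y = d \<cdot>\<^sub>m P (x \<otimes>\<^bsub>G\<^esub> y)"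
  then have "d \<cdot>\<^sub>m P (x \<otimes>\<^bsub>G\<^esub> y) = c \<cdot>\<^sub>m P (x \<otimes>\<^bsub>G\<^esub> y)" using assms(3) by simp
  then show "d = c" by (rule smult_GL_cancel[OF assms(1,2)])
qed (rule assms(3))

lemma projective_rep_factor_set:
  assumes P: "projective_rep G n P" "n > 0" and G: "group G" and x: "x \<in> carrier G" "y \<in> carrier G"
  shows "root_of_unity (factor_set G P x y)" "P x * P y = factor_set G P x y \<cdot>\<^sub>m P (x \<otimes>\<^bsub>G\<^esub> y)"
proof -
  interpret group G by fact
  obtain c where c: "root_of_unity c" "P x * P y = c \<cdot>\<^sub>m P (x \<otimes>\<^bsub>G\<^esub> y)"
    using P x unfolding projective_rep_def by blast
  have "P (x \<otimes>\<^bsub>G\<^esub> y) \<in> carrier (GL n)" using P(1) x by (simp add: projective_rep_def)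
  then have "factor_set G P x y = c" using P(2) c(2) by (rule factor_set_eqI)
  then show "root_of_unity (factor_set G P x y)" "P x * P y = factor_set G P x y \<cdot>\<^sub>m P (x \<otimes>\<^bsub>G\<^esub> y)"
    using c by auto
qed

lemma root_of_unity_nonzero: "root_of_unity c \<Longrightarrow> c \<noteq> 0"
  by (auto simp: root_of_unity_def power_0_left)

lemma one_smult_mat: "(1 :: complex) \<cdot>\<^sub>m A = A"
  by (intro eq_matI) auto

lemma root_of_unity_inverse: "root_of_unity c \<Longrightarrow> root_of_unity (inverse c)"
  unfolding root_of_unity_def by (metis inverse_1 power_inverse)

lemma root_of_unity_mult:
  assumes "root_of_unity a" "root_of_unity b"
  shows "root_of_unity (a * b)"
proof -
  obtain m n where mn: "m > 0" "a ^ m = 1" "n > 0" "b ^ n = 1" using assms by (auto simp: root_of_unity_def)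
  have "(a * b) ^ (m * n) = (a ^ m) ^ n * (b ^ n) ^ m"
    by (simp only: power_mult_distrib power_mult[symmetric] mult.commute)
  then show ?thesis unfolding root_of_unity_def using mn by (intro exI[of _ "m * n"]) simp
qed

lemma root_of_unity_1: "root_of_unity 1"
  by (auto simp: root_of_unity_def)

lemma root_of_unity_algebraic_int:
  assumes "root_of_unity c"
  shows "algebraic_int c"
proof -
  obtain n where n: "n > 0" "c ^ n = 1" using assms by (auto simp: root_of_unity_def)
  show ?thesis
  proof (rule algebraic_int_root)
    show "poly (Polynomial.monom 1 n) c = 1" using n by (simp add: poly_monom)
    show "lead_coeff (Polynomial.monom (1::complex) n) = 1" by (simp add: degree_monom_eq)
  qed (use n in \<open>auto simp: degree_monom_eq\<close>)
qed

lemma conj_closed_sum_partition: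
  fixes f :: "'a \<Rightarrow> 'b :: comm_monoid_add"
  assumes G: "group G" "subgroup N G" and K: "K \<subseteq> carrier G" "finite K"
    "\<And>x h. x \<in> K \<Longrightarrow> h \<in> N \<Longrightarrow> h \<otimes>\<^bsub>G\<^esub> x \<otimes>\<^bsub>G\<^esub> inv\<^bsub>G\<^esub> h \<in> K"
  shows "(\<Sum>x\<in>K. f x) = (\<Sum>C\<in>conj_orbit G N ` K. \<Sum>x\<in>C. f x)"
proof -
  have "(\<Sum>x\<in>K. f x) = (\<Sum>C\<in>conj_orbit G N ` K. sum f {x \<in> K. conj_orbit G N x = C})"
    by (rule sum.image_gen[OF K(2)])
  also have "\<dots> = (\<Sum>C\<in>conj_orbit G N ` K. \<Sum>x\<in>C. f x)"
  proof (rule sum.cong[OF refl])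
    fix C assume "C \<in> conj_orbit G N ` K"
    then obtain z where z: "z \<in> K" "C = conj_orbit G N z" by auto
    have zc: "z \<in> carrier G" using z K by auto
    have "{x \<in> K. conj_orbit G N x = C} = C"
    proof (intro equalityI subsetI)
      fix x assume "x \<in> {x \<in> K. conj_orbit G N x = C}"
      then show "x \<in> C" using conj_orbit_self[OF G, of x] K by auto
    next
      fix x assume x: "x \<in> C"
      then have "x \<in> K" using z K(3) by (auto simp: conj_orbit_def)
      moreover have "conj_orbit G N x = C" unfolding z(2)
        by (rule conj_orbit_eq[OF G zc]) (use x z in simp)
      ultimately show "x \<in> {x \<in> K. conj_orbit G N x = C}" by simp
    qed
    then show "sum f {x \<in> K. conj_orbit G N x = C} = (\<Sum>x\<in>C. f x)" by simp
  qed
  finally show ?thesis .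
qed

lemma kronecker_partial_trace:
  assumes "A \<in> carrier_mat m m" "B \<in> carrier_mat n n" "i < m" "j < m"
  shows "(\<Sum>k<n. kronecker A B $$ (i * n + k, j * n + k)) = A $$ (i, j) * mat_trace B"
proof -
  have "(\<Sum>k<n. kronecker A B $$ (i * n + k, j * n + k)) = (\<Sum>k<n. A $$ (i, j) * B $$ (k, k))"
    by (intro sum.cong refl kronecker_entry[OF assms(1,2)]) (use assms in auto)
  then show ?thesis using assms by (simp add: mat_trace_def sum_distrib_left)
qed

text \<open>The partial trace over the second factor of the class sum, which is a scalar matrix.\<close>
lemma class_sum_tensor_factor:
  assumes W: "group W" "finite (carrier W)"
    and irr: "irreducible_rep W (m * n) (\<lambda>x. kronecker (Q x) (P x))"
    and \<xi>: "\<xi> = (\<lambda>x\<in>carrier W. mat_trace (kronecker (Q x) (P x)))"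
    and Q: "\<And>x. x \<in> carrier W \<Longrightarrow> Q x \<in> carrier_mat m m" and P: "\<And>x. x \<in> carrier W \<Longrightarrow> P x \<in> carrier_mat n n"
    and K: "K \<subseteq> carrier W" "\<And>x h. x \<in> K \<Longrightarrow> h \<in> carrier W \<Longrightarrow> h \<otimes>\<^bsub>W\<^esub> x \<otimes>\<^bsub>W\<^esub> inv\<^bsub>W\<^esub> h \<in> K"
    and ij: "i < m" "j < m"
  shows "(\<Sum>x\<in>K. Q x $$ (i, j) * (mat_trace (P x) / of_nat n)) = (if i = j then omega W \<xi> K else 0)"
proof -
  have n: "n > 0" using irreducible_rep_trace_one(2)[OF W(1) irr] by simp
  have "(\<Sum>x\<in>K. Q x $$ (i, j) * mat_trace (P x)) =
    (\<Sum>x\<in>K. \<Sum>k<n. kronecker (Q x) (P x) $$ (i * n + k, j * n + k))"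
    using K(1) Q P ij by (intro sum.cong refl kronecker_partial_trace[symmetric]) auto
  also have "\<dots> = (\<Sum>k<n. \<Sum>x\<in>K. kronecker (Q x) (P x) $$ (i * n + k, j * n + k))"
    by (rule sum.swap)
  also have "\<dots> = (\<Sum>k<n. if i = j then omega W \<xi> K else 0)"
  proof (rule sum.cong[OF refl])
    fix k assume "k \<in> {..<n}"
    then have k: "i * n + k < m * n" "j * n + k < m * n" "i * n + k = j * n + k \<longleftrightarrow> i = j"
      using index_pair_less ij n by auto
    show "(\<Sum>x\<in>K. kronecker (Q x) (P x) $$ (i * n + k, j * n + k)) = (if i = j then omega W \<xi> K else 0)"
      using class_sum_omega[OF W irr \<xi> K k(1,2)] k(3) by simp
  qed
  also have "\<dots> = of_nat n * (if i = j then omega W \<xi> K else 0)" by simp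
  finally have "(\<Sum>x\<in>K. Q x $$ (i, j) * mat_trace (P x)) = of_nat n * (if i = j then omega W \<xi> K else 0)" .
  then show ?thesis using n by (simp add: sum_divide_distrib[symmetric] field_simps)
qed

lemma tensor_rep_hom:
  assumes W: "group W"
    and P: "\<And>x. x \<in> carrier W \<Longrightarrow> P x \<in> carrier_mat n n"
    and Q: "\<And>x. x \<in> carrier W \<Longrightarrow> Q x \<in> carrier_mat m m"
    and one: "P \<one>\<^bsub>W\<^esub> = 1\<^sub>m n" "Q \<one>\<^bsub>W\<^esub> = 1\<^sub>m m"
    and Pm: "\<And>x y. x \<in> carrier W \<Longrightarrow> y \<in> carrier W \<Longrightarrow> P x * P y = \<alpha> x y \<cdot>\<^sub>m P (x \<otimes>\<^bsub>W\<^esub> y)"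
    and Qm: "\<And>x y. x \<in> carrier W \<Longrightarrow> y \<in> carrier W \<Longrightarrow> Q x * Q y = inverse (\<alpha> x y) \<cdot>\<^sub>m Q (x \<otimes>\<^bsub>W\<^esub> y)"
    and \<alpha>: "\<And>x y. x \<in> carrier W \<Longrightarrow> y \<in> carrier W \<Longrightarrow> \<alpha> x y \<noteq> 0"
  shows "(\<lambda>x. kronecker (Q x) (P x)) \<in> hom W (GL (m * n))"
proof (rule hom_GL_I[OF W])
  interpret group W by fact
  show "kronecker (Q x) (P x) \<in> carrier_mat (m * n) (m * n)" if "x \<in> carrier W" for x
    by (rule kronecker_carrier[OF Q[OF that] P[OF that]])
  show "kronecker (Q \<one>\<^bsub>W\<^esub>) (P \<one>\<^bsub>W\<^esub>) = 1\<^sub>m (m * n)" by (simp add: one kronecker_one)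
  fix x y assume xy: "x \<in> carrier W" "y \<in> carrier W"
  have "kronecker (Q x) (P x) * kronecker (Q y) (P y) = kronecker (Q x * Q y) (P x * P y)"
    by (rule kronecker_mult[OF Q[OF xy(1)] P[OF xy(1)] Q[OF xy(2)] P[OF xy(2)]])
  also have "\<dots> = (inverse (\<alpha> x y) * \<alpha> x y) \<cdot>\<^sub>m kronecker (Q (x \<otimes>\<^bsub>W\<^esub> y)) (P (x \<otimes>\<^bsub>W\<^esub> y))"
    unfolding Pm[OF xy] Qm[OF xy] using xy by (intro kronecker_smult[OF Q P]) auto
  also have "\<dots> = kronecker (Q (x \<otimes>\<^bsub>W\<^esub> y)) (P (x \<otimes>\<^bsub>W\<^esub> y))"
    using \<alpha>[OF xy] by (intro eq_matI) auto
  finally show "kronecker (Q (x \<otimes>\<^bsub>W\<^esub> y)) (P (x \<otimes>\<^bsub>W\<^esub> y)) = kronecker (Q x) (P x) * kronecker (Q y) (P y)" ..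
qed

text \<open>For irreducibility of \<open>\<psi>\<close>: the matrices \<open>Q x\<close> act irreducibly because \<open>\<xi>\<close> is irreducible, they take all
  their values on \<open>J\<close>, and they are trivial on \<open>N \<inter> J\<close>, where \<open>P'\<close> is irreducible.

  For the congruence: split \<open>K\<close> into orbits \<open>C\<close> of \<open>N\<close>. As \<open>Q\<close> is constant on \<open>C\<close>, the partial traces of
  the two class sums differ by \<open>(\<Sum>C. mO C * Q (r C))\<close>, where \<open>r C\<close> is a representative and \<open>mO C\<close> is the
  difference of the normalised orbit sums, which lies in \<open>\<MM>\<close>. Both partial traces are scalar, so the
  difference \<open>d\<close> of the central characters satisfies \<open>d * Q b = (\<Sum>C. mO C * Q (r C) * Q b)\<close> for all \<open>b\<close>,
  which is again a combination of values of \<open>Q\<close> with coefficients in \<open>\<MM>\<close>.\<close>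
theorem block_transfer:
  assumes MM: "maximalideal \<MM> alg_int_ring"
    and W: "group W" "finite (carrier W)" and N: "N \<lhd> W" and J: "subgroup J W" "carrier W = N <#>\<^bsub>W\<^esub> J"
    and n: "n > 0" "n' > 0"
    and P: "\<And>x. x \<in> carrier W \<Longrightarrow> P x \<in> carrier (GL n)" "P \<one>\<^bsub>W\<^esub> = 1\<^sub>m n"
      "\<And>x y. x \<in> carrier W \<Longrightarrow> y \<in> carrier W \<Longrightarrow> P x * P y = \<alpha> x y \<cdot>\<^sub>m P (x \<otimes>\<^bsub>W\<^esub> y)"
    and P': "\<And>x. x \<in> J \<Longrightarrow> P' x \<in> carrier (GL n')"
      "\<And>x y. x \<in> J \<Longrightarrow> y \<in> J \<Longrightarrow> P' x * P' y = \<alpha> x y \<cdot>\<^sub>m P' (x \<otimes>\<^bsub>W\<^esub> y)"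
    and P'irr: "irreducible_rep (W\<lparr>carrier := N \<inter> J\<rparr>) n' P'"
    and Q: "\<And>x. x \<in> carrier W \<Longrightarrow> Q x \<in> carrier (GL m)"
      "\<And>x y. x \<in> carrier W \<Longrightarrow> y \<in> carrier W \<Longrightarrow> Q x * Q y = inverse (\<alpha> x y) \<cdot>\<^sub>m Q (x \<otimes>\<^bsub>W\<^esub> y)"
      "\<And>x h. x \<in> carrier W \<Longrightarrow> h \<in> N \<Longrightarrow> Q (h \<otimes>\<^bsub>W\<^esub> x) = Q x"
    and \<alpha>: "\<And>x y. x \<in> carrier W \<Longrightarrow> y \<in> carrier W \<Longrightarrow> root_of_unity (\<alpha> x y)"
    and \<xi>: "\<xi> = (\<lambda>x\<in>carrier W. mat_trace (kronecker (Q x) (P x)))" "\<xi> \<in> Irr W"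
    and \<psi>: "\<psi> = (\<lambda>x\<in>J. mat_trace (kronecker (Q x) (P' x)))"
    and orb: "\<And>x. x \<in> carrier W \<Longrightarrow>
      (\<Sum>y\<in>conj_orbit W N x. mat_trace (P y)) / of_nat n
      - (\<Sum>y\<in>conj_orbit W N x \<inter> J. mat_trace (P' y)) / of_nat n' \<in> \<MM>"
  shows "\<psi> \<in> Irr (W\<lparr>carrier := J\<rparr>)"
    "\<And>K. K \<in> conj_classes W \<Longrightarrow> omega W \<xi> K - omega (W\<lparr>carrier := J\<rparr>) \<psi> (K \<inter> J) \<in> \<MM>"
proof -
  interpret group W by fact
  interpret N: normal N W by fact
  interpret J: subgroup J W by fact
  let ?J = "W\<lparr>carrier := J\<rparr>"
  have gJ: "group ?J" by (rule subgroup_imp_group[OF J(1)])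
  have finJ: "finite (carrier ?J)" using W(2) J.subset finite_subset by simp
  have gM: "group (W\<lparr>carrier := N \<inter> J\<rparr>)"
    by (rule subgroup_imp_group[OF subgroups_Inter_pair[OF N.subgroup_axioms J(1)]])
  have finM: "finite (carrier (W\<lparr>carrier := N \<inter> J\<rparr>))" using finJ by simp
  have Pc: "P x \<in> carrier_mat n n" and Qc: "Q x \<in> carrier_mat m m" if "x \<in> carrier W" for x
    using P(1)[OF that] Q(1)[OF that] by (auto dest: GL_D)
  have P'c: "P' x \<in> carrier_mat n' n'" if "x \<in> J" for x using P'(1)[OF that] by (rule GL_D)
  have \<alpha>0: "\<alpha> x y \<noteq> 0" if "x \<in> carrier W" "y \<in> carrier W" for x y
    using \<alpha>[OF that] by (rule root_of_unity_nonzero)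
  have \<alpha>1: "\<alpha> \<one>\<^bsub>W\<^esub> \<one>\<^bsub>W\<^esub> = 1"
  proof (rule smult_GL_cancel[OF P(1)[OF one_closed] n(1)])
    show "\<alpha> \<one>\<^bsub>W\<^esub> \<one>\<^bsub>W\<^esub> \<cdot>\<^sub>m P \<one>\<^bsub>W\<^esub> = 1 \<cdot>\<^sub>m P \<one>\<^bsub>W\<^esub>"
      using P(3)[of "\<one>\<^bsub>W\<^esub>" "\<one>\<^bsub>W\<^esub>"] P(2) by (simp add: one_smult_mat)
  qed
  have Q1: "Q \<one>\<^bsub>W\<^esub> = 1\<^sub>m m"
  proof -
    have QQ: "Q \<one>\<^bsub>W\<^esub> * Q \<one>\<^bsub>W\<^esub> = Q \<one>\<^bsub>W\<^esub>"
      using Q(2)[of "\<one>\<^bsub>W\<^esub>" "\<one>\<^bsub>W\<^esub>"] \<alpha>1 by (simp add: one_smult_mat)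
    obtain B where B: "B \<in> carrier_mat m m" "B * Q \<one>\<^bsub>W\<^esub> = 1\<^sub>m m"
      using Q(1)[OF one_closed] unfolding carrier_GL by auto
    have "Q \<one>\<^bsub>W\<^esub> = (B * Q \<one>\<^bsub>W\<^esub>) * Q \<one>\<^bsub>W\<^esub>" unfolding B(2) using Qc[OF one_closed] by simp
    also have "\<dots> = B * Q \<one>\<^bsub>W\<^esub>" by (subst assoc_mult_mat[OF B(1) Qc Qc]) (simp_all add: QQ)
    finally show ?thesis using B(2) by simp
  qed
  \<comment> \<open>\<open>Q\<close> is inflated from \<open>W / N\<close>, so it is trivial on \<open>N\<close>.\<close>
  have QN: "Q h = 1\<^sub>m m" if "h \<in> N" for h
    using Q(3)[OF one_closed that] Q1 that by simp
  have P'1: "P' \<one>\<^bsub>W\<^esub> = 1\<^sub>m n'"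
    using hom_GL_D(2)[OF gM] P'irr by (simp add: irreducible_rep_iff)
  have homR: "(\<lambda>x. kronecker (Q x) (P x)) \<in> hom W (GL (m * n))"
    by (rule tensor_rep_hom[OF W(1) Pc Qc P(2) Q1 P(3) Q(2) \<alpha>0])
  have homR': "(\<lambda>x. kronecker (Q x) (P' x)) \<in> hom ?J (GL (m * n'))"
    by (rule tensor_rep_hom[OF gJ, of P' n' Q m \<alpha>]) (use P'c Qc P'1 Q1 P'(2) Q(2) \<alpha>0 in auto)
  obtain d S where S: "irreducible_rep W d S" "\<xi> = (\<lambda>x\<in>carrier W. mat_trace (S x))" using \<xi>(2) by (rule IrrE)
  have irrR: "irreducible_rep W (m * n) (\<lambda>x. kronecker (Q x) (P x))"
  proof (rule irreducible_of_character[OF W S(1) homR])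
    show "mat_trace (kronecker (Q g) (P g)) = mat_trace (S g)" if "g \<in> carrier W" for g
      using fun_cong[OF \<xi>(1), of g] fun_cong[OF S(2), of g] that by simp
  qed
  then have "acts_irreducibly (m * n) ((\<lambda>x. kronecker (Q x) (P x)) ` carrier W)" by (simp add: irreducible_rep_iff)
  then have "acts_irreducibly m (Q ` carrier W)"
    by (rule acts_irreducibly_tensor_factor[OF _ Qc Pc])
  moreover have "Q ` carrier W = Q ` J"
  proof (intro equalityI subsetI)
    fix A assume "A \<in> Q ` carrier W"
    then obtain h y where "h \<in> N" "y \<in> J" "A = Q (h \<otimes>\<^bsub>W\<^esub> y)" unfolding J(2) by (auto simp: set_mult_def)
    then show "A \<in> Q ` J" using Q(3)[of y h] by auto
  qed auto
  ultimately have "acts_irreducibly m (Q ` J)" by simp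
  then have "acts_irreducibly (m * n') ((\<lambda>x. kronecker (Q x) (P' x)) ` J)"
  proof (rule tensor_acts_irreducibly[OF _ _ _ gM finM P'irr])
    show "\<exists>x\<in>J. Q x = 1\<^sub>m m \<and> P' x = P' g" if "g \<in> carrier (W\<lparr>carrier := N \<inter> J\<rparr>)" for g
      using that QN by (intro bexI[of _ g]) auto
  qed (use Qc P'(1) in auto)
  then have irrR': "irreducible_rep ?J (m * n') (\<lambda>x. kronecker (Q x) (P' x))"
    using homR' by (simp add: irreducible_rep_iff)
  have \<psi>': "\<psi> = (\<lambda>x\<in>carrier ?J. mat_trace (kronecker (Q x) (P' x)))" by (simp add: \<psi>)
  show \<psi>I: "\<psi> \<in> Irr ?J" unfolding \<psi>' by (rule IrrI[OF irrR'])
  fix K assume K: "K \<in> conj_classes W"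
  note Kc = conj_classes_invariant[OF W(1) K]
  have finK: "finite K" using Kc W(2) finite_subset by blast
  have KJ: "K \<inter> J \<subseteq> carrier ?J" by simp
  have KJ': "h \<otimes>\<^bsub>?J\<^esub> x \<otimes>\<^bsub>?J\<^esub> inv\<^bsub>?J\<^esub> h \<in> K \<inter> J" if "x \<in> K \<inter> J" "h \<in> carrier ?J" for x h
    using that Kc(2)[of x h] by (simp add: m_inv_consistent[OF J(1)])
  define d where "d = omega W \<xi> K - omega ?J \<psi> (K \<inter> J)"
  \<comment> \<open>The function whose sums over orbits are the differences of the normalised orbit sums.\<close>
  define f where "f x = mat_trace (P x) / of_nat n - (if x \<in> J then mat_trace (P' x) / of_nat n' else 0)" for x
  have d_eq: "(if i = j then d else 0) = (\<Sum>x\<in>K. Q x $$ (i, j) * f x)" if "i < m" "j < m" for i j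
  proof -
    have "(\<Sum>x\<in>K. Q x $$ (i, j) * f x) = (\<Sum>x\<in>K. Q x $$ (i, j) * (mat_trace (P x) / of_nat n)) -
      (\<Sum>x\<in>K. if x \<in> J then Q x $$ (i, j) * (mat_trace (P' x) / of_nat n') else 0)"
      unfolding sum_subtractf[symmetric] by (intro sum.cong refl) (simp add: f_def right_diff_distrib)
    also have "(\<Sum>x\<in>K. if x \<in> J then Q x $$ (i, j) * (mat_trace (P' x) / of_nat n') else 0) =
      (\<Sum>x\<in>K \<inter> J. Q x $$ (i, j) * (mat_trace (P' x) / of_nat n'))"
      by (rule sum.inter_restrict[OF finK, symmetric])
    also have "\<dots> = (if i = j then omega ?J \<psi> (K \<inter> J) else 0)"
      by (rule class_sum_tensor_factor[OF gJ finJ irrR' \<psi>' _ _ KJ KJ' that]) (use Qc P'c in auto)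
    also have "(\<Sum>x\<in>K. Q x $$ (i, j) * (mat_trace (P x) / of_nat n)) = (if i = j then omega W \<xi> K else 0)"
      by (rule class_sum_tensor_factor[OF W irrR \<xi>(1) Qc Pc Kc that])
    finally show ?thesis by (simp add: d_def)
  qed
  define Os where "Os = conj_orbit W N ` K"
  have finOs: "finite Os" using finK by (simp add: Os_def)
  define r where "r C = (SOME x. x \<in> K \<and> C = conj_orbit W N x)" for C
  have r: "r C \<in> K" "C = conj_orbit W N (r C)" if "C \<in> Os" for C
  proof -
    have "\<exists>x. x \<in> K \<and> C = conj_orbit W N x" using that by (auto simp: Os_def)
    then have "r C \<in> K \<and> C = conj_orbit W N (r C)" unfolding r_def by (rule someI_ex)
    then show "r C \<in> K" "C = conj_orbit W N (r C)" by auto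
  qed
  have rc: "r C \<in> carrier W" if "C \<in> Os" for C using r(1)[OF that] Kc(1) by auto
  define mO where "mO C = (\<Sum>x\<in>C. f x)" for C
  have mO: "mO C \<in> \<MM>" if C: "C \<in> Os" for C
  proof -
    have fO: "finite C" using r(2)[OF C] finite_subset[OF N.subset W(2)] by (metis conj_orbit_def finite_imageI)
    have "mO C = (\<Sum>x\<in>C. mat_trace (P x)) / of_nat n - (\<Sum>x\<in>C \<inter> J. mat_trace (P' x)) / of_nat n'"
      unfolding mO_def f_def sum_subtractf sum_divide_distrib sum.inter_restrict[OF fO]
      by (intro arg_cong2[of _ _ _ _ "(-)"] sum.cong refl) simp
    then show ?thesis using orb[OF rc[OF C]] r(2)[OF C] by simp
  qed
  have QO: "Q x = Q (r C)" if CO: "C \<in> Os" and xC: "x \<in> C" for C x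
  proof -
    have "x \<in> conj_orbit W N (r C)" using xC by (subst r(2)[OF CO, symmetric])
    then obtain k where "k \<in> N" "x = k \<otimes>\<^bsub>W\<^esub> r C" by (rule conj_orbit_coset[OF N rc[OF CO]])
    then show ?thesis using Q(3)[OF rc[OF CO]] by simp
  qed
  have d_eq': "(if i = j then d else 0) = (\<Sum>C\<in>Os. mO C * Q (r C) $$ (i, j))" if "i < m" "j < m" for i j
  proof -
    have "(if i = j then d else 0) = (\<Sum>C\<in>Os. \<Sum>x\<in>C. Q x $$ (i, j) * f x)"
      unfolding d_eq[OF that] Os_def
      by (rule conj_closed_sum_partition[OF W(1) N.subgroup_axioms Kc(1) finK Kc(2)]) auto
    also have "\<dots> = (\<Sum>C\<in>Os. mO C * Q (r C) $$ (i, j))"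
      unfolding mO_def sum_distrib_right by (intro sum.cong refl) (simp add: QO)
    finally show ?thesis .
  qed
  have m: "m > 0" using irreducible_rep_trace_one(2)[OF W(1) irrR] by simp
  show "omega W \<xi> K - omega ?J \<psi> (K \<inter> J) \<in> \<MM>"
    unfolding d_def[symmetric]
  proof (rule MM_eigenvalue[OF MM, of "carrier W" "\<one>\<^bsub>W\<^esub>" "\<lambda>b. Q b $$ (0, 0)" d
        "\<lambda>b c. \<Sum>C | C \<in> Os \<and> r C \<otimes>\<^bsub>W\<^esub> b = c. mO C * inverse (\<alpha> (r C) b)"])
    show "Q \<one>\<^bsub>W\<^esub> $$ (0, 0) \<noteq> 0" using m by (simp add: Q1)
    show "algebraic_int d" unfolding d_def
      by (intro alg_int_diff[OF MM] omega_algebraic_int[OF W \<xi>(2) Kc] omega_algebraic_int[OF gJ finJ \<psi>I KJ KJ'])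
    fix b assume b: "b \<in> carrier W"
    show "(\<Sum>C | C \<in> Os \<and> r C \<otimes>\<^bsub>W\<^esub> b = c. mO C * inverse (\<alpha> (r C) b)) \<in> \<MM>" for c
      by (intro MM_sum[OF MM] MM_mult[OF MM] mO root_of_unity_algebraic_int root_of_unity_inverse \<alpha>)
        (use b rc in auto)
    have "d * Q b $$ (0, 0) = (\<Sum>l<m. if 0 = l then d * Q b $$ (l, 0) else 0)" using m by simp
    also have "\<dots> = (\<Sum>l<m. (if 0 = l then d else 0) * Q b $$ (l, 0))" by (intro sum.cong refl) simp
    also have "\<dots> = (\<Sum>l<m. (\<Sum>C\<in>Os. mO C * Q (r C) $$ (0, l)) * Q b $$ (l, 0))"
    proof (rule sum.cong[OF refl])
      fix l assume "l \<in> {..<m}"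
      then show "(if 0 = l then d else 0) * Q b $$ (l, 0) = (\<Sum>C\<in>Os. mO C * Q (r C) $$ (0, l)) * Q b $$ (l, 0)"
        using d_eq'[OF m, of l] by (simp only: lessThan_iff)
    qed
    also have "\<dots> = (\<Sum>C\<in>Os. \<Sum>l<m. mO C * (Q (r C) $$ (0, l) * Q b $$ (l, 0)))"
      unfolding sum_distrib_right by (subst sum.swap) (simp add: mult.assoc)
    also have "\<dots> = (\<Sum>C\<in>Os. mO C * inverse (\<alpha> (r C) b) * Q (r C \<otimes>\<^bsub>W\<^esub> b) $$ (0, 0))"
    proof (rule sum.cong[OF refl])
      fix C assume C: "C \<in> Os"
      note c = rc[OF C]
      have "(\<Sum>l<m. mO C * (Q (r C) $$ (0, l) * Q b $$ (l, 0))) = mO C * (Q (r C) * Q b) $$ (0, 0)"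
        unfolding sum_distrib_left[symmetric] by (subst mult_mat_entry[OF Qc[OF c] Qc[OF b] m m]) simp
      also have "\<dots> = mO C * (inverse (\<alpha> (r C) b) * Q (r C \<otimes>\<^bsub>W\<^esub> b) $$ (0, 0))"
        unfolding Q(2)[OF c b] using m Qc[of "r C \<otimes>\<^bsub>W\<^esub> b"] c b by simp
      finally show "(\<Sum>l<m. mO C * (Q (r C) $$ (0, l) * Q b $$ (l, 0))) =
        mO C * inverse (\<alpha> (r C) b) * Q (r C \<otimes>\<^bsub>W\<^esub> b) $$ (0, 0)" by simp
    qed
    also have "\<dots> = (\<Sum>c\<in>carrier W. \<Sum>C | C \<in> Os \<and> r C \<otimes>\<^bsub>W\<^esub> b = c. mO C * inverse (\<alpha> (r C) b) * Q (r C \<otimes>\<^bsub>W\<^esub> b) $$ (0, 0))"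
      by (rule sum.group[OF finOs W(2), symmetric]) (use rc b in auto)
    also have "\<dots> = (\<Sum>c\<in>carrier W. (\<Sum>C | C \<in> Os \<and> r C \<otimes>\<^bsub>W\<^esub> b = c. mO C * inverse (\<alpha> (r C) b)) * Q c $$ (0, 0))"
      unfolding sum_distrib_right by (intro sum.cong refl) auto
    finally show "d * Q b $$ (0, 0) = (\<Sum>c\<in>carrier W. (\<Sum>C | C \<in> Os \<and> r C \<otimes>\<^bsub>W\<^esub> b = c. mO C * inverse (\<alpha> (r C) b)) * Q c $$ (0, 0))" .
  qed (use W in auto)
qed

section \<open>Twisting a projective representation over a cyclic quotient\<close>

lemma root_of_unity_power: "root_of_unity c \<Longrightarrow> root_of_unity (c ^ i)"
  by (induction i) (auto intro: root_of_unity_mult root_of_unity_1)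

lemma root_of_unity_root:
  assumes "root_of_unity c" "k > 0"
  obtains g where "g ^ k = c" "root_of_unity g"
proof -
  obtain g where g: "g ^ k = c" using nth_root_exists[OF assms(2), of c] by blast
  obtain n where n: "n > 0" "c ^ n = 1" using assms(1) by (auto simp: root_of_unity_def)
  have "g ^ (k * n) = 1" using g n by (simp add: power_mult)
  then have "root_of_unity g" unfolding root_of_unity_def using n assms(2) by (intro exI[of _ "k * n"]) simp
  then show ?thesis using that g by blast
qed

lemma pow_mat_add_exponent:
  assumes "A \<in> carrier_mat n n"
  shows "A ^\<^sub>m (i + j) = A ^\<^sub>m i * A ^\<^sub>m j"
proof (induction j)
  case 0
  show ?case using pow_carrier_mat[OF assms, of i] assms by simp
next
  case (Suc j)
  then show ?case
    using assoc_mult_mat[OF pow_carrier_mat[OF assms, of i] pow_carrier_mat[OF assms, of j] assms] by simp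
qed

text \<open>Write \<open>P x ^ i = c i * P (x ^ i)\<close>, and let \<open>k\<close> be the order of \<open>x\<close> modulo \<open>N\<close>. Choosing a root \<open>g\<close> of
  \<open>g ^ k = inverse (c k)\<close> makes \<open>d i = g ^ i * c i\<close> periodic modulo \<open>k\<close>, so that \<open>q (h * x ^ i) = d i\<close> is well
  defined on the group generated by \<open>N\<close> and \<open>x\<close>. The additivity law of \<open>c\<close> then says that \<open>\<alpha>\<close> is the
  coboundary of \<open>q\<close>.\<close>
theorem cyclic_twist:
  fixes G (structure)
  assumes G: "group G" "finite (carrier G)" and N: "N \<lhd> G" and T: "subgroup T G" "N \<subseteq> T" and x: "x \<in> T"
    and n: "n > 0" and P: "\<And>y. y \<in> T \<Longrightarrow> P y \<in> carrier (GL n)"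
    and \<alpha>: "\<And>u v. u \<in> T \<Longrightarrow> v \<in> T \<Longrightarrow> root_of_unity (\<alpha> u v)"
      "\<And>u v. u \<in> T \<Longrightarrow> v \<in> T \<Longrightarrow> P u * P v = \<alpha> u v \<cdot>\<^sub>m P (u \<otimes> v)"
    and PN: "\<And>h y. h \<in> N \<Longrightarrow> y \<in> T \<Longrightarrow> P (h \<otimes> y) = P h * P y"
      "\<And>h y. h \<in> N \<Longrightarrow> y \<in> T \<Longrightarrow> P (y \<otimes> h) = P y * P h"
    and P1: "P \<one> = 1\<^sub>m n"
  obtains W q where "subgroup W G" "N \<subseteq> W" "W \<subseteq> T" "x \<in> W"
    "\<forall>w\<in>W. \<exists>h\<in>N. \<exists>i::nat. w = h \<otimes> x [^] i"
    "\<forall>w\<in>W. root_of_unity (q w)"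
    "\<forall>h\<in>N. \<forall>w\<in>W. q (h \<otimes> w) = q w"
    "q \<one> = 1"
    "\<forall>u\<in>W. \<forall>v\<in>W. q (u \<otimes> v) = q u * q v * \<alpha> u v"
proof -
  interpret group G by fact
  interpret N: normal N G by fact
  interpret T: subgroup T G by fact
  have xc: "x \<in> carrier G" using x by simp
  have xT: "x [^] i \<in> T" for i :: nat by (induction i) (use x in auto)
  have Pc: "P y \<in> carrier_mat n n" if "y \<in> T" for y using P[OF that] by (rule GL_D)
  have hT: "h \<in> T" if "h \<in> N" for h using that T(2) by auto
  have \<alpha>N: "\<alpha> h y = 1" "\<alpha> y h = 1" if "h \<in> N" "y \<in> T" for h y
  proof -
    show "\<alpha> h y = 1"
      by (rule smult_GL_cancel[OF P n, of "h \<otimes> y"])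
        (use that hT \<alpha>(2)[OF hT[OF that(1)] that(2)] PN(1)[OF that] in \<open>auto simp: one_smult_mat\<close>)
    show "\<alpha> y h = 1"
      by (rule smult_GL_cancel[OF P n, of "y \<otimes> h"])
        (use that hT \<alpha>(2)[OF that(2) hT[OF that(1)]] PN(2)[OF that] in \<open>auto simp: one_smult_mat\<close>)
  qed
  define c where "c = rec_nat (1::complex) (\<lambda>i r. r * \<alpha> (x [^] i) x)"
  have c0: "c 0 = 1" and cS: "c (Suc i) = c i * \<alpha> (x [^] i) x" for i by (simp_all add: c_def)
  have pow: "P x ^\<^sub>m i = c i \<cdot>\<^sub>m P (x [^] i)" for i
  proof (induction i)
    case 0
    then show ?case using Pc[OF x] by (simp add: c0 P1 one_smult_mat)
  next
    case (Suc i)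
    have "P x ^\<^sub>m Suc i = (c i \<cdot>\<^sub>m P (x [^] i)) * P x" by (simp add: Suc)
    also have "\<dots> = c i \<cdot>\<^sub>m (P (x [^] i) * P x)" by (rule mult_smult_assoc_mat[OF Pc[OF xT] Pc[OF x]])
    also have "\<dots> = c (Suc i) \<cdot>\<^sub>m P (x [^] Suc i)"
      unfolding \<alpha>(2)[OF xT x] by (intro eq_matI) (auto simp: cS)
    finally show ?case .
  qed
  have croot: "root_of_unity (c i)" for i
    by (induction i) (auto simp: c0 cS root_of_unity_1 intro!: root_of_unity_mult \<alpha>(1) xT x)
  have c_add: "c (i + j) = c i * c j * \<alpha> (x [^] i) (x [^] j)" for i j
  proof (rule smult_GL_cancel[OF P[OF xT] n])
    have "c (i + j) \<cdot>\<^sub>m P (x [^] (i + j)) = P x ^\<^sub>m i * P x ^\<^sub>m j"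
      unfolding pow[symmetric] by (rule pow_mat_add_exponent[OF Pc[OF x]])
    also have "\<dots> = c j \<cdot>\<^sub>m (c i \<cdot>\<^sub>m (P (x [^] i) * P (x [^] j)))"
      unfolding pow using Pc[OF xT[of i]] Pc[OF xT[of j]]
      by (simp add: mult_smult_assoc_mat[of _ n n _ n] mult_smult_distrib[of _ n n _ n])
    also have "\<dots> = (c i * c j * \<alpha> (x [^] i) (x [^] j)) \<cdot>\<^sub>m P (x [^] (i + j))"
      unfolding \<alpha>(2)[OF xT xT] using xc by (intro eq_matI) (auto simp: nat_pow_mult mult.assoc mult.left_commute)
    finally show "c (i + j) \<cdot>\<^sub>m P (x [^] (i + j)) = (c i * c j * \<alpha> (x [^] i) (x [^] j)) \<cdot>\<^sub>m P (x [^] (i + j))" .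
  qed
  define k where "k = (LEAST i::nat. i > 0 \<and> x [^] i \<in> N)"
  have "Coset.order G > 0 \<and> x [^] Coset.order G \<in> N"
    using pow_order_eq_1[OF xc] finite_group_card[OF G] by (simp add: Coset.order_def)
  then have k: "k > 0 \<and> x [^] k \<in> N" unfolding k_def by (rule LeastI)
  have kmin: "k \<le> i" if "i > 0" "x [^] i \<in> N" for i :: nat
    unfolding k_def using that by (intro Least_le) auto
  have kdvd: "k dvd i" if i: "x [^] i \<in> N" for i :: nat
  proof -
    have "(x [^] k) [^] t \<in> N" for t :: nat using k by (induction t) auto
    then have xk: "x [^] (k * (i div k)) \<in> N" using xc by (simp add: nat_pow_pow)
    have "x [^] i = x [^] (k * (i div k)) \<otimes> x [^] (i mod k)"
      using xc by (simp add: nat_pow_mult)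
    then have "x [^] (i mod k) = inv (x [^] (k * (i div k))) \<otimes> x [^] i"
      using xc by (simp add: inv_solve_left)
    then have "x [^] (i mod k) \<in> N" using xk i by simp
    then have "\<not> i mod k > 0" using kmin[of "i mod k"] k by (metis mod_less_divisor not_le)
    then show ?thesis by (simp add: mod_eq_0_iff_dvd)
  qed
  obtain g where g: "g ^ k = inverse (c k)" "root_of_unity g"
    using root_of_unity_root[OF root_of_unity_inverse[OF croot[of k]]] k by blast
  define d where "d i = g ^ i * c i" for i
  have d_add: "d (i + j) = d i * d j * \<alpha> (x [^] i) (x [^] j)" for i j
    by (simp add: d_def c_add power_add)
  have droot: "root_of_unity (d i)" for i
    unfolding d_def by (intro root_of_unity_mult root_of_unity_power g croot)
  have d0: "d 0 = 1" by (simp add: d_def c0)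
  have dk: "d k = 1" using g root_of_unity_nonzero[OF croot[of k]] by (simp add: d_def)
  have d_per: "d (i + k * t) = d i" for i t
  proof (induction t)
    case (Suc t)
    have "d (i + k * Suc t) = d ((i + k * t) + k)" by (simp add: algebra_simps)
    also have "\<dots> = d (i + k * t) * d k * \<alpha> (x [^] (i + k * t)) (x [^] k)" by (rule d_add)
    also have "\<dots> = d i" using Suc dk \<alpha>N(2)[OF _ xT] k by simp
    finally show ?case .
  qed simp
  have d_eq: "d i = d j" if eq: "h \<otimes> x [^] i = h' \<otimes> x [^] j" "h \<in> N" "h' \<in> N" "i \<le> j" for h h' i j
  proof -
    have hc: "h \<in> carrier G" "h' \<in> carrier G" using eq by auto
    have "x [^] j = x [^] (j - i) \<otimes> x [^] i" using xc eq(4) by (simp add: nat_pow_mult)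
    then have "h \<otimes> x [^] i = (h' \<otimes> x [^] (j - i)) \<otimes> x [^] i" using eq(1) hc xc by (simp add: m_assoc)
    then have "h = h' \<otimes> x [^] (j - i)" using hc xc by simp
    then have "x [^] (j - i) = inv h' \<otimes> h" using hc xc by (simp add: m_assoc[symmetric])
    then have "x [^] (j - i) \<in> N" using eq(2,3) by simp
    then obtain t where "j - i = k * t" using kdvd by (auto elim: dvdE)
    then have "j = i + k * t" using eq(4) by simp
    then show ?thesis using d_per by simp
  qed
  let ?W = "{w. \<exists>h\<in>N. \<exists>i::nat. w = h \<otimes> x [^] i}"
  define q where "q w = d (SOME i. \<exists>h\<in>N. w = h \<otimes> x [^] i)" for w
  have q: "q (h \<otimes> x [^] i) = d i" if h: "h \<in> N" for h and i :: nat
  proof -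
    have "\<exists>j. \<exists>h'\<in>N. h \<otimes> x [^] i = h' \<otimes> x [^] (j::nat)" using h by blast
    then have "\<exists>h'\<in>N. h \<otimes> x [^] i = h' \<otimes> x [^] (SOME j. \<exists>h'\<in>N. h \<otimes> x [^] i = h' \<otimes> x [^] (j::nat))"
      by (rule someI_ex)
    then obtain h' where h': "h' \<in> N"
      "h \<otimes> x [^] i = h' \<otimes> x [^] (SOME j. \<exists>h'\<in>N. h \<otimes> x [^] i = h' \<otimes> x [^] (j::nat))" by blast
    show ?thesis unfolding q_def
      using d_eq[OF h'(2) h h'(1)] d_eq[OF h'(2)[symmetric] h'(1) h] by (metis nle_le)
  qed
  have conjN: "x [^] i \<otimes> h \<otimes> inv (x [^] i) \<in> N" if "h \<in> N" for h and i :: nat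
    using N.inv_op_closed2[OF _ that, of "x [^] i"] xc by simp
  have mult: "(h \<otimes> x [^] i) \<otimes> (h' \<otimes> x [^] j) = (h \<otimes> (x [^] i \<otimes> h' \<otimes> inv (x [^] i))) \<otimes> x [^] (i + j)"
    if "h \<in> N" "h' \<in> N" for h h' and i j :: nat
  proof -
    have c: "h \<in> carrier G" "h' \<in> carrier G" "x [^] i \<in> carrier G" "x [^] j \<in> carrier G" using that xc by auto
    have "inv (x [^] i) \<otimes> (x [^] i \<otimes> x [^] j) = x [^] j" using c by (simp add: m_assoc[symmetric])
    then show ?thesis using c xc by (simp add: m_assoc nat_pow_mult[symmetric])
  qed
  have sub: "subgroup ?W G"
  proof (rule subgroupI)
    show "?W \<subseteq> carrier G" using xc by auto
    show "?W \<noteq> {}" using N.one_closed by blast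
    fix a assume "a \<in> ?W"
    then obtain h and i :: nat where a: "h \<in> N" "a = h \<otimes> x [^] i" by blast
    show "a \<otimes> b \<in> ?W" if bW: "b \<in> ?W" for b
    proof -
      obtain h' and j :: nat where b: "h' \<in> N" "b = h' \<otimes> x [^] j" using bW by blast
      show ?thesis unfolding a(2) b(2) mult[OF a(1) b(1)] using a(1) b(1) conjN by blast
    qed
    have ac: "a \<in> carrier G" using a xc by auto
    \<comment> \<open>In a finite group the inverse of \<open>a\<close> is a power of \<open>a\<close>.\<close>
    define o' where "o' = Coset.order G - 1"
    have ord: "Suc o' = Coset.order G" using finite_group_card[OF G] by (simp add: o'_def Coset.order_def)
    have "a [^] o' \<otimes> a = \<one>" using pow_order_eq_1[OF ac] unfolding ord[symmetric] by simp
    then have "inv a = a [^] o'" by (rule inv_equality) (use ac in auto)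
    moreover have "a [^] (m::nat) \<in> ?W" for m
    proof (induction m)
      case 0
      have "\<one> = \<one> \<otimes> x [^] (0::nat)" by simp
      then show ?case using N.one_closed by (metis (mono_tags, lifting) mem_Collect_eq nat_pow_0)
    next
      case (Suc m)
      then obtain h' and j :: nat where b: "h' \<in> N" "a [^] m = h' \<otimes> x [^] j" by blast
      have "a [^] Suc m = (h' \<otimes> (x [^] j \<otimes> h \<otimes> inv (x [^] j))) \<otimes> x [^] (j + i)"
        using mult[OF b(1) a(1), of j i] b(2) a(2) by simp
      then show ?case using b(1) conjN[OF a(1)] by blast
    qed
    ultimately show "inv a \<in> ?W" by simp
  qed
  show ?thesis
  proof (rule that[OF sub])
    show "N \<subseteq> ?W"
    proof
      fix h assume h: "h \<in> N"
      then have "h = h \<otimes> x [^] (0::nat)" by simp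
      then show "h \<in> ?W" using h by blast
    qed
    show "?W \<subseteq> T" using hT xT by auto
    have "x = \<one> \<otimes> x [^] (1::nat)" using xc by simp
    then show "x \<in> ?W" using N.one_closed by blast
    show "\<forall>w\<in>?W. \<exists>h\<in>N. \<exists>i::nat. w = h \<otimes> x [^] i" by simp
    show "\<forall>w\<in>?W. root_of_unity (q w)" unfolding q_def by (intro ballI droot)
    have "q (h \<otimes> w) = q w" if h: "h \<in> N" and wW: "w \<in> ?W" for h w
    proof -
      obtain h' and j :: nat where b: "h' \<in> N" "w = h' \<otimes> x [^] j" using wW by blast
      then have "h \<otimes> w = (h \<otimes> h') \<otimes> x [^] j" using h xc by (simp add: m_assoc)
      then show ?thesis using q[of "h \<otimes> h'" j] q[OF b(1), of j] b h by simp
    qed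
    then show "\<forall>h\<in>N. \<forall>w\<in>?W. q (h \<otimes> w) = q w" by (intro ballI)
    have "q (\<one> \<otimes> x [^] (0::nat)) = d 0" by (rule q[OF N.one_closed])
    then show "q \<one> = 1" using d0 by simp
    show "\<forall>u\<in>?W. \<forall>v\<in>?W. q (u \<otimes> v) = q u * q v * \<alpha> u v"
    proof (intro ballI)
    fix u v assume "u \<in> ?W" "v \<in> ?W"
    then obtain h h' and i j :: nat where u: "h \<in> N" "u = h \<otimes> x [^] i" and v: "h' \<in> N" "v = h' \<otimes> x [^] j" by blast
    let ?h = "x [^] i \<otimes> h' \<otimes> inv (x [^] i)"
    have hh: "?h \<in> N" by (rule conjN[OF v(1)])
    have uT: "u \<in> T" "v \<in> T" using u v hT xT by auto
    have hc: "h \<in> carrier G" "h' \<in> carrier G" "?h \<in> carrier G" using u v hh by auto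
    have "\<alpha> u v = \<alpha> (x [^] i) (x [^] j)"
    proof (rule smult_GL_cancel[OF P n])
      show "u \<otimes> v \<in> T" using uT by simp
      have e1: "P (x [^] i) * P h' = P ?h * P (x [^] i)"
      proof -
        have "P (x [^] i) * P h' = P (x [^] i \<otimes> h')" by (rule PN(2)[OF v(1) xT, symmetric])
        also have "x [^] i \<otimes> h' = ?h \<otimes> x [^] i" using hc xc by (simp add: m_assoc)
        also have "P \<dots> = P ?h * P (x [^] i)" by (rule PN(1)[OF hh xT])
        finally show ?thesis .
      qed
      note cs = Pc[OF hT[OF u(1)]] Pc[OF hT[OF v(1)]] Pc[OF hT[OF hh]] Pc[OF xT[of i]] Pc[OF xT[of j]]
      have "\<alpha> u v \<cdot>\<^sub>m P (u \<otimes> v) = P u * P v" by (rule \<alpha>(2)[OF uT, symmetric])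
      also have "\<dots> = (P h * P (x [^] i)) * (P h' * P (x [^] j))"
        unfolding u(2) v(2) PN(1)[OF u(1) xT] PN(1)[OF v(1) xT] ..
      also have "\<dots> = P h * ((P (x [^] i) * P h') * P (x [^] j))"
        using cs by (simp add: assoc_mult_mat[of _ n n _ n _ n])
      also have "\<dots> = P h * (P ?h * (P (x [^] i) * P (x [^] j)))"
        unfolding e1 using cs by (simp add: assoc_mult_mat[of _ n n _ n _ n])
      also have "\<dots> = P h * (P ?h * (\<alpha> (x [^] i) (x [^] j) \<cdot>\<^sub>m P (x [^] (i + j))))"
        unfolding \<alpha>(2)[OF xT xT] using xc by (simp add: nat_pow_mult)
      also have "\<dots> = \<alpha> (x [^] i) (x [^] j) \<cdot>\<^sub>m (P h * (P ?h * P (x [^] (i + j))))"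
        using cs Pc[OF xT[of "i + j"]] by (simp add: mult_smult_distrib[of _ n n _ n])
      also have "P h * (P ?h * P (x [^] (i + j))) = P (h \<otimes> (?h \<otimes> x [^] (i + j)))"
        using PN(1)[OF hh xT, of "i + j"] PN(1)[OF u(1), of "?h \<otimes> x [^] (i + j)"] hT[OF hh] xT[of "i + j"] by simp
      also have "h \<otimes> (?h \<otimes> x [^] (i + j)) = u \<otimes> v"
        unfolding u(2) v(2) mult[OF u(1) v(1)] using hc xc by (simp add: m_assoc)
      finally show "\<alpha> u v \<cdot>\<^sub>m P (u \<otimes> v) = \<alpha> (x [^] i) (x [^] j) \<cdot>\<^sub>m P (u \<otimes> v)" .
    qed
    moreover have "q (u \<otimes> v) = d (i + j)"
      unfolding u(2) v(2) mult[OF u(1) v(1)] by (rule q) (use u(1) hh in simp)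
    ultimately show "q (u \<otimes> v) = q u * q v * \<alpha> u v"
      unfolding u(2) v(2) q[OF u(1)] q[OF v(1)] d_add[symmetric] using d_add[of i j] u(2) v(2) by simp
    qed
  qed
qed

section \<open>Inertia groups and associated representations\<close>

lemma conj_act_conj_act:
  assumes "N \<lhd> G" "a \<in> carrier G" "b \<in> carrier G"
  shows "conj_act G N a (conj_act G N b \<chi>) = conj_act G N (b \<otimes>\<^bsub>G\<^esub> a) \<chi>"
proof -
  interpret N: normal N G by fact
  have "a \<otimes>\<^bsub>G\<^esub> x \<otimes>\<^bsub>G\<^esub> inv\<^bsub>G\<^esub> a \<in> N" if "x \<in> N" for x using that assms by (simp add: N.inv_op_closed2)
  then show ?thesis using assms
    by (auto simp: conj_act_def fun_eq_iff N.m_assoc N.inv_mult_group)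
qed

lemma conj_act_one:
  assumes "N \<lhd> G" "\<chi> \<in> extensional N"
  shows "conj_act G N \<one>\<^bsub>G\<^esub> \<chi> = \<chi>"
proof -
  interpret N: normal N G by fact
  show ?thesis using assms by (auto simp: conj_act_def fun_eq_iff extensional_def)
qed

lemma conj_act_extensional: "conj_act G N g \<chi> \<in> extensional N"
  by (simp add: conj_act_def)

lemma gal_act_extensional: "gal_act N \<sigma> \<chi> \<in> extensional N"
  by (simp add: gal_act_def)

lemma conj_act_inv:
  assumes "N \<lhd> G" "\<chi> \<in> extensional N" "g \<in> carrier G"
  shows "conj_act G N (inv\<^bsub>G\<^esub> g) (conj_act G N g \<chi>) = \<chi>"
    "conj_act G N g (conj_act G N (inv\<^bsub>G\<^esub> g) \<chi>) = \<chi>"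
proof -
  interpret N: normal N G by fact
  show "conj_act G N (inv\<^bsub>G\<^esub> g) (conj_act G N g \<chi>) = \<chi>"
    "conj_act G N g (conj_act G N (inv\<^bsub>G\<^esub> g) \<chi>) = \<chi>"
    using assms by (simp_all add: conj_act_conj_act conj_act_one)
qed

lemma inertia_subgroup:
  assumes "N \<lhd> G" "\<chi> \<in> extensional N"
  shows "subgroup (inertia G N \<chi>) G"
proof -
  interpret N: normal N G by fact
  show ?thesis
  proof (rule N.subgroupI)
    show "inertia G N \<chi> \<subseteq> carrier G" by (auto simp: inertia_def)
    have "\<one>\<^bsub>G\<^esub> \<in> inertia G N \<chi>" using conj_act_one[OF assms] by (simp add: inertia_def)
    then show "inertia G N \<chi> \<noteq> {}" by blast
    fix a assume a: "a \<in> inertia G N \<chi>"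
    then have ac: "a \<in> carrier G" "conj_act G N a \<chi> = \<chi>" by (auto simp: inertia_def)
    show "inv\<^bsub>G\<^esub> a \<in> inertia G N \<chi>"
      using conj_act_inv(1)[OF assms ac(1)] ac by (simp add: inertia_def)
    fix b assume "b \<in> inertia G N \<chi>"
    then have bc: "b \<in> carrier G" "conj_act G N b \<chi> = \<chi>" by (auto simp: inertia_def)
    show "a \<otimes>\<^bsub>G\<^esub> b \<in> inertia G N \<chi>"
      using conj_act_conj_act[OF assms(1) bc(1) ac(1), of \<chi>] ac bc by (simp add: inertia_def)
  qed
qed

lemma conj_act_restrict:
  assumes "group G" "subgroup A G" "h \<in> A"
  shows "conj_act (G\<lparr>carrier := A\<rparr>) N h \<chi> = conj_act G N h \<chi>"
  by (simp add: conj_act_def group.m_inv_consistent[OF assms])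

lemma inertia_restrict:
  assumes "group G" "subgroup A G"
  shows "inertia (G\<lparr>carrier := A\<rparr>) N \<chi> = A \<inter> inertia G N \<chi>"
  using conj_act_restrict[OF assms] subgroup.subset[OF assms(2)] by (auto simp: inertia_def)

lemma Irr_extensional: "\<chi> \<in> Irr (G\<lparr>carrier := N\<rparr>) \<Longrightarrow> \<chi> \<in> extensional N"
  using Irr_undefined[of \<chi> "G\<lparr>carrier := N\<rparr>"] by (auto simp: extensional_def)

lemma conj_act_inner:
  assumes "N \<lhd> G" "\<chi> \<in> Irr (G\<lparr>carrier := N\<rparr>)" "g \<in> N"
  shows "conj_act G N g \<chi> = \<chi>"
proof -
  interpret N: normal N G by fact
  have g: "group (G\<lparr>carrier := N\<rparr>)" by (rule N.subgroup_imp_group[OF N.subgroup_axioms])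
  have "\<chi> (g \<otimes>\<^bsub>G\<^esub> x \<otimes>\<^bsub>G\<^esub> inv\<^bsub>G\<^esub> g) = \<chi> x" if "x \<in> N" for x
    using Irr_conj[OF g assms(2), of x g] that assms(3) N.m_inv_consistent[OF N.subgroup_axioms] by simp
  then show ?thesis using Irr_extensional[OF assms(2)] by (auto simp: conj_act_def fun_eq_iff extensional_def)
qed

lemma normal_subset_inertia:
  assumes "N \<lhd> G" "\<chi> \<in> Irr (G\<lparr>carrier := N\<rparr>)"
  shows "N \<subseteq> inertia G N \<chi>"
proof -
  interpret N: normal N G by fact
  show ?thesis using conj_act_inner[OF assms] N.subset by (auto simp: inertia_def)
qed

text \<open>The degree of \<open>P\<close> is recovered as the dimension of \<open>P \<one>\<close>. The restriction to \<open>N\<close> is irreducible because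
  its character \<open>\<theta>\<close> is.\<close>
lemma associated_rep_data:
  assumes G: "group G" "finite (carrier G)" and N: "N \<lhd> G" and \<theta>: "\<theta> \<in> Irr (G\<lparr>carrier := N\<rparr>)"
    and P: "associated_rep G N \<theta> P"
  shows "dim_row (P \<one>\<^bsub>G\<^esub>) > 0" "\<theta> \<one>\<^bsub>G\<^esub> = of_nat (dim_row (P \<one>\<^bsub>G\<^esub>))" "irreducible_rep (G\<lparr>carrier := N\<rparr>) (dim_row (P \<one>\<^bsub>G\<^esub>)) P" "P \<one>\<^bsub>G\<^esub> = 1\<^sub>m (dim_row (P \<one>\<^bsub>G\<^esub>))"
    "projective_rep (G\<lparr>carrier := inertia G N \<theta>\<rparr>) (dim_row (P \<one>\<^bsub>G\<^esub>)) P"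
    "\<And>x. x \<in> inertia G N \<theta> \<Longrightarrow> P x \<in> carrier (GL (dim_row (P \<one>\<^bsub>G\<^esub>)))"
    "\<And>x. x \<in> inertia G N \<theta> \<Longrightarrow> elements_mat (P x) \<subseteq> Q_ab"
    "\<And>x y. x \<in> inertia G N \<theta> \<Longrightarrow> y \<in> inertia G N \<theta> \<Longrightarrow> root_of_unity (factor_set G P x y)"
    "\<And>x y. x \<in> inertia G N \<theta> \<Longrightarrow> y \<in> inertia G N \<theta> \<Longrightarrow> P x * P y = factor_set G P x y \<cdot>\<^sub>m P (x \<otimes>\<^bsub>G\<^esub> y)"
    "\<And>h x. h \<in> N \<Longrightarrow> x \<in> inertia G N \<theta> \<Longrightarrow> P (h \<otimes>\<^bsub>G\<^esub> x) = P h * P x"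
    "\<And>h x. h \<in> N \<Longrightarrow> x \<in> inertia G N \<theta> \<Longrightarrow> P (x \<otimes>\<^bsub>G\<^esub> h) = P x * P h"
    "\<And>x. x \<in> N \<Longrightarrow> \<theta> x = mat_trace (P x)"
proof -
  interpret group G by fact
  interpret N: normal N G by fact
  let ?T = "inertia G N \<theta>" and ?N = "G\<lparr>carrier := N\<rparr>"
  have gN: "group ?N" by (rule subgroup_imp_group[OF N.subgroup_axioms])
  have finN: "finite (carrier ?N)" using G(2) N.subset finite_subset by simp
  have gT: "group (G\<lparr>carrier := ?T\<rparr>)"
    by (rule subgroup_imp_group[OF inertia_subgroup[OF N Irr_extensional[OF \<theta>]]])
  obtain n where pr: "projective_rep (G\<lparr>carrier := ?T\<rparr>) n P" and hom: "P \<in> hom ?N (GL n)"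
    using P by (auto simp: associated_rep_def)
  have tr: "(\<lambda>x\<in>N. mat_trace (P x)) = \<theta>" and
    m: "\<And>h x. h \<in> N \<Longrightarrow> x \<in> ?T \<Longrightarrow> P (h \<otimes>\<^bsub>G\<^esub> x) = P h * P x"
    "\<And>h x. h \<in> N \<Longrightarrow> x \<in> ?T \<Longrightarrow> P (x \<otimes>\<^bsub>G\<^esub> h) = P x * P h"
    using P unfolding associated_rep_def by blast+
  obtain d S where S: "irreducible_rep ?N d S" "\<theta> = (\<lambda>x\<in>carrier ?N. mat_trace (S x))" using \<theta> by (rule IrrE)
  have tr': "\<theta> x = mat_trace (P x)" if "x \<in> N" for x using fun_cong[OF tr, of x] that by simp
  have irr: "irreducible_rep ?N n P"
  proof (rule irreducible_of_character[OF gN finN S(1) hom])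
    show "mat_trace (P g) = mat_trace (S g)" if "g \<in> carrier ?N" for g
      using tr'[of g] fun_cong[OF S(2), of g] that by simp
  qed
  have n: "n > 0" using irreducible_rep_trace_one(2)[OF gN irr] .
  have P1: "P \<one>\<^bsub>G\<^esub> = 1\<^sub>m n" using hom_GL_D(2)[OF gN hom] by simp
  have fs: "factor_set (G\<lparr>carrier := ?T\<rparr>) P = factor_set G P" by (simp add: factor_set_def fun_eq_iff)
  have d: "dim_row (P \<one>\<^bsub>G\<^esub>) = n" using P1 by simp
  show "dim_row (P \<one>\<^bsub>G\<^esub>) > 0" "irreducible_rep (G\<lparr>carrier := N\<rparr>) (dim_row (P \<one>\<^bsub>G\<^esub>)) P"
    "P \<one>\<^bsub>G\<^esub> = 1\<^sub>m (dim_row (P \<one>\<^bsub>G\<^esub>))"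
    "projective_rep (G\<lparr>carrier := inertia G N \<theta>\<rparr>) (dim_row (P \<one>\<^bsub>G\<^esub>)) P"
    using n irr P1 pr by (simp_all add: d)
  show "\<theta> \<one>\<^bsub>G\<^esub> = of_nat (dim_row (P \<one>\<^bsub>G\<^esub>))" using tr'[of "\<one>\<^bsub>G\<^esub>"] P1 by simp
  show "P x \<in> carrier (GL (dim_row (P \<one>\<^bsub>G\<^esub>)))" "elements_mat (P x) \<subseteq> Q_ab" if "x \<in> ?T" for x
    using pr that by (auto simp: projective_rep_def d)
  show "root_of_unity (factor_set G P x y)" "P x * P y = factor_set G P x y \<cdot>\<^sub>m P (x \<otimes>\<^bsub>G\<^esub> y)"
    if "x \<in> ?T" "y \<in> ?T" for x y
    using projective_rep_factor_set[OF pr n gT, of x y] that by (simp_all add: fs)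
  show "P (h \<otimes>\<^bsub>G\<^esub> x) = P h * P x" "P (x \<otimes>\<^bsub>G\<^esub> h) = P x * P h" if "h \<in> N" "x \<in> ?T" for h x
    using m that by auto
  show "\<theta> x = mat_trace (P x)" if "x \<in> N" for x by (rule tr'[OF that])
qed

lemma Q_ab_0: "0 \<in> Q_ab" and Q_ab_1: "1 \<in> Q_ab"
proof -
  show o: "1 \<in> Q_ab" by (rule Q_ab.root[OF root_of_unity_1])
  show "0 \<in> Q_ab" using Q_ab.add[OF o Q_ab.uminus[OF o]] by simp
qed

lemma Q_ab_sum: "(\<And>i. i \<in> I \<Longrightarrow> f i \<in> Q_ab) \<Longrightarrow> (\<Sum>i\<in>I. f i) \<in> Q_ab"
  by (induction I rule: infinite_finite_induct) (auto intro: Q_ab_0 Q_ab.add)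

lemma mat_trace_Q_ab:
  assumes "A \<in> carrier_mat n n" "elements_mat A \<subseteq> Q_ab"
  shows "mat_trace A \<in> Q_ab"
  unfolding mat_trace_def
proof (rule Q_ab_sum)
  fix i assume "i \<in> {..<dim_row A}"
  then have "A $$ (i, i) \<in> elements_mat A" using elements_matI[OF assms(1), of i i] assms(1) by simp
  then show "A $$ (i, i) \<in> Q_ab" using assms(2) by auto
qed

text \<open>Automorphisms are undefined outside \<open>Q_ab\<close>, and so is this identity map.\<close>
definition id_Q_ab :: "complex \<Rightarrow> complex" where "id_Q_ab = (\<lambda>x\<in>Q_ab. x)"

lemma id_Q_ab_galH: "id_Q_ab \<in> galH p"
proof -
  have "\<xi> \<in> Q_ab" if "n > 0" "\<xi> ^ n = 1" for \<xi> :: complex and n :: nat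
    using that by (intro Q_ab.root) (auto simp: root_of_unity_def)
  moreover have "id_Q_ab \<in> Gal_Q_ab"
    by (auto simp: Gal_Q_ab_def id_Q_ab_def Bij_def bij_betw_def inj_on_def intro: Q_ab.add Q_ab.mult)
  ultimately show ?thesis unfolding galH_def
    by (intro CollectI conjI exI[of _ 0] disjI1) (auto simp: id_Q_ab_def)
qed

lemma gal_act_id:
  assumes "\<chi> \<in> extensional N" "\<And>x. x \<in> N \<Longrightarrow> \<chi> x \<in> Q_ab"
  shows "gal_act N id_Q_ab \<chi> = \<chi>"
  using assms by (auto simp: gal_act_def id_Q_ab_def fun_eq_iff extensional_def)

lemma associated_rep_Q_ab:
  assumes "group G" "finite (carrier G)" "N \<lhd> G" "\<theta> \<in> Irr (G\<lparr>carrier := N\<rparr>)" "associated_rep G N \<theta> P" "x \<in> N"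
  shows "\<theta> x \<in> Q_ab"
proof -
  note P = associated_rep_data[OF assms(1-5)]
  have x: "x \<in> inertia G N \<theta>" using normal_subset_inertia[OF assms(3,4)] assms(6) by auto
  show ?thesis unfolding P(12)[OF assms(6)] by (rule mat_trace_Q_ab[OF GL_D[OF P(6)[OF x]] P(7)[OF x]])
qed

text \<open>An element \<open>h\<close> fixes a character iff the pair of \<open>h\<close> and the trivial Galois automorphism does.\<close>
lemma inertia_of_mixed_inertia:
  assumes ext: "\<theta> \<in> extensional N" "\<phi> \<in> extensional M"
    and Q: "\<And>x. x \<in> N \<Longrightarrow> \<theta> x \<in> Q_ab" "\<And>x. x \<in> M \<Longrightarrow> \<phi> x \<in> Q_ab"
    and N: "N \<lhd> G" and H: "subgroup H G" and M: "M \<subseteq> N"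
    and Mn: "\<And>h x. h \<in> H \<Longrightarrow> x \<in> M \<Longrightarrow> h \<otimes>\<^bsub>G\<^esub> x \<otimes>\<^bsub>G\<^esub> inv\<^bsub>G\<^esub> h \<in> M"
    and eq: "mixed_inertia p G H N \<theta> = mixed_inertia p G H M \<phi>"
  shows "H \<inter> inertia G N \<theta> = H \<inter> inertia G M \<phi>"
proof -
  interpret N: normal N G by fact
  have a1: "gal_act N id_Q_ab (conj_act G N h \<theta>) = conj_act G N h \<theta>" if "h \<in> H" for h
    by (rule gal_act_id[OF conj_act_extensional])
      (use that subgroup.subset[OF H] Q N.inv_op_closed2 in \<open>auto simp: conj_act_def\<close>)
  have a2: "gal_act M id_Q_ab (conj_act G M h \<phi>) = conj_act G M h \<phi>" if "h \<in> H" for h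
    by (rule gal_act_id[OF conj_act_extensional]) (use that Q Mn in \<open>auto simp: conj_act_def\<close>)
  have a3: "(h, id_Q_ab) \<in> mixed_inertia p G H N \<theta> \<longleftrightarrow> (h, id_Q_ab) \<in> mixed_inertia p G H M \<phi>" for h
    using eq by simp
  have "conj_act G N h \<theta> = \<theta> \<longleftrightarrow> conj_act G M h \<phi> = \<phi>" if "h \<in> H" for h
    using a3[of h] that by (simp add: mixed_inertia_def id_Q_ab_galH a1[OF that] a2[OF that])
  then show ?thesis using subgroup.subset[OF H] by (auto simp: inertia_def)
qed

lemma acts_irreducibly_1:
  "acts_irreducibly 1 \<S>"
  unfolding acts_irreducibly_def
proof (intro conjI allI impI)
  fix U assume U: "U \<subseteq> carrier_vec 1 \<and> 0\<^sub>v 1 \<in> U \<and> (\<forall>v\<in>U. \<forall>w\<in>U. v + w \<in> U) \<and>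
     (\<forall>c. \<forall>v\<in>U. c \<cdot>\<^sub>v v \<in> U) \<and> (\<forall>A\<in>\<S>. \<forall>v\<in>U. A *\<^sub>v v \<in> U)"
  show "U = {0\<^sub>v 1} \<or> U = carrier_vec 1"
  proof (cases "U = {0\<^sub>v 1}")
    case False
    then obtain u where u: "u \<in> U" "u \<noteq> 0\<^sub>v 1" using U by blast
    then have uc: "u \<in> carrier_vec 1" using U by blast
    have u0: "u $ 0 \<noteq> 0"
    proof
      assume "u $ 0 = 0"
      then have "u = 0\<^sub>v 1" using uc by (intro eq_vecI) auto
      then show False using u by simp
    qed
    have "v \<in> U" if "v \<in> carrier_vec 1" for v
    proof -
      have "v = (v $ 0 / u $ 0) \<cdot>\<^sub>v u" using that uc u0 by (intro eq_vecI) auto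
      moreover have "(v $ 0 / u $ 0) \<cdot>\<^sub>v u \<in> U" using U u(1) by blast
      ultimately show ?thesis by simp
    qed
    then show ?thesis using U by blast
  qed simp
qed simp

section \<open>From induced blocks to congruences of orbit sums\<close>

lemma affords_block_rel_data:
  assumes "affords_block_rel \<MM> p G N \<theta> H M \<phi> P P' D"
  shows "group G" "finite (carrier G)" "N \<lhd> G" "\<theta> \<in> Irr (G\<lparr>carrier := N\<rparr>)" "subgroup H G" "M = N \<inter> H"
    "group (G\<lparr>carrier := H\<rparr>)" "finite (carrier (G\<lparr>carrier := H\<rparr>))" "M \<lhd> G\<lparr>carrier := H\<rparr>"
    "\<phi> \<in> Irr (G\<lparr>carrier := H\<rparr>\<lparr>carrier := M\<rparr>)" "carrier G = N <#>\<^bsub>G\<^esub> H" "centralizer G N \<subseteq> H"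
    "mixed_inertia p G H N \<theta> = mixed_inertia p G H M \<phi>"
    "associated_rep G N \<theta> P" "associated_rep (G\<lparr>carrier := H\<rparr>) M \<phi> P'"
    "\<forall>x\<in>inertia (G\<lparr>carrier := H\<rparr>) M \<phi>. \<forall>y\<in>inertia (G\<lparr>carrier := H\<rparr>) M \<phi>.
        factor_set G P x y = factor_set G P' x y"
    "\<forall>c\<in>centralizer G N. \<exists>z. P c = z \<cdot>\<^sub>m 1\<^sub>m (dim_row (P c)) \<and> P' c = z \<cdot>\<^sub>m 1\<^sub>m (dim_row (P' c))"
    "\<forall>(h, \<sigma>)\<in>mixed_inertia p G H N \<theta>. \<exists>\<mu> \<mu>'.
        comparison_function G N \<theta> P h \<sigma> \<mu> \<and>
        comparison_function (G\<lparr>carrier := H\<rparr>) M \<phi> P' h \<sigma> \<mu>' \<and>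
        (\<forall>x\<in>inertia (G\<lparr>carrier := H\<rparr>) M \<phi>. \<mu>' x = \<mu> x)"
    "defect_group \<MM> p (G\<lparr>carrier := N\<rparr>) (bl \<MM> (G\<lparr>carrier := N\<rparr>) \<theta>) D"
    "defect_group \<MM> p (G\<lparr>carrier := M\<rparr>) (bl \<MM> (G\<lparr>carrier := M\<rparr>) \<phi>) D"
    "normalizer (G\<lparr>carrier := N\<rparr>) D \<subseteq> M"
  using assms unfolding affords_block_rel_def H_triple_def by - (elim conjE; assumption)+

lemma affords_inertia:
  assumes "affords_block_rel \<MM> p G N \<theta> H M \<phi> P P' D"
  shows "inertia (G\<lparr>carrier := H\<rparr>) M \<phi> = H \<inter> inertia G N \<theta>"
proof -
  note r = affords_block_rel_data[OF assms]
  interpret N: normal N G by (rule r(3))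
  interpret H: subgroup H G by (rule r(5))
  have \<phi>: "\<phi> \<in> Irr (G\<lparr>carrier := M\<rparr>)" using r(10) by simp
  have "H \<inter> inertia G N \<theta> = H \<inter> inertia G M \<phi>"
  proof (rule inertia_of_mixed_inertia[OF Irr_extensional[OF r(4)] Irr_extensional[OF \<phi>] _ _ r(3,5) _ _ r(13)])
    show "\<theta> x \<in> Q_ab" if "x \<in> N" for x by (rule associated_rep_Q_ab[OF r(1-4,14) that])
    show "\<phi> x \<in> Q_ab" if "x \<in> M" for x by (rule associated_rep_Q_ab[OF r(7-10,15) that])
    show "M \<subseteq> N" using r(6) by simp
    show "h \<otimes>\<^bsub>G\<^esub> x \<otimes>\<^bsub>G\<^esub> inv\<^bsub>G\<^esub> h \<in> M" if "h \<in> H" "x \<in> M" for h x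
      using that r(6) N.inv_op_closed2[of h x] by auto
  qed
  then show ?thesis using inertia_restrict[OF r(1,5), of M \<phi>] by simp
qed

text \<open>Apply the block condition to \<open>W = \<langle>N, x\<rangle>\<close> and to the character \<open>\<xi> = q * mat_trace P\<close> given by \<open>cyclic_twist\<close>;
  here \<open>Q\<close> is the one-dimensional projective representation \<open>q\<close>. Since \<open>x\<close> commutes with its powers, the
  orbit of \<open>x\<close> under \<open>N\<close> is its conjugacy class in \<open>W\<close>, and on this class \<open>q\<close> is constant. The central
  characters of \<open>\<xi>\<close> and its correspondent are therefore \<open>q x\<close> times the two orbit sums, and \<open>q x\<close> is a
  unit of the ring of algebraic integers.\<close>
theorem orbit_congruence:
  assumes MM: "maximalideal \<MM> alg_int_ring"
    and rel: "affords_block_rel \<MM> p G N \<theta> H M \<phi> P P' D"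
    and x: "x \<in> inertia G N \<theta>"
  shows "algebraic_int ((\<Sum>y\<in>conj_orbit G N x. mat_trace (P y)) / \<theta> \<one>\<^bsub>G\<^esub>)"
    "algebraic_int ((\<Sum>y\<in>conj_orbit G N x \<inter> H. mat_trace (P' y)) / \<phi> \<one>\<^bsub>G\<^esub>)"
    "(\<Sum>y\<in>conj_orbit G N x. mat_trace (P y)) / \<theta> \<one>\<^bsub>G\<^esub> - (\<Sum>y\<in>conj_orbit G N x \<inter> H. mat_trace (P' y)) / \<phi> \<one>\<^bsub>G\<^esub> \<in> \<MM>"
proof -
  let ?s = "(\<Sum>y\<in>conj_orbit G N x. mat_trace (P y)) / \<theta> \<one>\<^bsub>G\<^esub>" and ?s' = "(\<Sum>y\<in>conj_orbit G N x \<inter> H. mat_trace (P' y)) / \<phi> \<one>\<^bsub>G\<^esub>"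
  note r = affords_block_rel_data[OF rel]
  note G = r(1,2) and N = r(3) and \<theta> = r(4) and H = r(5) and M = r(6) and gH = r(7,8) and MH = r(9)
    and \<phi>H = r(10) and P = r(14) and P' = r(15)
  have fs: "factor_set G P x y = factor_set G P' x y"
    if "x \<in> inertia (G\<lparr>carrier := H\<rparr>) M \<phi>" "y \<in> inertia (G\<lparr>carrier := H\<rparr>) M \<phi>" for x y
    using r(16) that by blast
  have block: "induced_block_eq \<MM> (G\<lparr>carrier := W\<rparr>) (W \<inter> H)
      (bl \<MM> (G\<lparr>carrier := W \<inter> H\<rparr>) \<psi>) (bl \<MM> (G\<lparr>carrier := W\<rparr>) \<xi>)"
    if "subgroup W G" "N \<subseteq> W" "W \<subseteq> inertia G N \<theta>" "(\<xi>, \<psi>) \<in> afforded_graph G N \<theta> H P P' W" for W \<xi> \<psi>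
    using rel that unfolding affords_block_rel_def by auto
  interpret group G by fact
  interpret N: normal N G by fact
  interpret H: subgroup H G by fact
  let ?H = "G\<lparr>carrier := H\<rparr>" and ?T = "inertia G N \<theta>"
  define n where "n = dim_row (P \<one>\<^bsub>G\<^esub>)"
  note data = associated_rep_data[OF G N \<theta> P, folded n_def]
  note n = data(1,2) and Pirr = data(3) and P1 = data(4) and PGL = data(6) and \<alpha> = data(8,9)
    and PN = data(10,11) and \<theta>P = data(12)
  define n' where "n' = dim_row (P' \<one>\<^bsub>?H\<^esub>)"
  note data' = associated_rep_data[OF gH MH \<phi>H P', folded n'_def]
  note n' = data'(1,2) and P'irr = data'(3) and P'1 = data'(4) and P'GL = data'(6) and \<alpha>' = data'(9)
  have T: "inertia ?H M \<phi> = H \<inter> ?T" by (rule affords_inertia[OF rel])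
  have subT: "subgroup ?T G" by (rule inertia_subgroup[OF N Irr_extensional[OF \<theta>]])
  have NT: "N \<subseteq> ?T" by (rule normal_subset_inertia[OF N \<theta>])
  obtain W q where W: "subgroup W G" "N \<subseteq> W" "W \<subseteq> ?T" "x \<in> W"
    and Wx': "\<forall>w\<in>W. \<exists>h\<in>N. \<exists>i::nat. w = h \<otimes>\<^bsub>G\<^esub> x [^]\<^bsub>G\<^esub> i"
    and q': "\<forall>w\<in>W. root_of_unity (q w)" "\<forall>h\<in>N. \<forall>w\<in>W. q (h \<otimes>\<^bsub>G\<^esub> w) = q w"
      "q \<one>\<^bsub>G\<^esub> = 1"
      "\<forall>u\<in>W. \<forall>v\<in>W. q (u \<otimes>\<^bsub>G\<^esub> v) = q u * q v * factor_set G P u v"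
    by (rule cyclic_twist[OF G N subT NT x n(1) PGL \<alpha> PN P1])
  note Wx = Wx'[rule_format] and q = q'[rule_format]
  interpret W: subgroup W G by fact
  define J where "J = W \<inter> H"
  have subJ: "subgroup J G" unfolding J_def by (rule subgroups_Inter_pair[OF W(1) H])
  let ?W = "G\<lparr>carrier := W\<rparr>" and ?J = "G\<lparr>carrier := J\<rparr>"
  have gW: "group ?W" "finite (carrier ?W)" using subgroup_imp_group[OF W(1)] W.subset G(2) finite_subset by auto
  have gJ: "group ?J" "finite (carrier ?J)"
    using subgroup_imp_group[OF subJ] subgroup.subset[OF subJ] G(2) finite_subset by auto
  have gN: "group (G\<lparr>carrier := N\<rparr>)" "finite (carrier (G\<lparr>carrier := N\<rparr>))"
    using subgroup_imp_group[OF N.subgroup_axioms] N.subset G(2) finite_subset by auto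
  have subM: "subgroup M G" unfolding M by (rule subgroups_Inter_pair[OF N.subgroup_axioms H])
  have gM: "group (G\<lparr>carrier := M\<rparr>)" "finite (carrier (G\<lparr>carrier := M\<rparr>))"
    using subgroup_imp_group[OF subM] subgroup.subset[OF subM] G(2) finite_subset by auto
  have MJ: "M \<subseteq> J" using W(2) by (auto simp: M J_def)
  define Q where "Q w = mat 1 1 (\<lambda>_. q w)" for w
  have Qc: "Q w \<in> carrier_mat 1 1" for w by (simp add: Q_def)
  have Q1: "Q w = 1\<^sub>m 1" if "w \<in> N" for w
  proof -
    have "q w = 1" using q(2)[OF that W.one_closed] q(3) that by simp
    then show ?thesis by (intro eq_matI) (auto simp: Q_def)
  qed
  have QGL: "Q w \<in> carrier (GL 1)" if "w \<in> W" for w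
    unfolding carrier_GL
  proof (intro conjI bexI[of _ "mat 1 1 (\<lambda>_. inverse (q w))"])
    have "q w \<noteq> 0" by (rule root_of_unity_nonzero[OF q(1)[OF that]])
    then show "mat 1 1 (\<lambda>_. inverse (q w)) * Q w = 1\<^sub>m 1" "Q w * mat 1 1 (\<lambda>_. inverse (q w)) = 1\<^sub>m 1"
      by (auto intro!: eq_matI simp: Q_def scalar_prod_def)
  qed (auto simp: Q_def)
  have \<alpha>W: "root_of_unity (factor_set G P u v)" if "u \<in> W" "v \<in> W" for u v using \<alpha>(1) that W(3) by auto
  have Qm: "Q u * Q v = inverse (factor_set G P u v) \<cdot>\<^sub>m Q (u \<otimes>\<^bsub>G\<^esub> v)" if "u \<in> W" "v \<in> W" for u v
    using q(4)[OF that] root_of_unity_nonzero[OF \<alpha>W[OF that]]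
    by (intro eq_matI) (auto simp: Q_def scalar_prod_def)
  have fsQ: "factor_set G Q u v = inverse (factor_set G P u v)" if "u \<in> W" "v \<in> W" for u v
    by (rule factor_set_eqI[OF QGL _ Qm[OF that]]) (use that in auto)
  have PmW: "P u * P v = factor_set G P u v \<cdot>\<^sub>m P (u \<otimes>\<^bsub>G\<^esub> v)" if "u \<in> W" "v \<in> W" for u v
    by (rule \<alpha>(2)) (use that W(3) in auto)
  have PW: "P w \<in> carrier (GL n)" if "w \<in> W" for w using PGL that W(3) by auto
  have JT: "J \<subseteq> inertia ?H M \<phi>" using W(3) by (auto simp: T J_def)
  have P'J: "P' w \<in> carrier (GL n')" if "w \<in> J" for w using P'GL that JT by auto
  have P'm: "P' u * P' v = factor_set G P u v \<cdot>\<^sub>m P' (u \<otimes>\<^bsub>G\<^esub> v)" if "u \<in> J" "v \<in> J" for u v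
  proof -
    have uv: "u \<in> inertia ?H M \<phi>" "v \<in> inertia ?H M \<phi>" using that JT by auto
    have "factor_set ?H P' u v = factor_set G P' u v" by (simp add: factor_set_def)
    then show ?thesis using \<alpha>'[OF uv] fs[OF uv] by simp
  qed
  have hR: "(\<lambda>w. kronecker (Q w) (P w)) \<in> hom ?W (GL (1 * n))"
    by (rule tensor_rep_hom[OF gW(1), of P n Q 1 "factor_set G P"])
      (use PW[THEN GL_D] Qc P1 Q1[OF N.one_closed] Qm PmW \<alpha>W[THEN root_of_unity_nonzero] in auto)
  have hR': "(\<lambda>w. kronecker (Q w) (P' w)) \<in> hom ?J (GL (1 * n'))"
    by (rule tensor_rep_hom[OF gJ(1), of P' n' Q 1 "factor_set G P"])
      (use P'J[THEN GL_D] Qc P'1 Q1[OF N.one_closed] Qm P'm \<alpha>W[THEN root_of_unity_nonzero] in \<open>auto simp: J_def\<close>)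
  have aR: "acts_irreducibly (1 * n) ((\<lambda>w. kronecker (Q w) (P w)) ` W)"
    by (rule tensor_acts_irreducibly[OF acts_irreducibly_1 Qc PW gN Pirr]) (use Q1 W(2) in auto)
  have aR': "acts_irreducibly (1 * n') ((\<lambda>w. kronecker (Q w) (P' w)) ` J)"
  proof (rule tensor_acts_irreducibly[OF acts_irreducibly_1 Qc P'J gM])
    show "irreducible_rep (G\<lparr>carrier := M\<rparr>) n' P'" using P'irr by simp
    show "\<exists>x\<in>J. Q x = 1\<^sub>m 1 \<and> P' x = P' g" if "g \<in> carrier (G\<lparr>carrier := M\<rparr>)" for g
      using that MJ Q1 M by auto
  qed
  define \<xi> where "\<xi> = (\<lambda>w\<in>W. mat_trace (kronecker (Q w) (P w)))"
  define \<psi> where "\<psi> = (\<lambda>w\<in>J. mat_trace (kronecker (Q w) (P' w)))"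
  have \<xi>I: "\<xi> \<in> Irr ?W"
    using IrrI[of ?W "1 * n" "\<lambda>w. kronecker (Q w) (P w)"] hR aR by (simp add: \<xi>_def irreducible_rep_iff)
  have \<psi>I: "\<psi> \<in> Irr ?J"
    using IrrI[of ?J "1 * n'" "\<lambda>w. kronecker (Q w) (P' w)"] hR' aR' by (simp add: \<psi>_def irreducible_rep_iff)
  have \<xi>q: "\<xi> w = q w * mat_trace (P w)" if "w \<in> W" for w
    using that mat_trace_kronecker[OF Qc[of w] GL_D[OF PW[OF that]]] by (simp add: \<xi>_def) (simp add: Q_def mat_trace_def)
  have \<psi>q: "\<psi> w = q w * mat_trace (P' w)" if "w \<in> J" for w
    using that mat_trace_kronecker[OF Qc[of w] GL_D[OF P'J[OF that]]] by (simp add: \<psi>_def) (simp add: Q_def mat_trace_def)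
  have over: "\<xi> \<in> Irr_over ?W N \<theta>"
  proof -
    have "(\<Sum>x\<in>N. \<xi> x * cnj (\<theta> x)) = (\<Sum>x\<in>N. of_real ((cmod (\<theta> x))\<^sup>2))"
    proof (rule sum.cong[OF refl])
      fix y assume y: "y \<in> N"
      have "q y = 1" using q(2)[OF y W.one_closed] q(3) y by simp
      then have "\<xi> y = \<theta> y" using \<xi>q[of y] \<theta>P[OF y] y W(2) by auto
      then show "\<xi> y * cnj (\<theta> y) = of_real ((cmod (\<theta> y))\<^sup>2)" by (simp only: complex_norm_square)
    qed
    also have "\<dots> = of_real (\<Sum>x\<in>N. (cmod (\<theta> x))\<^sup>2)" by simp
    finally have s: "(\<Sum>x\<in>N. \<xi> x * cnj (\<theta> x)) = of_real (\<Sum>x\<in>N. (cmod (\<theta> x))\<^sup>2)" .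
    have "(\<Sum>x\<in>N. (cmod (\<theta> x))\<^sup>2) > 0"
      by (rule sum_pos2[of _ "\<one>\<^bsub>G\<^esub>"]) (use gN n in auto)
    then have "(\<Sum>x\<in>N. (cmod (\<theta> x))\<^sup>2) \<noteq> 0" by simp
    then have "(\<Sum>x\<in>N. \<xi> x * cnj (\<theta> x)) \<noteq> 0" unfolding s of_real_eq_0_iff .
    moreover have "card N \<noteq> 0" using finite_group_card[OF gN] by simp
    ultimately show ?thesis using \<xi>I by (simp add: Irr_over_def)
  qed
  have "projective_rep ?W 1 Q"
    unfolding projective_rep_def
  proof (intro conjI ballI)
    fix u assume u: "u \<in> carrier ?W"
    show "Q u \<in> carrier (GL 1)" using QGL u by simp
    show "elements_mat (Q u) \<subseteq> Q_ab" using q(1)[of u] u by (auto simp: elements_mat_def Q_def intro: Q_ab.root)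
    fix v assume v: "v \<in> carrier ?W"
    show "\<exists>c. root_of_unity c \<and> Q u * Q v = c \<cdot>\<^sub>m Q (u \<otimes>\<^bsub>?W\<^esub> v)"
      using Qm[of u v] u v root_of_unity_inverse[OF \<alpha>W[of u v]] by auto
  qed
  moreover have "Q (h \<otimes>\<^bsub>G\<^esub> w) = Q w" if "h \<in> N" "w \<in> W" for h w using q(2)[OF that] by (simp add: Q_def)
  ultimately have "(\<xi>, \<psi>) \<in> afforded_graph G N \<theta> H P P' W"
    unfolding afforded_graph_def using over fsQ
    by (auto simp: \<xi>_def \<psi>_def J_def intro!: exI[of _ 1] exI[of _ Q])
  then have ib: "induced_block_eq \<MM> ?W J (bl \<MM> ?J \<psi>) (bl \<MM> ?W \<xi>)"
    using block[OF W(1-3)] unfolding J_def by blast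
  let ?O = "conj_orbit G N x"
  have xc: "x \<in> carrier G" using W(4) by simp
  have O: "conj_class ?W x = ?O"
  proof (intro equalityI subsetI)
    fix y assume "y \<in> conj_class ?W x"
    then obtain w where w: "w \<in> W" "y = w \<otimes>\<^bsub>G\<^esub> x \<otimes>\<^bsub>G\<^esub> inv\<^bsub>G\<^esub> w"
      by (auto simp: conj_class_def m_inv_consistent[OF W(1)])
    obtain h and i :: nat where h: "h \<in> N" "w = h \<otimes>\<^bsub>G\<^esub> x [^]\<^bsub>G\<^esub> i" using Wx[OF w(1)] by blast
    have hc: "h \<in> carrier G" "x [^]\<^bsub>G\<^esub> i \<in> carrier G" using h xc by auto
    have "x [^]\<^bsub>G\<^esub> i \<otimes>\<^bsub>G\<^esub> x \<otimes>\<^bsub>G\<^esub> inv\<^bsub>G\<^esub> (x [^]\<^bsub>G\<^esub> i) = x"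
    proof -
      have "x [^]\<^bsub>G\<^esub> i \<otimes>\<^bsub>G\<^esub> x = x \<otimes>\<^bsub>G\<^esub> x [^]\<^bsub>G\<^esub> i" using nat_pow_Suc2[OF xc, of i] by simp
      then show ?thesis using hc xc by (simp add: m_assoc)
    qed
    then have "y = h \<otimes>\<^bsub>G\<^esub> x \<otimes>\<^bsub>G\<^esub> inv\<^bsub>G\<^esub> h"
    proof -
      assume e: "x [^]\<^bsub>G\<^esub> i \<otimes>\<^bsub>G\<^esub> x \<otimes>\<^bsub>G\<^esub> inv\<^bsub>G\<^esub> (x [^]\<^bsub>G\<^esub> i) = x"
      have "y = h \<otimes>\<^bsub>G\<^esub> (x [^]\<^bsub>G\<^esub> i \<otimes>\<^bsub>G\<^esub> x \<otimes>\<^bsub>G\<^esub> inv\<^bsub>G\<^esub> (x [^]\<^bsub>G\<^esub> i)) \<otimes>\<^bsub>G\<^esub> inv\<^bsub>G\<^esub> h"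
        unfolding w(2) h(2) using hc xc by (simp add: inv_mult_group m_assoc)
      then show ?thesis unfolding e .
    qed
    then show "y \<in> ?O" using h(1) by (auto simp: conj_orbit_def)
  next
    fix y assume "y \<in> ?O"
    then show "y \<in> conj_class ?W x"
      using W(2) by (auto simp: conj_orbit_def conj_class_def m_inv_consistent[OF W(1)])
  qed
  have OK: "?O \<in> conj_classes ?W" unfolding O[symmetric] conj_classes_eq using W(4) by simp
  note Oc = conj_classes_invariant[OF gW(1) OK]
  have OJ: "?O \<inter> J = ?O \<inter> H" using Oc(1) by (auto simp: J_def)
  have qO: "q y = q x" if yO: "y \<in> ?O" for y
  proof -
    obtain k where "k \<in> N" "y = k \<otimes>\<^bsub>G\<^esub> x" by (rule conj_orbit_coset[OF N xc yO])
    then show ?thesis using q(2)[OF _ W(4)] by simp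
  qed
  have oneJ: "\<one>\<^bsub>G\<^esub> \<in> J" using subgroup.one_closed[OF subJ] .
  have om: "omega ?W \<xi> ?O = q x * ?s"
  proof -
    have "(\<Sum>y\<in>?O. \<xi> y) = (\<Sum>y\<in>?O. q x * mat_trace (P y))"
      using Oc(1) by (intro sum.cong refl) (auto simp: \<xi>q qO)
    moreover have "\<xi> \<one>\<^bsub>G\<^esub> = of_nat n" using \<xi>q[OF W.one_closed] q(3) P1 by simp
    ultimately show ?thesis using n by (simp add: omega_def sum_distrib_left)
  qed
  have om': "omega ?J \<psi> (?O \<inter> J) = q x * ?s'"
  proof -
    have "(\<Sum>y\<in>?O \<inter> J. \<psi> y) = (\<Sum>y\<in>?O \<inter> J. q x * mat_trace (P' y))"
      by (intro sum.cong refl) (auto simp: \<psi>q qO)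
    moreover have "\<psi> \<one>\<^bsub>G\<^esub> = of_nat n'" using \<psi>q[OF oneJ] q(3) P'1 by simp
    ultimately show ?thesis using n' by (simp add: omega_def sum_distrib_left OJ)
  qed
  have OJinv: "h \<otimes>\<^bsub>?J\<^esub> y \<otimes>\<^bsub>?J\<^esub> inv\<^bsub>?J\<^esub> h \<in> ?O \<inter> J" if "y \<in> ?O \<inter> J" "h \<in> carrier ?J" for y h
  proof -
    have "h \<in> W" using that by (simp add: J_def)
    then have "h \<otimes>\<^bsub>G\<^esub> y \<otimes>\<^bsub>G\<^esub> inv\<^bsub>G\<^esub> h \<in> ?O" using Oc(2)[of y h] that by (simp add: m_inv_consistent[OF W(1)])
    moreover have "h \<otimes>\<^bsub>G\<^esub> y \<otimes>\<^bsub>G\<^esub> inv\<^bsub>G\<^esub> h \<in> J"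
      using that by (simp add: subgroup.m_closed[OF subJ] subgroup.m_inv_closed[OF subJ])
    ultimately show ?thesis using that by (simp add: m_inv_consistent[OF subJ])
  qed
  have a1: "algebraic_int (q x * ?s)" unfolding om[symmetric] by (rule omega_algebraic_int[OF gW \<xi>I Oc])
  have a2: "algebraic_int (q x * ?s')" unfolding om'[symmetric]
    by (rule omega_algebraic_int[OF gJ \<psi>I _ OJinv]) auto
  have "\<xi> \<in> bl \<MM> ?W \<xi>" "\<psi> \<in> bl \<MM> ?J \<psi>" using \<xi>I \<psi>I by (auto simp: bl_def)
  then have "lambda \<MM> ?J \<psi> (?O \<inter> J) = lambda \<MM> ?W \<xi> ?O"
    using ib OK unfolding induced_block_eq_def by simp
  then have a3: "q x * ?s - q x * ?s' \<in> \<MM>"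
    using MM_uminus[OF MM] unfolding lambda_eq_iff[OF MM] om om' by (metis minus_diff_eq)
  have qx: "q x \<noteq> 0" "algebraic_int (inverse (q x))"
    using root_of_unity_nonzero[OF q(1)[OF W(4)]] root_of_unity_algebraic_int[OF root_of_unity_inverse[OF q(1)[OF W(4)]]] by auto
  have e: "inverse (q x) * (q x * ?s) = ?s" "inverse (q x) * (q x * ?s') = ?s'"
    "inverse (q x) * (q x * ?s - q x * ?s') = ?s - ?s'" using qx(1) by (simp_all add: field_simps)
  show "algebraic_int ?s" using alg_int_mult[OF MM qx(2) a1] unfolding e .
  show "algebraic_int ?s'" using alg_int_mult[OF MM qx(2) a2] unfolding e .
  show "?s - ?s' \<in> \<MM>" using MM_mult'[OF MM a3 qx(2)] unfolding e .
qed

section \<open>Galois twists and stabilisers of Galois orbits\<close>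

lemma galH_props:
  assumes "\<sigma> \<in> galH p"
  shows "\<And>x. x \<in> Q_ab \<Longrightarrow> \<sigma> x \<in> Q_ab" "bij_betw \<sigma> Q_ab Q_ab"
    "\<And>x y. x \<in> Q_ab \<Longrightarrow> y \<in> Q_ab \<Longrightarrow> \<sigma> (x + y) = \<sigma> x + \<sigma> y"
    "\<And>x y. x \<in> Q_ab \<Longrightarrow> y \<in> Q_ab \<Longrightarrow> \<sigma> (x * y) = \<sigma> x * \<sigma> y"
    "\<sigma> 0 = 0" "\<sigma> 1 = 1" "\<And>n::nat. \<sigma> (of_nat n) = of_nat n"
proof -
  have g: "\<sigma> \<in> Gal_Q_ab" using assms by (simp add: galH_def)
  show b: "bij_betw \<sigma> Q_ab Q_ab" using g by (simp add: Gal_Q_ab_def Bij_def)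
  then show c: "\<And>x. x \<in> Q_ab \<Longrightarrow> \<sigma> x \<in> Q_ab" by (auto simp: bij_betw_def)
  show a: "\<And>x y. x \<in> Q_ab \<Longrightarrow> y \<in> Q_ab \<Longrightarrow> \<sigma> (x + y) = \<sigma> x + \<sigma> y"
    and m: "\<And>x y. x \<in> Q_ab \<Longrightarrow> y \<in> Q_ab \<Longrightarrow> \<sigma> (x * y) = \<sigma> x * \<sigma> y"
    using g by (auto simp: Gal_Q_ab_def)
  have "\<sigma> 0 = \<sigma> 0 + \<sigma> 0" using a[OF Q_ab_0 Q_ab_0] by simp
  then show z: "\<sigma> 0 = 0" by simp
  have "\<sigma> 1 \<noteq> 0"
  proof
    assume "\<sigma> 1 = 0"
    then have "\<sigma> 1 = \<sigma> 0" using z by simp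
    then show False using inj_onD[OF bij_betw_imp_inj_on[OF b], of 1 0] Q_ab_0 Q_ab_1 by simp
  qed
  moreover have "\<sigma> 1 = \<sigma> 1 * \<sigma> 1" using m[OF Q_ab_1 Q_ab_1] by simp
  ultimately show o: "\<sigma> 1 = 1" by simp
  have "of_nat n \<in> Q_ab \<and> \<sigma> (of_nat n) = of_nat n" for n :: nat
    by (induction n) (auto simp: z o a Q_ab_0 Q_ab_1 intro: Q_ab.add)
  then show "\<And>n::nat. \<sigma> (of_nat n) = of_nat n" by blast
qed

definition p_prime_root :: "nat \<Rightarrow> complex \<Rightarrow> bool" where
  "p_prime_root p \<xi> \<longleftrightarrow> (\<exists>n>0. coprime n p \<and> \<xi> ^ n = 1)"

lemma p_prime_root_Q_ab: "p_prime_root p \<xi> \<Longrightarrow> \<xi> \<in> Q_ab"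
  by (rule Q_ab.root) (auto simp: p_prime_root_def root_of_unity_def)

lemma galH_iff: "\<sigma> \<in> galH p \<longleftrightarrow> \<sigma> \<in> Gal_Q_ab \<and> (\<exists>k::nat.
    (\<forall>\<xi>. p_prime_root p \<xi> \<longrightarrow> \<sigma> \<xi> = \<xi> ^ (p ^ k)) \<or> (\<forall>\<xi>. p_prime_root p \<xi> \<longrightarrow> (\<sigma> \<xi>) ^ (p ^ k) = \<xi>))"
  by (simp add: galH_def p_prime_root_def)

lemma galH_power:
  assumes "\<sigma> \<in> galH p" "x \<in> Q_ab"
  shows "\<sigma> (x ^ n) = \<sigma> x ^ n \<and> x ^ n \<in> Q_ab"
proof (induction n)
  case 0
  show ?case using galH_props(6)[OF assms(1)] Q_ab_1 by simp
next
  case (Suc n)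
  then show ?case using galH_props(4)[OF assms(1,2), of "x ^ n"] assms(2) by (auto intro: Q_ab.mult)
qed

lemma galH_p_prime_root:
  assumes "\<sigma> \<in> galH p" "p_prime_root p \<xi>"
  shows "p_prime_root p (\<sigma> \<xi>)"
proof -
  obtain n where n: "n > 0" "coprime n p" "\<xi> ^ n = 1" using assms(2) by (auto simp: p_prime_root_def)
  then have "(\<sigma> \<xi>) ^ n = 1"
    using galH_power[OF assms(1) p_prime_root_Q_ab[OF assms(2)], of n] galH_props(6)[OF assms(1)] by simp
  then show ?thesis using n by (auto simp: p_prime_root_def)
qed

text \<open>Inverting an automorphism interchanges the two alternatives in the definition of \<open>galH\<close>.\<close>
lemma galH_inverse:
  assumes \<sigma>: "\<sigma> \<in> galH p"
  obtains \<tau> where "\<tau> \<in> galH p" "\<forall>x\<in>Q_ab. \<tau> (\<sigma> x) = x" "\<forall>x\<in>Q_ab. \<sigma> (\<tau> x) = x"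
proof -
  note s = galH_props[OF \<sigma>]
  define \<tau> where "\<tau> = (\<lambda>x\<in>Q_ab. inv_into Q_ab \<sigma> x)"
  have \<tau>\<sigma>: "\<tau> (\<sigma> x) = x" if "x \<in> Q_ab" for x
    using that s(1,2) by (simp add: \<tau>_def bij_betw_def inv_into_f_f)
  have \<sigma>\<tau>: "\<sigma> (\<tau> x) = x" and \<tau>Q: "\<tau> x \<in> Q_ab" if "x \<in> Q_ab" for x
    using that s(2) by (auto simp: \<tau>_def bij_betw_def f_inv_into_f inv_into_into)
  have "bij_betw \<tau> Q_ab Q_ab" by (rule bij_betw_byWitness[of _ \<sigma>]) (use \<sigma>\<tau> \<tau>\<sigma> \<tau>Q s(1) in auto)
  moreover have "\<tau> \<in> extensional Q_ab" by (simp add: \<tau>_def)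
  moreover have "\<tau> (x + y) = \<tau> x + \<tau> y" "\<tau> (x * y) = \<tau> x * \<tau> y" if "x \<in> Q_ab" "y \<in> Q_ab" for x y
  proof -
    have q: "\<tau> x \<in> Q_ab" "\<tau> y \<in> Q_ab" using \<tau>Q that by auto
    have "\<tau> (x + y) = \<tau> (\<sigma> (\<tau> x + \<tau> y))" using s(3)[OF q] \<sigma>\<tau> that by simp
    then show "\<tau> (x + y) = \<tau> x + \<tau> y" using \<tau>\<sigma>[OF Q_ab.add[OF q]] by simp
    have "\<tau> (x * y) = \<tau> (\<sigma> (\<tau> x * \<tau> y))" using s(4)[OF q] \<sigma>\<tau> that by simp
    then show "\<tau> (x * y) = \<tau> x * \<tau> y" using \<tau>\<sigma>[OF Q_ab.mult[OF q]] by simp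
  qed
  ultimately have g: "\<tau> \<in> Gal_Q_ab" by (simp add: Gal_Q_ab_def Bij_def)
  have pr: "p_prime_root p (\<tau> \<xi>)" if "p_prime_root p \<xi>" for \<xi>
  proof -
    obtain n where n: "n > 0" "coprime n p" "\<xi> ^ n = 1" using \<open>p_prime_root p \<xi>\<close> by (auto simp: p_prime_root_def)
    have xi: "\<xi> \<in> Q_ab" by (rule p_prime_root_Q_ab[OF that])
    have "\<sigma> (\<tau> \<xi> ^ n) = \<sigma> 1" using galH_power[OF \<sigma> \<tau>Q[OF xi], of n] \<sigma>\<tau>[OF xi] n s(6) by simp
    then have "\<tau> \<xi> ^ n = 1" using s(2) galH_power[OF \<sigma> \<tau>Q[OF xi], of n] Q_ab_1
      by (auto simp: bij_betw_def inj_on_def)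
    then show ?thesis using n by (auto simp: p_prime_root_def)
  qed
  obtain k :: nat where "(\<forall>\<xi>. p_prime_root p \<xi> \<longrightarrow> \<sigma> \<xi> = \<xi> ^ (p ^ k)) \<or> (\<forall>\<xi>. p_prime_root p \<xi> \<longrightarrow> (\<sigma> \<xi>) ^ (p ^ k) = \<xi>)"
    using \<sigma> unfolding galH_iff by blast
  then have "(\<forall>\<xi>. p_prime_root p \<xi> \<longrightarrow> \<tau> \<xi> = \<xi> ^ (p ^ k)) \<or> (\<forall>\<xi>. p_prime_root p \<xi> \<longrightarrow> (\<tau> \<xi>) ^ (p ^ k) = \<xi>)"
  proof
    assume k: "\<forall>\<xi>. p_prime_root p \<xi> \<longrightarrow> \<sigma> \<xi> = \<xi> ^ (p ^ k)"
    have "(\<tau> \<xi>) ^ (p ^ k) = \<xi>" if "p_prime_root p \<xi>" for \<xi>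
      using k pr[OF that] \<sigma>\<tau>[OF p_prime_root_Q_ab[OF that]] by simp
    then show ?thesis by blast
  next
    assume k: "\<forall>\<xi>. p_prime_root p \<xi> \<longrightarrow> (\<sigma> \<xi>) ^ (p ^ k) = \<xi>"
    have "\<tau> \<xi> = \<xi> ^ (p ^ k)" if "p_prime_root p \<xi>" for \<xi>
      using k pr[OF that] \<sigma>\<tau>[OF p_prime_root_Q_ab[OF that]] by fastforce
    then show ?thesis by blast
  qed
  then have "\<tau> \<in> galH p" using g unfolding galH_iff by blast
  then show ?thesis using that \<tau>\<sigma> \<sigma>\<tau> by blast
qed

text \<open>When one automorphism acts as a positive and the other one as a negative power of the map
  \<open>\<xi> \<mapsto> \<xi> ^ p\<close>, the exponents are subtracted, and their order decides which alternative in the definition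
  of \<open>galH\<close> holds for the composition.\<close>
lemma galH_compose:
  assumes \<sigma>: "\<sigma> \<in> galH p" and \<tau>: "\<tau> \<in> galH p"
  obtains \<rho> where "\<rho> \<in> galH p" "\<forall>x\<in>Q_ab. \<rho> x = \<sigma> (\<tau> x)"
proof -
  note s = galH_props[OF \<sigma>] and t = galH_props[OF \<tau>]
  define \<rho> where "\<rho> = (\<lambda>x\<in>Q_ab. \<sigma> (\<tau> x))"
  have \<rho>: "\<rho> x = \<sigma> (\<tau> x)" if "x \<in> Q_ab" for x using that by (simp add: \<rho>_def)
  have "bij_betw (\<sigma> \<circ> \<tau>) Q_ab Q_ab" by (rule bij_betw_trans[OF t(2) s(2)])
  then have "bij_betw \<rho> Q_ab Q_ab" by (rule bij_betw_cong[THEN iffD1, rotated]) (simp add: \<rho>)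
  moreover have "\<rho> \<in> extensional Q_ab" by (simp add: \<rho>_def)
  moreover have "\<rho> (x + y) = \<rho> x + \<rho> y" "\<rho> (x * y) = \<rho> x * \<rho> y" if "x \<in> Q_ab" "y \<in> Q_ab" for x y
    using that s t by (simp_all add: \<rho> Q_ab.add Q_ab.mult)
  ultimately have g: "\<rho> \<in> Gal_Q_ab" by (simp add: Gal_Q_ab_def Bij_def)
  have pw: "\<sigma> (\<xi> ^ n) = \<sigma> \<xi> ^ n" if "p_prime_root p \<xi>" for \<xi> n
    using galH_power[OF \<sigma> p_prime_root_Q_ab[OF that]] by blast
  obtain k :: nat where k: "(\<forall>\<xi>. p_prime_root p \<xi> \<longrightarrow> \<sigma> \<xi> = \<xi> ^ (p ^ k)) \<or> (\<forall>\<xi>. p_prime_root p \<xi> \<longrightarrow> (\<sigma> \<xi>) ^ (p ^ k) = \<xi>)"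
    using \<sigma> unfolding galH_iff by blast
  obtain l :: nat where l: "(\<forall>\<xi>. p_prime_root p \<xi> \<longrightarrow> \<tau> \<xi> = \<xi> ^ (p ^ l)) \<or> (\<forall>\<xi>. p_prime_root p \<xi> \<longrightarrow> (\<tau> \<xi>) ^ (p ^ l) = \<xi>)"
    using \<tau> unfolding galH_iff by blast
  have pt: "p_prime_root p (\<tau> \<xi>)" if "p_prime_root p \<xi>" for \<xi> by (rule galH_p_prime_root[OF \<tau> that])
  have split: "x ^ (p ^ a) = (x ^ (p ^ b)) ^ (p ^ (a - b))" if "b \<le> a" for x :: complex and a b
    using that by (simp flip: power_mult power_add)
  have "\<exists>m::nat. (\<forall>\<xi>. p_prime_root p \<xi> \<longrightarrow> \<rho> \<xi> = \<xi> ^ (p ^ m)) \<or> (\<forall>\<xi>. p_prime_root p \<xi> \<longrightarrow> (\<rho> \<xi>) ^ (p ^ m) = \<xi>)"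
    using k
  proof
    assume k: "\<forall>\<xi>. p_prime_root p \<xi> \<longrightarrow> \<sigma> \<xi> = \<xi> ^ (p ^ k)"
    have r: "\<rho> \<xi> = \<tau> \<xi> ^ (p ^ k)" if "p_prime_root p \<xi>" for \<xi>
      using k pt[OF that] \<rho>[OF p_prime_root_Q_ab[OF that]] by simp
    show ?thesis using l
    proof
      assume l: "\<forall>\<xi>. p_prime_root p \<xi> \<longrightarrow> \<tau> \<xi> = \<xi> ^ (p ^ l)"
      have "\<rho> \<xi> = \<xi> ^ (p ^ (l + k))" if "p_prime_root p \<xi>" for \<xi>
        using l r that by (simp flip: power_mult power_add)
      then show ?thesis by blast
    next
      assume l: "\<forall>\<xi>. p_prime_root p \<xi> \<longrightarrow> (\<tau> \<xi>) ^ (p ^ l) = \<xi>"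
      show ?thesis
      proof (cases "l \<le> k")
        case True
        have "\<rho> \<xi> = \<xi> ^ (p ^ (k - l))" if "p_prime_root p \<xi>" for \<xi>
          using l r[OF that] that split[OF True, of "\<tau> \<xi>"] by simp
        then show ?thesis by blast
      next
        case False
        have "\<rho> \<xi> ^ (p ^ (l - k)) = \<xi>" if "p_prime_root p \<xi>" for \<xi>
          using l r[OF that] that split[of k l "\<tau> \<xi>"] False by simp
        then show ?thesis by blast
      qed
    qed
  next
    assume k: "\<forall>\<xi>. p_prime_root p \<xi> \<longrightarrow> (\<sigma> \<xi>) ^ (p ^ k) = \<xi>"
    have r: "\<rho> \<xi> ^ (p ^ k) = \<tau> \<xi>" if "p_prime_root p \<xi>" for \<xi>
      using k pt[OF that] \<rho>[OF p_prime_root_Q_ab[OF that]] by simp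
    show ?thesis using l
    proof
      assume l: "\<forall>\<xi>. p_prime_root p \<xi> \<longrightarrow> \<tau> \<xi> = \<xi> ^ (p ^ l)"
      have r': "\<rho> \<xi> = \<sigma> \<xi> ^ (p ^ l)" if "p_prime_root p \<xi>" for \<xi>
        using l that pw[OF that] \<rho>[OF p_prime_root_Q_ab[OF that]] by simp
      show ?thesis
      proof (cases "k \<le> l")
        case True
        have "\<rho> \<xi> = \<xi> ^ (p ^ (l - k))" if "p_prime_root p \<xi>" for \<xi>
          using k r'[OF that] that split[OF True, of "\<sigma> \<xi>"] by simp
        then show ?thesis by blast
      next
        case False
        have "\<rho> \<xi> ^ (p ^ (k - l)) = \<xi>" if "p_prime_root p \<xi>" for \<xi>
          using k r'[OF that] that split[of l k "\<sigma> \<xi>"] False by simp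
        then show ?thesis by blast
      qed
    next
      assume l: "\<forall>\<xi>. p_prime_root p \<xi> \<longrightarrow> (\<tau> \<xi>) ^ (p ^ l) = \<xi>"
      have "\<rho> \<xi> ^ (p ^ (k + l)) = \<xi>" if "p_prime_root p \<xi>" for \<xi>
        using l r[OF that] that by (simp add: power_add power_mult)
      then show ?thesis by blast
    qed
  qed
  then have "\<rho> \<in> galH p" using g unfolding galH_iff by blast
  then show ?thesis using that \<rho> by blast
qed

lemma conj_gal_commute:
  assumes "N \<lhd> G" "h \<in> carrier G"
  shows "conj_act G N h (gal_act N \<sigma> \<chi>) = gal_act N \<sigma> (conj_act G N h \<chi>)"
proof -
  interpret N: normal N G by fact
  have "h \<otimes>\<^bsub>G\<^esub> x \<otimes>\<^bsub>G\<^esub> inv\<^bsub>G\<^esub> h \<in> N" if "x \<in> N" for x using that assms by (simp add: N.inv_op_closed2)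
  then show ?thesis by (auto simp: conj_act_def gal_act_def fun_eq_iff)
qed

lemma gal_act_cong:
  assumes "\<And>x. x \<in> N \<Longrightarrow> \<chi> x \<in> Q_ab" "\<forall>x\<in>Q_ab. \<rho> x = \<sigma> (\<tau> x)"
  shows "gal_act N \<sigma> (gal_act N \<tau> \<chi>) = gal_act N \<rho> \<chi>"
  using assms by (auto simp: gal_act_def fun_eq_iff)

lemma gal_act_cancel:
  assumes "\<chi> \<in> extensional N" "\<And>x. x \<in> N \<Longrightarrow> \<chi> x \<in> Q_ab" "\<forall>x\<in>Q_ab. \<tau> (\<sigma> x) = x"
  shows "gal_act N \<tau> (gal_act N \<sigma> \<chi>) = \<chi>"
  using assms by (auto simp: gal_act_def fun_eq_iff extensional_def)

lemma conj_act_Q_ab: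
  assumes "N \<lhd> G" "h \<in> carrier G" "\<And>x. x \<in> N \<Longrightarrow> \<chi> x \<in> Q_ab" "x \<in> N"
  shows "conj_act G N h \<chi> x \<in> Q_ab"
proof -
  interpret N: normal N G by fact
  show ?thesis using assms N.inv_op_closed2[OF assms(2,4)] by (simp add: conj_act_def)
qed

lemma orbit_inertia_iff_mixed:
  assumes N: "N \<lhd> G" and \<chi>: "\<chi> \<in> extensional N" "\<And>x. x \<in> N \<Longrightarrow> \<chi> x \<in> Q_ab"
    and h: "h \<in> B" "h \<in> carrier G"
  shows "h \<in> orbit_inertia p G N \<chi> \<longleftrightarrow> (\<exists>\<sigma>. (h, \<sigma>) \<in> mixed_inertia p G B N \<chi>)"
proof
  assume "h \<in> orbit_inertia p G N \<chi>"
  then obtain \<sigma> where \<sigma>: "\<sigma> \<in> galH p" "conj_act G N h \<chi> = gal_act N \<sigma> \<chi>" by (auto simp: orbit_inertia_def gal_orbit_def)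
  obtain \<tau> where \<tau>: "\<tau> \<in> galH p" "\<forall>x\<in>Q_ab. \<tau> (\<sigma> x) = x" "\<forall>x\<in>Q_ab. \<sigma> (\<tau> x) = x" using galH_inverse[OF \<sigma>(1)] .
  have "gal_act N \<tau> (conj_act G N h \<chi>) = \<chi>" unfolding \<sigma>(2) by (rule gal_act_cancel) (use \<chi> \<tau>(2) in auto)
  then show "\<exists>\<sigma>. (h, \<sigma>) \<in> mixed_inertia p G B N \<chi>" using \<tau> h by (auto simp: mixed_inertia_def)
next
  assume "\<exists>\<sigma>. (h, \<sigma>) \<in> mixed_inertia p G B N \<chi>"
  then obtain \<sigma> where \<sigma>: "\<sigma> \<in> galH p" "gal_act N \<sigma> (conj_act G N h \<chi>) = \<chi>" by (auto simp: mixed_inertia_def)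
  obtain \<tau> where \<tau>: "\<tau> \<in> galH p" "\<forall>x\<in>Q_ab. \<tau> (\<sigma> x) = x" "\<forall>x\<in>Q_ab. \<sigma> (\<tau> x) = x" using galH_inverse[OF \<sigma>(1)] .
  have "conj_act G N h \<chi> = gal_act N \<tau> \<chi>"
    using gal_act_cancel[where \<chi> = "conj_act G N h \<chi>" and \<sigma> = \<sigma> and \<tau> = \<tau> and N = N]
      conj_act_Q_ab[OF N h(2) \<chi>(2)] \<tau>(2) \<sigma>(2) by (simp add: conj_act_extensional)
  then show "h \<in> orbit_inertia p G N \<chi>" using \<tau> h by (auto simp: orbit_inertia_def gal_orbit_def)
qed

lemma orbit_inertia_subgroup:
  assumes N: "N \<lhd> G" and \<chi>: "\<chi> \<in> extensional N" "\<And>x. x \<in> N \<Longrightarrow> \<chi> x \<in> Q_ab"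
  shows "subgroup (orbit_inertia p G N \<chi>) G"
proof -
  interpret N: normal N G by fact
  show ?thesis
  proof (rule N.subgroupI)
    show "orbit_inertia p G N \<chi> \<subseteq> carrier G" by (auto simp: orbit_inertia_def)
    have "\<one>\<^bsub>G\<^esub> \<in> orbit_inertia p G N \<chi>"
      using conj_act_one[OF N \<chi>(1)] gal_act_id[OF \<chi>, symmetric] id_Q_ab_galH
      by (auto simp: orbit_inertia_def gal_orbit_def)
    then show "orbit_inertia p G N \<chi> \<noteq> {}" by blast
    fix a assume "a \<in> orbit_inertia p G N \<chi>"
    then obtain \<sigma> where a: "a \<in> carrier G" "\<sigma> \<in> galH p" "conj_act G N a \<chi> = gal_act N \<sigma> \<chi>"
      by (auto simp: orbit_inertia_def gal_orbit_def)
    obtain \<tau> where \<tau>: "\<tau> \<in> galH p" "\<forall>x\<in>Q_ab. \<tau> (\<sigma> x) = x" "\<forall>x\<in>Q_ab. \<sigma> (\<tau> x) = x" using galH_inverse[OF a(2)] .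
    have ia: "inv\<^bsub>G\<^esub> a \<in> carrier G" using a by simp
    have "gal_act N \<sigma> (conj_act G N (inv\<^bsub>G\<^esub> a) \<chi>) = conj_act G N (inv\<^bsub>G\<^esub> a) (conj_act G N a \<chi>)"
      unfolding a(3) by (rule conj_gal_commute[OF N ia, symmetric])
    also have "\<dots> = \<chi>" by (rule conj_act_inv(1)[OF N \<chi>(1) a(1)])
    finally have "gal_act N \<sigma> (conj_act G N (inv\<^bsub>G\<^esub> a) \<chi>) = \<chi>" .
    then have "conj_act G N (inv\<^bsub>G\<^esub> a) \<chi> = gal_act N \<tau> \<chi>"
      using gal_act_cancel[where \<chi> = "conj_act G N (inv\<^bsub>G\<^esub> a) \<chi>" and \<sigma> = \<sigma> and \<tau> = \<tau> and N = N]
        conj_act_Q_ab[OF N ia \<chi>(2)] \<tau>(2) by (simp add: conj_act_extensional)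
    then show "inv\<^bsub>G\<^esub> a \<in> orbit_inertia p G N \<chi>" using \<tau> ia by (auto simp: orbit_inertia_def gal_orbit_def)
    fix b assume "b \<in> orbit_inertia p G N \<chi>"
    then obtain \<upsilon> where b: "b \<in> carrier G" "\<upsilon> \<in> galH p" "conj_act G N b \<chi> = gal_act N \<upsilon> \<chi>"
      by (auto simp: orbit_inertia_def gal_orbit_def)
    obtain \<rho> where \<rho>: "\<rho> \<in> galH p" "\<forall>x\<in>Q_ab. \<rho> x = \<sigma> (\<upsilon> x)" using galH_compose[OF a(2) b(2)] .
    have "conj_act G N (a \<otimes>\<^bsub>G\<^esub> b) \<chi> = conj_act G N b (conj_act G N a \<chi>)"
      by (rule conj_act_conj_act[OF N b(1) a(1), symmetric])
    also have "\<dots> = gal_act N \<sigma> (gal_act N \<upsilon> \<chi>)"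
      unfolding a(3) conj_gal_commute[OF N b(1)] b(3) ..
    also have "\<dots> = gal_act N \<rho> \<chi>" by (rule gal_act_cong) (use \<chi>(2) \<rho>(2) in auto)
    finally show "a \<otimes>\<^bsub>G\<^esub> b \<in> orbit_inertia p G N \<chi>" using \<rho> a b by (auto simp: orbit_inertia_def gal_orbit_def)
  qed
qed

lemma map_mat_kronecker:
  assumes \<sigma>: "\<sigma> \<in> galH p" and A: "A \<in> carrier_mat m m" "elements_mat A \<subseteq> Q_ab"
    and B: "B \<in> carrier_mat n n" "elements_mat B \<subseteq> Q_ab"
  shows "map_mat \<sigma> (kronecker A B) = kronecker (map_mat \<sigma> A) (map_mat \<sigma> B)"
proof (rule eq_mat_pairI)
  show "map_mat \<sigma> (kronecker A B) \<in> carrier_mat (m * n) (m * n)" using kronecker_carrier[OF A(1) B(1)] by simp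
  have mA: "map_mat \<sigma> A \<in> carrier_mat m m" "map_mat \<sigma> B \<in> carrier_mat n n" using A B by auto
  show "kronecker (map_mat \<sigma> A) (map_mat \<sigma> B) \<in> carrier_mat (m * n) (m * n)" by (rule kronecker_carrier[OF mA])
  fix i k j l assume ix: "i < m" "k < n" "j < m" "l < n"
  have "A $$ (i, j) \<in> Q_ab" "B $$ (k, l) \<in> Q_ab"
    using elements_matI[OF A(1) ix(1,3) refl] elements_matI[OF B(1) ix(2,4) refl] A(2) B(2) by auto
  then show "map_mat \<sigma> (kronecker A B) $$ (i * n + k, j * n + l) = kronecker (map_mat \<sigma> A) (map_mat \<sigma> B) $$ (i * n + k, j * n + l)"
    using ix carrier_matD[OF kronecker_carrier[OF A(1) B(1)]] A(1) B(1) galH_props(4)[OF \<sigma>]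
    by (simp add: kronecker_entry[OF mA] kronecker_entry[OF A(1) B(1)] index_pair_less)
qed

lemma elements_kronecker_Q_ab:
  assumes A: "A \<in> carrier_mat m m" "elements_mat A \<subseteq> Q_ab"
    and B: "B \<in> carrier_mat n n" "elements_mat B \<subseteq> Q_ab"
  shows "elements_mat (kronecker A B) \<subseteq> Q_ab"
proof
  fix z assume "z \<in> elements_mat (kronecker A B)"
  then obtain r s where rs: "r < m * n" "s < m * n" "z = kronecker A B $$ (r, s)"
    using kronecker_carrier[OF A(1) B(1)] by (auto elim!: elements_matD)
  obtain i k where ik: "i < m" "k < n" "r = i * n + k" using index_pair_cases[OF rs(1)] .
  obtain j l where jl: "j < m" "l < n" "s = j * n + l" using index_pair_cases[OF rs(2)] .
  have "A $$ (i, j) \<in> Q_ab" "B $$ (k, l) \<in> Q_ab"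
    using elements_matI[OF A(1) ik(1) jl(1) refl] elements_matI[OF B(1) ik(2) jl(2) refl] A(2) B(2) by auto
  then show "z \<in> Q_ab" unfolding rs(3) ik(3) jl(3) kronecker_entry[OF A(1) B(1) ik(1,2) jl(1,2)]
    by (rule Q_ab.mult)
qed

lemma similar_mat_wit_kronecker:
  assumes "similar_mat_wit A B T S" "similar_mat_wit A' B' T' S'"
  shows "similar_mat_wit (kronecker A A') (kronecker B B') (kronecker T T') (kronecker S S')"
proof -
  obtain n where A: "A \<in> carrier_mat n n" "B \<in> carrier_mat n n" "T \<in> carrier_mat n n" "S \<in> carrier_mat n n"
    "T * S = 1\<^sub>m n" "S * T = 1\<^sub>m n" "A = T * B * S"
    using assms(1) unfolding similar_mat_wit_def Let_def by (metis insert_subset)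
  obtain n' where A': "A' \<in> carrier_mat n' n'" "B' \<in> carrier_mat n' n'" "T' \<in> carrier_mat n' n'" "S' \<in> carrier_mat n' n'"
    "T' * S' = 1\<^sub>m n'" "S' * T' = 1\<^sub>m n'" "A' = T' * B' * S'"
    using assms(2) unfolding similar_mat_wit_def Let_def by (metis insert_subset)
  have TB: "T * B \<in> carrier_mat n n" "T' * B' \<in> carrier_mat n' n'" using A A' by auto
  have "kronecker A A' = kronecker T T' * kronecker B B' * kronecker S S'"
    unfolding A(7) A'(7) kronecker_mult[OF A(3) A'(3) A(2) A'(2)] kronecker_mult[OF TB A(4) A'(4)] ..
  moreover have "dim_row (kronecker A A') = n * n'" using kronecker_carrier[OF A(1) A'(1)] by simp
  moreover have "kronecker T T' * kronecker S S' = 1\<^sub>m (n * n')" "kronecker S S' * kronecker T T' = 1\<^sub>m (n * n')"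
    using kronecker_mult[OF A(3) A'(3) A(4) A'(4)] kronecker_mult[OF A(4) A'(4) A(3) A'(3)] A A'
    by (simp_all add: kronecker_one)
  ultimately show ?thesis unfolding similar_mat_wit_def Let_def
    using kronecker_carrier[OF A(1) A'(1)] kronecker_carrier[OF A(2) A'(2)]
      kronecker_carrier[OF A(3) A'(3)] kronecker_carrier[OF A(4) A'(4)] by simp
qed

lemma normalizer_DirProd_subset:
  assumes "group G1" "group G2" "D1 \<subseteq> carrier G1" "D2 \<subseteq> carrier G2" "D1 \<noteq> {}" "D2 \<noteq> {}"
  shows "normalizer (G1 \<times>\<times> G2) (D1 \<times> D2) \<subseteq> normalizer G1 D1 \<times> normalizer G2 D2"
proof
  fix g assume g: "g \<in> normalizer (G1 \<times>\<times> G2) (D1 \<times> D2)"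
  have c: "a <#\<^bsub>G\<^esub> D #>\<^bsub>G\<^esub> b = (\<lambda>d. a \<otimes>\<^bsub>G\<^esub> d \<otimes>\<^bsub>G\<^esub> b) ` D" for a b D and G :: "('x, 'y) monoid_scheme"
    by (auto simp: l_coset_def r_coset_def)
  obtain a b where ab: "g = (a, b)" "a \<in> carrier G1" "b \<in> carrier G2"
    using g by (cases g) (auto simp: normalizer_def stabilizer_def)
  have sub: "D1 \<times> D2 \<subseteq> carrier (G1 \<times>\<times> G2)" using assms by auto
  have "(\<lambda>d. g \<otimes>\<^bsub>G1 \<times>\<times> G2\<^esub> d \<otimes>\<^bsub>G1 \<times>\<times> G2\<^esub> inv\<^bsub>G1 \<times>\<times> G2\<^esub> g) ` (D1 \<times> D2) = D1 \<times> D2"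
    using g sub by (simp add: normalizer_def stabilizer_def c)
  moreover have "(\<lambda>d. g \<otimes>\<^bsub>G1 \<times>\<times> G2\<^esub> d \<otimes>\<^bsub>G1 \<times>\<times> G2\<^esub> inv\<^bsub>G1 \<times>\<times> G2\<^esub> g) ` (D1 \<times> D2) =
    (\<lambda>d. a \<otimes>\<^bsub>G1\<^esub> d \<otimes>\<^bsub>G1\<^esub> inv\<^bsub>G1\<^esub> a) ` D1 \<times> (\<lambda>d. b \<otimes>\<^bsub>G2\<^esub> d \<otimes>\<^bsub>G2\<^esub> inv\<^bsub>G2\<^esub> b) ` D2"
    unfolding ab(1) inv_DirProd[OF assms(1,2) ab(2,3)] by (force simp: image_iff)
  ultimately have e: "(\<lambda>d. a \<otimes>\<^bsub>G1\<^esub> d \<otimes>\<^bsub>G1\<^esub> inv\<^bsub>G1\<^esub> a) ` D1 \<times> (\<lambda>d. b \<otimes>\<^bsub>G2\<^esub> d \<otimes>\<^bsub>G2\<^esub> inv\<^bsub>G2\<^esub> b) ` D2 = D1 \<times> D2" by simp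
  then have "(\<lambda>d. a \<otimes>\<^bsub>G1\<^esub> d \<otimes>\<^bsub>G1\<^esub> inv\<^bsub>G1\<^esub> a) ` D1 = D1" "(\<lambda>d. b \<otimes>\<^bsub>G2\<^esub> d \<otimes>\<^bsub>G2\<^esub> inv\<^bsub>G2\<^esub> b) ` D2 = D2"
    using assms(5,6) by (metis Times_empty times_eq_iff)+
  then show "g \<in> normalizer G1 D1 \<times> normalizer G2 D2"
    using ab assms(3,4) by (simp add: normalizer_def stabilizer_def c)
qed

text \<open>Membership in a block compares central characters at conjugacy classes; a set closed under
  conjugation is a disjoint union of classes.\<close>
lemma omega_congruence_of_block:
  assumes MM: "maximalideal \<MM> alg_int_ring" and G: "group G" "finite (carrier G)"
    and \<psi>: "\<psi> \<in> bl \<MM> G \<chi>"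
    and S: "S \<subseteq> carrier G" "\<And>x h. x \<in> S \<Longrightarrow> h \<in> carrier G \<Longrightarrow> h \<otimes>\<^bsub>G\<^esub> x \<otimes>\<^bsub>G\<^esub> inv\<^bsub>G\<^esub> h \<in> S"
  shows "omega G \<psi> S - omega G \<chi> S \<in> \<MM>"
proof -
  interpret group G by fact
  have finS: "finite S" using S G finite_subset by blast
  have eq: "conj_orbit G (carrier G) x = conj_class G x" for x by (simp add: conj_orbit_def conj_class_def)
  have om: "omega G \<eta> S = (\<Sum>C\<in>conj_class G ` S. omega G \<eta> C)" for \<eta>
    using conj_closed_sum_partition[OF G(1) subgroup_self S(1) finS S(2), of \<eta>]
    by (simp add: omega_def eq sum_divide_distrib)
  have "omega G \<psi> C - omega G \<chi> C \<in> \<MM>" if "C \<in> conj_class G ` S" for C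
  proof -
    have "C \<in> conj_classes G" using that S(1) by (auto simp: conj_classes_eq)
    then show ?thesis using \<psi> by (simp add: bl_def lambda_eq_iff[OF MM])
  qed
  then show ?thesis unfolding om sum_subtractf[symmetric] by (rule MM_sum[OF MM])
qed

section \<open>The tensor product of two associated representations\<close>

lemma carrier_DirProd_restrict:
  "(G1 \<times>\<times> G2)\<lparr>carrier := A \<times> B\<rparr> = (G1\<lparr>carrier := A\<rparr>) \<times>\<times> (G2\<lparr>carrier := B\<rparr>)"
  by (simp add: DirProd_def)

lemma normal_DirProd:
  assumes "N1 \<lhd> G1" "N2 \<lhd> G2"
  shows "N1 \<times> N2 \<lhd> G1 \<times>\<times> G2"
proof -
  interpret N1: normal N1 G1 by fact
  interpret N2: normal N2 G2 by fact
  have g: "group (G1 \<times>\<times> G2)" by (rule DirProd_group[OF N1.is_group N2.is_group])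
  have s: "subgroup (N1 \<times> N2) (G1 \<times>\<times> G2)"
    by (rule DirProd_subgroups[OF N1.is_group N1.subgroup_axioms N2.is_group N2.subgroup_axioms])
  show ?thesis unfolding group.normal_inv_iff[OF g]
    using s N1.inv_op_closed2 N2.inv_op_closed2 by (auto simp: inv_DirProd[OF N1.is_group N2.is_group])
qed

lemma normal_restrict:
  assumes "N \<lhd> G" "subgroup A G" "N \<subseteq> A"
  shows "N \<lhd> G\<lparr>carrier := A\<rparr>"
proof -
  interpret N: normal N G by fact
  have gA: "group (G\<lparr>carrier := A\<rparr>)" by (rule N.subgroup_imp_group[OF assms(2)])
  have "subgroup N (G\<lparr>carrier := A\<rparr>)" by (rule N.subgroup_incl[OF N.subgroup_axioms assms(2,3)])
  moreover have "x \<otimes>\<^bsub>G\<^esub> h \<otimes>\<^bsub>G\<^esub> inv\<^bsub>G\<lparr>carrier := A\<rparr>\<^esub> x \<in> N" if "x \<in> A" "h \<in> N" for x h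
    using that subgroup.subset[OF assms(2)] N.inv_op_closed2[of x h] by (auto simp: N.m_inv_consistent[OF assms(2)])
  ultimately show ?thesis unfolding group.normal_inv_iff[OF gA] by simp
qed

text \<open>The situation occurs twice: for the groups \<open>G\<^sub>i\<close> with \<open>N\<^sub>i\<close>, \<open>\<theta>\<^sub>i\<close>, \<open>P\<^sub>i\<close> and for the groups \<open>H\<^sub>i\<close> with \<open>M\<^sub>i\<close>,
  \<open>\<phi>\<^sub>i\<close>, \<open>P'\<^sub>i\<close>.\<close>
locale associated_pair =
  fixes G1 :: "('a, 'm) monoid_scheme" and G2 :: "('b, 'n) monoid_scheme"
    and N1 :: "'a set" and N2 :: "'b set" and \<theta>1 \<theta>2 P1 P2
  assumes G1: "group G1" "finite (carrier G1)" and G2: "group G2" "finite (carrier G2)"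
    and N1: "N1 \<lhd> G1" and N2: "N2 \<lhd> G2"
    and \<theta>1: "\<theta>1 \<in> Irr (G1\<lparr>carrier := N1\<rparr>)" and \<theta>2: "\<theta>2 \<in> Irr (G2\<lparr>carrier := N2\<rparr>)"
    and P1: "associated_rep G1 N1 \<theta>1 P1" and P2: "associated_rep G2 N2 \<theta>2 P2"
begin

interpretation N1: normal N1 G1 by (rule N1)
interpretation N2: normal N2 G2 by (rule N2)

abbreviation "GG \<equiv> G1 \<times>\<times> G2"
abbreviation "NN \<equiv> N1 \<times> N2"
abbreviation "\<Theta> \<equiv> char_tensor N1 N2 \<theta>1 \<theta>2"
abbreviation "T1 \<equiv> inertia G1 N1 \<theta>1"
abbreviation "T2 \<equiv> inertia G2 N2 \<theta>2"
definition "n1 = dim_row (P1 \<one>\<^bsub>G1\<^esub>)"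
definition "n2 = dim_row (P2 \<one>\<^bsub>G2\<^esub>)"

lemmas data1 = associated_rep_data[OF G1 N1 \<theta>1 P1, folded n1_def]
lemmas data2 = associated_rep_data[OF G2 N2 \<theta>2 P2, folded n2_def]
lemmas ext1 = Irr_extensional[OF \<theta>1]
lemmas ext2 = Irr_extensional[OF \<theta>2]
lemmas Q1 = associated_rep_Q_ab[OF G1 N1 \<theta>1 P1]
lemmas Q2 = associated_rep_Q_ab[OF G2 N2 \<theta>2 P2]

lemma GG: "group GG" "finite (carrier GG)"
  using DirProd_group[OF G1(1) G2(1)] G1 G2 by auto

lemma NN: "NN \<lhd> GG" by (rule normal_DirProd[OF N1 N2])

lemma factor_groups:
  "group (G1\<lparr>carrier := N1\<rparr>)" "finite (carrier (G1\<lparr>carrier := N1\<rparr>))"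
  "group (G2\<lparr>carrier := N2\<rparr>)" "finite (carrier (G2\<lparr>carrier := N2\<rparr>))"
  using N1.subgroup_imp_group[OF N1.subgroup_axioms] N2.subgroup_imp_group[OF N2.subgroup_axioms]
    finite_subset[OF N1.subset G1(2)] finite_subset[OF N2.subset G2(2)] by auto

lemma tensor_Irr: "\<Theta> \<in> Irr (GG\<lparr>carrier := NN\<rparr>)"
  using char_tensor_Irr[OF factor_groups \<theta>1 \<theta>2] by (simp add: carrier_DirProd_restrict)

lemma tensor_ext: "\<Theta> \<in> extensional NN" by (rule Irr_extensional[OF tensor_Irr])

lemma tensor_Q: "x \<in> NN \<Longrightarrow> \<Theta> x \<in> Q_ab"
  using Q1 Q2 by (auto simp: char_tensor_def intro: Q_ab.mult)

lemma conj_act_tensor: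
  assumes "a \<in> carrier G1" "b \<in> carrier G2"
  shows "conj_act GG NN (a, b) \<Theta> = char_tensor N1 N2 (conj_act G1 N1 a \<theta>1) (conj_act G2 N2 b \<theta>2)"
proof
  fix z
  show "conj_act GG NN (a, b) \<Theta> z = char_tensor N1 N2 (conj_act G1 N1 a \<theta>1) (conj_act G2 N2 b \<theta>2) z"
    using assms N1.inv_op_closed2[OF assms(1), of "fst z"] N2.inv_op_closed2[OF assms(2), of "snd z"]
    by (cases z) (simp add: conj_act_def char_tensor_def inv_DirProd[OF G1(1) G2(1)])
qed

lemma twist_tensor:
  assumes ab: "a \<in> carrier G1" "b \<in> carrier G2" and \<sigma>: "\<sigma> \<in> galH p"
  shows "gal_act NN \<sigma> (conj_act GG NN (a, b) \<Theta>) =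
    char_tensor N1 N2 (gal_act N1 \<sigma> (conj_act G1 N1 a \<theta>1)) (gal_act N2 \<sigma> (conj_act G2 N2 b \<theta>2))"
  unfolding conj_act_tensor[OF ab]
proof
  fix z
  show "gal_act NN \<sigma> (char_tensor N1 N2 (conj_act G1 N1 a \<theta>1) (conj_act G2 N2 b \<theta>2)) z =
    char_tensor N1 N2 (gal_act N1 \<sigma> (conj_act G1 N1 a \<theta>1)) (gal_act N2 \<sigma> (conj_act G2 N2 b \<theta>2)) z"
    using galH_props(4)[OF \<sigma>] conj_act_Q_ab[OF N1 ab(1) Q1] conj_act_Q_ab[OF N2 ab(2) Q2]
    by (cases z) (simp add: gal_act_def char_tensor_def)
qed

text \<open>A twist does not change the degree of a character, so evaluating at \<open>(x, \<one>)\<close> and \<open>(\<one>, y)\<close> recovers the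
  factors.\<close>
lemma twist_fixed_iff:
  assumes ab: "a \<in> carrier G1" "b \<in> carrier G2" and \<sigma>: "\<sigma> \<in> galH p"
  shows "gal_act NN \<sigma> (conj_act GG NN (a, b) \<Theta>) = \<Theta> \<longleftrightarrow>
    gal_act N1 \<sigma> (conj_act G1 N1 a \<theta>1) = \<theta>1 \<and> gal_act N2 \<sigma> (conj_act G2 N2 b \<theta>2) = \<theta>2"
proof
  let ?\<chi>1 = "gal_act N1 \<sigma> (conj_act G1 N1 a \<theta>1)" and ?\<chi>2 = "gal_act N2 \<sigma> (conj_act G2 N2 b \<theta>2)"
  assume "gal_act NN \<sigma> (conj_act GG NN (a, b) \<Theta>) = \<Theta>"
  then have e: "char_tensor N1 N2 ?\<chi>1 ?\<chi>2 = \<Theta>" unfolding twist_tensor[OF ab \<sigma>] .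
  have e: "?\<chi>1 x * ?\<chi>2 y = \<theta>1 x * \<theta>2 y" if "x \<in> N1" "y \<in> N2" for x y
    using fun_cong[OF e, of "(x, y)"] that by (simp add: char_tensor_def)
  have o1: "?\<chi>1 \<one>\<^bsub>G1\<^esub> = of_nat n1" "\<theta>1 \<one>\<^bsub>G1\<^esub> = of_nat n1"
    using data1(2) galH_props(7)[OF \<sigma>] ab by (simp_all add: gal_act_def conj_act_def)
  have o2: "?\<chi>2 \<one>\<^bsub>G2\<^esub> = of_nat n2" "\<theta>2 \<one>\<^bsub>G2\<^esub> = of_nat n2"
    using data2(2) galH_props(7)[OF \<sigma>] ab by (simp_all add: gal_act_def conj_act_def)
  have "?\<chi>1 x = \<theta>1 x" if "x \<in> N1" for x using e[OF that subgroup.one_closed[OF N2.subgroup_axioms]] data2(1) by (simp add: o2)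
  moreover have "?\<chi>2 y = \<theta>2 y" if "y \<in> N2" for y using e[OF subgroup.one_closed[OF N1.subgroup_axioms] that] data1(1) by (simp add: o1)
  ultimately show "?\<chi>1 = \<theta>1 \<and> ?\<chi>2 = \<theta>2"
    using extensionalityI[OF gal_act_extensional ext1] extensionalityI[OF gal_act_extensional ext2] by blast
next
  assume "gal_act N1 \<sigma> (conj_act G1 N1 a \<theta>1) = \<theta>1 \<and> gal_act N2 \<sigma> (conj_act G2 N2 b \<theta>2) = \<theta>2"
  then show "gal_act NN \<sigma> (conj_act GG NN (a, b) \<Theta>) = \<Theta>" unfolding twist_tensor[OF ab \<sigma>] by simp
qed

lemma mixed_inertia_tensor:
  assumes "B1 \<subseteq> carrier G1" "B2 \<subseteq> carrier G2"
  shows "((a, b), \<sigma>) \<in> mixed_inertia p GG (B1 \<times> B2) NN \<Theta> \<longleftrightarrow>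
    (a, \<sigma>) \<in> mixed_inertia p G1 B1 N1 \<theta>1 \<and> (b, \<sigma>) \<in> mixed_inertia p G2 B2 N2 \<theta>2"
  using assms twist_fixed_iff[of a b \<sigma> p] by (auto simp: mixed_inertia_def)

lemma inertia_tensor: "inertia GG NN \<Theta> = T1 \<times> T2"
proof -
  have "(a, b) \<in> inertia GG NN \<Theta> \<longleftrightarrow> (a, b) \<in> T1 \<times> T2" for a b
  proof (cases "a \<in> carrier G1 \<and> b \<in> carrier G2")
    case True
    then have ab: "a \<in> carrier G1" "b \<in> carrier G2" "(a, b) \<in> carrier GG" by auto
    have "gal_act NN id_Q_ab (conj_act GG NN (a, b) \<Theta>) = conj_act GG NN (a, b) \<Theta>"
      by (rule gal_act_id[OF conj_act_extensional conj_act_Q_ab[OF NN ab(3) tensor_Q]])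
    moreover have "gal_act N1 id_Q_ab (conj_act G1 N1 a \<theta>1) = conj_act G1 N1 a \<theta>1"
      by (rule gal_act_id[OF conj_act_extensional conj_act_Q_ab[OF N1 ab(1) Q1]])
    moreover have "gal_act N2 id_Q_ab (conj_act G2 N2 b \<theta>2) = conj_act G2 N2 b \<theta>2"
      by (rule gal_act_id[OF conj_act_extensional conj_act_Q_ab[OF N2 ab(2) Q2]])
    ultimately show ?thesis using twist_fixed_iff[OF ab(1,2) id_Q_ab_galH[of 0]] ab by (simp add: inertia_def)
  qed (auto simp: inertia_def)
  then show ?thesis by auto
qed

abbreviation "AA p \<equiv> orbit_inertia p GG NN \<Theta>"

lemma AA_subgroup: "subgroup (AA p) GG"
  by (rule orbit_inertia_subgroup[OF NN tensor_ext tensor_Q])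

lemma inertia_subset_AA: "T1 \<times> T2 \<subseteq> AA p"
proof -
  have "inertia GG NN \<Theta> \<subseteq> AA p"
    using gal_act_id[OF tensor_ext tensor_Q] id_Q_ab_galH[of p]
    by (auto simp: inertia_def orbit_inertia_def gal_orbit_def) metis
  then show ?thesis by (simp add: inertia_tensor)
qed

lemma NN_subset_AA: "NN \<subseteq> AA p"
  using normal_subset_inertia[OF NN tensor_Irr] inertia_subset_AA by (auto simp: inertia_tensor)

lemma H_triple_tensor: "H_triple p (GG\<lparr>carrier := AA p\<rparr>) NN \<Theta>"
  unfolding H_triple_def
proof (intro conjI ballI)
  show "group (GG\<lparr>carrier := AA p\<rparr>)" by (rule group.subgroup_imp_group[OF GG(1) AA_subgroup])
  show "finite (carrier (GG\<lparr>carrier := AA p\<rparr>))" using finite_subset[OF subgroup.subset[OF AA_subgroup] GG(2)] by simp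
  show "NN \<lhd> GG\<lparr>carrier := AA p\<rparr>" by (rule normal_restrict[OF NN AA_subgroup NN_subset_AA])
  show "\<Theta> \<in> Irr (GG\<lparr>carrier := AA p, carrier := NN\<rparr>)" using tensor_Irr by simp
  fix g assume "g \<in> carrier (GG\<lparr>carrier := AA p\<rparr>)"
  then have g: "g \<in> AA p" by simp
  then show "conj_act (GG\<lparr>carrier := AA p\<rparr>) NN g \<Theta> \<in> gal_orbit p NN \<Theta>"
    unfolding conj_act_restrict[OF GG(1) AA_subgroup g] by (simp add: orbit_inertia_def)
qed

lemma inertia_restrict_AA: "inertia (GG\<lparr>carrier := AA p\<rparr>) NN \<Theta> = T1 \<times> T2"
  unfolding inertia_restrict[OF GG(1) AA_subgroup] inertia_tensor using inertia_subset_AA by blast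

abbreviation "PP \<equiv> rep_tensor P1 P2"

lemma PP_eq: "PP (x, y) = kronecker (P1 x) (P2 y)" by (simp add: rep_tensor_def)

lemma dims_pos: "n1 * n2 > 0" using data1(1) data2(1) by simp

lemma PP_GL: "z \<in> T1 \<times> T2 \<Longrightarrow> PP z \<in> carrier (GL (n1 * n2))"
  using kronecker_GL[OF data1(6) data2(6)] by (auto simp: PP_eq)

lemma PP_one: "PP \<one>\<^bsub>GG\<^esub> = 1\<^sub>m (n1 * n2)"
  using data1(4) data2(4) by (simp add: PP_eq kronecker_one)

lemma T_subgroups: "subgroup T1 G1" "subgroup T2 G2"
  by (rule inertia_subgroup[OF N1 ext1], rule inertia_subgroup[OF N2 ext2])

lemma PP_mult:
  assumes "x \<in> T1" "x' \<in> T1" "y \<in> T2" "y' \<in> T2"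
  shows "PP (x, y) * PP (x', y') =
    (factor_set G1 P1 x x' * factor_set G2 P2 y y') \<cdot>\<^sub>m PP (x \<otimes>\<^bsub>G1\<^esub> x', y \<otimes>\<^bsub>G2\<^esub> y')"
proof -
  note c = GL_D[OF data1(6)[OF assms(1)]] GL_D[OF data2(6)[OF assms(3)]] GL_D[OF data1(6)[OF assms(2)]] GL_D[OF data2(6)[OF assms(4)]]
  have m: "x \<otimes>\<^bsub>G1\<^esub> x' \<in> T1" "y \<otimes>\<^bsub>G2\<^esub> y' \<in> T2"
    using assms subgroup.m_closed[OF T_subgroups(1)] subgroup.m_closed[OF T_subgroups(2)] by auto
  show ?thesis unfolding PP_eq kronecker_mult[OF c] data1(9)[OF assms(1,2)] data2(9)[OF assms(3,4)]
    by (rule kronecker_smult[OF GL_D[OF data1(6)[OF m(1)]] GL_D[OF data2(6)[OF m(2)]]])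
qed

lemma factor_set_tensor:
  assumes "x \<in> T1" "x' \<in> T1" "y \<in> T2" "y' \<in> T2"
  shows "factor_set GG PP (x, y) (x', y') = factor_set G1 P1 x x' * factor_set G2 P2 y y'"
proof (rule factor_set_eqI)
  have "x \<otimes>\<^bsub>G1\<^esub> x' \<in> T1" "y \<otimes>\<^bsub>G2\<^esub> y' \<in> T2"
    using assms subgroup.m_closed[OF T_subgroups(1)] subgroup.m_closed[OF T_subgroups(2)] by auto
  then show "PP ((x, y) \<otimes>\<^bsub>GG\<^esub> (x', y')) \<in> carrier (GL (n1 * n2))" by (simp add: PP_GL)
  show "PP (x, y) * PP (x', y') = (factor_set G1 P1 x x' * factor_set G2 P2 y y') \<cdot>\<^sub>m PP ((x, y) \<otimes>\<^bsub>GG\<^esub> (x', y'))"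
    using PP_mult[OF assms] by simp
qed (rule dims_pos)

lemma PP_factor_set:
  assumes "u \<in> T1 \<times> T2" "v \<in> T1 \<times> T2"
  shows "root_of_unity (factor_set GG PP u v)" "PP u * PP v = factor_set GG PP u v \<cdot>\<^sub>m PP (u \<otimes>\<^bsub>GG\<^esub> v)"
proof -
  obtain x y x' y' where uv: "u = (x, y)" "v = (x', y')" "x \<in> T1" "x' \<in> T1" "y \<in> T2" "y' \<in> T2"
    using assms by auto
  show "root_of_unity (factor_set GG PP u v)" "PP u * PP v = factor_set GG PP u v \<cdot>\<^sub>m PP (u \<otimes>\<^bsub>GG\<^esub> v)"
    unfolding uv(1,2) factor_set_tensor[OF uv(3-6)]
    using PP_mult[OF uv(3-6)] root_of_unity_mult[OF data1(8)[OF uv(3,4)] data2(8)[OF uv(5,6)]] by simp_all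
qed

lemma PP_irreducible: "irreducible_rep (GG\<lparr>carrier := NN\<rparr>) (n1 * n2) PP"
  using irreducible_rep_tensor[OF factor_groups data1(3) data2(3)] by (simp add: carrier_DirProd_restrict)

lemma trace_PP: "z \<in> T1 \<times> T2 \<Longrightarrow> mat_trace (PP z) = mat_trace (P1 (fst z)) * mat_trace (P2 (snd z))"
  using mat_trace_kronecker[OF GL_D[OF data1(6)] GL_D[OF data2(6)]] by (auto simp: PP_eq)

lemma NT: "N1 \<subseteq> T1" "N2 \<subseteq> T2"
  by (rule normal_subset_inertia[OF N1 \<theta>1], rule normal_subset_inertia[OF N2 \<theta>2])

lemma associated_rep_tensor: "associated_rep (GG\<lparr>carrier := AA p\<rparr>) NN \<Theta> PP"
  unfolding associated_rep_def inertia_restrict_AA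
proof (intro conjI ballI exI[of _ "n1 * n2"])
  show "projective_rep (GG\<lparr>carrier := AA p, carrier := T1 \<times> T2\<rparr>) (n1 * n2) PP"
    unfolding projective_rep_def
  proof (intro conjI ballI)
    fix u assume "u \<in> carrier (GG\<lparr>carrier := AA p, carrier := T1 \<times> T2\<rparr>)"
    then have u: "u \<in> T1 \<times> T2" by simp
    show "PP u \<in> carrier (GL (n1 * n2))" by (rule PP_GL[OF u])
    show "elements_mat (PP u) \<subseteq> Q_ab"
      using u elements_kronecker_Q_ab[OF GL_D[OF data1(6)] data1(7) GL_D[OF data2(6)] data2(7)]
      by (cases u) (auto simp: PP_eq)
    fix v assume "v \<in> carrier (GG\<lparr>carrier := AA p, carrier := T1 \<times> T2\<rparr>)"
    then have v: "v \<in> T1 \<times> T2" by simp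
    show "\<exists>c. root_of_unity c \<and> PP u * PP v = c \<cdot>\<^sub>m PP (u \<otimes>\<^bsub>GG\<lparr>carrier := AA p, carrier := T1 \<times> T2\<rparr>\<^esub> v)"
      using PP_factor_set[OF u v] by auto
  qed
  show "PP \<in> hom (GG\<lparr>carrier := AA p, carrier := NN\<rparr>) (GL (n1 * n2))"
    using PP_irreducible by (simp add: irreducible_rep_iff)
  show "(\<lambda>x\<in>NN. mat_trace (PP x)) = \<Theta>"
  proof
    fix z
    show "(\<lambda>x\<in>NN. mat_trace (PP x)) z = \<Theta> z"
    proof (cases "z \<in> NN")
      case True
      then have "z \<in> T1 \<times> T2" using NT by auto
      then show ?thesis using True trace_PP[of z] data1(12) data2(12) by (auto simp: char_tensor_def)
    qed (auto simp: char_tensor_def)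
  qed
  fix h x assume "h \<in> NN" "x \<in> T1 \<times> T2"
  then obtain h1 h2 x1 x2 where hx: "h = (h1, h2)" "x = (x1, x2)" "h1 \<in> N1" "h2 \<in> N2" "x1 \<in> T1" "x2 \<in> T2" by auto
  have hT: "h1 \<in> T1" "h2 \<in> T2" using hx NT by auto
  note c = GL_D[OF data1(6)[OF hT(1)]] GL_D[OF data2(6)[OF hT(2)]] GL_D[OF data1(6)[OF hx(5)]] GL_D[OF data2(6)[OF hx(6)]]
  show "PP (h \<otimes>\<^bsub>GG\<lparr>carrier := AA p\<rparr>\<^esub> x) = PP h * PP x"
    unfolding hx(1,2) by (simp add: PP_eq kronecker_mult[OF c] data1(10)[OF hx(3,5)] data2(10)[OF hx(4,6)])
  show "PP (x \<otimes>\<^bsub>GG\<lparr>carrier := AA p\<rparr>\<^esub> h) = PP x * PP h"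
    unfolding hx(1,2) by (simp add: PP_eq kronecker_mult[OF c(3,4,1,2)] data1(11)[OF hx(3,5)] data2(11)[OF hx(4,6)])
qed

text \<open>The Kronecker products of the matrices that conjugate the twists of \<open>P1\<close> and \<open>P2\<close> conjugate the
  twist of the tensor product.\<close>
lemma comparison_function_tensor:
  assumes ab: "a \<in> carrier G1" "b \<in> carrier G2" "(a, b) \<in> AA p" and \<sigma>: "\<sigma> \<in> galH p"
    and \<mu>1: "comparison_function G1 N1 \<theta>1 P1 a \<sigma> \<mu>1" and \<mu>2: "comparison_function G2 N2 \<theta>2 P2 b \<sigma> \<mu>2"
  shows "comparison_function (GG\<lparr>carrier := AA p\<rparr>) NN \<Theta> PP (a, b) \<sigma> (\<lambda>z. \<mu>1 (fst z) * \<mu>2 (snd z))"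
  unfolding comparison_function_def inertia_restrict_AA
proof (intro conjI ballI)
  fix z assume z: "z \<in> T1 \<times> T2"
  then show "\<mu>1 (fst z) * \<mu>2 (snd z) \<in> Q_ab - {0}"
    using \<mu>1 \<mu>2 by (auto simp: comparison_function_def intro: Q_ab.mult)
next
  fix h z assume "h \<in> NN" "z \<in> T1 \<times> T2"
  then show "\<mu>1 (fst (h \<otimes>\<^bsub>GG\<lparr>carrier := AA p\<rparr>\<^esub> z)) * \<mu>2 (snd (h \<otimes>\<^bsub>GG\<lparr>carrier := AA p\<rparr>\<^esub> z)) = \<mu>1 (fst z) * \<mu>2 (snd z)"
    using \<mu>1 \<mu>2 by (auto simp: comparison_function_def)
next
  show "\<mu>1 (fst \<one>\<^bsub>GG\<lparr>carrier := AA p\<rparr>\<^esub>) * \<mu>2 (snd \<one>\<^bsub>GG\<lparr>carrier := AA p\<rparr>\<^esub>) = 1"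
    using \<mu>1 \<mu>2 by (simp add: comparison_function_def)
next
  obtain T S where TS: "\<And>x. x \<in> T1 \<Longrightarrow> similar_mat_wit (map_mat \<sigma> (P1 (a \<otimes>\<^bsub>G1\<^esub> x \<otimes>\<^bsub>G1\<^esub> inv\<^bsub>G1\<^esub> a))) (\<mu>1 x \<cdot>\<^sub>m P1 x) T S"
    using \<mu>1 unfolding comparison_function_def by blast
  obtain T' S' where TS': "\<And>x. x \<in> T2 \<Longrightarrow> similar_mat_wit (map_mat \<sigma> (P2 (b \<otimes>\<^bsub>G2\<^esub> x \<otimes>\<^bsub>G2\<^esub> inv\<^bsub>G2\<^esub> b))) (\<mu>2 x \<cdot>\<^sub>m P2 x) T' S'"
    using \<mu>2 unfolding comparison_function_def by blast
  have inva: "inv\<^bsub>GG\<lparr>carrier := AA p\<rparr>\<^esub> (a, b) = (inv\<^bsub>G1\<^esub> a, inv\<^bsub>G2\<^esub> b)"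
    using group.m_inv_consistent[OF GG(1) AA_subgroup ab(3)] inv_DirProd[OF G1(1) G2(1) ab(1,2)] by simp
  show "\<exists>T S. \<forall>z\<in>T1 \<times> T2. similar_mat_wit
      (map_mat \<sigma> (PP ((a, b) \<otimes>\<^bsub>GG\<lparr>carrier := AA p\<rparr>\<^esub> z \<otimes>\<^bsub>GG\<lparr>carrier := AA p\<rparr>\<^esub> inv\<^bsub>GG\<lparr>carrier := AA p\<rparr>\<^esub> (a, b))))
      ((\<mu>1 (fst z) * \<mu>2 (snd z)) \<cdot>\<^sub>m PP z) T S"
  proof (intro exI ballI)
    fix z assume "z \<in> T1 \<times> T2"
    then obtain x y where z: "z = (x, y)" "x \<in> T1" "y \<in> T2" by auto
    have cx: "a \<otimes>\<^bsub>G1\<^esub> x \<otimes>\<^bsub>G1\<^esub> inv\<^bsub>G1\<^esub> a \<in> T1 \<and> b \<otimes>\<^bsub>G2\<^esub> y \<otimes>\<^bsub>G2\<^esub> inv\<^bsub>G2\<^esub> b \<in> T2"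
    proof -
      \<comment> \<open>Conjugation and the Galois action commute, so the stabiliser of the Galois orbit normalises
        the inertia group.\<close>
      obtain \<tau> where \<tau>: "\<tau> \<in> galH p" "conj_act GG NN (a, b) \<Theta> = gal_act NN \<tau> \<Theta>"
        using ab(3) by (auto simp: orbit_inertia_def gal_orbit_def)
      let ?g = "(a, b)"
      have gc: "?g \<in> carrier GG" "inv\<^bsub>GG\<^esub> ?g \<in> carrier GG" "z \<in> carrier GG"
        using ab z group.inv_closed[OF GG(1)] by (auto simp: inertia_def)
      have zf: "conj_act GG NN z \<Theta> = \<Theta>"
        using inertia_tensor z by (auto simp: inertia_def)
      have "conj_act GG NN ((?g \<otimes>\<^bsub>GG\<^esub> z) \<otimes>\<^bsub>GG\<^esub> inv\<^bsub>GG\<^esub> ?g) \<Theta> =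
        conj_act GG NN (inv\<^bsub>GG\<^esub> ?g) (conj_act GG NN z (conj_act GG NN ?g \<Theta>))"
        using conj_act_conj_act[OF NN gc(2), of "?g \<otimes>\<^bsub>GG\<^esub> z" \<Theta>] conj_act_conj_act[OF NN gc(3,1), of \<Theta>]
          monoid.m_closed[OF group.is_monoid[OF GG(1)] gc(1,3)] by simp
      also have "conj_act GG NN z (conj_act GG NN ?g \<Theta>) = conj_act GG NN ?g \<Theta>"
        unfolding \<tau>(2) conj_gal_commute[OF NN gc(3)] zf ..
      also have "conj_act GG NN (inv\<^bsub>GG\<^esub> ?g) \<dots> = \<Theta>" by (rule conj_act_inv(1)[OF NN tensor_ext gc(1)])
      finally have "(?g \<otimes>\<^bsub>GG\<^esub> z) \<otimes>\<^bsub>GG\<^esub> inv\<^bsub>GG\<^esub> ?g \<in> inertia GG NN \<Theta>"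
        using gc monoid.m_closed[OF group.is_monoid[OF GG(1)]] by (simp add: inertia_def)
      then show ?thesis unfolding inertia_tensor z(1) using inv_DirProd[OF G1(1) G2(1) ab(1,2)] by simp
    qed
    have e1: "map_mat \<sigma> (PP ((a, b) \<otimes>\<^bsub>GG\<lparr>carrier := AA p\<rparr>\<^esub> z \<otimes>\<^bsub>GG\<lparr>carrier := AA p\<rparr>\<^esub> inv\<^bsub>GG\<lparr>carrier := AA p\<rparr>\<^esub> (a, b))) =
      kronecker (map_mat \<sigma> (P1 (a \<otimes>\<^bsub>G1\<^esub> x \<otimes>\<^bsub>G1\<^esub> inv\<^bsub>G1\<^esub> a))) (map_mat \<sigma> (P2 (b \<otimes>\<^bsub>G2\<^esub> y \<otimes>\<^bsub>G2\<^esub> inv\<^bsub>G2\<^esub> b)))"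
      unfolding inva z(1)
      using map_mat_kronecker[OF \<sigma> GL_D[OF data1(6)] data1(7) GL_D[OF data2(6)] data2(7)] cx by (simp add: PP_eq)
    have e2: "(\<mu>1 (fst z) * \<mu>2 (snd z)) \<cdot>\<^sub>m PP z = kronecker (\<mu>1 x \<cdot>\<^sub>m P1 x) (\<mu>2 y \<cdot>\<^sub>m P2 y)"
      unfolding z(1) PP_eq fst_conv snd_conv
      by (rule kronecker_smult[OF GL_D[OF data1(6)[OF z(2)]] GL_D[OF data2(6)[OF z(3)]], symmetric])
    show "similar_mat_wit
      (map_mat \<sigma> (PP ((a, b) \<otimes>\<^bsub>GG\<lparr>carrier := AA p\<rparr>\<^esub> z \<otimes>\<^bsub>GG\<lparr>carrier := AA p\<rparr>\<^esub> inv\<^bsub>GG\<lparr>carrier := AA p\<rparr>\<^esub> (a, b))))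
      ((\<mu>1 (fst z) * \<mu>2 (snd z)) \<cdot>\<^sub>m PP z) (kronecker T T') (kronecker S S')"
      unfolding e1 e2 by (rule similar_mat_wit_kronecker[OF TS[OF z(2)] TS'[OF z(3)]])
  qed
qed

lemma conj_orbit_tensor:
  assumes "x \<in> carrier G1" "y \<in> carrier G2"
  shows "conj_orbit GG NN (x, y) = conj_orbit G1 N1 x \<times> conj_orbit G2 N2 y"
proof -
  have "conj_orbit GG NN (x, y) = (\<lambda>(h1, h2). (h1 \<otimes>\<^bsub>G1\<^esub> x \<otimes>\<^bsub>G1\<^esub> inv\<^bsub>G1\<^esub> h1, h2 \<otimes>\<^bsub>G2\<^esub> y \<otimes>\<^bsub>G2\<^esub> inv\<^bsub>G2\<^esub> h2)) ` NN"
    unfolding conj_orbit_def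
    by (intro image_cong refl) (auto simp: inv_DirProd[OF G1(1) G2(1)])
  then show ?thesis by (auto simp: conj_orbit_def)
qed

end

section \<open>The block relation for a direct product\<close>

lemma mixed_inertia_restrict:
  assumes "group G" "subgroup A G" "B \<subseteq> A"
  shows "mixed_inertia p (G\<lparr>carrier := A\<rparr>) B N \<chi> = mixed_inertia p G B N \<chi>"
  using conj_act_restrict[OF assms(1,2)] assms(3) by (auto simp: mixed_inertia_def)

lemma factor_set_restrict: "factor_set (G\<lparr>carrier := A\<rparr>) P = factor_set G P"
  by (simp add: factor_set_def fun_eq_iff)

lemma defect_group_subset:
  assumes "defect_group \<MM> p G B D"
  shows "D \<subseteq> carrier G" "D \<noteq> {}"
proof -
  obtain x where s: "subgroup D (G\<lparr>carrier := centralizer G {x}\<rparr>)"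
    using assms by (auto simp: defect_group_def sylow_subgroup_def)
  show "D \<subseteq> carrier G" "D \<noteq> {}"
    using subgroup.subset[OF s] subgroup.one_closed[OF s] by (auto simp: centralizer_def)
qed

lemma Dedekind_modular_law:
  assumes "group G" "subgroup W G" "N \<subseteq> W" "H \<subseteq> carrier G" "carrier G = N <#>\<^bsub>G\<^esub> H"
  shows "W = N <#>\<^bsub>G\<^esub> (H \<inter> W)"
proof (intro equalityI subsetI)
  interpret group G by fact
  interpret W: subgroup W G by fact
  fix g assume g: "g \<in> W"
  then obtain n h where nh: "n \<in> N" "h \<in> H" "g = n \<otimes>\<^bsub>G\<^esub> h"
    using assms(5) W.subset by (auto simp: set_mult_def)
  have c: "n \<in> carrier G" "h \<in> carrier G" "n \<in> W" using nh assms(3,4) W.subset by auto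
  have "h = inv\<^bsub>G\<^esub> n \<otimes>\<^bsub>G\<^esub> g" using c unfolding nh(3) by (simp add: m_assoc[symmetric])
  then have "h \<in> W" using c(3) g by simp
  then show "g \<in> N <#>\<^bsub>G\<^esub> (H \<inter> W)" using nh by (auto simp: set_mult_def)
next
  interpret W: subgroup W G by fact
  fix g assume "g \<in> N <#>\<^bsub>G\<^esub> (H \<inter> W)"
  then show "g \<in> W" using assms(3) by (auto simp: set_mult_def)
qed

lemma set_mult_DirProd:
  "(A \<times> B) <#>\<^bsub>G1 \<times>\<times> G2\<^esub> (C \<times> D) = (A <#>\<^bsub>G1\<^esub> C) \<times> (B <#>\<^bsub>G2\<^esub> D)"
  unfolding set_mult_def by force

lemma set_mult_restrict: "A <#>\<^bsub>G\<lparr>carrier := C\<rparr>\<^esub> B = A <#>\<^bsub>G\<^esub> B"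
  by (simp add: set_mult_def)

lemma scalar_kronecker:
  assumes "A = z \<cdot>\<^sub>m 1\<^sub>m (dim_row A)" "B = w \<cdot>\<^sub>m 1\<^sub>m (dim_row B)"
  shows "kronecker A B = (z * w) \<cdot>\<^sub>m 1\<^sub>m (dim_row (kronecker A B))"
proof -
  have "kronecker A B = kronecker (z \<cdot>\<^sub>m 1\<^sub>m (dim_row A)) (w \<cdot>\<^sub>m 1\<^sub>m (dim_row B))" using assms by simp
  also have "\<dots> = (z * w) \<cdot>\<^sub>m 1\<^sub>m (dim_row A * dim_row B)"
    by (subst kronecker_smult[OF one_carrier_mat one_carrier_mat]) (simp add: kronecker_one)
  finally show ?thesis by (simp add: kronecker_def)
qed

theorem lemma1p7:
  fixes p :: nat and \<MM> :: "complex set"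
    and G1 :: "('a, 'm) monoid_scheme" and G2 :: "('b, 'n) monoid_scheme"
    and N1 H1 M1 D1 :: "'a set" and N2 H2 M2 D2 :: "'b set"
    and \<theta>1 \<phi>1 :: "'a \<Rightarrow> complex" and \<theta>2 \<phi>2 :: "'b \<Rightarrow> complex"
    and P1 P1' :: "'a \<Rightarrow> complex mat" and P2 P2' :: "'b \<Rightarrow> complex mat"
  assumes "prime p"
    and "maximalideal \<MM> alg_int_ring" and "of_nat p \<in> \<MM>"
    and "affords_block_rel \<MM> p G1 N1 \<theta>1 H1 M1 \<phi>1 P1 P1' D1"
    and "affords_block_rel \<MM> p G2 N2 \<theta>2 H2 M2 \<phi>2 P2 P2' D2"
  shows
    "let G = G1 \<times>\<times> G2; H = H1 \<times> H2; N = N1 \<times> N2; M = M1 \<times> M2;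
         \<Theta> = char_tensor N1 N2 \<theta>1 \<theta>2; \<Phi> = char_tensor M1 M2 \<phi>1 \<phi>2;
         D = D1 \<times> D2
     in affords_block_rel \<MM> p
          (G\<lparr>carrier := orbit_inertia p G N \<Theta>\<rparr>) N \<Theta>
          (orbit_inertia p (G\<lparr>carrier := H\<rparr>) M \<Phi>) M \<Phi>
          (rep_tensor P1 P2) (rep_tensor P1' P2') D"
proof -
  note MM = assms(2) and r1 = affords_block_rel_data[OF assms(4)] and r2 = affords_block_rel_data[OF assms(5)]
  interpret X: associated_pair G1 G2 N1 N2 \<theta>1 \<theta>2 P1 P2
    by (rule associated_pair.intro[OF r1(1,2) r2(1,2) r1(3) r2(3) r1(4) r2(4) r1(14) r2(14)])
  interpret Y: associated_pair "G1\<lparr>carrier := H1\<rparr>" "G2\<lparr>carrier := H2\<rparr>" M1 M2 \<phi>1 \<phi>2 P1' P2'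
    by (rule associated_pair.intro[OF r1(7,8) r2(7,8) r1(9) r2(9) r1(10) r2(10) r1(15) r2(15)])
  let ?G = "G1 \<times>\<times> G2" and ?H = "H1 \<times> H2" and ?N = "N1 \<times> N2" and ?M = "M1 \<times> M2"
    and ?\<Theta> = "char_tensor N1 N2 \<theta>1 \<theta>2" and ?\<Phi> = "char_tensor M1 M2 \<phi>1 \<phi>2"
    and ?P = "rep_tensor P1 P2" and ?P' = "rep_tensor P1' P2'"
  let ?GH = "(G1\<lparr>carrier := H1\<rparr>) \<times>\<times> (G2\<lparr>carrier := H2\<rparr>)"
  define A where "A = orbit_inertia p ?G ?N ?\<Theta>"
  define B where "B = orbit_inertia p ?GH ?M ?\<Phi>"
  have GH: "?G\<lparr>carrier := ?H\<rparr> = ?GH" by (rule carrier_DirProd_restrict)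
  have eqB: "?GH\<lparr>carrier := C\<rparr> = ?G\<lparr>carrier := C\<rparr>" for C by (simp add: DirProd_def)
  interpret G: group ?G by (rule X.GG(1))
  have H: "subgroup ?H ?G" by (rule DirProd_subgroups[OF r1(1,5) r2(1,5)])
  have H1c: "H1 \<subseteq> carrier G1" and H2c: "H2 \<subseteq> carrier G2"
    using subgroup.subset[OF r1(5)] subgroup.subset[OF r2(5)] by auto
  have A: "subgroup A ?G" unfolding A_def by (rule X.AA_subgroup)
  have T1: "Y.T1 = H1 \<inter> X.T1" and T2: "Y.T2 = H2 \<inter> X.T2"
    using affords_inertia[OF assms(4)] affords_inertia[OF assms(5)] by auto
  have TA: "X.T1 \<times> X.T2 \<subseteq> A" unfolding A_def by (rule X.inertia_subset_AA)
  have NA: "?N \<subseteq> A" unfolding A_def by (rule X.NN_subset_AA)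
  have conjGH: "conj_act ?GH L h \<chi> = conj_act ?G L h \<chi>" if "h \<in> ?H" for L h \<chi>
    using conj_act_restrict[OF G.is_group H that] by (simp add: GH)
  have m1: "mixed_inertia p (G1\<lparr>carrier := H1\<rparr>) H1 M1 \<phi>1 = mixed_inertia p G1 H1 N1 \<theta>1"
    using mixed_inertia_restrict[OF r1(1,5), of H1] r1(13) by simp
  have m2: "mixed_inertia p (G2\<lparr>carrier := H2\<rparr>) H2 M2 \<phi>2 = mixed_inertia p G2 H2 N2 \<theta>2"
    using mixed_inertia_restrict[OF r2(1,5), of H2] r2(13) by simp
  \<comment> \<open>Both mixed inertia groups over \<open>H1 \<times> H2\<close> are described by the same condition on the components.\<close>
  have mixX: "((a, b), \<sigma>) \<in> mixed_inertia p ?G ?H ?N ?\<Theta> \<longleftrightarrow>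
      (a, \<sigma>) \<in> mixed_inertia p G1 H1 N1 \<theta>1 \<and> (b, \<sigma>) \<in> mixed_inertia p G2 H2 N2 \<theta>2" for a b \<sigma>
    by (rule X.mixed_inertia_tensor[OF H1c H2c])
  have mixY: "((a, b), \<sigma>) \<in> mixed_inertia p ?GH ?H ?M ?\<Phi> \<longleftrightarrow>
      (a, \<sigma>) \<in> mixed_inertia p G1 H1 N1 \<theta>1 \<and> (b, \<sigma>) \<in> mixed_inertia p G2 H2 N2 \<theta>2" for a b \<sigma>
    unfolding m1[symmetric] m2[symmetric] by (rule Y.mixed_inertia_tensor) auto
  have mix: "mixed_inertia p ?G ?H ?N ?\<Theta> = mixed_inertia p ?GH ?H ?M ?\<Phi>"
  proof (rule Set.set_eqI)
    fix w :: "('a \<times> 'b) \<times> (complex \<Rightarrow> complex)"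
    obtain a b \<sigma> where "w = ((a, b), \<sigma>)" by (metis surj_pair)
    then show "w \<in> mixed_inertia p ?G ?H ?N ?\<Theta> \<longleftrightarrow> w \<in> mixed_inertia p ?GH ?H ?M ?\<Phi>"
      using mixX mixY by simp
  qed
  \<comment> \<open>An element stabilises a Galois orbit iff it occurs in the mixed inertia group, so the
    equality of the latter transfers to the former.\<close>
  have BHA: "B = ?H \<inter> A"
  proof (intro equalityI subsetI)
    fix h assume h: "h \<in> B"
    then have hH: "h \<in> ?H" "h \<in> carrier ?GH" by (auto simp: B_def orbit_inertia_def)
    have "\<exists>\<sigma>. (h, \<sigma>) \<in> mixed_inertia p ?GH ?H ?M ?\<Phi>"
      using h orbit_inertia_iff_mixed[OF Y.NN Y.tensor_ext Y.tensor_Q hH, of p] by (simp add: B_def)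
    then have "h \<in> A" unfolding A_def
      using orbit_inertia_iff_mixed[OF X.NN X.tensor_ext X.tensor_Q hH(1), of p] subgroup.subset[OF H] hH mix by auto
    then show "h \<in> ?H \<inter> A" using hH by simp
  next
    fix h assume h: "h \<in> ?H \<inter> A"
    then have hH: "h \<in> ?H" "h \<in> carrier ?G" "h \<in> carrier ?GH" using subgroup.subset[OF H] by auto
    have "\<exists>\<sigma>. (h, \<sigma>) \<in> mixed_inertia p ?G ?H ?N ?\<Theta>"
      using h orbit_inertia_iff_mixed[OF X.NN X.tensor_ext X.tensor_Q hH(1,2), of p] by (simp add: A_def)
    then show "h \<in> B" unfolding B_def
      using orbit_inertia_iff_mixed[OF Y.NN Y.tensor_ext Y.tensor_Q hH(1,3), of p] mix by auto
  qed
  have B: "subgroup B ?G" unfolding BHA by (rule G.subgroups_Inter_pair[OF H A])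
  have BA: "B \<subseteq> A" and BH: "B \<subseteq> ?H" using BHA by auto
  have M: "?M = ?N \<inter> B" using r1(6) r2(6) NA BHA by auto
  have TB: "Y.T1 \<times> Y.T2 \<subseteq> B" unfolding BHA T1 T2 using TA by auto
  have TY: "w \<in> Y.T1 \<times> Y.T2" if "w \<in> X.T1 \<times> X.T2" "w \<in> B" for w
    using that unfolding BHA T1 T2 by auto
  have inX: "inertia (?G\<lparr>carrier := A\<rparr>) ?N ?\<Theta> = X.T1 \<times> X.T2" unfolding A_def by (rule X.inertia_restrict_AA)
  have inY: "inertia (?G\<lparr>carrier := B\<rparr>) ?M ?\<Phi> = Y.T1 \<times> Y.T2"
    using Y.inertia_restrict_AA[of p] by (simp add: B_def[symmetric] eqB)
  have fsP: "factor_set ?G ?P u v = factor_set ?G ?P' u v" if uvT: "u \<in> Y.T1 \<times> Y.T2" "v \<in> Y.T1 \<times> Y.T2" for u v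
  proof -
    obtain x y x' y' where uv: "u = (x, y)" "v = (x', y')" and Y: "x \<in> Y.T1" "x' \<in> Y.T1" "y \<in> Y.T2" "y' \<in> Y.T2"
      using uvT by auto
    then have X: "x \<in> X.T1" "x' \<in> X.T1" "y \<in> X.T2" "y' \<in> X.T2" using T1 T2 by auto
    have "factor_set ?GH ?P' = factor_set ?G ?P'" by (simp add: GH[symmetric] factor_set_restrict)
    then show ?thesis unfolding uv X.factor_set_tensor[OF X]
      using Y.factor_set_tensor[OF Y] r1(16) r2(16) Y by (simp add: factor_set_restrict)
  qed
  have NH: "carrier ?G = ?N <#>\<^bsub>?G\<^esub> ?H"
    unfolding set_mult_DirProd using r1(11) r2(11) by simp
  have goal: "affords_block_rel \<MM> p (?G\<lparr>carrier := A\<rparr>) ?N ?\<Theta> B ?M ?\<Phi> ?P ?P' (D1 \<times> D2)"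
    unfolding affords_block_rel_def
  proof (intro conjI)
    show "H_triple p (?G\<lparr>carrier := A\<rparr>) ?N ?\<Theta>" unfolding A_def by (rule X.H_triple_tensor)
    show "subgroup B (?G\<lparr>carrier := A\<rparr>)" by (rule G.subgroup_incl[OF B A BA])
    show "?M = ?N \<inter> B" by (rule M)
    show "H_triple p (?G\<lparr>carrier := A, carrier := B\<rparr>) ?M ?\<Phi>"
      using Y.H_triple_tensor[of p] by (simp add: B_def[symmetric] eqB)
    show "carrier (?G\<lparr>carrier := A\<rparr>) = ?N <#>\<^bsub>?G\<lparr>carrier := A\<rparr>\<^esub> B"
      using Dedekind_modular_law[OF G.is_group A NA subgroup.subset[OF H] NH] by (simp add: set_mult_restrict BHA)
    have cent: "c1 \<in> centralizer G1 N1 \<and> c2 \<in> centralizer G2 N2"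
      if c: "(c1, c2) \<in> centralizer (?G\<lparr>carrier := A\<rparr>) ?N" for c1 c2
    proof -
      have cc: "c1 \<in> carrier G1" "c2 \<in> carrier G2" using c subgroup.subset[OF A] by (auto simp: centralizer_def)
      have one: "\<one>\<^bsub>G1\<^esub> \<in> N1" "\<one>\<^bsub>G2\<^esub> \<in> N2" using r1(3) r2(3) by (auto simp: normal_def subgroup.one_closed)
      have e: "c1 \<otimes>\<^bsub>G1\<^esub> s = s \<otimes>\<^bsub>G1\<^esub> c1 \<and> c2 \<otimes>\<^bsub>G2\<^esub> t = t \<otimes>\<^bsub>G2\<^esub> c2" if "s \<in> N1" "t \<in> N2" for s t
        using c that by (auto simp: centralizer_def)
      show ?thesis using cc e one by (auto simp: centralizer_def)
    qed
    show "centralizer (?G\<lparr>carrier := A\<rparr>) ?N \<subseteq> B"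
    proof
      fix c assume c: "c \<in> centralizer (?G\<lparr>carrier := A\<rparr>) ?N"
      obtain c1 c2 where c12: "c = (c1, c2)" by (cases c)
      have "c \<in> ?H" using cent[of c1 c2] c r1(12) r2(12) unfolding c12 by auto
      then show "c \<in> B" unfolding BHA using c by (simp add: centralizer_def)
    qed
    have mixA: "mixed_inertia p (?G\<lparr>carrier := A\<rparr>) B ?N ?\<Theta> = {w \<in> mixed_inertia p ?G ?H ?N ?\<Theta>. fst w \<in> B}"
      unfolding mixed_inertia_restrict[OF G.is_group A BA] using BH by (auto simp: mixed_inertia_def)
    have "mixed_inertia p (?G\<lparr>carrier := A\<rparr>) B ?M ?\<Phi> = {w \<in> mixed_inertia p ?GH ?H ?M ?\<Phi>. fst w \<in> B}"
      unfolding mixed_inertia_restrict[OF G.is_group A BA] using BH conjGH by (auto simp: mixed_inertia_def)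
    then show "mixed_inertia p (?G\<lparr>carrier := A\<rparr>) B ?N ?\<Theta> = mixed_inertia p (?G\<lparr>carrier := A\<rparr>) B ?M ?\<Phi>"
      unfolding mixA mix by simp
    show "associated_rep (?G\<lparr>carrier := A\<rparr>) ?N ?\<Theta> ?P" unfolding A_def by (rule X.associated_rep_tensor)
    show "associated_rep (?G\<lparr>carrier := A, carrier := B\<rparr>) ?M ?\<Phi> ?P'"
      using Y.associated_rep_tensor[of p] by (simp add: B_def[symmetric] eqB)
    show "\<forall>x\<in>inertia (?G\<lparr>carrier := A, carrier := B\<rparr>) ?M ?\<Phi>. \<forall>y\<in>inertia (?G\<lparr>carrier := A, carrier := B\<rparr>) ?M ?\<Phi>.
        factor_set (?G\<lparr>carrier := A\<rparr>) ?P x y = factor_set (?G\<lparr>carrier := A\<rparr>) ?P' x y"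
      using fsP by (simp add: inY factor_set_restrict)
    show "\<forall>c\<in>centralizer (?G\<lparr>carrier := A\<rparr>) ?N. \<exists>z. ?P c = z \<cdot>\<^sub>m 1\<^sub>m (dim_row (?P c)) \<and> ?P' c = z \<cdot>\<^sub>m 1\<^sub>m (dim_row (?P' c))"
    proof
      fix c assume c: "c \<in> centralizer (?G\<lparr>carrier := A\<rparr>) ?N"
      obtain c1 c2 where c12: "c = (c1, c2)" by (cases c)
      obtain z where z: "P1 c1 = z \<cdot>\<^sub>m 1\<^sub>m (dim_row (P1 c1))" "P1' c1 = z \<cdot>\<^sub>m 1\<^sub>m (dim_row (P1' c1))"
        using r1(17) cent[of c1 c2] c unfolding c12 by blast
      obtain w where w: "P2 c2 = w \<cdot>\<^sub>m 1\<^sub>m (dim_row (P2 c2))" "P2' c2 = w \<cdot>\<^sub>m 1\<^sub>m (dim_row (P2' c2))"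
        using r2(17) cent[of c1 c2] c unfolding c12 by blast
      show "\<exists>z. ?P c = z \<cdot>\<^sub>m 1\<^sub>m (dim_row (?P c)) \<and> ?P' c = z \<cdot>\<^sub>m 1\<^sub>m (dim_row (?P' c))"
        unfolding c12 X.PP_eq Y.PP_eq
        using scalar_kronecker[OF z(1) w(1)] scalar_kronecker[OF z(2) w(2)] by blast
    qed
    show "\<forall>(h, \<sigma>)\<in>mixed_inertia p (?G\<lparr>carrier := A\<rparr>) B ?N ?\<Theta>. \<exists>\<mu> \<mu>'.
        comparison_function (?G\<lparr>carrier := A\<rparr>) ?N ?\<Theta> ?P h \<sigma> \<mu> \<and>
        comparison_function (?G\<lparr>carrier := A, carrier := B\<rparr>) ?M ?\<Phi> ?P' h \<sigma> \<mu>' \<and>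
        (\<forall>x\<in>inertia (?G\<lparr>carrier := A, carrier := B\<rparr>) ?M ?\<Phi>. \<mu>' x = \<mu> x)"
    proof (intro ballI, clarify)
      fix a b \<sigma> assume w: "((a, b), \<sigma>) \<in> mixed_inertia p (?G\<lparr>carrier := A\<rparr>) B ?N ?\<Theta>"
      then have abB: "(a, b) \<in> B" and \<sigma>: "\<sigma> \<in> galH p" by (auto simp: mixed_inertia_def)
      have w12: "(a, \<sigma>) \<in> mixed_inertia p G1 H1 N1 \<theta>1" "(b, \<sigma>) \<in> mixed_inertia p G2 H2 N2 \<theta>2"
        using w unfolding mixA using mixX by auto
      have abH: "a \<in> H1" "b \<in> H2" using abB BH by auto
      obtain \<mu>1 \<mu>1' where \<mu>1: "comparison_function G1 N1 \<theta>1 P1 a \<sigma> \<mu>1"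
        "comparison_function (G1\<lparr>carrier := H1\<rparr>) M1 \<phi>1 P1' a \<sigma> \<mu>1'" "\<forall>x\<in>Y.T1. \<mu>1' x = \<mu>1 x"
        using r1(18) w12(1) by blast
      obtain \<mu>2 \<mu>2' where \<mu>2: "comparison_function G2 N2 \<theta>2 P2 b \<sigma> \<mu>2"
        "comparison_function (G2\<lparr>carrier := H2\<rparr>) M2 \<phi>2 P2' b \<sigma> \<mu>2'" "\<forall>x\<in>Y.T2. \<mu>2' x = \<mu>2 x"
        using r2(18) w12(2) by blast
      have cX: "comparison_function (?G\<lparr>carrier := A\<rparr>) ?N ?\<Theta> ?P (a, b) \<sigma> (\<lambda>z. \<mu>1 (fst z) * \<mu>2 (snd z))"
        using X.comparison_function_tensor[OF _ _ _ \<sigma> \<mu>1(1) \<mu>2(1)] abH abB H1c H2c BA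
        by (auto simp: A_def[symmetric])
      have cY: "comparison_function (?GH\<lparr>carrier := B\<rparr>) ?M ?\<Phi> ?P' (a, b) \<sigma> (\<lambda>z. \<mu>1' (fst z) * \<mu>2' (snd z))"
        using Y.comparison_function_tensor[OF _ _ _ \<sigma> \<mu>1(2) \<mu>2(2)] abH abB
        by (auto simp: B_def[symmetric])
      show "\<exists>\<mu> \<mu>'. comparison_function (?G\<lparr>carrier := A\<rparr>) ?N ?\<Theta> ?P (a, b) \<sigma> \<mu> \<and>
        comparison_function (?G\<lparr>carrier := A, carrier := B\<rparr>) ?M ?\<Phi> ?P' (a, b) \<sigma> \<mu>' \<and>
        (\<forall>x\<in>inertia (?G\<lparr>carrier := A, carrier := B\<rparr>) ?M ?\<Phi>. \<mu>' x = \<mu> x)"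
      proof (intro exI conjI)
        show "comparison_function (?G\<lparr>carrier := A, carrier := B\<rparr>) ?M ?\<Phi> ?P' (a, b) \<sigma> (\<lambda>z. \<mu>1' (fst z) * \<mu>2' (snd z))"
          using cY by (simp add: eqB)
        show "\<forall>x\<in>inertia (?G\<lparr>carrier := A, carrier := B\<rparr>) ?M ?\<Phi>. \<mu>1' (fst x) * \<mu>2' (snd x) = \<mu>1 (fst x) * \<mu>2 (snd x)"
          using \<mu>1(3) \<mu>2(3) by (auto simp: inY)
      qed (rule cX)
    qed
    have fgX: "G1\<lparr>carrier := N1\<rparr> \<times>\<times> G2\<lparr>carrier := N2\<rparr> = ?G\<lparr>carrier := ?N\<rparr>" by (rule carrier_DirProd_restrict[symmetric])
    have fgY: "G1\<lparr>carrier := M1\<rparr> \<times>\<times> G2\<lparr>carrier := M2\<rparr> = ?G\<lparr>carrier := ?M\<rparr>" by (rule carrier_DirProd_restrict[symmetric])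
    show "defect_group \<MM> p (?G\<lparr>carrier := A, carrier := ?N\<rparr>) (bl \<MM> (?G\<lparr>carrier := A, carrier := ?N\<rparr>) ?\<Theta>) (D1 \<times> D2)"
      using defect_group_DirProd[OF MM assms(1,3) X.factor_groups r1(4) r2(4) r1(19) r2(19)] by (simp add: fgX)
    have Yf: "group (G1\<lparr>carrier := M1\<rparr>)" "finite (carrier (G1\<lparr>carrier := M1\<rparr>))"
      "group (G2\<lparr>carrier := M2\<rparr>)" "finite (carrier (G2\<lparr>carrier := M2\<rparr>))"
      "\<phi>1 \<in> Irr (G1\<lparr>carrier := M1\<rparr>)" "\<phi>2 \<in> Irr (G2\<lparr>carrier := M2\<rparr>)"
      using Y.factor_groups r1(10) r2(10) by simp_all
    show "defect_group \<MM> p (?G\<lparr>carrier := A, carrier := ?M\<rparr>) (bl \<MM> (?G\<lparr>carrier := A, carrier := ?M\<rparr>) ?\<Phi>) (D1 \<times> D2)"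
      using defect_group_DirProd[OF MM assms(1,3) Yf r1(20) r2(20)] by (simp add: fgY)
    show "normalizer (?G\<lparr>carrier := A, carrier := ?N\<rparr>) (D1 \<times> D2) \<subseteq> ?M"
    proof -
      have "normalizer (?G\<lparr>carrier := ?N\<rparr>) (D1 \<times> D2) \<subseteq> normalizer (G1\<lparr>carrier := N1\<rparr>) D1 \<times> normalizer (G2\<lparr>carrier := N2\<rparr>) D2"
        unfolding fgX[symmetric]
        by (rule normalizer_DirProd_subset[OF X.factor_groups(1,3)])
          (use defect_group_subset[OF r1(19)] defect_group_subset[OF r2(19)] in auto)
      then show ?thesis using r1(21) r2(21) by auto
    qed
    show "\<forall>W. subgroup W (?G\<lparr>carrier := A\<rparr>) \<and> ?N \<subseteq> W \<and> W \<subseteq> inertia (?G\<lparr>carrier := A\<rparr>) ?N ?\<Theta> \<longrightarrow>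
        (\<forall>(\<xi>, \<psi>)\<in>afforded_graph (?G\<lparr>carrier := A\<rparr>) ?N ?\<Theta> B ?P ?P' W.
           induced_block_eq \<MM> (?G\<lparr>carrier := A, carrier := W\<rparr>) (W \<inter> B)
             (bl \<MM> (?G\<lparr>carrier := A, carrier := W \<inter> B\<rparr>) \<psi>) (bl \<MM> (?G\<lparr>carrier := A, carrier := W\<rparr>) \<xi>))"
    proof (intro allI impI ballI, clarify)
      fix W \<xi> \<psi>
      assume W0: "subgroup W (?G\<lparr>carrier := A\<rparr>)" "?N \<subseteq> W" "W \<subseteq> inertia (?G\<lparr>carrier := A\<rparr>) ?N ?\<Theta>"
        and g: "(\<xi>, \<psi>) \<in> afforded_graph (?G\<lparr>carrier := A\<rparr>) ?N ?\<Theta> B ?P ?P' W"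
      have WT: "W \<subseteq> X.T1 \<times> X.T2" using W0(3) unfolding inX .
      have W: "subgroup W ?G" by (rule G.incl_subgroup[OF A W0(1)])
      let ?W = "?G\<lparr>carrier := W\<rparr>"
      define J where "J = W \<inter> B"
      have J: "subgroup J ?G" unfolding J_def by (rule G.subgroups_Inter_pair[OF W B])
      have JW: "J \<subseteq> W" by (simp add: J_def)
      have JT: "J \<subseteq> Y.T1 \<times> Y.T2" using WT TY by (auto simp: J_def)
      have gW: "group ?W" "finite (carrier ?W)"
        using G.subgroup_imp_group[OF W] finite_subset[OF subgroup.subset[OF W] X.GG(2)] by auto
      obtain m Q where \<xi>0: "\<xi> \<in> Irr_over ?W ?N ?\<Theta>" and pQ: "projective_rep ?W m Q"
        and QN: "\<forall>x\<in>W. \<forall>n\<in>?N. Q (n \<otimes>\<^bsub>?G\<^esub> x) = Q x"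
        and fsQ: "\<forall>x\<in>W. \<forall>y\<in>W. factor_set ?G Q x y = inverse (factor_set ?G ?P x y)"
        and \<xi>: "\<xi> = (\<lambda>x\<in>W. mat_trace (kronecker (Q x) (?P x)))"
        and \<psi>: "\<psi> = (\<lambda>x\<in>W \<inter> B. mat_trace (kronecker (Q x) (?P' x)))"
        using g by (auto simp: afforded_graph_def factor_set_restrict)
      have \<xi>I: "\<xi> \<in> Irr ?W" using \<xi>0 by (simp add: Irr_over_def)
      have oneW: "\<one>\<^bsub>?G\<^esub> \<in> W" by (rule subgroup.one_closed[OF W])
      have QGL: "Q x \<in> carrier (GL m)" if "x \<in> W" for x using pQ that by (simp add: projective_rep_def)
      \<comment> \<open>Degree 0 is excluded because the degree of \<open>\<xi>\<close> is positive.\<close>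
      have m: "m > 0"
      proof (rule ccontr)
        assume "\<not> m > 0"
        then have "Q \<one>\<^bsub>?G\<^esub> \<in> carrier_mat 0 0" using GL_D[OF QGL[OF oneW]] by simp
        then have "mat_trace (kronecker (Q \<one>\<^bsub>?G\<^esub>) (?P \<one>\<^bsub>?G\<^esub>)) = 0" by (simp add: mat_trace_def kronecker_def)
        then have "\<xi> \<one>\<^bsub>?W\<^esub> = 0" using oneW by (simp add: \<xi>)
        moreover obtain k where "k > (0::nat)" "\<xi> \<one>\<^bsub>?W\<^esub> = of_nat k" using Irr_one[OF gW(1) \<xi>I] .
        ultimately show False by simp
      qed
      have Qm: "Q x * Q y = inverse (factor_set ?G ?P x y) \<cdot>\<^sub>m Q (x \<otimes>\<^bsub>?W\<^esub> y)" if "x \<in> W" "y \<in> W" for x y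
        using projective_rep_factor_set(2)[OF pQ m gW(1), of x y] fsQ that by (simp add: factor_set_restrict)
      have NW: "?N \<lhd> ?W" by (rule normal_restrict[OF X.NN W W0(2)])
      have subJ: "subgroup J ?W" by (rule G.subgroup_incl[OF J W JW])
      have JHW: "J = ?H \<inter> W" unfolding J_def BHA using WT TA by auto
      have WNJ: "carrier ?W = ?N <#>\<^bsub>?W\<^esub> J"
        using Dedekind_modular_law[OF G.is_group W W0(2) subgroup.subset[OF H] NH] by (simp add: set_mult_restrict JHW)
      have orbW: "conj_orbit ?W ?N x = conj_orbit ?G ?N x" for x
        unfolding conj_orbit_def using W0(2) G.m_inv_consistent[OF W] by (intro image_cong refl) auto
      \<comment> \<open>The congruence for the product is the product of the congruences for the factors.\<close>
      have orb: "(\<Sum>y\<in>conj_orbit ?W ?N x. mat_trace (?P y)) / of_nat (X.n1 * X.n2)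
          - (\<Sum>y\<in>conj_orbit ?W ?N x \<inter> J. mat_trace (?P' y)) / of_nat (Y.n1 * Y.n2) \<in> \<MM>" if x: "x \<in> carrier ?W" for x
      proof -
        obtain x1 x2 where x12: "x = (x1, x2)" "x1 \<in> X.T1" "x2 \<in> X.T2" using x WT by auto
        have xc: "x1 \<in> carrier G1" "x2 \<in> carrier G2" using x12 by (auto simp: inertia_def)
        let ?O1 = "conj_orbit G1 N1 x1" and ?O2 = "conj_orbit G2 N2 x2"
        have O: "conj_orbit ?W ?N x = ?O1 \<times> ?O2" unfolding orbW x12(1) by (rule X.conj_orbit_tensor[OF xc])
        have OW: "?O1 \<times> ?O2 \<subseteq> W"
        proof
          fix y assume "y \<in> ?O1 \<times> ?O2"
          then obtain h where "h \<in> ?N" "y = h \<otimes>\<^bsub>?G\<^esub> x \<otimes>\<^bsub>?G\<^esub> inv\<^bsub>?G\<^esub> h"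
            unfolding O[symmetric] orbW by (auto simp: conj_orbit_def)
          then show "y \<in> W" using x W0(2) subgroup.m_closed[OF W] subgroup.m_inv_closed[OF W]
            by (metis subsetD partial_object.select_convs(1) partial_object.surjective partial_object.update_convs(1))
        qed
        have OJ: "?O1 \<times> ?O2 \<inter> J = (?O1 \<inter> H1) \<times> (?O2 \<inter> H2)"
          using OW WT TA unfolding J_def BHA by blast
        have "(\<Sum>y\<in>?O1 \<times> ?O2. mat_trace (?P y)) = (\<Sum>y\<in>?O1 \<times> ?O2. mat_trace (P1 (fst y)) * mat_trace (P2 (snd y)))"
          by (intro sum.cong refl X.trace_PP) (use OW WT in blast)
        also have "\<dots> = (\<Sum>y\<in>?O1. mat_trace (P1 y)) * (\<Sum>y\<in>?O2. mat_trace (P2 y))"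
          by (simp add: sum_product sum.cartesian_product case_prod_unfold)
        finally have s: "(\<Sum>y\<in>?O1 \<times> ?O2. mat_trace (?P y)) / of_nat (X.n1 * X.n2) =
          ((\<Sum>y\<in>?O1. mat_trace (P1 y)) / \<theta>1 \<one>\<^bsub>G1\<^esub>) * ((\<Sum>y\<in>?O2. mat_trace (P2 y)) / \<theta>2 \<one>\<^bsub>G2\<^esub>)"
          using X.data1(2) X.data2(2) by simp
        have "(\<Sum>y\<in>(?O1 \<inter> H1) \<times> (?O2 \<inter> H2). mat_trace (?P' y)) =
          (\<Sum>y\<in>(?O1 \<inter> H1) \<times> (?O2 \<inter> H2). mat_trace (P1' (fst y)) * mat_trace (P2' (snd y)))"
          by (intro sum.cong refl Y.trace_PP) (use OJ JT in blast)
        also have "\<dots> = (\<Sum>y\<in>?O1 \<inter> H1. mat_trace (P1' y)) * (\<Sum>y\<in>?O2 \<inter> H2. mat_trace (P2' y))"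
          by (simp add: sum_product sum.cartesian_product case_prod_unfold)
        finally have s': "(\<Sum>y\<in>(?O1 \<inter> H1) \<times> (?O2 \<inter> H2). mat_trace (?P' y)) / of_nat (Y.n1 * Y.n2) =
          ((\<Sum>y\<in>?O1 \<inter> H1. mat_trace (P1' y)) / \<phi>1 \<one>\<^bsub>G1\<^esub>) * ((\<Sum>y\<in>?O2 \<inter> H2. mat_trace (P2' y)) / \<phi>2 \<one>\<^bsub>G2\<^esub>)"
          using Y.data1(2) Y.data2(2) by simp
        show ?thesis unfolding O OJ s s'
          by (rule MM_mult_cong[OF MM orbit_congruence(1)[OF MM assms(4) x12(2)] orbit_congruence(2)[OF MM assms(5) x12(3)]
              orbit_congruence(3)[OF MM assms(4) x12(2)] orbit_congruence(3)[OF MM assms(5) x12(3)]])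
      qed
      have NJ: "?N \<inter> J = ?M" unfolding J_def M using W0(2) by auto
      have P'irr: "irreducible_rep (?W\<lparr>carrier := ?N \<inter> J\<rparr>) (Y.n1 * Y.n2) ?P'"
        unfolding NJ using Y.PP_irreducible by (simp add: eqB)
      have \<psi>J: "\<psi> = (\<lambda>x\<in>J. mat_trace (kronecker (Q x) (?P' x)))" by (simp add: \<psi> J_def)
      have fsGH: "factor_set ?GH ?P' = factor_set ?G ?P'" by (simp add: GH[symmetric] factor_set_restrict)
      have P'm: "?P' x * ?P' y = factor_set ?G ?P x y \<cdot>\<^sub>m ?P' (x \<otimes>\<^bsub>?W\<^esub> y)" if "x \<in> J" "y \<in> J" for x y
      proof -
        have T: "x \<in> Y.T1 \<times> Y.T2" "y \<in> Y.T1 \<times> Y.T2" using JT that by auto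
        have "x \<otimes>\<^bsub>?GH\<^esub> y = x \<otimes>\<^bsub>?W\<^esub> y" by (simp add: GH[symmetric])
        then show ?thesis using Y.PP_factor_set(2)[OF T] fsP[OF T] fsGH by simp
      qed
      have W_in_T: "x \<in> X.T1 \<times> X.T2" if "x \<in> carrier ?W" for x using WT that by auto
      have Pm: "?P x * ?P y = factor_set ?G ?P x y \<cdot>\<^sub>m ?P (x \<otimes>\<^bsub>?W\<^esub> y)" if "x \<in> carrier ?W" "y \<in> carrier ?W" for x y
        using X.PP_factor_set(2)[OF W_in_T[OF that(1)] W_in_T[OF that(2)]] by simp
      have \<xi>W: "\<xi> = (\<lambda>x\<in>carrier ?W. mat_trace (kronecker (Q x) (?P x)))" by (simp add: \<xi>)
      have P1W: "?P \<one>\<^bsub>?W\<^esub> = 1\<^sub>m (X.n1 * X.n2)" using X.PP_one by simp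
      have QN': "Q (h \<otimes>\<^bsub>?W\<^esub> x) = Q x" if "x \<in> carrier ?W" "h \<in> ?N" for x h using QN[rule_format, of x h] that by simp
      have QW: "Q x \<in> carrier (GL m)" if "x \<in> carrier ?W" for x using QGL that by simp
      have QmW: "Q x * Q y = inverse (factor_set ?G ?P x y) \<cdot>\<^sub>m Q (x \<otimes>\<^bsub>?W\<^esub> y)" if "x \<in> carrier ?W" "y \<in> carrier ?W" for x y
        using Qm that by simp
      note bt = block_transfer[where W = ?W and N = ?N and J = J and n = "X.n1 * X.n2" and n' = "Y.n1 * Y.n2" and P = ?P
          and P' = ?P' and Q = Q and m = m and \<alpha> = "factor_set ?G ?P" and \<xi> = \<xi> and \<psi> = \<psi>,
          OF MM gW NW subJ WNJ X.dims_pos Y.dims_pos X.PP_GL[OF W_in_T] P1W Pm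
            Y.PP_GL[OF subsetD[OF JT]] P'm P'irr QW QmW QN'
            X.PP_factor_set(1)[OF W_in_T W_in_T] \<xi>W \<xi>I \<psi>J orb]
      have \<psi>I: "\<psi> \<in> Irr (?W\<lparr>carrier := J\<rparr>)" by (rule bt(1))
      have cong: "omega ?W \<xi> K - omega (?W\<lparr>carrier := J\<rparr>) \<psi> (K \<inter> J) \<in> \<MM>" if "K \<in> conj_classes ?W" for K
        using bt(2) that by blast
      have gJ: "group (?G\<lparr>carrier := J\<rparr>)" "finite (carrier (?G\<lparr>carrier := J\<rparr>))"
        using G.subgroup_imp_group[OF J] finite_subset[OF subgroup.subset[OF J] X.GG(2)] by auto
      show "induced_block_eq \<MM> (?G\<lparr>carrier := A, carrier := W\<rparr>) (W \<inter> B)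
             (bl \<MM> (?G\<lparr>carrier := A, carrier := W \<inter> B\<rparr>) \<psi>) (bl \<MM> (?G\<lparr>carrier := A, carrier := W\<rparr>) \<xi>)"
        unfolding induced_block_eq_def J_def[symmetric]
      proof (intro conjI ballI)
        show "bl \<MM> (?G\<lparr>carrier := A, carrier := J\<rparr>) \<psi> \<in> blocks \<MM> (?G\<lparr>carrier := A, carrier := W, carrier := J\<rparr>)"
          using \<psi>I by (simp add: blocks_def)
        show "bl \<MM> (?G\<lparr>carrier := A, carrier := W\<rparr>) \<xi> \<in> blocks \<MM> (?G\<lparr>carrier := A, carrier := W\<rparr>)"
          using \<xi>I by (simp add: blocks_def)
        fix \<psi>' \<xi>' K assume \<psi>': "\<psi>' \<in> bl \<MM> (?G\<lparr>carrier := A, carrier := J\<rparr>) \<psi>"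
          and \<xi>': "\<xi>' \<in> bl \<MM> (?G\<lparr>carrier := A, carrier := W\<rparr>) \<xi>" and K: "K \<in> conj_classes (?G\<lparr>carrier := A, carrier := W\<rparr>)"
        have K: "K \<in> conj_classes ?W" using K by simp
        note Kc = conj_classes_invariant[OF gW(1) K]
        \<comment> \<open>The congruence has been shown for \<open>\<xi>\<close> and \<open>\<psi>\<close>; it remains to pass to other members of their blocks.\<close>
        have c1: "omega (?G\<lparr>carrier := J\<rparr>) \<psi>' (K \<inter> J) - omega (?G\<lparr>carrier := J\<rparr>) \<psi> (K \<inter> J) \<in> \<MM>"
        proof (rule omega_congruence_of_block[OF MM gJ])
          show "\<psi>' \<in> bl \<MM> (?G\<lparr>carrier := J\<rparr>) \<psi>" using \<psi>' by simp
          fix x h assume "x \<in> K \<inter> J" "h \<in> carrier (?G\<lparr>carrier := J\<rparr>)"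
          then have xh: "x \<in> K" "x \<in> J" "h \<in> J" "h \<in> W" using JW by auto
          have "h \<otimes>\<^bsub>?G\<^esub> x \<otimes>\<^bsub>?G\<^esub> inv\<^bsub>?G\<^esub> h \<in> K"
            using Kc(2)[of x h] xh by (simp add: G.m_inv_consistent[OF W])
          moreover have "h \<otimes>\<^bsub>?G\<^esub> x \<otimes>\<^bsub>?G\<^esub> inv\<^bsub>?G\<^esub> h \<in> J"
            using xh by (simp add: subgroup.m_closed[OF J] subgroup.m_inv_closed[OF J])
          ultimately show "h \<otimes>\<^bsub>?G\<lparr>carrier := J\<rparr>\<^esub> x \<otimes>\<^bsub>?G\<lparr>carrier := J\<rparr>\<^esub> inv\<^bsub>?G\<lparr>carrier := J\<rparr>\<^esub> h \<in> K \<inter> J"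
            using xh by (simp add: G.m_inv_consistent[OF J])
        qed simp
        have c2: "omega ?W \<xi>' K - omega ?W \<xi> K \<in> \<MM>"
          using \<xi>' K by (simp add: bl_def lambda_eq_iff[OF MM])
        have c3: "omega ?W \<xi> K - omega (?G\<lparr>carrier := J\<rparr>) \<psi> (K \<inter> J) \<in> \<MM>" using cong[OF K] by simp
        have "omega (?G\<lparr>carrier := J\<rparr>) \<psi>' (K \<inter> J) - omega ?W \<xi>' K \<in> \<MM>"
          using MM_diff[OF MM MM_diff[OF MM c1 c3] c2] by (simp add: algebra_simps)
        then show "lambda \<MM> (?G\<lparr>carrier := A, carrier := W, carrier := J\<rparr>) \<psi>' (K \<inter> J) = lambda \<MM> (?G\<lparr>carrier := A, carrier := W\<rparr>) \<xi>' K"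
          by (simp add: lambda_eq_iff[OF MM])
      qed
    qed
  qed
  then show ?thesis unfolding Let_def A_def B_def GH .
qed

end
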